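(* Let $\Omega\subset\mathbb R^N$ be open, let $p,q,m\ge1$ be real numbers with $\frac1p+\frac1q=1+\frac1m$, and let $(u_\varepsilon)_{\varepsilon\in E}\subset L^p(\Omega)$ and $(v_\varepsilon)_{\varepsilon\in E}\subset L^q(\mathbb R^N)$ be two sequences. Suppose that, as $E\ni\varepsilon\to0$, $u_\varepsilon\to u_0$ reit. in $L^p(\Omega)$-weak and $v_\varepsilon\to v_0$ reit. in $L^q(\mathbb R^N)$-strong, where $u_0\in L^p(\Omega\times Y\times Z)$ and $v_0\in L^q(\mathbb R^N\times Y\times Z)$. Then, as $E\ni\varepsilon\to0$, $$u_\varepsilon\ast v_\varepsilon\to u_0\ast\ast v_0\quad\text{reit. in }L^m(\Omega)\text{-weak}.$$
   Context: $Y=Z=[0,1)^N$; $E$ is a sequence $(\varepsilon_n)_{n\in\mathbb N}$ with $0<\varepsilon_n\le1$, $\varepsilon_n\to0$. $\mathcal C_{\rm per}(Y\times Z)$ is the space of continuous functions on $\mathbb R^N\times\mathbb R^N$ that are $Y\times Z$-periodic; functions on $\cdot\times Y\times Z$ are identified with functions periodic in $(y,z)$. For an open set $O\subset\mathbb R^N$ (here $O=\Omega$ or $O=\mathbb R^N$) and $1\le p<\infty$, $\frac1{p'}=1-\frac1p$: - $w_\varepsilon\to w_0$ reit. in $L^p(O)$-weak (weak multiscale convergence), with $w_\varepsilon\in L^p(O)$ and $w_0\in L^p(O\times Y\times Z)$, means $\int_Ow_\varepsilon(x)\psi(x,\frac x\varepsilon,\frac x{\varepsilon^2})dx\to\iiint_{O\times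 Y\times Z}w_0\psi\,dxdydz$ for every $\psi\in L^{p'}(O;\mathcal C_{\rm per}(Y\times Z))$. - $w_\varepsilon\to w_0$ reit. in $L^p(O)$-strong means that $w_\varepsilon\to w_0$ reit. in $L^p(O)$-weak and $\|w_\varepsilon\|_{L^p(O)}\to\|w_0\|_{L^p(O\times Y\times Z)}$. Convolutions: $u_\varepsilon$ is extended by zero outside $\Omega$ and $(u_\varepsilon\ast v_\varepsilon)(x)=\int_{\mathbb R^N}u_\varepsilon(\xi)v_\varepsilon(x-\xi)d\xi$. For $u\in L^p(\mathbb R^N\times Y\times Z)$, $v\in L^q(\mathbb R^N\times Y\times Z)$ (periodic in the last two variables), $(u\ast\ast v)(x,y,z)=\iiint_{\mathbb R^N\times Y\times Z}u(\xi,r,s)v(x-\xi,y-r,z-s)d\xi drds$; $u_0$ is extended by zero for $x\notin\Omega$. *)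

theory Defs
  imports "HOL-Analysis.Analysis"
begin

text \<open>
  Scalars live in a type of class \<open>real_normed_field\<close> and \<open>euclidean_space\<close>, which covers
  both real- and complex-valued functions. The space \<open>\<real>\<^sup>N\<close> is \<open>real ^ 'n\<close>, and
  functions of \<open>(x, y, z)\<close> are functions on triples. Elements of Lebesgue spaces are
  represented by functions; their values outside the set under consideration are irrelevant.
\<close>

definition unit_cell :: "(real ^ 'n) set" where
  "unit_cell = {y. \<forall>i. 0 \<le> y $ i \<and> y $ i < 1}"

definition int_vec :: "real ^ 'n \<Rightarrow> bool" where
  "int_vec k \<longleftrightarrow> (\<forall>i. k $ i \<in> \<int>)"

definition Lp :: "real \<Rightarrow> 'b::euclidean_space set
    \<Rightarrow> ('b \<Rightarrow> 'a::{real_normed_field, euclidean_space}) set" where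
  "Lp p S = {f. f \<in> borel_measurable (lebesgue_on S) \<and>
                integrable (lebesgue_on S) (\<lambda>x. norm (f x) powr p)}"

definition Lp_norm :: "real \<Rightarrow> 'b::euclidean_space set
    \<Rightarrow> ('b \<Rightarrow> 'a::{real_normed_field, euclidean_space}) \<Rightarrow> real" where
  "Lp_norm p S f = (\<integral>x. norm (f x) powr p \<partial>lebesgue_on S) powr (1 / p)"

text \<open>
  \<open>L\<^sup>p(S \<times> Y \<times> Z)\<close>, each element being represented by a function that is periodic in
  \<open>(y, z)\<close>; integrability is only required over the cell.
\<close>

definition Lp_per :: "real \<Rightarrow> (real ^ 'n) set
    \<Rightarrow> ((real ^ 'n) \<times> (real ^ 'n) \<times> (real ^ 'n)
        \<Rightarrow> 'a::{real_normed_field, euclidean_space}) set" where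
  "Lp_per p S = {w. w \<in> Lp p (S \<times> unit_cell \<times> unit_cell) \<and>
     (\<forall>x\<in>S. \<forall>y z k l. int_vec k \<longrightarrow> int_vec l \<longrightarrow> w (x, y + k, z + l) = w (x, y, z))}"

text \<open>
  A continuous periodic function is bounded, so the periodic functions form a subspace of the
  bounded continuous functions, whose norm is the supremum norm.
\<close>

definition C_per :: "(((real ^ 'n) \<times> (real ^ 'n))
    \<Rightarrow>\<^sub>C 'a::{real_normed_field, euclidean_space}) set" where
  "C_per = {f. \<forall>y z k l. int_vec k \<longrightarrow> int_vec l \<longrightarrow>
     apply_bcontfun f (y + k, z + l) = apply_bcontfun f (y, z)}"

text \<open>
  The Bochner space \<open>L\<^sup>r(S; C_per)\<close>, where \<open>1 \<le> r \<le> \<infinity>\<close>. Strong measurability is spelled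
  out as almost everywhere approximation by simple functions, because the Bochner integration
  theory of the library is confined to second countable spaces.
\<close>

definition strongly_measurable_C_per :: "(real ^ 'n) set
    \<Rightarrow> (real ^ 'n \<Rightarrow> (((real ^ 'n) \<times> (real ^ 'n))
        \<Rightarrow>\<^sub>C 'a::{real_normed_field, euclidean_space})) \<Rightarrow> bool" where
  "strongly_measurable_C_per S \<psi> \<longleftrightarrow>
     (\<exists>s. (\<forall>j::nat. simple_function (lebesgue_on S) (s j) \<and> (\<forall>x\<in>S. s j x \<in> C_per)) \<and>
          (AE x in lebesgue_on S. (\<lambda>j. s j x) \<longlonglongrightarrow> \<psi> x))"

definition Lp_C_per :: "ereal \<Rightarrow> (real ^ 'n) set
    \<Rightarrow> (real ^ 'n \<Rightarrow> (((real ^ 'n) \<times> (real ^ 'n))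
        \<Rightarrow>\<^sub>C 'a::{real_normed_field, euclidean_space})) set" where
  "Lp_C_per r S = {\<psi>. (\<forall>x\<in>S. \<psi> x \<in> C_per) \<and> strongly_measurable_C_per S \<psi> \<and>
     (if r = \<infinity> then \<exists>C. AE x in lebesgue_on S. norm (\<psi> x) \<le> C
      else integrable (lebesgue_on S) (\<lambda>x. norm (\<psi> x) powr real_of_ereal r))}"

definition conj_exponent :: "real \<Rightarrow> ereal" where
  "conj_exponent p = (if p = 1 then \<infinity> else ereal (1 / (1 - 1 / p)))"

text \<open>
  In the following, \<open>e\<close> is the sequence of scales and \<open>w n\<close> stands for the
  function with index \<open>e n\<close>, so that the limit is taken as \<open>n\<close> tends to infinity.
\<close>

definition reit_weak :: "(nat \<Rightarrow> real) \<Rightarrow> real \<Rightarrow> (real ^ 'n) set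
    \<Rightarrow> (nat \<Rightarrow> real ^ 'n \<Rightarrow> 'a::{real_normed_field, euclidean_space})
    \<Rightarrow> ((real ^ 'n) \<times> (real ^ 'n) \<times> (real ^ 'n) \<Rightarrow> 'a) \<Rightarrow> bool" where
  "reit_weak e p S w w0 \<longleftrightarrow>
     (\<forall>n. w n \<in> Lp p S) \<and> w0 \<in> Lp_per p S \<and>
     (\<forall>\<psi> \<in> Lp_C_per (conj_exponent p) S.
        (\<lambda>n. \<integral>x. w n x * apply_bcontfun (\<psi> x) (x /\<^sub>R e n, x /\<^sub>R (e n)\<^sup>2) \<partial>lebesgue_on S)
        \<longlonglongrightarrow> (\<integral>(x, y, z). w0 (x, y, z) * apply_bcontfun (\<psi> x) (y, z)
               \<partial>lebesgue_on (S \<times> unit_cell \<times> unit_cell)))"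

definition reit_strong :: "(nat \<Rightarrow> real) \<Rightarrow> real \<Rightarrow> (real ^ 'n) set
    \<Rightarrow> (nat \<Rightarrow> real ^ 'n \<Rightarrow> 'a::{real_normed_field, euclidean_space})
    \<Rightarrow> ((real ^ 'n) \<times> (real ^ 'n) \<times> (real ^ 'n) \<Rightarrow> 'a) \<Rightarrow> bool" where
  "reit_strong e p S w w0 \<longleftrightarrow> reit_weak e p S w w0 \<and>
     (\<lambda>n. Lp_norm p S (w n)) \<longlonglongrightarrow> Lp_norm p (S \<times> unit_cell \<times> unit_cell) w0"

definition zero_ext :: "'b set \<Rightarrow> ('b \<Rightarrow> 'a::zero) \<Rightarrow> 'b \<Rightarrow> 'a" where
  "zero_ext S f = (\<lambda>x. if x \<in> S then f x else 0)"

definition conv :: "(real ^ 'n \<Rightarrow> 'a::{real_normed_field, euclidean_space})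
    \<Rightarrow> (real ^ 'n \<Rightarrow> 'a) \<Rightarrow> real ^ 'n \<Rightarrow> 'a" where
  "conv u v x = (\<integral>\<xi>. u \<xi> * v (x - \<xi>) \<partial>lebesgue)"

definition double_conv :: "((real ^ 'n) \<times> (real ^ 'n) \<times> (real ^ 'n)
      \<Rightarrow> 'a::{real_normed_field, euclidean_space})
    \<Rightarrow> ((real ^ 'n) \<times> (real ^ 'n) \<times> (real ^ 'n) \<Rightarrow> 'a)
    \<Rightarrow> (real ^ 'n) \<times> (real ^ 'n) \<times> (real ^ 'n) \<Rightarrow> 'a" where
  "double_conv u v = (\<lambda>(x, y, z).
     \<integral>(\<xi>, r, s). u (\<xi>, r, s) * v (x - \<xi>, y - r, z - s)
       \<partial>lebesgue_on (UNIV \<times> unit_cell \<times> unit_cell))"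

end

theory Submission
  imports Defs
begin

text \<open>
  Tested against a function \<open>G\<close>, a convolution is a bilinear expression in its two factors:
  \<open>\<integral> (u\<^sub>\<epsilon> * v\<^sub>\<epsilon>)(x) G(x, x/\<epsilon>, x/\<epsilon>\<^sup>2) dx\<close> is the integral of \<open>u\<^sub>\<epsilon>(\<xi>)\<close> against
  \<open>\<integral> v\<^sub>\<epsilon>(\<eta>) G(\<xi> + \<eta>, (\<xi> + \<eta>)/\<epsilon>, (\<xi> + \<eta>)/\<epsilon>\<^sup>2) d\<eta>\<close>. As the scales act additively, this inner integral is
  the value at \<open>(\<xi>, \<xi>/\<epsilon>, \<xi>/\<epsilon>\<^sup>2)\<close> of the function \<open>\<Psi>\<^sub>\<epsilon>\<close> that sends \<open>P\<close> to the pairing of \<open>v\<^sub>\<epsilon>\<close> with the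
  translate \<open>G(P + \<cdot>)\<close>. Weak convergence of \<open>v\<^sub>\<epsilon>\<close> makes \<open>\<Psi>\<^sub>\<epsilon>\<close> converge pointwise; if \<open>G\<close> is continuous with
  bounded support and the \<open>v\<^sub>\<epsilon>\<close> live in a common ball, the \<open>\<Psi>\<^sub>\<epsilon>\<close> are equicontinuous, so they
  converge uniformly to a fixed test function, and weak convergence of \<open>u\<^sub>\<epsilon>\<close> finishes the argument
  (\<open>pairing_compact\<close>). Hence the only thing that weak convergence of both factors does not supply is
  tightness: no mass of \<open>\<bar>v\<^sub>\<epsilon>\<bar>\<^sup>q\<close> may escape to infinity. With tightness, Young's inequality
  (\<open>kernel_young\<close>, \<open>pair_kernel\<close>) bounds the error of a cut-off uniformly in \<open>\<epsilon>\<close> (\<open>conv_test\<close>).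

  Tightness is what the strong convergence of \<open>v\<^sub>\<epsilon>\<close> provides. For \<open>q > 1\<close> it follows from the convergence of the norms:
  a test function close to the dual function of \<open>v\<^sub>0\<close>, supported in a ball, detects almost all of the
  limit mass inside this ball (\<open>tight_of_norm_convergence\<close>); this needs the mean value theorem for
  oscillating functions (\<open>mean_value\<close>). For \<open>q = 1\<close> weak convergence is tested against all bounded
  functions of \<open>x\<close>, and a gliding hump argument gives uniform integrability and with it tightness
  (\<open>weakly_null_uniformly_small\<close>, \<open>weak_L1_uniformly_integrable\<close>).

  The step from continuous test functions to all of \<open>L\<^bsup>m'\<^esup>(\<Omega>; C_per)\<close> is an approximation argument
  (\<open>passes_to_limit_closed\<close>, \<open>passes_strongly_measurable\<close>), which needs that the convolutions carry
  uniformly little mass against weights tending to zero. For \<open>m > 1\<close> this is their boundedness in \<open>L\<^sup>m\<close>;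
  for \<open>m = 1\<close>, where \<open>p = q = 1\<close>, they inherit uniform integrability from both factors
  (\<open>W_uniformly_small\<close>). The uniform bounds come from two versions of the uniform boundedness principle
  (\<open>L1_uniform_boundedness\<close>, \<open>Lp_uniform_boundedness\<close>).

  The two periodic variables \<open>y\<close>, \<open>z\<close> are treated as one variable \<open>w\<close>, and everything but \<open>mean_value\<close> and
  the tightness for \<open>q > 1\<close> works for an arbitrary additive scale map in place of
  \<open>x \<mapsto> (x/\<epsilon>, x/\<epsilon>\<^sup>2)\<close>. Integrals are computed with Borel representatives on \<open>lborel\<close>, for which
  Fubini's theorem is at hand; the last part translates the definitions, stated for the completed
  measure, into this form.
\<close>

section \<open>Periodic functions and fundamental domains\<close>

definition lattice_point :: "'c::euclidean_space \<Rightarrow> bool" where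
  "lattice_point k \<longleftrightarrow> (\<forall>b\<in>Basis. k \<bullet> b \<in> \<int>)"

definition ucell :: "'c::euclidean_space set" where
  "ucell = {w. \<forall>b\<in>Basis. 0 \<le> w \<bullet> b \<and> w \<bullet> b < 1}"

definition vfloor :: "'c::euclidean_space \<Rightarrow> 'c" where
  "vfloor w = (\<Sum>b\<in>Basis. of_int \<lfloor>w \<bullet> b\<rfloor> *\<^sub>R b)"

definition vfrac :: "'c::euclidean_space \<Rightarrow> 'c" where
  "vfrac w = w - vfloor w"

definition periodic :: "('c::euclidean_space \<Rightarrow> 'd) \<Rightarrow> bool" where
  "periodic h \<longleftrightarrow> (\<forall>w k. lattice_point k \<longrightarrow> h (w + k) = h w)"

definition fundamental_domain :: "'c::euclidean_space set \<Rightarrow> bool" where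
  "fundamental_domain D \<longleftrightarrow> D \<in> sets borel \<and> (\<forall>w. \<exists>!k. lattice_point k \<and> w + k \<in> D)"

lemma periodicD: "periodic h \<Longrightarrow> lattice_point k \<Longrightarrow> h (w + k) = h w"
  by (simp add: periodic_def)

lemma lattice_point_minus: "lattice_point k \<Longrightarrow> lattice_point (- k)"
  by (simp add: lattice_point_def)

lemma vfloor_inner: "b \<in> Basis \<Longrightarrow> vfloor w \<bullet> b = of_int \<lfloor>w \<bullet> b\<rfloor>"
  by (simp add: vfloor_def inner_sum_left inner_Basis if_distrib cong: if_cong)

lemma vfrac_inner: "b \<in> Basis \<Longrightarrow> vfrac w \<bullet> b = frac (w \<bullet> b)"
  by (simp add: vfrac_def inner_diff_left vfloor_inner frac_def)

lemma lattice_point_vfloor: "lattice_point (vfloor w)"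
  by (simp add: lattice_point_def vfloor_inner)

lemma vfrac_in_ucell: "vfrac w \<in> ucell"
  by (simp add: ucell_def vfrac_inner frac_lt_1)

lemma vfrac_ucell:
  assumes "w \<in> ucell" shows "vfrac w = w"
proof (rule euclidean_eqI)
  fix b :: 'a assume b: "b \<in> Basis"
  then have "0 \<le> w \<bullet> b" "w \<bullet> b < 1" using assms by (auto simp: ucell_def)
  then show "vfrac w \<bullet> b = w \<bullet> b" by (simp only: vfrac_inner[OF b] frac_eq)
qed

lemma vfrac_add_lattice_point:
  assumes "lattice_point k" shows "vfrac (w + k) = vfrac w"
proof (rule euclidean_eqI)
  fix b :: 'a assume b: "b \<in> Basis"
  then have "k \<bullet> b \<in> \<int>" using assms by (simp add: lattice_point_def)
  then obtain i where "k \<bullet> b = of_int i" by (auto elim: Ints_cases)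
  then show "vfrac (w + k) \<bullet> b = vfrac w \<bullet> b"
    using b by (simp add: vfrac_inner inner_add_left frac_def)
qed

lemma periodic_vfrac: "periodic h \<Longrightarrow> h (vfrac w) = h w"
  using periodicD[of h "- vfloor w" w] lattice_point_minus[OF lattice_point_vfloor, of w]
  by (simp add: vfrac_def)

lemma measurable_vfrac[measurable]: "vfrac \<in> borel_measurable borel"
proof -
  have "(\<lambda>w. w - (\<Sum>b\<in>Basis. real_of_int \<lfloor>w \<bullet> b\<rfloor> *\<^sub>R b)) \<in> borel_measurable (borel :: 'a measure)"
    by measurable
  then show ?thesis by (simp add: vfrac_def[abs_def] vfloor_def)
qed

lemma measurable_ucell[measurable]: "ucell \<in> sets borel"
proof -
  have "ucell = (\<Inter>b\<in>Basis. {w::'a. 0 \<le> w \<bullet> b \<and> w \<bullet> b < 1})" by (auto simp: ucell_def)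
  also have "\<dots> \<in> sets borel"
    by (intro sets.countable_INT'') (auto intro!: borel_measurable_pred_less simp: countable_finite)
  finally show ?thesis .
qed

lemma ucell_bounds: "box 0 One \<subseteq> (ucell :: 'c::euclidean_space set)" "ucell \<subseteq> (cbox 0 One :: 'c set)"
  by (auto simp: ucell_def mem_box less_imp_le)

lemma emeasure_ucell: "emeasure lborel (ucell :: 'c::euclidean_space set) = 1"
proof (rule antisym)
  have "emeasure lborel (ucell :: 'c set) \<le> emeasure lborel (cbox 0 One :: 'c set)"
    by (rule emeasure_mono) (use ucell_bounds in auto)
  then show "emeasure lborel (ucell :: 'c set) \<le> 1" by (simp add: emeasure_lborel_cbox)
  have "emeasure lborel (box 0 One :: 'c set) \<le> emeasure lborel (ucell :: 'c set)"
    by (rule emeasure_mono) (use ucell_bounds in auto)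
  then show "1 \<le> emeasure lborel (ucell :: 'c set)" by (simp add: emeasure_lborel_box)
qed

lemma countable_lattice: "countable {k :: 'c::euclidean_space. lattice_point k}"
proof -
  have "{k :: 'c. lattice_point k} \<subseteq> (\<lambda>f. \<Sum>b\<in>Basis. of_int (f b) *\<^sub>R b) ` (PiE Basis (\<lambda>_. UNIV :: int set))"
  proof
    fix k :: 'c assume k: "k \<in> {k. lattice_point k}"
    have "k = (\<Sum>b\<in>Basis. of_int (restrict (\<lambda>b. \<lfloor>k \<bullet> b\<rfloor>) Basis b) *\<^sub>R b)"
    proof -
      have "(\<Sum>b\<in>Basis. of_int (restrict (\<lambda>b. \<lfloor>k \<bullet> b\<rfloor>) Basis b) *\<^sub>R b) = (\<Sum>b\<in>Basis. (k \<bullet> b) *\<^sub>R b)"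
        using k by (intro sum.cong) (auto simp: lattice_point_def elim!: ballE Ints_cases)
      then show ?thesis by (simp add: euclidean_representation)
    qed
    then show "k \<in> (\<lambda>f. \<Sum>b\<in>Basis. of_int (f b) *\<^sub>R b) ` (PiE Basis (\<lambda>_. UNIV :: int set))"
      by (rule image_eqI[where x = "restrict (\<lambda>b. \<lfloor>k \<bullet> b\<rfloor>) Basis"]) simp
  qed
  moreover have "countable (PiE (Basis :: 'c set) (\<lambda>_. UNIV :: int set))"
    by (rule countable_PiE) auto
  ultimately show ?thesis by (meson countable_image countable_subset)
qed

lemma fundamental_domain_ucell: "fundamental_domain ucell"
proof -
  have "\<exists>!k. lattice_point k \<and> w + k \<in> ucell" for w :: 'a
  proof (rule ex1I[of _ "- vfloor w"])
    show "lattice_point (- vfloor w) \<and> w + - vfloor w \<in> ucell"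
      using lattice_point_minus[OF lattice_point_vfloor, of w] vfrac_in_ucell[of w] by (simp add: vfrac_def)
    fix k assume k: "lattice_point k \<and> w + k \<in> ucell"
    show "k = - vfloor w"
    proof (rule euclidean_eqI)
      fix b :: 'a assume b: "b \<in> Basis"
      obtain i where i: "k \<bullet> b = of_int i" using k b by (auto simp: lattice_point_def elim: Ints_cases)
      have "0 \<le> w \<bullet> b + of_int i" "w \<bullet> b + of_int i < 1"
        using k b i by (auto simp: ucell_def inner_add_left)
      then have "\<lfloor>w \<bullet> b\<rfloor> = - i" by linarith
      then show "k \<bullet> b = - vfloor w \<bullet> b" using b i by (simp add: vfloor_inner)
    qed
  qed
  then show ?thesis by (simp add: fundamental_domain_def)
qed

lemma fundamental_domain_shift:
  assumes "fundamental_domain D" shows "fundamental_domain {w. w - a \<in> D}"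
proof -
  have [measurable]: "D \<in> sets borel" using assms by (simp add: fundamental_domain_def)
  have "{w. w - a \<in> D} \<in> sets borel" by measurable
  moreover have "\<exists>!k. lattice_point k \<and> w + k \<in> {w. w - a \<in> D}" for w
    using assms[unfolded fundamental_domain_def, THEN conjunct2, rule_format, of "w - a"]
    by (simp add: algebra_simps)
  ultimately show ?thesis by (simp add: fundamental_domain_def)
qed

lemma fundamental_domain_reflect:
  assumes "fundamental_domain D" shows "fundamental_domain {w. a - w \<in> D}"
proof -
  have [measurable]: "D \<in> sets borel" using assms by (simp add: fundamental_domain_def)
  have "{w. a - w \<in> D} \<in> sets borel" by measurable
  moreover have "\<exists>!k. lattice_point k \<and> w + k \<in> {w. a - w \<in> D}" for w
  proof -
    obtain k where k: "lattice_point k" "a - w + k \<in> D"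
      and u: "\<And>l. lattice_point l \<Longrightarrow> a - w + l \<in> D \<Longrightarrow> l = k"
      using assms unfolding fundamental_domain_def by metis
    show ?thesis
    proof (rule ex1I[of _ "- k"])
      show "lattice_point (- k) \<and> w + - k \<in> {w. a - w \<in> D}"
        using k lattice_point_minus by (auto simp: algebra_simps)
      fix l assume "lattice_point l \<and> w + l \<in> {w. a - w \<in> D}"
      then show "l = - k" using u[of "- l"] lattice_point_minus[of l] by (auto simp: algebra_simps)
    qed
  qed
  ultimately show ?thesis by (simp add: fundamental_domain_def)
qed

lemma nn_integral_lborel_shift:
  fixes f :: "'b::euclidean_space \<Rightarrow> ennreal"
  assumes [measurable]: "f \<in> borel_measurable borel"
  shows "(\<integral>\<^sup>+x. f (x + a) \<partial>lborel) = (\<integral>\<^sup>+x. f x \<partial>lborel)"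
proof -
  have "(\<integral>\<^sup>+x. f x \<partial>lborel) = (\<integral>\<^sup>+x. f x \<partial>distr lborel borel ((+) a))"
    by (simp add: lborel_distr_plus)
  also have "\<dots> = (\<integral>\<^sup>+x. f (x + a) \<partial>lborel)" by (simp add: nn_integral_distr add.commute)
  finally show ?thesis by simp
qed

lemma nn_integral_lborel_reflect:
  fixes f :: "'b::euclidean_space \<Rightarrow> ennreal"
  assumes [measurable]: "f \<in> borel_measurable borel"
  shows "(\<integral>\<^sup>+x. f (a - x) \<partial>lborel) = (\<integral>\<^sup>+x. f x \<partial>lborel)"
proof -
  have "(\<integral>\<^sup>+x. f x \<partial>lborel) = (\<integral>\<^sup>+x. f x \<partial>distr lborel borel (\<lambda>x. a - x))"
    using lborel_affine[of "-1" a] by (simp add: density_1)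
  also have "\<dots> = (\<integral>\<^sup>+x. f (a - x) \<partial>lborel)" by (simp add: nn_integral_distr)
  finally show ?thesis by simp
qed

text \<open>
  Cut \<open>D\<^sub>1\<close> into the pieces that lie in the translates of \<open>D\<^sub>2\<close>; moving the pieces back by
  lattice vectors, which \<open>h\<close> does not notice, reassembles \<open>D\<^sub>2\<close>.
\<close>

lemma nn_integral_fundamental_domains:
  fixes h :: "'c::euclidean_space \<Rightarrow> ennreal"
  assumes D: "fundamental_domain D1" "fundamental_domain D2" and h: "periodic h"
    and [measurable]: "h \<in> borel_measurable borel"
  shows "(\<integral>\<^sup>+w. indicator D1 w * h w \<partial>lborel) = (\<integral>\<^sup>+w. indicator D2 w * h w \<partial>lborel)"
proof -
  define L where "L = {k :: 'c. lattice_point k}"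
  have [measurable]: "D1 \<in> sets borel" "D2 \<in> sets borel" using D by (auto simp: fundamental_domain_def)
  have L: "countable L" unfolding L_def by (rule countable_lattice)
  have one: "(\<integral>\<^sup>+k. indicator D (w + k) \<partial>count_space L) = (1::ennreal)"
    if fd: "fundamental_domain D" for D and w :: 'c
  proof -
    obtain k where k: "lattice_point k" "w + k \<in> D"
      and u: "\<And>l. lattice_point l \<Longrightarrow> w + l \<in> D \<Longrightarrow> l = k"
      using fd unfolding fundamental_domain_def by metis
    have "(\<integral>\<^sup>+k. indicator D (w + k) \<partial>count_space L) = (\<integral>\<^sup>+l. indicator {k} l \<partial>count_space L)"
    proof (rule nn_integral_cong)
      fix l assume "l \<in> space (count_space L)"
      then have "w + l \<in> D \<longleftrightarrow> l = k" using k u[of l] by (auto simp: L_def)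
      then show "(indicator D (w + l) :: ennreal) = indicator {k} l" by (simp add: indicator_def)
    qed
    also have "\<dots> = 1" using k by (simp add: L_def)
    finally show ?thesis .
  qed
  have one': "(\<integral>\<^sup>+k. indicator D (w - k) \<partial>count_space L) = (1::ennreal)"
    if "fundamental_domain D" for D and w :: 'c
  proof -
    have "bij_betw uminus L L"
      by (rule bij_betw_byWitness[where f' = uminus]) (auto simp: L_def lattice_point_minus)
    then have "(\<integral>\<^sup>+k. indicator D (w + - k) \<partial>count_space L) = (\<integral>\<^sup>+k. indicator D (w + k) \<partial>count_space L :: ennreal)"
      by (rule nn_integral_bij_count_space)
    with one[OF that, of w] show ?thesis by simp
  qed
  have "(\<integral>\<^sup>+w. indicator D1 w * h w \<partial>lborel)
      = (\<integral>\<^sup>+w. (\<integral>\<^sup>+k. indicator D1 w * h w * indicator D2 (w + k) \<partial>count_space L) \<partial>lborel)"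
    by (simp add: nn_integral_cmult one[OF D(2)])
  also have "\<dots> = (\<integral>\<^sup>+k. (\<integral>\<^sup>+w. indicator D1 w * h w * indicator D2 (w + k) \<partial>lborel) \<partial>count_space L)"
    by (rule nn_integral_count_space_nn_integral) (use L in auto)
  also have "\<dots> = (\<integral>\<^sup>+k. (\<integral>\<^sup>+w. indicator D2 w * h w * indicator D1 (w - k) \<partial>lborel) \<partial>count_space L)"
  proof (rule nn_integral_cong)
    fix k assume "k \<in> space (count_space L)"
    then have k: "lattice_point k" by (simp add: L_def)
    have "(\<integral>\<^sup>+w. indicator D1 w * h w * indicator D2 (w + k) \<partial>lborel)
        = (\<integral>\<^sup>+w. indicator D2 (w + k) * h (w + k) * indicator D1 (w + k - k) \<partial>lborel)"
      by (rule nn_integral_cong) (simp add: periodicD[OF h k] mult.commute mult.left_commute)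
    also have "\<dots> = (\<integral>\<^sup>+w. indicator D2 w * h w * indicator D1 (w - k) \<partial>lborel)"
      by (rule nn_integral_lborel_shift[where f = "\<lambda>w. indicator D2 w * h w * indicator D1 (w - k)"]) measurable
    finally show "(\<integral>\<^sup>+w. indicator D1 w * h w * indicator D2 (w + k) \<partial>lborel)
      = (\<integral>\<^sup>+w. indicator D2 w * h w * indicator D1 (w - k) \<partial>lborel)" .
  qed
  also have "\<dots> = (\<integral>\<^sup>+w. (\<integral>\<^sup>+k. indicator D2 w * h w * indicator D1 (w - k) \<partial>count_space L) \<partial>lborel)"
    by (rule nn_integral_count_space_nn_integral[symmetric]) (use L in auto)
  also have "\<dots> = (\<integral>\<^sup>+w. indicator D2 w * h w \<partial>lborel)"
    by (simp add: nn_integral_cmult one'[OF D(1)])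
  finally show ?thesis .
qed

lemma nn_integral_ucell_shift:
  assumes h: "periodic h" and [measurable]: "h \<in> borel_measurable borel"
  shows "(\<integral>\<^sup>+w. indicator ucell w * h (w + a) \<partial>lborel) = (\<integral>\<^sup>+w. indicator ucell w * h w \<partial>lborel)"
proof -
  have "(\<integral>\<^sup>+w. indicator ucell w * h (w + a) \<partial>lborel)
      = (\<integral>\<^sup>+w. indicator {w. w - a \<in> ucell} (w + a) * h (w + a) \<partial>lborel)"
    by (rule nn_integral_cong) (simp add: indicator_def)
  also have "\<dots> = (\<integral>\<^sup>+w. indicator {w. w - a \<in> ucell} w * h w \<partial>lborel)"
    by (rule nn_integral_lborel_shift[where f = "\<lambda>w. indicator {w. w - a \<in> ucell} w * h w"]) measurable
  also have "\<dots> = (\<integral>\<^sup>+w. indicator ucell w * h w \<partial>lborel)"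
    by (intro nn_integral_fundamental_domains fundamental_domain_shift fundamental_domain_ucell assms)
  finally show ?thesis .
qed

lemma nn_integral_ucell_reflect:
  assumes h: "periodic h" and [measurable]: "h \<in> borel_measurable borel"
  shows "(\<integral>\<^sup>+w. indicator ucell w * h (a - w) \<partial>lborel) = (\<integral>\<^sup>+w. indicator ucell w * h w \<partial>lborel)"
proof -
  have "(\<integral>\<^sup>+w. indicator ucell w * h (a - w) \<partial>lborel)
      = (\<integral>\<^sup>+w. indicator {w. a - w \<in> ucell} (a - w) * h (a - w) \<partial>lborel)"
    by (rule nn_integral_cong) (simp add: indicator_def)
  also have "\<dots> = (\<integral>\<^sup>+w. indicator {w. a - w \<in> ucell} w * h w \<partial>lborel)"
    by (rule nn_integral_lborel_reflect[where f = "\<lambda>w. indicator {w. a - w \<in> ucell} w * h w"]) measurable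
  also have "\<dots> = (\<integral>\<^sup>+w. indicator ucell w * h w \<partial>lborel)"
    by (intro nn_integral_fundamental_domains fundamental_domain_reflect fundamental_domain_ucell assms)
  finally show ?thesis .
qed

text \<open>
  Functions of \<open>(x, w)\<close> that are periodic in \<open>w\<close>: the integral over \<open>\<real>\<^sup>N \<times> ucell\<close>, written
  with the factor \<open>cell_ind\<close>, is invariant under translations and reflections in both variables.
\<close>

definition cell_ind :: "'b \<times> 'c::euclidean_space \<Rightarrow> real" where
  "cell_ind P = indicator ucell (snd P)"

lemma cell_ind_pair: "cell_ind (x, w) = indicator ucell w"
  by (simp add: cell_ind_def)

lemma cell_ind_nonneg: "0 \<le> cell_ind P"
  by (simp add: cell_ind_def)

lemma cell_ind_cases: "cell_ind P = 0 \<or> cell_ind P = 1"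
  by (auto simp: cell_ind_def indicator_def)

lemma measurable_cell_ind[measurable]:
  "cell_ind \<in> borel_measurable (borel :: ('b::euclidean_space \<times> 'c::euclidean_space) measure)"
  unfolding cell_ind_def[abs_def] borel_prod[symmetric] by measurable

lemma nn_integral_lborel_prod:
  assumes "f \<in> borel_measurable borel"
  shows "(\<integral>\<^sup>+P. f P \<partial>lborel) = (\<integral>\<^sup>+x. (\<integral>\<^sup>+w. f (x, w) \<partial>lborel) \<partial>lborel)"
  using assms by (subst lborel_prod[symmetric], subst lborel.nn_integral_fst[symmetric])
    (auto simp: borel_prod lborel_prod)

lemma nn_integral_cell_shift:
  fixes h :: "'b::euclidean_space \<times> 'c::euclidean_space \<Rightarrow> ennreal"
  assumes h: "\<And>x. periodic (\<lambda>w. h (x, w))" and [measurable]: "h \<in> borel_measurable borel"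
  shows "(\<integral>\<^sup>+P. cell_ind P * h (P + Q) \<partial>lborel) = (\<integral>\<^sup>+P. cell_ind P * h P \<partial>lborel)"
proof -
  obtain a c where Q: "Q = (a, c)" by (cases Q)
  note [measurable] = assms(2)[folded borel_prod]
  have ind: "ennreal (indicator ucell w) = indicator ucell w" for w :: 'c by (simp add: indicator_def)
  have "(\<integral>\<^sup>+P. cell_ind P * h (P + Q) \<partial>lborel)
      = (\<integral>\<^sup>+x. (\<integral>\<^sup>+w. indicator ucell w * h (x + a, w + c) \<partial>lborel) \<partial>lborel)"
    by (subst nn_integral_lborel_prod) (auto simp: cell_ind_pair Q ind)
  also have "\<dots> = (\<integral>\<^sup>+x. (\<integral>\<^sup>+w. indicator ucell w * h (x + a, w) \<partial>lborel) \<partial>lborel)"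
    by (intro nn_integral_cong nn_integral_ucell_shift h) measurable
  also have "\<dots> = (\<integral>\<^sup>+x. (\<integral>\<^sup>+w. indicator ucell w * h (x, w) \<partial>lborel) \<partial>lborel)"
    by (rule nn_integral_lborel_shift) measurable
  also have "\<dots> = (\<integral>\<^sup>+P. cell_ind P * h P \<partial>lborel)"
    by (subst nn_integral_lborel_prod) (auto simp: cell_ind_pair ind)
  finally show ?thesis .
qed

lemma nn_integral_cell_reflect:
  fixes h :: "'b::euclidean_space \<times> 'c::euclidean_space \<Rightarrow> ennreal"
  assumes h: "\<And>x. periodic (\<lambda>w. h (x, w))" and [measurable]: "h \<in> borel_measurable borel"
  shows "(\<integral>\<^sup>+P. cell_ind P * h (Q - P) \<partial>lborel) = (\<integral>\<^sup>+P. cell_ind P * h P \<partial>lborel)"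
proof -
  obtain a c where Q: "Q = (a, c)" by (cases Q)
  note [measurable] = assms(2)[folded borel_prod]
  have ind: "ennreal (indicator ucell w) = indicator ucell w" for w :: 'c by (simp add: indicator_def)
  have "(\<integral>\<^sup>+P. cell_ind P * h (Q - P) \<partial>lborel)
      = (\<integral>\<^sup>+x. (\<integral>\<^sup>+w. indicator ucell w * h (a - x, c - w) \<partial>lborel) \<partial>lborel)"
    by (subst nn_integral_lborel_prod) (auto simp: cell_ind_pair Q ind)
  also have "\<dots> = (\<integral>\<^sup>+x. (\<integral>\<^sup>+w. indicator ucell w * h (a - x, w) \<partial>lborel) \<partial>lborel)"
    by (intro nn_integral_cong nn_integral_ucell_reflect h) measurable
  also have "\<dots> = (\<integral>\<^sup>+x. (\<integral>\<^sup>+w. indicator ucell w * h (x, w) \<partial>lborel) \<partial>lborel)"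
    by (rule nn_integral_lborel_reflect) measurable
  also have "\<dots> = (\<integral>\<^sup>+P. cell_ind P * h P \<partial>lborel)"
    by (subst nn_integral_lborel_prod) (auto simp: cell_ind_pair ind)
  finally show ?thesis .
qed

text \<open>
  The Bochner version: reduced modulo the lattice, the translation by \<open>Q\<close> preserves Lebesgue
  measure on \<open>\<real>\<^sup>N \<times> ucell\<close>.
\<close>

lemma integral_cell_shift:
  fixes h :: "'b::euclidean_space \<times> 'c::euclidean_space \<Rightarrow> 'a::{banach, second_countable_topology}"
  assumes h: "\<And>x. periodic (\<lambda>w. h (x, w))" and [measurable]: "h \<in> borel_measurable borel"
  shows "(\<integral>P. cell_ind P *\<^sub>R h (P + Q) \<partial>lborel) = (\<integral>P. cell_ind P *\<^sub>R h P \<partial>lborel)"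
proof -
  define N where "N = density lborel (\<lambda>P :: 'b \<times> 'c. ennreal (cell_ind P))"
  define T where "T = (\<lambda>P :: 'b \<times> 'c. (fst P + fst Q, vfrac (snd P + snd Q)))"
  have T[measurable]: "T \<in> borel \<rightarrow>\<^sub>M borel"
    unfolding T_def borel_prod[symmetric] by measurable
  have TN[measurable]: "T \<in> N \<rightarrow>\<^sub>M borel" using T by (simp add: N_def)
  have "distr N borel T = N"
  proof (rule measure_eqI)
    show "sets (distr N borel T) = sets N" by (simp add: N_def)
    fix A assume "A \<in> sets (distr N borel T)"
    then have A[measurable]: "A \<in> sets borel" by simp
    define g where "g = (\<lambda>P :: 'b \<times> 'c. indicator A (fst P, vfrac (snd P)) :: ennreal)"
    have gm: "g \<in> borel_measurable borel"
    proof -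
      have "(\<lambda>P::'b\<times>'c. (fst P, vfrac (snd P))) \<in> borel \<rightarrow>\<^sub>M borel"
        unfolding borel_prod[symmetric] by measurable
      then show ?thesis unfolding g_def by measurable
    qed
    have gp: "periodic (\<lambda>w. g (x, w))" for x
      by (simp add: periodic_def g_def vfrac_add_lattice_point)
    have Tm: "(\<lambda>P. indicator A (T P) :: ennreal) \<in> borel_measurable borel"
      by (rule measurable_compose[OF T borel_measurable_indicator]) (rule A)
    have red: "ennreal (cell_ind P) * g P = ennreal (cell_ind P) * indicator A P" for P
    proof (cases "snd P \<in> ucell")
      case True
      then have "vfrac (snd P) = snd P" by (rule vfrac_ucell)
      then show ?thesis by (simp add: g_def)
    qed (simp add: cell_ind_def)
    have "emeasure (distr N borel T) A = (\<integral>\<^sup>+P. indicator A (T P) \<partial>N)"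
      using A by (subst nn_integral_indicator[symmetric], simp)
        (rule nn_integral_distr[OF TN], simp)
    moreover have "(\<integral>\<^sup>+P. indicator A (T P) \<partial>N) = (\<integral>\<^sup>+P. ennreal (cell_ind P) * indicator A (T P) \<partial>lborel)"
      using Tm unfolding N_def by (intro nn_integral_density) simp_all
    moreover have "(\<integral>\<^sup>+P. ennreal (cell_ind P) * indicator A (T P) \<partial>lborel) = (\<integral>\<^sup>+P. cell_ind P * g P \<partial>lborel)"
      using nn_integral_cell_shift[OF gp gm, of Q] unfolding g_def T_def fst_add snd_add .
    moreover have "(\<integral>\<^sup>+P. cell_ind P * g P \<partial>lborel) = emeasure N A"
      unfolding N_def red by (rule emeasure_density[symmetric]) simp_all
    ultimately show "emeasure (distr N borel T) A = emeasure N A" by (simp only:)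
  qed
  then have "(\<integral>P. h P \<partial>N) = (\<integral>P. h P \<partial>distr N borel T)" by simp
  also have "\<dots> = (\<integral>P. h (T P) \<partial>N)" by (rule integral_distr) measurable
  also have "\<dots> = (\<integral>P. h (P + Q) \<partial>N)"
    by (rule Bochner_Integration.integral_cong) (auto simp: T_def periodic_vfrac[OF h] plus_prod_def)
  also have "\<dots> = (\<integral>P. cell_ind P *\<^sub>R h (P + Q) \<partial>lborel)"
    unfolding N_def by (rule integral_density) (simp_all add: cell_ind_nonneg)
  also have "(\<integral>P. h P \<partial>N) = (\<integral>P. cell_ind P *\<^sub>R h P \<partial>lborel)"
    unfolding N_def by (rule integral_density) (simp_all add: cell_ind_nonneg)
  finally show ?thesis by (rule sym)
qed

section \<open>Young's inequality for kernels\<close>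

text \<open>
  The three factors of \<open>a b = (a\<^sup>p b\<^sup>q)\<^bsup>1/m\<^esup> (a\<^sup>p)\<^bsup>1/p - 1/m\<^esup> (b\<^sup>q)\<^bsup>1/q - 1/m\<^esup>\<close> have exponents that
  add up to 1, so each base may be replaced by the sum of the three. Taking for \<open>W\<close> the
  integral of \<open>a\<^sup>p b\<^sup>q\<close> normalises the first base.
\<close>

lemma young_pointwise:
  fixes a b W :: real
  assumes "0 \<le> a" "0 \<le> b" "0 < W" "p \<ge> 1" "q \<ge> 1" "m \<ge> 1" and pq: "1 / p + 1 / q = 1 + 1 / m"
  shows "a * b \<le> W powr (1 / m) * (a powr p * b powr q / W + a powr p + b powr q)"
proof (cases "a = 0 \<or> b = 0")
  case True
  then show ?thesis using assms by auto
next
  case False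
  then have pos: "0 < a" "0 < b" using assms by auto
  define X where "X = a powr p * b powr q / W"
  define s where "s = X + a powr p + b powr q"
  have X: "0 < X" using pos assms by (simp add: X_def)
  have s: "0 < s" "X \<le> s" "a powr p \<le> s" "b powr q \<le> s"
    using X pos by (auto simp: s_def intro!: add_nonneg_nonneg add_pos_nonneg)
  have e1: "0 \<le> 1 / p - 1 / m"
  proof -
    have "1 / q \<le> 1" using assms by simp
    then show ?thesis using pq by linarith
  qed
  have e2: "0 \<le> 1 / q - 1 / m"
  proof -
    have "1 / p \<le> 1" using assms by simp
    then show ?thesis using pq by linarith
  qed
  have lnX: "ln X = p * ln a + q * ln b - ln W"
    using pos assms by (simp add: X_def ln_div ln_mult ln_powr)
  have "a * b = W powr (1 / m) * (X powr (1 / m) * (a powr p) powr (1 / p - 1 / m) * (b powr q) powr (1 / q - 1 / m))"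
  proof -
    have "ln W / m + ln X / m + (1 / p - 1 / m) * (p * ln a) + (1 / q - 1 / m) * (q * ln b) = ln a + ln b"
      using assms(4-6) unfolding lnX by (simp add: field_simps)
    then have "exp (ln W / m + ln X / m + (1 / p - 1 / m) * (p * ln a) + (1 / q - 1 / m) * (q * ln b)) = a * b"
      using pos by (simp add: exp_add)
    then show ?thesis
      using pos X assms by (simp add: powr_def exp_add mult.assoc)
  qed
  also have "\<dots> \<le> W powr (1 / m) * (s powr (1 / m) * s powr (1 / p - 1 / m) * s powr (1 / q - 1 / m))"
    using X s pos e1 e2 assms by (intro mult_left_mono mult_mono powr_mono2 mult_nonneg_nonneg) auto
  also have "s powr (1 / m) * s powr (1 / p - 1 / m) * s powr (1 / q - 1 / m) = s"
  proof -
    have "1 / m + (1 / p - 1 / m) + (1 / q - 1 / m) = 1" using pq by simp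
    then show ?thesis using s(1) by (simp only: powr_add[symmetric]) simp
  qed
  finally show ?thesis by (simp add: s_def X_def)
qed

text \<open>
  Splits a nonnegative function into a bounded part and a part controlled by its \<open>m\<close>th power; the
  parameter \<open>t\<close> can be chosen small. This replaces Hoelder's inequality on sets of finite measure.
\<close>

lemma le_add_powr:
  fixes j t m :: real
  assumes "0 \<le> j" "0 < t" "1 \<le> m"
  shows "j \<le> t + t powr (1 - m) * j powr m"
proof (cases "j \<le> t")
  case True
  then show ?thesis using assms by (smt (verit) mult_nonneg_nonneg powr_ge_zero)
next
  case False
  then have "j = j powr (1 - m) * j powr m"
    using assms by (simp add: powr_add[symmetric])
  also have "\<dots> \<le> t powr (1 - m) * j powr m"
    using False assms by (intro mult_right_mono powr_mono2') auto
  finally show ?thesis using assms by linarith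
qed

text \<open>
  With \<open>W(x) = \<integral> f\<^sup>p k(x, \<cdot>)\<^sup>q\<close>, integrating \<open>young_pointwise\<close> in \<open>y\<close> bounds the inner integral by
  \<open>W(x)\<^bsup>1/m\<^esup> (1 + A + B)\<close>, and \<open>\<integral> W \<le> A B\<close> by Fubini's theorem. The constant is not the sharp one;
  what matters is that it tends to zero with \<open>B\<close>.
\<close>

lemma kernel_young:
  fixes f :: "'x \<Rightarrow> real" and k :: "'x \<Rightarrow> 'x \<Rightarrow> real"
  assumes M: "sigma_finite_measure M"
    and [measurable]: "f \<in> borel_measurable M" and k[measurable]: "case_prod k \<in> borel_measurable (M \<Otimes>\<^sub>M M)"
    and nonneg: "\<And>x. 0 \<le> f x" "\<And>x y. 0 \<le> k x y"
    and pqm: "p \<ge> 1" "q \<ge> 1" "m \<ge> 1" "1 / p + 1 / q = 1 + 1 / m"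
    and AB: "0 \<le> A" "0 \<le> B"
    and A: "(\<integral>\<^sup>+y. f y powr p \<partial>M) \<le> ennreal A"
    and B1: "\<And>x. x \<in> space M \<Longrightarrow> (\<integral>\<^sup>+y. k x y powr q \<partial>M) \<le> ennreal B"
    and B2: "\<And>y. y \<in> space M \<Longrightarrow> (\<integral>\<^sup>+x. k x y powr q \<partial>M) \<le> ennreal B"
  shows "AE x in M. integrable M (\<lambda>y. f y * k x y)"
    and "integrable M (\<lambda>x. (\<integral>y. f y * k x y \<partial>M) powr m)"
    and "(\<integral>x. (\<integral>y. f y * k x y \<partial>M) powr m \<partial>M) \<le> A * B * (1 + A + B) powr m"
proof -
  interpret M: sigma_finite_measure M by fact
  interpret MM: pair_sigma_finite M M ..
  define W where "W = (\<lambda>x. \<integral>\<^sup>+y. f y powr p * k x y powr q \<partial>M)"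
  define J where "J = (\<lambda>x. \<integral>y. f y * k x y \<partial>M)"
  have k1[measurable]: "k x \<in> borel_measurable M" if "x \<in> space M" for x
    using measurable_Pair2[OF k that] by simp
  have Wm[measurable]: "W \<in> borel_measurable M" unfolding W_def by measurable
  have Jm[measurable]: "J \<in> borel_measurable M" unfolding J_def by measurable
  have J0: "0 \<le> J x" for x unfolding J_def by (intro Bochner_Integration.integral_nonneg) (simp add: nonneg)
  have "(\<integral>\<^sup>+x. W x \<partial>M) = (\<integral>\<^sup>+y. \<integral>\<^sup>+x. f y powr p * k x y powr q \<partial>M \<partial>M)"
    unfolding W_def by (intro MM.Fubini'[symmetric]) measurable
  also have "\<dots> = (\<integral>\<^sup>+y. ennreal (f y powr p) * (\<integral>\<^sup>+x. k x y powr q \<partial>M) \<partial>M)"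
    using nonneg by (intro nn_integral_cong) (simp add: ennreal_mult nn_integral_cmult)
  also have "\<dots> \<le> (\<integral>\<^sup>+y. ennreal (f y powr p) * ennreal B \<partial>M)"
    by (intro nn_integral_mono mult_left_mono B2) auto
  also have "\<dots> = (\<integral>\<^sup>+y. ennreal (f y powr p) \<partial>M) * ennreal B"
    by (rule nn_integral_multc) measurable
  also have "\<dots> \<le> ennreal (A * B)"
    using A AB by (simp add: ennreal_mult mult_right_mono)
  finally have W: "(\<integral>\<^sup>+x. W x \<partial>M) \<le> ennreal (A * B)" .
  have fin: "AE x in M. W x \<noteq> \<infinity>"
    by (rule nn_integral_noteq_infinite) (use W in \<open>auto simp: top_unique\<close>)
  (* If W x = 0 the product f * k x vanishes almost everywhere and young_pointwise, which divides by
     W x, is not available; this is the first of the two cases below. *)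
  have key: "integrable M (\<lambda>y. f y * k x y) \<and> J x powr m \<le> enn2real (W x) * (1 + A + B) powr m"
    if x: "x \<in> space M" and Wx: "W x \<noteq> \<infinity>" for x
  proof -
    note [measurable] = k1[OF x]
    define r where "r = enn2real (W x)"
    have r: "W x = ennreal r" "0 \<le> r" using Wx by (auto simp: r_def less_top)
    show ?thesis
    proof (cases "r = 0")
      case True
      have "(\<integral>\<^sup>+y. ennreal (f y powr p * k x y powr q) \<partial>M) = 0"
        using r(1) True by (simp add: W_def)
      then have "AE y in M. ennreal (f y powr p * k x y powr q) = 0"
        by (subst (asm) nn_integral_0_iff_AE) auto
      then have ae: "AE y in M. f y * k x y = 0"
        by eventually_elim (use nonneg in \<open>auto simp: ennreal_eq_0_iff mult_le_0_iff not_le\<close>)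
      have "integrable M (\<lambda>y. f y * k x y)"
        by (subst integrable_cong_AE[where g = "\<lambda>_. 0"]) (use ae in auto)
      moreover have "J x = 0" unfolding J_def by (rule integral_eq_zero_AE) (use ae in auto)
      ultimately show ?thesis using True r_def AB pqm by simp
    next
      case False
      then have r0: "0 < r" using r by simp
      have b: "0 \<le> r powr (1 / m) * (1 + A + B)" using AB by simp
      have "(\<integral>\<^sup>+y. f y * k x y \<partial>M)
          \<le> (\<integral>\<^sup>+y. ennreal (r powr (1 / m)) * (ennreal (1 / r) * ennreal (f y powr p * k x y powr q)
              + ennreal (f y powr p) + ennreal (k x y powr q)) \<partial>M)"
      proof (rule nn_integral_mono)
        fix y
        have "f y * k x y \<le> r powr (1 / m) * (1 / r * (f y powr p * k x y powr q) + f y powr p + k x y powr q)"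
          using young_pointwise[OF nonneg(1) nonneg(2) r0 pqm] by simp
        then show "ennreal (f y * k x y) \<le> ennreal (r powr (1 / m)) * (ennreal (1 / r) * ennreal (f y powr p * k x y powr q)
              + ennreal (f y powr p) + ennreal (k x y powr q))"
          using r0 by (simp flip: ennreal_mult ennreal_plus)
      qed
      also have "\<dots> = ennreal (r powr (1 / m)) * (ennreal (1 / r) * W x
            + (\<integral>\<^sup>+y. f y powr p \<partial>M) + (\<integral>\<^sup>+y. k x y powr q \<partial>M))"
        unfolding W_def by (simp add: nn_integral_cmult nn_integral_add)
      also have "\<dots> \<le> ennreal (r powr (1 / m)) * (ennreal (1 / r) * ennreal r + ennreal A + ennreal B)"
        using A B1[OF x] r by (intro mult_left_mono add_mono) auto
      also have "ennreal (1 / r) * ennreal r = 1"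
        using r0 by (simp flip: ennreal_mult)
      also have "ennreal (r powr (1 / m)) * (1 + ennreal A + ennreal B) = ennreal (r powr (1 / m) * (1 + A + B))"
        using r0 AB by (simp add: ennreal_mult)
      finally have le: "(\<integral>\<^sup>+y. f y * k x y \<partial>M) \<le> ennreal (r powr (1 / m) * (1 + A + B))" .
      have int: "integrable M (\<lambda>y. f y * k x y)"
        by (rule integrableI_bounded)
          (use le nonneg in \<open>auto simp: less_top[symmetric] top_unique\<close>)
      have "ennreal (J x) = (\<integral>\<^sup>+y. f y * k x y \<partial>M)"
        unfolding J_def by (rule nn_integral_eq_integral[symmetric]) (use int nonneg in auto)
      then have "ennreal (J x) \<le> ennreal (r powr (1 / m) * (1 + A + B))" using le by simp
      then have "J x \<le> r powr (1 / m) * (1 + A + B)" unfolding ennreal_le_iff[OF b] .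
      then have "J x powr m \<le> (r powr (1 / m) * (1 + A + B)) powr m"
        using pqm J0 by (intro powr_mono2) auto
      also have "\<dots> = r * (1 + A + B) powr m"
        using r0 AB pqm by (simp add: powr_mult powr_powr)
      finally show ?thesis using int by (simp add: r_def)
    qed
  qed
  show "AE x in M. integrable M (\<lambda>y. f y * k x y)"
    using fin AE_space by eventually_elim (use key in blast)
  have "(\<integral>\<^sup>+x. J x powr m \<partial>M) \<le> (\<integral>\<^sup>+x. W x * ennreal ((1 + A + B) powr m) \<partial>M)"
  proof (rule nn_integral_mono_AE)
    show "AE x in M. ennreal (J x powr m) \<le> W x * ennreal ((1 + A + B) powr m)"
      using fin AE_space
    proof eventually_elim
      fix x assume x: "W x \<noteq> \<infinity>" "x \<in> space M"
      have "ennreal (J x powr m) \<le> ennreal (enn2real (W x) * (1 + A + B) powr m)"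
        using key[OF x(2,1)] by (intro ennreal_leI) auto
      also have "\<dots> = W x * ennreal ((1 + A + B) powr m)"
        using x by (simp add: ennreal_mult less_top)
      finally show "ennreal (J x powr m) \<le> W x * ennreal ((1 + A + B) powr m)" .
    qed
  qed
  also have "\<dots> = (\<integral>\<^sup>+x. W x \<partial>M) * ennreal ((1 + A + B) powr m)"
    by (rule nn_integral_multc) measurable
  also have "\<dots> \<le> ennreal (A * B * (1 + A + B) powr m)"
    using W AB by (simp add: ennreal_mult mult_right_mono)
  finally have le: "(\<integral>\<^sup>+x. J x powr m \<partial>M) \<le> ennreal (A * B * (1 + A + B) powr m)" .
  have int: "integrable M (\<lambda>x. J x powr m)"
    by (rule integrableI_bounded) (use le in \<open>auto simp: less_top[symmetric] top_unique\<close>)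
  have "ennreal (\<integral>x. J x powr m \<partial>M) \<le> ennreal (A * B * (1 + A + B) powr m)"
    using le by (subst (asm) nn_integral_eq_integral[OF int]) auto
  moreover have "0 \<le> A * B * (1 + A + B) powr m" using AB by simp
  ultimately have "(\<integral>x. J x powr m \<partial>M) \<le> A * B * (1 + A + B) powr m"
    by (simp only: ennreal_le_iff)
  then show "(\<integral>x. (\<integral>y. f y * k x y \<partial>M) powr m \<partial>M) \<le> A * B * (1 + A + B) powr m"
    by (simp only: J_def)
  show "integrable M (\<lambda>x. (\<integral>y. f y * k x y \<partial>M) powr m)" using int by (simp only: J_def)
qed

section \<open>Consequences of weak convergence of integrable functions\<close>

text \<open>
  The factor that turns an integrand into its norm. Scalars of a real normed field have no
  conjugation, but the norm is multiplicative, so a quotient does; at 0 its value is 0.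
\<close>

definition conj_sign :: "'a::real_normed_field \<Rightarrow> 'a" where
  "conj_sign z = of_real (norm z) / z"

lemma mult_conj_sign: "z * conj_sign z = of_real (norm z)"
  by (simp add: conj_sign_def)

lemma norm_conj_sign_le: "norm (conj_sign z) \<le> 1"
  by (simp add: conj_sign_def norm_divide)

lemma measurable_conj_sign[measurable]:
  "(conj_sign :: 'a \<Rightarrow> 'a::{real_normed_field, euclidean_space}) \<in> borel_measurable borel"
  unfolding conj_sign_def[abs_def] by measurable

lemma norm_integral_le:
  fixes f :: "'x \<Rightarrow> 'a::{banach, second_countable_topology}"
  assumes "integrable M f" "integrable M g" "AE x in M. norm (f x) \<le> g x"
  shows "norm (\<integral>x. f x \<partial>M) \<le> (\<integral>x. g x \<partial>M)"
  using assms by (intro order_trans[OF integral_norm_bound] integral_mono_AE integrable_norm)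

lemma integrable_mult_bounded:
  fixes f b :: "'x \<Rightarrow> 'a::{real_normed_field, euclidean_space}"
  assumes f: "integrable M f" and b[measurable]: "b \<in> borel_measurable M" and C: "\<And>x. norm (b x) \<le> C"
  shows "integrable M (\<lambda>x. f x * b x)"
proof (rule Bochner_Integration.integrable_bound)
  have [measurable]: "f \<in> borel_measurable M" using f by auto
  show "integrable M (\<lambda>x. C * norm (f x))" using f by (intro integrable_mult_right integrable_norm)
  show "(\<lambda>x. f x * b x) \<in> borel_measurable M" by measurable
  have C0: "0 \<le> C" using C[of undefined] norm_ge_zero order_trans by blast
  show "AE x in M. norm (f x * b x) \<le> norm (C * norm (f x))"
    using C C0 by (intro AE_I2) (simp add: norm_mult abs_mult mult.commute mult_right_mono)
qed

text \<open>
  Otherwise pick indices \<open>\<nu> j\<close> with \<open>\<integral> \<bar>f\<^bsub>\<nu> j\<^esub>\<bar> > 4\<^sup>j\<close> and build a test function as a series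
  \<open>\<Sum>\<^sub>j \<plusminus> 3\<^sup>-\<^sup>j s\<^sub>j\<close>, where \<open>s\<^sub>j\<close> is the optimal test function for \<open>f\<^bsub>\<nu> j\<^esub>\<close>. The sign of the \<open>j\<close>th
  term is chosen so that the earlier terms do not cancel it, and the later terms add up to at
  most half of it; so the integral of \<open>f\<^bsub>\<nu> j\<^esub>\<close> against the series grows like \<open>(4/3)\<^sup>j\<close>.
\<close>

lemma L1_uniform_boundedness:
  fixes f :: "nat \<Rightarrow> 'x \<Rightarrow> 'a::{real_normed_field, euclidean_space}"
  assumes f: "\<And>n. integrable M (f n)"
    and weak: "\<And>b C. b \<in> borel_measurable M \<Longrightarrow> (\<And>x. norm (b x) \<le> C) \<Longrightarrow> Bseq (\<lambda>n. \<integral>x. f n x * b x \<partial>M)"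
  shows "\<exists>C. \<forall>n. (\<integral>x. norm (f n x) \<partial>M) \<le> C"
proof (rule ccontr)
  assume "\<not> ?thesis"
  then have "\<forall>j::nat. \<exists>n. 4 ^ j < (\<integral>x. norm (f n x) \<partial>M)" by (simp add: not_le)
  from choice[OF this] obtain \<nu> where \<nu>: "\<And>j::nat. 4 ^ j < (\<integral>x. norm (f (\<nu> j) x) \<partial>M)" by blast
  have [measurable]: "f n \<in> borel_measurable M" for n using f[of n] by auto
  define s where "s j x = conj_sign (f (\<nu> j) x)" for j x
  have s[measurable]: "s j \<in> borel_measurable M" for j unfolding s_def by measurable
  have s1: "norm (s j x) \<le> 1" for j x by (simp add: s_def norm_conj_sign_le)
  define T where "T j b = (\<integral>x. f (\<nu> j) x * b x \<partial>M)" for j b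
  (* The partial sums B of the series, with the sign c of the next term. That one of the two signs
     does not lead to cancellation follows because the two values differ by 2 * I / 3 ^ j. *)
  define Q where "Q j B B' \<longleftrightarrow> (\<exists>c::real. \<bar>c\<bar> = 1 \<and> B' = (\<lambda>x. B x + (c / 3 ^ j) *\<^sub>R s j x))
      \<and> (\<integral>x. norm (f (\<nu> j) x) \<partial>M) / 3 ^ j \<le> norm (T j B')" for j and B B' :: "'x \<Rightarrow> 'a"
  have "\<exists>B. \<forall>j. (B j \<in> borel_measurable M \<and> (\<exists>C. \<forall>x. norm (B j x) \<le> C)) \<and> Q j (B j) (B (Suc j))"
  proof (rule dependent_nat_choice)
    show "\<exists>B. B \<in> borel_measurable M \<and> (\<exists>C. \<forall>x. norm (B x :: 'a) \<le> C)"
      by (rule exI[of _ "\<lambda>_. 0"]) auto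
    fix B :: "'x \<Rightarrow> 'a" and j :: nat
    assume B: "B \<in> borel_measurable M \<and> (\<exists>C. \<forall>x. norm (B x) \<le> C)"
    then obtain C where C: "\<And>x. norm (B x) \<le> C" by auto
    define B' where "B' c = (\<lambda>x. B x + (c / 3 ^ j) *\<^sub>R s j x)" for c :: real
    define I where "I = (\<integral>x. norm (f (\<nu> j) x) \<partial>M)"
    have Im: "T j (B' c) = T j B + of_real (c / 3 ^ j * I)" for c
    proof -
      have pt: "f (\<nu> j) x * B' c x = f (\<nu> j) x * B x + of_real (c / 3 ^ j * norm (f (\<nu> j) x))" for x
      proof -
        have "f (\<nu> j) x * B' c x = f (\<nu> j) x * B x + of_real (c / 3 ^ j) * (f (\<nu> j) x * conj_sign (f (\<nu> j) x))"
          unfolding B'_def s_def scaleR_conv_of_real by (simp only: distrib_left mult.left_commute)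
        then show ?thesis by (simp only: mult_conj_sign of_real_mult)
      qed
      have i1: "integrable M (\<lambda>x. f (\<nu> j) x * B x)"
        using B C by (intro integrable_mult_bounded f) auto
      have i2: "integrable M (\<lambda>x. c / 3 ^ j * norm (f (\<nu> j) x))"
        by (rule integrable_mult_right, rule integrable_norm, rule f)
      have "T j (B' c) = (\<integral>x. f (\<nu> j) x * B x \<partial>M) + (\<integral>x. of_real (c / 3 ^ j * norm (f (\<nu> j) x)) \<partial>M)"
        unfolding T_def pt by (rule Bochner_Integration.integral_add[OF i1 integrable_of_real[OF i2]])
      then show ?thesis
        unfolding integral_of_real[OF i2] T_def integral_mult_right_zero I_def .
    qed
    have "\<exists>c::real. \<bar>c\<bar> = 1 \<and> I / 3 ^ j \<le> norm (T j (B' c))"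
    proof (rule ccontr)
      assume neg: "\<not> ?thesis"
      have n1: "norm (T j (B' 1)) < I / 3 ^ j" using neg by (auto simp: not_le dest: spec[of _ 1])
      have n2: "norm (T j (B' (-1))) < I / 3 ^ j" using neg by (auto simp: not_le dest: spec[of _ "-1"])
      from n1 n2 have "norm (T j (B' 1) - T j (B' (-1))) < 2 * (I / 3 ^ j)"
        using norm_triangle_ineq4[of "T j (B' 1)" "T j (B' (-1))"] by linarith
      also have "T j (B' 1) - T j (B' (-1)) = of_real (2 * (I / 3 ^ j))"
        unfolding Im by simp
      finally show False by (simp only: norm_of_real)
    qed
    then obtain c where c: "\<bar>c\<bar> = 1" "I / 3 ^ j \<le> norm (T j (B' c))" by auto
    have "norm (B' c x) \<le> C + 1" for x
    proof -
      have "norm (B' c x) \<le> norm (B x) + norm ((c / 3 ^ j) *\<^sub>R s j x)"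
        unfolding B'_def by (rule norm_triangle_ineq)
      moreover have "norm ((c / 3 ^ j) *\<^sub>R s j x) \<le> 1"
      proof -
        have "norm ((c / 3 ^ j) *\<^sub>R s j x) = norm (s j x) / 3 ^ j" using c(1) by simp
        also have "\<dots> \<le> 1 / 1" using s1[of j x] by (intro frac_le) auto
        finally show ?thesis by simp
      qed
      ultimately show ?thesis using C[of x] by linarith
    qed
    moreover have "B' c \<in> borel_measurable M"
    proof -
      have [measurable]: "B \<in> borel_measurable M" using B by simp
      show ?thesis unfolding B'_def by measurable
    qed
    ultimately show "\<exists>B'. (B' \<in> borel_measurable M \<and> (\<exists>C. \<forall>x. norm (B' x) \<le> C)) \<and> Q j B B'"
      using c by (intro exI[of _ "B' c"]) (auto simp: Q_def B'_def I_def)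
  qed
  then obtain B where B[measurable]: "\<And>j. B j \<in> borel_measurable M"
    and Bb: "\<And>j. \<exists>C. \<forall>x. norm (B j x) \<le> C" and Q: "\<And>j. Q j (B j) (B (Suc j))" by blast
  have step: "norm (B (Suc j) x - B j x) \<le> 1 / 3 ^ j" for j x
  proof -
    obtain c :: real where c: "\<bar>c\<bar> = 1" "B (Suc j) = (\<lambda>x. B j x + (c / 3 ^ j) *\<^sub>R s j x)"
      using Q[of j] unfolding Q_def by auto
    then show ?thesis using s1[of j x] by (simp add: divide_simps)
  qed
  have tail: "norm (B (i + Suc j) x - B (Suc j) x) \<le> (1 - 1 / 3 ^ i) / (2 * 3 ^ j)" for i j x
  proof (induction i)
    case (Suc i)
    have "norm (B (Suc i + Suc j) x - B (Suc j) x) \<le> norm (B (Suc (i + Suc j)) x - B (i + Suc j) x) + norm (B (i + Suc j) x - B (Suc j) x)"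
      using norm_triangle_ineq[of "B (Suc (i + Suc j)) x - B (i + Suc j) x" "B (i + Suc j) x - B (Suc j) x"] by simp
    also have "\<dots> \<le> 1 / 3 ^ (i + Suc j) + (1 - 1 / 3 ^ i) / (2 * 3 ^ j)"
      using step[of "i + Suc j" x] Suc by linarith
    also have "\<dots> = (1 - 1 / 3 ^ Suc i) / (2 * 3 ^ j)"
      by (simp add: field_simps power_add)
    finally show ?case .
  qed simp
  have tail': "norm (B k x - B (Suc j) x) \<le> 1 / (2 * 3 ^ j)" if "Suc j \<le> k" for k j x
  proof -
    have "norm (B ((k - Suc j) + Suc j) x - B (Suc j) x) \<le> (1 - 1 / 3 ^ (k - Suc j)) / (2 * 3 ^ j)" by (rule tail)
    also have "\<dots> \<le> 1 / (2 * 3 ^ j)" by (simp add: divide_simps)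
    finally show ?thesis using that by simp
  qed
  have conv: "convergent (\<lambda>k. B k x)" for x
  proof (rule Cauchy_convergent, rule metric_CauchyI)
    fix e :: real assume "0 < e"
    then obtain j where j: "(1/3) ^ j < e" using real_arch_pow_inv[of e "1/3"] by auto
    show "\<exists>M. \<forall>m\<ge>M. \<forall>n\<ge>M. dist (B m x) (B n x) < e"
    proof (intro exI[of _ "Suc j"] allI impI)
      fix m n assume mn: "Suc j \<le> m" "Suc j \<le> n"
      have "dist (B m x) (B n x) \<le> norm (B m x - B (Suc j) x) + norm (B n x - B (Suc j) x)"
        by (metis dist_norm dist_triangle2)
      also have "\<dots> \<le> 1 / (2 * 3 ^ j) + 1 / (2 * 3 ^ j)" by (intro add_mono tail' mn)
      also have "\<dots> = (1/3) ^ j" by (simp add: power_divide)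
      finally show "dist (B m x) (B n x) < e" using j by linarith
    qed
  qed
  define b where "b x = lim (\<lambda>k. B k x)" for x
  have lim: "(\<lambda>k. B k x) \<longlonglongrightarrow> b x" for x
    unfolding b_def using conv by (simp add: convergent_LIMSEQ_iff)
  have b[measurable]: "b \<in> borel_measurable M" unfolding b_def[abs_def] by measurable
  have bB: "norm (b x - B (Suc j) x) \<le> 1 / (2 * 3 ^ j)" for j x
    by (rule tendsto_upperbound[OF tendsto_norm[OF tendsto_diff[OF lim tendsto_const]]])
      (auto intro!: eventually_sequentiallyI[of "Suc j"] tail')
  obtain C1 where C1: "\<And>x. norm (B (Suc 0) x) \<le> C1" using Bb by blast
  have "norm (b x) \<le> C1 + 1" for x
    using bB[of x 0] C1[of x] norm_triangle_ineq2[of "b x" "B (Suc 0) x"] by simp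
  then have "Bseq (\<lambda>n. \<integral>x. f n x * b x \<partial>M)" using weak[OF b] by blast
  then obtain K where K: "\<And>n. norm (\<integral>x. f n x * b x \<partial>M) \<le> K" by (auto simp: Bseq_def)
  have low: "(4/3) ^ j / 2 \<le> K" for j
  proof -
    define I where "I = (\<integral>x. norm (f (\<nu> j) x) \<partial>M)"
    have int: "integrable M (\<lambda>x. f (\<nu> j) x * b x)"
      using \<open>\<And>x. norm (b x) \<le> C1 + 1\<close> by (intro integrable_mult_bounded f b)
    have bj: "norm (b x - B (Suc j) x) \<le> 1" for x

    proof -
      have "1 / (2 * 3 ^ j) \<le> (1::real) / 1"
      proof (intro frac_le)
        have "(1::real) \<le> 3 ^ j" by simp
        then show "(1::real) \<le> 2 * 3 ^ j" by linarith
      qed auto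
      then show ?thesis using bB[of x j] by linarith
    qed
    have int2: "integrable M (\<lambda>x. f (\<nu> j) x * (b x - B (Suc j) x))"
      by (intro integrable_mult_bounded f) (auto intro: bj)
    have "T j (B (Suc j)) = (\<integral>x. f (\<nu> j) x * b x - f (\<nu> j) x * (b x - B (Suc j) x) \<partial>M)"
      unfolding T_def by (simp add: right_diff_distrib)
    also have "\<dots> = (\<integral>x. f (\<nu> j) x * b x \<partial>M) - (\<integral>x. f (\<nu> j) x * (b x - B (Suc j) x) \<partial>M)"
      by (rule Bochner_Integration.integral_diff[OF int int2])
    finally have "norm (T j (B (Suc j))) \<le> K + norm (\<integral>x. f (\<nu> j) x * (b x - B (Suc j) x) \<partial>M)"
      using K[of "\<nu> j"] norm_triangle_ineq4 order_trans by (smt (verit))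
    also have "norm (\<integral>x. f (\<nu> j) x * (b x - B (Suc j) x) \<partial>M) \<le> (\<integral>x. 1 / (2 * 3 ^ j) * norm (f (\<nu> j) x) \<partial>M)"
    proof (rule norm_integral_le[OF int2])
      show "integrable M (\<lambda>x. 1 / (2 * 3 ^ j) * norm (f (\<nu> j) x))"
        using f by (intro integrable_mult_right integrable_norm)
      show "AE x in M. norm (f (\<nu> j) x * (b x - B (Suc j) x)) \<le> 1 / (2 * 3 ^ j) * norm (f (\<nu> j) x)"
        unfolding norm_mult by (intro AE_I2, subst mult.commute) (intro mult_right_mono bB norm_ge_zero)
    qed
    also have "\<dots> = I / 3 ^ j / 2" by (simp add: I_def)
    finally have "norm (T j (B (Suc j))) \<le> K + I / 3 ^ j / 2" by simp
    moreover have "I / 3 ^ j \<le> norm (T j (B (Suc j)))" using Q[of j] by (simp add: Q_def I_def)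
    ultimately have "I / 3 ^ j / 2 \<le> K" by linarith
    moreover have "(4/3) ^ j / 2 \<le> I / 3 ^ j / 2"
      using \<nu>[of j] by (simp add: I_def power_divide divide_simps)
    ultimately show ?thesis by linarith
  qed
  obtain j where "2 * K < (4/3) ^ j" using real_arch_pow[of "4/3" "2 * K"] by auto
  with low[of j] show False by linarith
qed

text \<open>
  The gliding hump. If the masses on \<open>A k\<close> were not uniformly small, a test function could be
  assembled from pieces living on disjoint shells \<open>A k - A k'\<close>, each of them the optimal test
  function for some \<open>h n\<close> with large mass on the shell. By weak convergence the pieces chosen
  before contribute little for this \<open>n\<close>, and the later ones live on a set that carries little
  mass of \<open>h n\<close>.
\<close>

lemma weakly_null_uniformly_small:
  fixes h :: "nat \<Rightarrow> 'x \<Rightarrow> 'a::{real_normed_field, euclidean_space}"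
  assumes h: "\<And>n. integrable M (h n)"
    and weak: "\<And>b. b \<in> borel_measurable M \<Longrightarrow> (\<And>x. norm (b x) \<le> 1) \<Longrightarrow> (\<lambda>n. \<integral>x. h n x * b x \<partial>M) \<longlonglongrightarrow> 0"
    and A[measurable]: "\<And>k. A k \<in> sets M" and dec: "decseq A" and empty: "(\<Inter>k. A k) = {}" and "0 < \<delta>"
  shows "\<exists>k. \<forall>n. (\<integral>x. indicator (A k) x * norm (h n x) \<partial>M) < \<delta>"
proof (rule ccontr)
  assume neg: "\<not> ?thesis"
  have [measurable]: "h n \<in> borel_measurable M" for n using h[of n] by auto
  define \<mu> where "\<mu> n k = (\<integral>x. indicator (A k) x * norm (h n x) \<partial>M)" for n k
  have neg: "\<exists>n. \<delta> \<le> \<mu> n k" for k using neg by (auto simp: \<mu>_def not_less)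
  have ind_int: "integrable M (\<lambda>x. indicator S x * norm (h n x))" if "S \<in> sets M" for S n
    by (rule Bochner_Integration.integrable_bound[OF integrable_norm[OF h[of n]]])
      (use that in \<open>auto simp: indicator_def\<close>)
  have mono: "\<mu> n l \<le> \<mu> n k" if "k \<le> l" for n k l
    unfolding \<mu>_def using decseqD[OF dec that]
    by (intro Bochner_Integration.integral_mono ind_int A) (auto simp: indicator_def)
  have to0: "(\<lambda>k. \<mu> n k) \<longlonglongrightarrow> 0" for n
  proof -
    have "(\<lambda>k. \<mu> n k) \<longlonglongrightarrow> (\<integral>x. 0 \<partial>M)"
      unfolding \<mu>_def
    proof (rule integral_dominated_convergence[where w = "\<lambda>x. norm (h n x)"])
      show "AE x in M. (\<lambda>k. indicator (A k) x * norm (h n x)) \<longlonglongrightarrow> 0"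
      proof (rule AE_I2)
        fix x
        obtain K where "x \<notin> A K" using empty by auto
        then have "x \<notin> A k" if "K \<le> k" for k using decseqD[OF dec that] by auto
        then show "(\<lambda>k. indicator (A k) x * norm (h n x)) \<longlonglongrightarrow> 0"
          by (intro tendsto_eventually eventually_sequentiallyI[of K]) simp
      qed
    qed (use h in \<open>auto simp: indicator_def\<close>)
    then show ?thesis by simp
  qed
  (* A state consists of the test function b assembled so far, which vanishes on the tail A k. Each
     step fills the shell A k - A k' for an index n so large that b contributes little. *)
  define P where "P = (\<lambda>(b :: 'x \<Rightarrow> 'a, k). b \<in> borel_measurable M \<and> (\<forall>x. norm (b x) \<le> 1) \<and> (\<forall>x\<in>A k. b x = 0))"
  define Q where "Q j = (\<lambda>(b :: 'x \<Rightarrow> 'a, k) (b', k'). k < k' \<and> (\<forall>x. x \<notin> A k \<longrightarrow> b' x = b x)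
      \<and> (\<exists>n\<ge>j. \<delta> / 2 \<le> norm (\<integral>x. h n x * b' x \<partial>M) \<and> \<mu> n k' < \<delta> / 4))" for j :: nat
  have "\<exists>F. \<forall>j. P (F j) \<and> Q j (F j) (F (Suc j))"
  proof (rule dependent_nat_choice)
    show "\<exists>F. P F" by (rule exI[of _ "(\<lambda>_. 0, 0)"]) (simp add: P_def)
    fix F :: "('x \<Rightarrow> 'a) \<times> nat" and j assume "P F"
    then obtain b k where F: "F = (b, k)" and b[measurable]: "b \<in> borel_measurable M"
      and b1: "\<And>x. norm (b x) \<le> 1" and b0: "\<And>x. x \<in> A k \<Longrightarrow> b x = 0"
      by (cases F) (auto simp: P_def)
    have "eventually (\<lambda>n. norm (\<integral>x. h n x * b x \<partial>M) < \<delta> / 4) sequentially"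
      using tendstoD[OF weak[OF b b1], of "\<delta> / 4"] \<open>0 < \<delta>\<close> by (simp add: dist_norm)
    then obtain N where N: "\<And>n. N \<le> n \<Longrightarrow> norm (\<integral>x. h n x * b x \<partial>M) < \<delta> / 4"
      by (auto simp: eventually_sequentially)
    have "eventually (\<lambda>l. \<forall>n\<in>{..<max N j}. \<mu> n l < \<delta>) sequentially"
      by (intro eventually_ball_finite ballI order_tendstoD(2)[OF to0] \<open>0 < \<delta>\<close>) auto
    then have "eventually (\<lambda>l. (\<forall>n\<in>{..<max N j}. \<mu> n l < \<delta>) \<and> k \<le> l) sequentially"
      by (intro eventually_conj eventually_ge_at_top)
    then obtain l where l: "\<And>n. n < max N j \<Longrightarrow> \<mu> n l < \<delta>" "k \<le> l"
      by (auto simp: eventually_sequentially)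
    obtain n where n: "\<delta> \<le> \<mu> n l" using neg by blast
    then have "\<not> n < max N j" using l(1)[of n] by auto
    then have n1: "N \<le> n" "j \<le> n" by (auto simp: not_less)
    have n2: "\<delta> \<le> \<mu> n k" using n mono[OF l(2), of n] by linarith
    have "eventually (\<lambda>k'. \<mu> n k' < \<delta> / 4 \<and> k < k') sequentially"
      using \<open>0 < \<delta>\<close> by (intro eventually_conj order_tendstoD(2)[OF to0] eventually_gt_at_top) auto
    then obtain k' where k': "\<mu> n k' < \<delta> / 4" "k < k'" by (auto simp: eventually_sequentially)
    have sub: "A k' \<subseteq> A k" using decseqD[OF dec, of k k'] k' by simp
    define b' where "b' x = (if x \<in> A k - A k' then conj_sign (h n x) else b x)" for x
    have b'm: "b' \<in> borel_measurable M" unfolding b'_def by measurable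
    have shell: "(\<integral>x. indicator (A k - A k') x * norm (h n x) \<partial>M) = \<mu> n k - \<mu> n k'"
    proof -
      have "indicator (A k - A k') x * norm (h n x) = indicator (A k) x * norm (h n x) - indicator (A k') x * norm (h n x)" for x
        using sub by (auto simp: indicator_def)
      then show ?thesis
        unfolding \<mu>_def by (simp only: Bochner_Integration.integral_diff[OF ind_int[OF A] ind_int[OF A]])
    qed
    have "(\<integral>x. h n x * b' x \<partial>M) = (\<integral>x. h n x * b x + of_real (indicator (A k - A k') x * norm (h n x)) \<partial>M)"
      by (rule Bochner_Integration.integral_cong) (auto simp: b'_def mult_conj_sign b0 indicator_def)
    also have "\<dots> = (\<integral>x. h n x * b x \<partial>M) + (\<integral>x. of_real (indicator (A k - A k') x * norm (h n x)) \<partial>M)"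
      by (intro Bochner_Integration.integral_add integrable_mult_bounded[OF h b b1] integrable_of_real ind_int) auto
    also have "(\<integral>x. of_real (indicator (A k - A k') x * norm (h n x)) \<partial>M) = (of_real (\<mu> n k - \<mu> n k') :: 'a)"
      by (subst integral_of_real) (simp_all add: shell ind_int)
    finally have "(of_real (\<mu> n k - \<mu> n k') :: 'a) = (\<integral>x. h n x * b' x \<partial>M) - (\<integral>x. h n x * b x \<partial>M)"
      by simp
    then have "norm (of_real (\<mu> n k - \<mu> n k') :: 'a) \<le> norm (\<integral>x. h n x * b' x \<partial>M) + norm (\<integral>x. h n x * b x \<partial>M)"
      by (simp only: norm_triangle_ineq4)
    then have "\<mu> n k - \<mu> n k' \<le> norm (\<integral>x. h n x * b' x \<partial>M) + norm (\<integral>x. h n x * b x \<partial>M)"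
      unfolding norm_of_real by linarith
    then have "\<delta> / 2 \<le> norm (\<integral>x. h n x * b' x \<partial>M)" using N[OF n1(1)] n2 k' by linarith
    moreover have "P (b', k')"
      unfolding P_def using b'm b1 b0 sub by (auto simp: b'_def norm_conj_sign_le)
    ultimately show "\<exists>F'. P F' \<and> Q j F F'"
      using k' n1 unfolding F by (intro exI[of _ "(b', k')"]) (auto simp: Q_def b'_def)
  qed
  then obtain F where PF: "\<And>j. P (F j)" and QF: "\<And>j. Q j (F j) (F (Suc j))" by blast
  define B where "B j = fst (F j)" for j
  define k where "k j = snd (F j)" for j
  have B[measurable]: "B j \<in> borel_measurable M" and B1: "norm (B j x) \<le> 1"
    and B0: "x \<in> A (k j) \<Longrightarrow> B j x = 0" for j x
  proof -
    have "P (B j, k j)" using PF by (simp add: B_def k_def)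
    then show "B j \<in> borel_measurable M" "norm (B j x) \<le> 1" "x \<in> A (k j) \<Longrightarrow> B j x = 0"
      unfolding P_def prod.case by blast+
  qed
  have kS: "k j < k (Suc j)" and Beq: "x \<notin> A (k j) \<Longrightarrow> B (Suc j) x = B j x"
    and ex: "\<exists>n\<ge>j. \<delta> / 2 \<le> norm (\<integral>x. h n x * B (Suc j) x \<partial>M) \<and> \<mu> n (k (Suc j)) < \<delta> / 4" for j x
  proof -
    have "Q j (B j, k j) (B (Suc j), k (Suc j))" using QF by (simp add: B_def k_def)
    then show "k j < k (Suc j)" "x \<notin> A (k j) \<Longrightarrow> B (Suc j) x = B j x"
      "\<exists>n\<ge>j. \<delta> / 2 \<le> norm (\<integral>x. h n x * B (Suc j) x \<partial>M) \<and> \<mu> n (k (Suc j)) < \<delta> / 4"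
      unfolding Q_def prod.case by blast+
  qed
  have k_mono: "k i \<le> k j" if "i \<le> j" for i j
    by (rule lift_Suc_mono_le[of k, OF less_imp_le[OF kS] that])
  have k_ge: "j \<le> k j" for j
    by (rule strict_mono_imp_increasing) (simp add: strict_mono_Suc_iff kS)
  have stable: "B (j + i) x = B j x" if "x \<notin> A (k j)" for i j x
  proof (induction i)
    case (Suc i)
    have "x \<notin> A (k (j + i))" using that decseqD[OF dec k_mono[of j "j + i"]] by auto
    then show ?case using Suc Beq[of x "j + i"] by simp
  qed simp
  define b where "b x = lim (\<lambda>j. B j x)" for x
  have b_eq: "b x = B j x" if "x \<notin> A (k j)" for j x
  proof -
    have "B i x = B j x" if "j \<le> i" for i using stable[OF \<open>x \<notin> A (k j)\<close>, of "i - j"] that by simp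
    then have "(\<lambda>j. B j x) \<longlonglongrightarrow> B j x"
      by (intro tendsto_eventually eventually_sequentiallyI[of j])
    then show ?thesis unfolding b_def by (rule limI)
  qed
  have b[measurable]: "b \<in> borel_measurable M" unfolding b_def[abs_def] by measurable
  have b1: "norm (b x) \<le> 1" for x
  proof -
    obtain K where "x \<notin> A K" using empty by auto
    then have "x \<notin> A (k K)" using decseqD[OF dec k_ge[of K]] by auto
    from b_eq[OF this] show ?thesis using B1[of K x] by simp
  qed
  have "eventually (\<lambda>n. norm (\<integral>x. h n x * b x \<partial>M) < \<delta> / 4) sequentially"
    using tendstoD[OF weak[OF b b1], of "\<delta> / 4"] \<open>0 < \<delta>\<close> by (simp add: dist_norm)
  then obtain N where N: "\<And>n. N \<le> n \<Longrightarrow> norm (\<integral>x. h n x * b x \<partial>M) < \<delta> / 4"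
    by (auto simp: eventually_sequentially)
  obtain n where n: "N \<le> n" "\<delta> / 2 \<le> norm (\<integral>x. h n x * B (Suc N) x \<partial>M)" "\<mu> n (k (Suc N)) < \<delta> / 4"
    using ex[of N] by blast
  have int: "integrable M (\<lambda>x. h n x * b x)" "integrable M (\<lambda>x. h n x * B (Suc N) x)"
    by (rule integrable_mult_bounded[OF h b b1], rule integrable_mult_bounded[OF h B B1])
  have "norm ((\<integral>x. h n x * B (Suc N) x \<partial>M) - (\<integral>x. h n x * b x \<partial>M)) = norm (\<integral>x. h n x * B (Suc N) x - h n x * b x \<partial>M)"
    by (simp only: Bochner_Integration.integral_diff[OF int(2,1)])
  also have "\<dots> \<le> \<mu> n (k (Suc N))"
    unfolding \<mu>_def
  proof (rule norm_integral_le)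
    have "norm (h n x * B (Suc N) x - h n x * b x) \<le> indicator (A (k (Suc N))) x * norm (h n x)" for x
      using B0[of x "Suc N"] b_eq[of x "Suc N"] b1[of x]
      by (cases "x \<in> A (k (Suc N))") (simp_all add: norm_mult mult_left_le)
    then show "AE x in M. norm (h n x * B (Suc N) x - h n x * b x) \<le> indicator (A (k (Suc N))) x * norm (h n x)" by simp
  qed (intro Bochner_Integration.integrable_diff int ind_int A)+
  finally show False
    using n N[OF n(1)] norm_triangle_ineq2[of "\<integral>x. h n x * B (Suc N) x \<partial>M" "\<integral>x. h n x * b x \<partial>M"] by linarith
qed

text \<open>
  Outside a set \<open>A k\<close> decreasing to the empty set the weights \<open>\<phi> j\<close> with \<open>j \<ge> k\<close> are at
  most \<open>\<eta>\<close>, which is harmless because the \<open>f n\<close> are bounded in \<open>L\<^sup>1\<close>. On \<open>A k\<close> the differences \<open>f n - g\<close>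
  have uniformly small mass by the gliding hump, and \<open>g\<close> by dominated convergence.
\<close>

lemma weak_L1_uniformly_integrable:
  fixes f :: "nat \<Rightarrow> 'x \<Rightarrow> 'a::{real_normed_field, euclidean_space}"
  assumes f: "\<And>n. integrable M (f n)" and g: "integrable M g"
    and weak: "\<And>b C. b \<in> borel_measurable M \<Longrightarrow> (\<And>x. norm (b x) \<le> C)
        \<Longrightarrow> (\<lambda>n. \<integral>x. f n x * b x \<partial>M) \<longlonglongrightarrow> (\<integral>x. g x * b x \<partial>M)"
    and \<phi>[measurable]: "\<And>j. \<phi> j \<in> borel_measurable M" and \<phi>0: "\<And>j x. 0 \<le> \<phi> j x" and \<phi>C: "\<And>j x. \<phi> j x \<le> (C::real)"
    and lim: "AE x in M. (\<lambda>j. \<phi> j x) \<longlonglongrightarrow> 0" and \<delta>: "0 < \<delta>"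
  shows "\<exists>J. \<forall>j\<ge>J. \<forall>n. (\<integral>x. norm (f n x) * \<phi> j x \<partial>M) < \<delta>"
proof -
  have [measurable]: "f n \<in> borel_measurable M" "g \<in> borel_measurable M" for n using f[of n] g by auto
  have C: "0 \<le> C" using \<phi>0[of 0 undefined] \<phi>C[of 0 undefined] by linarith
  have "\<exists>C. \<forall>n. (\<integral>x. norm (f n x) \<partial>M) \<le> C"
  proof (rule L1_uniform_boundedness[OF f])
    fix b :: "'x \<Rightarrow> 'a" and C assume "b \<in> borel_measurable M" "\<And>x. norm (b x) \<le> C"
    then have "(\<lambda>n. \<integral>x. f n x * b x \<partial>M) \<longlonglongrightarrow> (\<integral>x. g x * b x \<partial>M)" by (rule weak)
    then show "Bseq (\<lambda>n. \<integral>x. f n x * b x \<partial>M)"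
      by (intro convergent_imp_Bseq) (auto simp: convergent_def)
  qed
  then obtain K where K: "\<And>n. (\<integral>x. norm (f n x) \<partial>M) \<le> K" by blast
  have K0: "0 \<le> K" by (rule order_trans[OF _ K[of 0]]) (intro Bochner_Integration.integral_nonneg norm_ge_zero)
  obtain N where N: "N \<in> null_sets M" "\<And>x. x \<in> space M - N \<Longrightarrow> (\<lambda>j. \<phi> j x) \<longlonglongrightarrow> 0"
    using lim by (auto elim!: AE_E3)
  define \<eta> where "\<eta> = \<delta> / 2 / (K + 1)"
  have \<eta>: "0 < \<eta>" "\<eta> * K \<le> \<delta> / 2"
  proof -
    show "0 < \<eta>" using \<delta> K0 by (simp add: \<eta>_def)
    then have "\<eta> * K \<le> \<eta> * (K + 1)" by (intro mult_left_mono) auto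
    also have "\<dots> = \<delta> / 2"
      by (rule iffD1[OF nonzero_eq_divide_eq \<eta>_def]) (use K0 in simp)
    finally show "\<eta> * K \<le> \<delta> / 2" .
  qed
  define A where "A k = {x \<in> space M. \<exists>j\<ge>k. \<eta> < \<phi> j x} - N" for k
  have A[measurable]: "A k \<in> sets M" for k
    unfolding A_def using N(1) by (intro sets.Diff) auto
  have dec: "decseq A" by (auto simp: decseq_def A_def) (meson order_trans)
  have empty: "(\<Inter>k. A k) = {}"
  proof (rule equals0I)
    fix x assume x: "x \<in> (\<Inter>k. A k)"
    then have "x \<in> space M - N" by (auto simp: A_def)
    then have "eventually (\<lambda>j. \<phi> j x < \<eta>) sequentially"
      by (intro order_tendstoD(2)[OF N(2)] \<eta>)
    then obtain k where "\<And>j. k \<le> j \<Longrightarrow> \<phi> j x < \<eta>" by (auto simp: eventually_sequentially)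
    moreover have "x \<in> A k" using x by auto
    ultimately show False by (force simp: A_def)
  qed
  have ind_int: "integrable M (\<lambda>x. indicator S x * norm (u x))" if "S \<in> sets M" "integrable M u" for S and u :: "'x \<Rightarrow> 'a"
    by (rule Bochner_Integration.integrable_bound[OF integrable_norm[OF that(2)]])
      (use that in \<open>auto simp: indicator_def\<close>)
  have small: "\<exists>k. \<forall>n. (\<integral>x. indicator (A k) x * norm (u n x) \<partial>M) < \<epsilon>"
    if "\<And>n. integrable M (u n)" "0 < \<epsilon>"
      "\<And>b. b \<in> borel_measurable M \<Longrightarrow> (\<And>x. norm (b x) \<le> 1) \<Longrightarrow> (\<lambda>n. \<integral>x. u n x * b x \<partial>M) \<longlonglongrightarrow> 0"
    for u :: "nat \<Rightarrow> 'x \<Rightarrow> 'a" and \<epsilon>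
    using weakly_null_uniformly_small[OF that(1,3) A dec empty that(2)] by blast
  define \<epsilon> where "\<epsilon> = \<delta> / 4 / (C + 1)"
  have \<epsilon>: "0 < \<epsilon>" "C * (2 * \<epsilon>) < \<delta> / 2"
  proof -
    show "0 < \<epsilon>" using \<delta> C by (simp add: \<epsilon>_def)
    then have "C * (2 * \<epsilon>) < (C + 1) * (2 * \<epsilon>)" by (intro mult_strict_right_mono) auto
    also have "\<dots> = \<delta> / 2"
    proof -
      have "\<epsilon> * (C + 1) = \<delta> / 4" by (rule iffD1[OF nonzero_eq_divide_eq \<epsilon>_def]) (use C in simp)
      then show ?thesis by (simp add: algebra_simps)
    qed
    finally show "C * (2 * \<epsilon>) < \<delta> / 2" .
  qed
  have diff: "(\<lambda>n. \<integral>x. (f n x - g x) * b x \<partial>M) \<longlonglongrightarrow> 0"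
    if b: "b \<in> borel_measurable M" "\<And>x. norm (b x) \<le> 1" for b
  proof -
    have "(\<integral>x. (f n x - g x) * b x \<partial>M) = (\<integral>x. f n x * b x \<partial>M) - (\<integral>x. g x * b x \<partial>M)" for n
      unfolding left_diff_distrib
      by (intro Bochner_Integration.integral_diff integrable_mult_bounded[OF f b] integrable_mult_bounded[OF g b])
    then show ?thesis using weak[OF b] by (simp add: LIM_zero_iff)
  qed
  obtain k1 where k1: "\<And>n. (\<integral>x. indicator (A k1) x * norm (f n x - g x) \<partial>M) < \<epsilon>"
    using small[of "\<lambda>n x. f n x - g x" \<epsilon>] f g \<epsilon> diff by auto
  obtain k2 where k2: "(\<integral>x. indicator (A k2) x * norm (g x) \<partial>M) < \<epsilon>"
  proof -
    have "(\<lambda>k. \<integral>x. indicator (A k) x * norm (g x) \<partial>M) \<longlonglongrightarrow> (\<integral>x. 0 \<partial>M)"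
    proof (rule integral_dominated_convergence[where w = "\<lambda>x. norm (g x)"])
      show "AE x in M. (\<lambda>k. indicator (A k) x * norm (g x)) \<longlonglongrightarrow> 0"
      proof (rule AE_I2)
        fix x
        obtain K where "x \<notin> A K" using empty by auto
        then have "x \<notin> A k" if "K \<le> k" for k using decseqD[OF dec that] by auto
        then show "(\<lambda>k. indicator (A k) x * norm (g x)) \<longlonglongrightarrow> 0"
          by (intro tendsto_eventually eventually_sequentiallyI[of K]) simp
      qed
    qed (use g in \<open>auto simp: indicator_def\<close>)
    then have "eventually (\<lambda>k. (\<integral>x. indicator (A k) x * norm (g x) \<partial>M) < \<epsilon>) sequentially"
      using \<epsilon> by (intro order_tendstoD(2)) auto
    then show ?thesis using that by (auto simp: eventually_sequentially)
  qed
  have "(\<integral>x. norm (f n x) * \<phi> j x \<partial>M) < \<delta>" if j: "max k1 k2 \<le> j" for j n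
  proof -
    have sub: "A j \<subseteq> A k1" "A j \<subseteq> A k2" using decseqD[OF dec] j by auto
    have i1: "integrable M (\<lambda>x. indicator (A k1) x * norm (f n x - g x))"
      "integrable M (\<lambda>x. indicator (A k2) x * norm (g x))" "integrable M (\<lambda>x. norm (f n x))"
      using f g by (auto intro!: ind_int)
    have i2: "integrable M (\<lambda>x. C * (indicator (A k1) x * norm (f n x - g x) + indicator (A k2) x * norm (g x)))"
      by (intro integrable_mult_right Bochner_Integration.integrable_add i1)
    have "(\<integral>x. norm (f n x) * \<phi> j x \<partial>M) \<le> (\<integral>x. \<eta> * norm (f n x)
        + C * (indicator (A k1) x * norm (f n x - g x) + indicator (A k2) x * norm (g x)) \<partial>M)"
    proof (rule integral_mono_AE)
      show "integrable M (\<lambda>x. norm (f n x) * \<phi> j x)"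
        by (rule Bochner_Integration.integrable_bound[OF integrable_mult_right[OF i1(3), of C]])
          (use \<phi>0 \<phi>C C in \<open>auto simp: abs_mult mult.commute mult_right_mono\<close>)
      show "integrable M (\<lambda>x. \<eta> * norm (f n x) + C * (indicator (A k1) x * norm (f n x - g x) + indicator (A k2) x * norm (g x)))"
        by (intro Bochner_Integration.integrable_add integrable_mult_right i2 i1)
      show "AE x in M. norm (f n x) * \<phi> j x \<le> \<eta> * norm (f n x)
          + C * (indicator (A k1) x * norm (f n x - g x) + indicator (A k2) x * norm (g x))"
        using AE_not_in[OF N(1)] AE_space
      proof eventually_elim
        fix x assume x: "x \<notin> N" "x \<in> space M"
        have nn: "0 \<le> C * (indicator (A k1) x * norm (f n x - g x) + indicator (A k2) x * norm (g x))"
          using C by simp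
        show "norm (f n x) * \<phi> j x \<le> \<eta> * norm (f n x)
          + C * (indicator (A k1) x * norm (f n x - g x) + indicator (A k2) x * norm (g x))"
        proof (cases "\<eta> < \<phi> j x")
          case True
          then have "x \<in> A k1" "x \<in> A k2" using x sub by (auto simp: A_def)
          have "norm (f n x) * \<phi> j x \<le> C * norm (f n x)"
            using \<phi>C by (simp add: mult.commute mult_right_mono)
          also have "\<dots> \<le> C * (norm (f n x - g x) + norm (g x))"
            using C norm_triangle_ineq[of "f n x - g x" "g x"] by (intro mult_left_mono) auto
          finally have "norm (f n x) * \<phi> j x \<le> C * (norm (f n x - g x) + norm (g x))" .
          moreover have "0 \<le> \<eta> * norm (f n x)" using \<eta> by simp
          ultimately show ?thesis using \<open>x \<in> A k1\<close> \<open>x \<in> A k2\<close>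
            by (simp only: indicator_simps mult_1)
        next
          case False
          then have "norm (f n x) * \<phi> j x \<le> \<eta> * norm (f n x)" by (simp add: mult.commute mult_right_mono)
          then show ?thesis using nn by linarith
        qed
      qed
    qed
    also have "\<dots> = \<eta> * (\<integral>x. norm (f n x) \<partial>M)
        + C * ((\<integral>x. indicator (A k1) x * norm (f n x - g x) \<partial>M) + (\<integral>x. indicator (A k2) x * norm (g x) \<partial>M))"
      using i1 i2 by simp
    also have "\<dots> \<le> \<eta> * K + C * (2 * \<epsilon>)"
      using K[of n] k1[of n] k2 \<eta> C by (intro add_mono mult_left_mono) auto
    also have "\<dots> < \<delta>" using \<eta> \<epsilon> by linarith
    finally show ?thesis .
  qed
  then show ?thesis by blast
qed

section \<open>Continuous test functions\<close>

definition test_fun :: "('b::euclidean_space \<times> 'c::euclidean_space \<Rightarrow> 'a::real_normed_vector) \<Rightarrow> bool" where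
  "test_fun G \<longleftrightarrow> continuous_on UNIV G \<and> (\<forall>x. periodic (\<lambda>w. G (x, w)))
     \<and> (\<exists>R. \<forall>x w. R < norm x \<longrightarrow> G (x, w) = 0)"

lemma bounded_ucell: "\<exists>c\<ge>0. \<forall>w\<in>(ucell :: 'c::euclidean_space set). norm w \<le> c"
proof -
  have "bounded (ucell :: 'c set)" by (rule bounded_subset[OF bounded_cbox ucell_bounds(2)])
  then show ?thesis unfolding bounded_pos by (meson less_imp_le)
qed

lemma test_fun_periodic: "test_fun G \<Longrightarrow> lattice_point k \<Longrightarrow> G (x, w + k) = G (x, w)"
  by (auto simp: test_fun_def periodic_def)

text \<open>
  Modulo the lattice only a compact set of arguments matters, whence uniform continuity.
\<close>

lemma test_fun_uniform:
  fixes G :: "'b::euclidean_space \<times> 'c::euclidean_space \<Rightarrow> 'a::real_normed_vector"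
  assumes G: "test_fun G" and "0 < \<epsilon>"
  shows "\<exists>d>0. \<forall>P Q. dist P Q < d \<longrightarrow> dist (G P) (G Q) < \<epsilon>"
proof -
  obtain R where R: "\<And>x w. R < norm x \<Longrightarrow> G (x, w) = 0" using G by (auto simp: test_fun_def)
  obtain c where c: "0 \<le> c" "\<And>w::'c. w \<in> ucell \<Longrightarrow> norm w \<le> c" using bounded_ucell by blast
  define K where "K = cball (0::'b) (R + 1) \<times> cball (0::'c) (c + 1)"
  have "compact K" unfolding K_def by (intro compact_Times compact_cball)
  moreover have "continuous_on K G" using G by (auto simp: test_fun_def intro: continuous_on_subset)
  ultimately have "uniformly_continuous_on K G" by (rule compact_uniformly_continuous[rotated])
  then obtain d where d: "0 < d" "\<And>P Q. P \<in> K \<Longrightarrow> Q \<in> K \<Longrightarrow> dist P Q < d \<Longrightarrow> dist (G P) (G Q) < \<epsilon>"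
    unfolding uniformly_continuous_on_def using \<open>0 < \<epsilon>\<close> by (auto simp: dist_commute dest!: spec[of _ \<epsilon>])
  have "dist (G P) (G Q) < \<epsilon>" if PQ: "dist P Q < min d 1" for P Q
  proof -
    obtain x w x' w' where P: "P = (x, w)" and Q: "Q = (x', w')" by (cases P, cases Q)
    have dx: "dist x x' < 1" and dw: "dist w w' < 1"
      using PQ dist_fst_le[of P Q] dist_snd_le[of P Q] unfolding P Q by auto
    show ?thesis
    proof (cases "R < norm x \<and> R < norm x'")
      case True
      then show ?thesis using R[of x w] R[of x' w'] \<open>0 < \<epsilon>\<close> unfolding P Q by simp
    next
      case False
      have "norm x \<le> norm x' + dist x x'" "norm x' \<le> norm x + dist x x'"
        unfolding dist_norm using norm_triangle_ineq2[of x x'] norm_triangle_ineq2[of x' x]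
        by (auto simp: norm_minus_commute)
      then have nx: "norm x \<le> R + 1" "norm x' \<le> R + 1" using dx False by linarith+
      define k where "k = vfloor w"
      have eq: "G P = G (x, w - k)" "G Q = G (x', w' - k)"
        using test_fun_periodic[OF G lattice_point_vfloor[of w], of x "w - k"]
          test_fun_periodic[OF G lattice_point_vfloor[of w], of x' "w' - k"]
        unfolding P Q k_def by auto
      have n1: "norm (w - k) \<le> c" using c(2)[OF vfrac_in_ucell[of w]] by (simp add: vfrac_def k_def)
      have "norm (w' - k) \<le> norm (w - k) + dist w w'"
        unfolding dist_norm using norm_triangle_ineq4[of "w - k" "w - w'"] by simp
      then have "norm (w' - k) \<le> c + 1" using n1 dw by linarith
      then have inK: "(x, w - k) \<in> K" "(x', w' - k) \<in> K" using nx n1 by (auto simp: K_def)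
      have "dist (x, w - k) (x', w' - k) = dist P Q"
        unfolding P Q by (simp add: dist_Pair_Pair dist_norm)
      then have "dist (G (x, w - k)) (G (x', w' - k)) < \<epsilon>" using PQ by (intro d(2) inK) simp
      then show ?thesis by (simp only: eq)
    qed
  qed
  then show ?thesis using d(1) by (intro exI[of _ "min d 1"]) auto
qed

lemma test_fun_bounded:
  fixes G :: "'b::euclidean_space \<times> 'c::euclidean_space \<Rightarrow> 'a::real_normed_vector"
  assumes G: "test_fun G"
  shows "\<exists>C\<ge>0. \<forall>P. norm (G P) \<le> C"
proof -
  obtain R where R: "\<And>x w. R < norm x \<Longrightarrow> G (x, w) = 0" using G by (auto simp: test_fun_def)
  obtain c where c: "0 \<le> c" "\<And>w::'c. w \<in> ucell \<Longrightarrow> norm w \<le> c" using bounded_ucell by blast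
  define K where "K = cball (0::'b) R \<times> cball (0::'c) c"
  have "compact K" unfolding K_def by (intro compact_Times compact_cball)
  moreover have "continuous_on K G" using G by (auto simp: test_fun_def intro: continuous_on_subset)
  ultimately have "bounded (G ` K)" by (intro compact_imp_bounded compact_continuous_image)
  then obtain C where C: "0 < C" "\<And>P. P \<in> K \<Longrightarrow> norm (G P) \<le> C" by (auto simp: bounded_pos)
  have "norm (G P) \<le> C" for P
  proof -
    obtain x w where P: "P = (x, w)" by (cases P)
    have eq: "G P = G (x, vfrac w)"
      using test_fun_periodic[OF G lattice_point_vfloor[of w], of x "vfrac w"] by (simp add: P vfrac_def)
    show ?thesis
    proof (cases "R < norm x")
      case False
      then have "(x, vfrac w) \<in> K" using c(2)[OF vfrac_in_ucell[of w]] by (auto simp: K_def)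
      then show ?thesis using C eq by simp
    qed (use R C P in auto)
  qed
  then show ?thesis using C(1) by (meson less_imp_le)
qed

lemma test_fun_measurable: "test_fun G \<Longrightarrow> G \<in> borel_measurable borel"
  by (auto simp: test_fun_def intro: borel_measurable_continuous_onI)

definition test_bcf :: "('b::euclidean_space \<times> 'c::euclidean_space \<Rightarrow> 'a::real_normed_vector) \<Rightarrow> 'b \<Rightarrow> ('c \<Rightarrow>\<^sub>C 'a)" where
  "test_bcf G x = Bcontfun (\<lambda>w. G (x, w))"

lemma apply_test_bcf:
  assumes G: "test_fun G" shows "apply_bcontfun (test_bcf G x) w = G (x, w)"
proof -
  obtain C where "\<And>P. norm (G P) \<le> C" using test_fun_bounded[OF G] by blast
  moreover have "continuous_on UNIV (\<lambda>w. G (x, w))"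
    by (rule continuous_on_compose2[of UNIV G]) (use G in \<open>auto simp: test_fun_def intro!: continuous_intros\<close>)
  ultimately have "(\<lambda>w. G (x, w)) \<in> bcontfun" by (intro bcontfun_normI)
  then show ?thesis by (simp add: test_bcf_def Bcontfun_inverse)
qed

lemma continuous_on_test_bcf:
  fixes G :: "'b::euclidean_space \<times> 'c::euclidean_space \<Rightarrow> 'a::real_normed_vector"
  assumes G: "test_fun G" shows "continuous_on UNIV (test_bcf G)"
  unfolding continuous_on_iff
proof (intro ballI allI impI)
  fix x :: 'b and \<epsilon> :: real assume "0 < \<epsilon>"
  then obtain d where d: "0 < d" "\<And>P Q. dist P Q < d \<Longrightarrow> dist (G P) (G Q) < \<epsilon> / 2"
    using test_fun_uniform[OF G, of "\<epsilon> / 2"] by auto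
  have "dist (test_bcf G y) (test_bcf G x) < \<epsilon>" if "dist y x < d" for y
  proof -
    have "dist (test_bcf G y) (test_bcf G x) \<le> \<epsilon> / 2"
    proof (rule dist_bound)
      fix w :: 'c
      have "dist (y, w) (x, w) < d" using that by (simp add: dist_Pair_Pair)
      from d(2)[OF this] show "dist (apply_bcontfun (test_bcf G y) w) (apply_bcontfun (test_bcf G x) w) \<le> \<epsilon> / 2"
        by (simp add: apply_test_bcf[OF G])
    qed
    then show ?thesis using \<open>0 < \<epsilon>\<close> by linarith
  qed
  then show "\<exists>d>0. \<forall>y\<in>UNIV. dist y x < d \<longrightarrow> dist (test_bcf G y) (test_bcf G x) < \<epsilon>"
    using d(1) by auto
qed

text \<open>
  Sampling on finer and finer grids exhibits a continuous function of compact support as a limit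
  of simple functions, whatever its target space.
\<close>

lemma finite_vfloor_image:
  assumes "bounded S" shows "finite (vfloor ` (S :: 'c::euclidean_space set))"
proof -
  obtain r where r: "\<And>y. y \<in> S \<Longrightarrow> norm y \<le> r" using assms by (auto simp: bounded_iff)
  define K where "K = \<lceil>r\<rceil> + 1"
  have "vfloor ` S \<subseteq> (\<lambda>f. \<Sum>b\<in>Basis. of_int (f b) *\<^sub>R b) ` (PiE Basis (\<lambda>_. {- K..K}))"
  proof (rule image_subsetI)
    fix y assume y: "y \<in> S"
    have bnd: "\<lfloor>y \<bullet> b\<rfloor> \<in> {- K..K}" if "b \<in> Basis" for b
    proof -
      have "\<bar>y \<bullet> b\<bar> \<le> r" using Basis_le_norm[OF that, of y] r[OF y] by linarith
      then show ?thesis unfolding K_def by (simp, linarith)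
    qed
    have "vfloor y = (\<Sum>b\<in>Basis. of_int (restrict (\<lambda>b. \<lfloor>y \<bullet> b\<rfloor>) Basis b) *\<^sub>R b)"
      unfolding vfloor_def by (rule sum.cong) auto
    then show "vfloor y \<in> (\<lambda>f. \<Sum>b\<in>Basis. of_int (f b) *\<^sub>R b) ` (PiE Basis (\<lambda>_. {- K..K}))"
      by (rule image_eqI[where x = "restrict (\<lambda>b. \<lfloor>y \<bullet> b\<rfloor>) Basis"])
        (rule restrict_PiE_iff[THEN iffD2], rule ballI, rule bnd)
  qed
  moreover have "finite (PiE (Basis :: 'c set) (\<lambda>_. {- K..K}))" by (intro finite_PiE) auto
  ultimately show ?thesis by (meson finite_imageI finite_subset)
qed

lemma continuous_simple_approx:
  fixes F :: "'b::euclidean_space \<Rightarrow> 'd::real_normed_vector"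
  assumes F: "continuous_on UNIV F" and R: "\<And>x. R < norm x \<Longrightarrow> F x = 0"
    and M: "(\<lambda>x. x) \<in> M \<rightarrow>\<^sub>M borel"
  shows "\<exists>s. (\<forall>j::nat. simple_function M (s j) \<and> (\<forall>x. s j x \<in> range F)) \<and> (\<forall>x. (\<lambda>j. s j x) \<longlonglongrightarrow> F x)"
proof -
  obtain c where c: "0 \<le> c" "\<And>w::'b. w \<in> ucell \<Longrightarrow> norm w \<le> c" using bounded_ucell by blast
  obtain x0 :: 'b where x0: "norm x0 = \<bar>R\<bar> + 1" using vector_choose_size[of "\<bar>R\<bar> + 1"] by auto
  then have Fx0: "F x0 = 0" by (intro R) simp
  define q where "q j x = (if norm x \<le> \<bar>R\<bar> + 1 then (1 / real (Suc j)) *\<^sub>R vfloor (real (Suc j) *\<^sub>R x) else x0)" for j and x :: 'b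
  have vfl: "vfloor = (\<lambda>w::'b. w - vfrac w)" by (simp add: vfrac_def fun_eq_iff)
  have qm: "q j \<in> borel_measurable M" for j
  proof -
    have "q j \<in> borel_measurable borel" unfolding q_def vfl by measurable
    then show ?thesis by (rule measurable_compose[OF M])
  qed
  have fin: "finite (range (q j))" for j
  proof -
    have "range (q j) \<subseteq> insert x0 ((\<lambda>k. (1 / real (Suc j)) *\<^sub>R k) ` vfloor ` (\<lambda>x. real (Suc j) *\<^sub>R x) ` cball 0 (\<bar>R\<bar> + 1))"
      by (auto simp: q_def)
    moreover have "finite (insert x0 ((\<lambda>k. (1 / real (Suc j)) *\<^sub>R k) ` vfloor ` (\<lambda>x. real (Suc j) *\<^sub>R x) ` cball (0::'b) (\<bar>R\<bar> + 1)))"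
      by (intro finite.insertI finite_imageI finite_vfloor_image bounded_scaling bounded_cball)
    ultimately show ?thesis by (rule finite_subset)
  qed
  have simple: "simple_function M (q j)" for j
    unfolding simple_function_def
  proof (intro conjI ballI)
    show "finite (q j ` space M)" by (rule finite_subset[OF _ fin[of j]]) auto
    show "q j -` {v} \<inter> space M \<in> sets M" for v by (rule measurable_sets[OF qm]) simp
  qed
  have lim: "(\<lambda>j. F (q j x)) \<longlonglongrightarrow> F x" for x
  proof (cases "norm x \<le> \<bar>R\<bar> + 1")
    case True
    have qx: "norm (q j x - x) \<le> c / real (Suc j)" for j
    proof -
      have "q j x - x = (1 / real (Suc j)) *\<^sub>R (vfloor (real (Suc j) *\<^sub>R x) - real (Suc j) *\<^sub>R x)"
        using True by (simp add: q_def scaleR_diff_right)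
      also have "\<dots> = - ((1 / real (Suc j)) *\<^sub>R vfrac (real (Suc j) *\<^sub>R x))"
        by (simp add: vfrac_def scaleR_diff_right)
      finally have "norm (q j x - x) = norm (vfrac (real (Suc j) *\<^sub>R x)) / real (Suc j)" by simp
      also have "\<dots> \<le> c / real (Suc j)" by (intro divide_right_mono c(2) vfrac_in_ucell) simp
      finally show ?thesis .
    qed
    have "(\<lambda>j. c / real (Suc j)) \<longlonglongrightarrow> 0"
      by (rule LIMSEQ_Suc[OF lim_const_over_n[of c]])
    with always_eventually[OF allI, OF qx] have "(\<lambda>j. q j x - x) \<longlonglongrightarrow> 0"
      by (rule Lim_null_comparison)
    then have "(\<lambda>j. q j x) \<longlonglongrightarrow> x" by (rule LIM_zero_cancel)
    then show ?thesis by (rule continuous_on_tendsto_compose[OF F]) auto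
  next
    case False
    then have "F x = 0" by (intro R) linarith
    moreover have "q j x = x0" for j using False by (simp add: q_def)
    ultimately show ?thesis by (simp only: Fx0) (rule tendsto_const)
  qed
  show ?thesis
    by (intro exI[of _ "\<lambda>j x. F (q j x)"] conjI allI lim simple_function_compose1[OF simple] rangeI)
qed

section \<open>Pairings of two weakly convergent sequences\<close>

lemma equicontinuous_uniform_on_compact:
  fixes \<Psi> :: "nat \<Rightarrow> 'p::metric_space \<Rightarrow> 'a::real_normed_vector"
  assumes K: "compact K" and eq: "\<And>\<epsilon>. 0 < \<epsilon> \<Longrightarrow> \<exists>d>0. \<forall>n P Q. dist P Q < d \<longrightarrow> norm (\<Psi> n P - \<Psi> n Q) \<le> \<epsilon>"
    and lim: "\<And>P. (\<lambda>n. \<Psi> n P) \<longlonglongrightarrow> \<Psi>0 P" and \<epsilon>: "0 < \<epsilon>"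
  shows "eventually (\<lambda>n. \<forall>P\<in>K. norm (\<Psi> n P - \<Psi>0 P) \<le> \<epsilon>) sequentially"
proof -
  obtain d where d: "0 < d" "\<And>n P Q. dist P Q < d \<Longrightarrow> norm (\<Psi> n P - \<Psi> n Q) \<le> \<epsilon> / 3"
    using eq[of "\<epsilon> / 3"] \<epsilon> by auto
  have d0: "norm (\<Psi>0 P - \<Psi>0 Q) \<le> \<epsilon> / 3" if "dist P Q < d" for P Q
    by (rule tendsto_upperbound[OF tendsto_norm[OF tendsto_diff[OF lim lim]]
          always_eventually[OF allI, OF d(2)[OF that]] sequentially_bot])
  obtain k where k: "finite k" "K \<subseteq> (\<Union>x\<in>k. ball x d)"
    using compact_eq_totally_bounded[of K] K d(1) by blast
  have "eventually (\<lambda>n. \<forall>P\<in>k. norm (\<Psi> n P - \<Psi>0 P) < \<epsilon> / 3) sequentially"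
  proof (rule eventually_ball_finite[OF k(1)], rule ballI)
    fix P
    show "eventually (\<lambda>n. norm (\<Psi> n P - \<Psi>0 P) < \<epsilon> / 3) sequentially"
      using tendstoD[OF lim[of P], of "\<epsilon> / 3"] \<epsilon> by (simp add: dist_norm)
  qed
  then show ?thesis
  proof (rule eventually_mono, intro ballI)
    fix n P assume n: "\<forall>P\<in>k. norm (\<Psi> n P - \<Psi>0 P) < \<epsilon> / 3" and P: "P \<in> K"
    then obtain Q where Q: "Q \<in> k" "dist Q P < d" using k(2) by (auto simp: subset_eq)
    have "norm (\<Psi> n P - \<Psi> n Q) \<le> \<epsilon> / 3" "norm (\<Psi>0 Q - \<Psi>0 P) \<le> \<epsilon> / 3" "norm (\<Psi> n Q - \<Psi>0 Q) \<le> \<epsilon> / 3"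
      using d(2)[of P Q n] d0[of Q P] Q n by (auto simp: dist_commute less_imp_le)
    then have "norm ((\<Psi> n P - \<Psi> n Q) + (\<Psi> n Q - \<Psi>0 Q) + (\<Psi>0 Q - \<Psi>0 P)) \<le> \<epsilon>"
      by (intro order_trans[OF norm_triangle_ineq] order_trans[OF add_right_mono[OF norm_triangle_ineq]]) linarith
    then show "norm (\<Psi> n P - \<Psi>0 P) \<le> \<epsilon>" by simp
  qed
qed

lemma test_fun_shift:
  fixes G :: "'b::euclidean_space \<times> 'c::euclidean_space \<Rightarrow> 'a::real_normed_vector"
  assumes G: "test_fun G" shows "test_fun (\<lambda>Q. G (P + Q))"
proof -
  obtain x w where P: "P = (x, w)" by (cases P)
  obtain R where R: "\<And>x w. R < norm x \<Longrightarrow> G (x, w) = 0" using G by (auto simp: test_fun_def)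
  have "continuous_on UNIV (\<lambda>Q. G (P + Q))"
    by (rule continuous_on_compose2[of UNIV G])
      (use G in \<open>auto simp: test_fun_def intro!: continuous_intros\<close>)
  moreover have "periodic (\<lambda>w. G (P + (y, w)))" for y
    using G by (auto simp: P periodic_def add.assoc[symmetric] test_fun_periodic)
  moreover have "G (P + (y, v)) = 0" if "R + norm x < norm y" for y v
  proof -
    have "norm y \<le> norm (x + y) + norm x" using norm_triangle_ineq4[of "x + y" x] by simp
    then show ?thesis using that by (simp add: P R)
  qed
  ultimately show ?thesis unfolding test_fun_def by blast
qed

text \<open>
  Tested against \<open>G\<close>, the convolution of \<open>U n\<close> and \<open>V n\<close> is the integral of \<open>U n\<close> against the
  function \<open>\<Psi> n\<close> that arises by letting \<open>V n\<close> act on the translates of \<open>G\<close>. Weak convergence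
  of \<open>V n\<close> gives pointwise convergence of \<open>\<Psi> n\<close>; the uniform continuity of \<open>G\<close> makes the
  \<open>\<Psi> n\<close> equicontinuous, so the convergence is uniform and \<open>\<Psi> n\<close> may be replaced by its limit,
  which is a fixed test function for \<open>U n\<close>. That the scale map \<open>\<sigma> n\<close> is additive is what makes
  translations compatible with the oscillating arguments.
\<close>

lemma pairing_compact:
  fixes U V :: "nat \<Rightarrow> 'b::euclidean_space \<Rightarrow> 'a::{real_normed_field, euclidean_space}"
    and U0 V0 :: "'b \<times> 'c::euclidean_space \<Rightarrow> 'a" and \<sigma> :: "nat \<Rightarrow> 'b \<Rightarrow> 'c"
  assumes G: "test_fun G"
    and \<sigma>_add: "\<And>n x y. \<sigma> n (x + y) = \<sigma> n x + \<sigma> n y" and \<sigma>[measurable]: "\<And>n. \<sigma> n \<in> borel_measurable borel"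
    and U[measurable]: "\<And>n. U n \<in> borel_measurable borel"
    and Uint: "\<And>n r. integrable lborel (\<lambda>x. indicator (cball 0 r) x *\<^sub>R U n x)"
    and Ubd: "\<And>r. \<exists>C. \<forall>n. (\<integral>x. norm (indicator (cball 0 r) x *\<^sub>R U n x) \<partial>lborel) \<le> C"
    and V: "\<And>n. integrable lborel (V n)" and VC: "\<And>n. (\<integral>x. norm (V n x) \<partial>lborel) \<le> CV"
    and Vsupp: "\<And>n x. \<rho> < norm x \<Longrightarrow> V n x = 0"
    and weakU: "\<And>H. test_fun H \<Longrightarrow> (\<lambda>n. \<integral>x. U n x * H (x, \<sigma> n x) \<partial>lborel) \<longlonglongrightarrow> (\<integral>P. cell_ind P *\<^sub>R (U0 P * H P) \<partial>lborel)"
    and weakV: "\<And>H. test_fun H \<Longrightarrow> (\<lambda>n. \<integral>x. V n x * H (x, \<sigma> n x) \<partial>lborel) \<longlonglongrightarrow> (\<integral>P. cell_ind P *\<^sub>R (V0 P * H P) \<partial>lborel)"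
  shows "test_fun (\<lambda>P. \<integral>Q. cell_ind Q *\<^sub>R (V0 Q * G (P + Q)) \<partial>lborel)"
    and "(\<lambda>n. \<integral>\<xi>. U n \<xi> * (\<integral>\<eta>. V n \<eta> * G ((\<xi>, \<sigma> n \<xi>) + (\<eta>, \<sigma> n \<eta>)) \<partial>lborel) \<partial>lborel)
      \<longlonglongrightarrow> (\<integral>P. cell_ind P *\<^sub>R (U0 P * (\<integral>Q. cell_ind Q *\<^sub>R (V0 Q * G (P + Q)) \<partial>lborel)) \<partial>lborel)"
proof -
  have [measurable]: "V n \<in> borel_measurable borel" for n using V[of n] by auto
  have Gm[measurable]: "G \<in> borel_measurable borel" by (rule test_fun_measurable[OF G])
  obtain R where R: "\<And>x w. R < norm x \<Longrightarrow> G (x, w) = 0" using G by (auto simp: test_fun_def)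
  obtain CG where CG: "\<And>P. norm (G P) \<le> CG" using test_fun_bounded[OF G] by blast
  define \<Psi> where "\<Psi> n P = (\<integral>\<eta>. V n \<eta> * G (P + (\<eta>, \<sigma> n \<eta>)) \<partial>lborel)" for n P
  define \<Psi>0 where "\<Psi>0 P = (\<integral>Q. cell_ind Q *\<^sub>R (V0 Q * G (P + Q)) \<partial>lborel)" for P
  have CV0: "0 \<le> CV" by (rule order_trans[OF _ VC[of 0]]) (intro Bochner_Integration.integral_nonneg norm_ge_zero)
  have mG: "(\<lambda>\<eta>. G (P + (\<eta>, \<sigma> n \<eta>))) \<in> borel_measurable lborel" for P n
  proof -
    have "(\<lambda>\<eta>. P + (\<eta>, \<sigma> n \<eta>)) \<in> borel \<rightarrow>\<^sub>M borel"
    proof -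
      have "(\<lambda>\<eta>. (fst P + \<eta>, snd P + \<sigma> n \<eta>)) \<in> borel \<rightarrow>\<^sub>M borel" unfolding borel_prod[symmetric] by measurable
      then show ?thesis by (simp add: plus_prod_def)
    qed
    from measurable_compose[OF this Gm] show ?thesis by simp
  qed
  have iV: "integrable lborel (\<lambda>\<eta>. V n \<eta> * G (P + (\<eta>, \<sigma> n \<eta>)))" for n P
    by (rule integrable_mult_bounded[OF V mG CG])
  have lim: "(\<lambda>n. \<Psi> n P) \<longlonglongrightarrow> \<Psi>0 P" for P
    unfolding \<Psi>_def \<Psi>0_def by (rule weakV[OF test_fun_shift[OF G]])
  have equi: "\<exists>d>0. \<forall>n P Q. dist P Q < d \<longrightarrow> norm (\<Psi> n P - \<Psi> n Q) \<le> \<epsilon>" if \<epsilon>: "0 < \<epsilon>" for \<epsilon>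
  proof -
    define \<epsilon>' where "\<epsilon>' = \<epsilon> / (CV + 1)"
    have \<epsilon>': "0 < \<epsilon>'" "\<epsilon>' * CV \<le> \<epsilon>"
    proof -
      show "0 < \<epsilon>'" using \<epsilon> CV0 by (simp add: \<epsilon>'_def)
      then have "\<epsilon>' * CV \<le> \<epsilon>' * (CV + 1)" by (intro mult_left_mono) auto
      also have "\<dots> = \<epsilon>" by (rule iffD1[OF nonzero_eq_divide_eq \<epsilon>'_def]) (use CV0 in simp)
      finally show "\<epsilon>' * CV \<le> \<epsilon>" .
    qed
    obtain d where d: "0 < d" "\<And>P Q. dist P Q < d \<Longrightarrow> dist (G P) (G Q) < \<epsilon>'"
      using test_fun_uniform[OF G \<epsilon>'(1)] by blast
    have "norm (\<Psi> n P - \<Psi> n Q) \<le> \<epsilon>" if PQ: "dist P Q < d" for n P Q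
    proof -
      have "\<Psi> n P - \<Psi> n Q = (\<integral>\<eta>. V n \<eta> * G (P + (\<eta>, \<sigma> n \<eta>)) - V n \<eta> * G (Q + (\<eta>, \<sigma> n \<eta>)) \<partial>lborel)"
        unfolding \<Psi>_def by (rule Bochner_Integration.integral_diff[symmetric]) (rule iV)+
      also have "norm \<dots> \<le> (\<integral>\<eta>. \<epsilon>' * norm (V n \<eta>) \<partial>lborel)"
      proof (rule norm_integral_le)
        show "AE \<eta> in lborel. norm (V n \<eta> * G (P + (\<eta>, \<sigma> n \<eta>)) - V n \<eta> * G (Q + (\<eta>, \<sigma> n \<eta>))) \<le> \<epsilon>' * norm (V n \<eta>)"
        proof (rule AE_I2)
          fix \<eta>
          have "norm (G (P + (\<eta>, \<sigma> n \<eta>)) - G (Q + (\<eta>, \<sigma> n \<eta>))) \<le> \<epsilon>'"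
            using d(2)[of "P + (\<eta>, \<sigma> n \<eta>)" "Q + (\<eta>, \<sigma> n \<eta>)"] PQ by (simp add: dist_norm)
          then have "norm (V n \<eta>) * norm (G (P + (\<eta>, \<sigma> n \<eta>)) - G (Q + (\<eta>, \<sigma> n \<eta>))) \<le> norm (V n \<eta>) * \<epsilon>'"
            by (intro mult_left_mono norm_ge_zero)
          then show "norm (V n \<eta> * G (P + (\<eta>, \<sigma> n \<eta>)) - V n \<eta> * G (Q + (\<eta>, \<sigma> n \<eta>))) \<le> \<epsilon>' * norm (V n \<eta>)"
            by (simp only: right_diff_distrib[symmetric] norm_mult mult.commute)
        qed
      qed (intro Bochner_Integration.integrable_diff iV integrable_mult_right integrable_norm V)+
      also have "\<dots> = \<epsilon>' * (\<integral>\<eta>. norm (V n \<eta>) \<partial>lborel)" by simp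
      also have "\<dots> \<le> \<epsilon>' * CV" using \<epsilon>' VC[of n] by (intro mult_left_mono) auto
      finally show ?thesis using \<epsilon>' by linarith
    qed
    then show ?thesis using d(1) by blast
  qed
  have equi0: "\<exists>d>0. \<forall>P Q. dist P Q < d \<longrightarrow> norm (\<Psi>0 P - \<Psi>0 Q) \<le> \<epsilon>" if \<epsilon>: "0 < \<epsilon>" for \<epsilon>
  proof -
    obtain d where d: "0 < d" "\<And>n P Q. dist P Q < d \<Longrightarrow> norm (\<Psi> n P - \<Psi> n Q) \<le> \<epsilon>"
      using equi[OF \<epsilon>] by blast
    have "norm (\<Psi>0 P - \<Psi>0 Q) \<le> \<epsilon>" if "dist P Q < d" for P Q
      by (rule tendsto_upperbound[OF tendsto_norm[OF tendsto_diff[OF lim lim]]])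
        (simp_all add: d(2)[OF that])
    then show ?thesis using d(1) by blast
  qed
  have per: "\<Psi> n (x, w + k) = \<Psi> n (x, w)" if "lattice_point k" for n x w k
  proof -
    have "G ((x, w + k) + (\<eta>, v)) = G ((x, w) + (\<eta>, v))" for \<eta> v
      using test_fun_periodic[OF G that, of "x + \<eta>" "w + v"] by (simp add: algebra_simps)
    then show ?thesis by (simp add: \<Psi>_def)
  qed
  have per0: "\<Psi>0 (x, w + k) = \<Psi>0 (x, w)" if "lattice_point k" for x w k
    by (rule LIMSEQ_unique[OF lim]) (simp only: per[OF that] lim)
  have supp: "\<Psi> n (x, w) = 0" if x: "R + \<rho> < norm x" for n x w
  proof -
    have "V n \<eta> * G ((x, w) + (\<eta>, \<sigma> n \<eta>)) = 0" for \<eta>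
    proof (cases "\<rho> < norm \<eta>")
      case False
      have "norm x \<le> norm (x + \<eta>) + norm \<eta>" using norm_triangle_ineq4[of "x + \<eta>" \<eta>] by simp
      then have "R < norm (x + \<eta>)" using x False by linarith
      then show ?thesis by (simp add: R)
    qed (simp add: Vsupp)
    then show ?thesis unfolding \<Psi>_def by (simp only: Bochner_Integration.integral_zero)
  qed
  have supp0: "\<Psi>0 (x, w) = 0" if x: "R + \<rho> < norm x" for x w
    by (rule LIMSEQ_unique[OF lim]) (simp only: supp[OF x] tendsto_const)
  have cont: "continuous_on UNIV F" if H: "\<And>\<epsilon>. 0 < \<epsilon> \<Longrightarrow> \<exists>d>0. \<forall>P Q. dist P Q < d \<longrightarrow> norm (F P - F Q) \<le> \<epsilon>" for F :: "'b \<times> 'c \<Rightarrow> 'a"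
    unfolding continuous_on_iff
  proof (intro ballI allI impI)
    fix P and \<epsilon> :: real assume "0 < \<epsilon>"
    then obtain d where d: "0 < d" "\<And>P Q. dist P Q < d \<Longrightarrow> norm (F P - F Q) \<le> \<epsilon> / 2" using H[of "\<epsilon> / 2"] by auto
    then show "\<exists>d>0. \<forall>Q\<in>UNIV. dist Q P < d \<longrightarrow> dist (F Q) (F P) < \<epsilon>"
    proof (intro exI[of _ d] conjI ballI impI d(1))
      fix Q assume "dist Q P < d"
      from d(2)[OF this] have "dist (F Q) (F P) \<le> \<epsilon> / 2" by (simp only: dist_norm)
      then show "dist (F Q) (F P) < \<epsilon>" using \<open>0 < \<epsilon>\<close> by linarith
    qed
  qed
  have tfn: "test_fun (\<Psi> n)" for n
    unfolding test_fun_def periodic_def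
  proof (intro conjI allI impI exI[of _ "R + \<rho>"])
    show "continuous_on UNIV (\<Psi> n)"
    proof (rule cont)
      fix \<epsilon> :: real assume "0 < \<epsilon>"
      from equi[OF this] show "\<exists>d>0. \<forall>P Q. dist P Q < d \<longrightarrow> norm (\<Psi> n P - \<Psi> n Q) \<le> \<epsilon>" by meson
    qed
  qed (rule per supp, assumption)+
  have tf0: "test_fun \<Psi>0"
    unfolding test_fun_def periodic_def
  proof (intro conjI allI impI exI[of _ "R + \<rho>"])
    show "continuous_on UNIV \<Psi>0" by (rule cont) (rule equi0)
  qed (rule per0 supp0, assumption)+
  then show "test_fun (\<lambda>P. \<integral>Q. cell_ind Q *\<^sub>R (V0 Q * G (P + Q)) \<partial>lborel)"
    by (simp only: \<Psi>0_def[abs_def])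
  have sm: "(\<lambda>x. F (x, \<sigma> n x)) \<in> borel_measurable lborel" if F: "test_fun F" for F :: "'b \<times> 'c \<Rightarrow> 'a" and n
  proof -
    have "(\<lambda>x. (x, \<sigma> n x)) \<in> borel \<rightarrow>\<^sub>M borel" unfolding borel_prod[symmetric] by measurable
    from measurable_compose[OF this test_fun_measurable[OF F]] show ?thesis by simp
  qed
  obtain c where c: "0 \<le> c" "\<And>w::'c. w \<in> ucell \<Longrightarrow> norm w \<le> c" using bounded_ucell by blast
  (* Uniform convergence is only obtained on compact sets, but by periodicity and bounded support
     the values on K determine the functions. *)
  define K where "K = cball (0::'b) (R + \<rho>) \<times> cball (0::'c) c"
  have K: "compact K" unfolding K_def by (intro compact_Times compact_cball)
  have unif: "eventually (\<lambda>n. \<forall>P. norm (\<Psi> n P - \<Psi>0 P) \<le> \<epsilon>) sequentially" if "0 < \<epsilon>" for \<epsilon>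
  proof -
    have "eventually (\<lambda>n. \<forall>P\<in>K. norm (\<Psi> n P - \<Psi>0 P) \<le> \<epsilon>) sequentially"
      by (rule equicontinuous_uniform_on_compact[OF K _ lim that]) (rule equi)
    then show ?thesis
  proof (rule eventually_mono, intro allI)
    fix n and P :: "'b \<times> 'c" assume n: "\<forall>P\<in>K. norm (\<Psi> n P - \<Psi>0 P) \<le> \<epsilon>"
    obtain x w where P: "P = (x, w)" by (cases P)
    show "norm (\<Psi> n P - \<Psi>0 P) \<le> \<epsilon>"
    proof (cases "R + \<rho> < norm x")
      case True
      then show ?thesis using \<open>0 < \<epsilon>\<close> by (simp add: P supp supp0)
    next
      case False
      then have "(x, vfrac w) \<in> K" using c(2)[OF vfrac_in_ucell[of w]] by (auto simp: K_def)
      then have "norm (\<Psi> n (x, vfrac w) - \<Psi>0 (x, vfrac w)) \<le> \<epsilon>" using n by blast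
      then show ?thesis
        using per[OF lattice_point_vfloor[of w], of n x "vfrac w"] per0[OF lattice_point_vfloor[of w], of x "vfrac w"]
        by (simp add: P vfrac_def)
    qed
  qed
  qed
  obtain CU where CU: "\<And>n. (\<integral>x. norm (indicator (cball 0 (R + \<rho>)) x *\<^sub>R U n x) \<partial>lborel) \<le> CU"
    using Ubd by blast
  have loc: "U n x * F (x, \<sigma> n x) = (indicator (cball 0 (R + \<rho>)) x *\<^sub>R U n x) * F (x, \<sigma> n x)"
    if "\<And>x w. R + \<rho> < norm x \<Longrightarrow> F (x, w) = 0" for F :: "'b \<times> 'c \<Rightarrow> 'a" and n x
    using that[of x "\<sigma> n x"] by (cases "R + \<rho> < norm x") auto
  have iU: "integrable lborel (\<lambda>x. U n x * F (x, \<sigma> n x))"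
    if F: "test_fun F" "\<And>x w. R + \<rho> < norm x \<Longrightarrow> F (x, w) = 0" for F :: "'b \<times> 'c \<Rightarrow> 'a" and n
  proof -
    obtain C where C: "\<And>P. norm (F P) \<le> C" using test_fun_bounded[OF F(1)] by blast
    have "(\<lambda>x. U n x * F (x, \<sigma> n x)) = (\<lambda>x. (indicator (cball 0 (R + \<rho>)) x *\<^sub>R U n x) * F (x, \<sigma> n x))"
      by (rule ext) (rule loc[of F, OF F(2)])
    moreover have "integrable lborel (\<lambda>x. (indicator (cball 0 (R + \<rho>)) x *\<^sub>R U n x) * F (x, \<sigma> n x))"
      by (rule integrable_mult_bounded[OF Uint sm[OF F(1)] C])
    ultimately show ?thesis by simp
  qed
  have diff: "(\<lambda>n. (\<integral>x. U n x * \<Psi> n (x, \<sigma> n x) \<partial>lborel) - (\<integral>x. U n x * \<Psi>0 (x, \<sigma> n x) \<partial>lborel)) \<longlonglongrightarrow> 0"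
  proof (rule tendstoI)
    fix \<epsilon> :: real assume \<epsilon>: "0 < \<epsilon>"
    have CU0: "0 \<le> CU" by (rule order_trans[OF _ CU[of 0]]) (intro Bochner_Integration.integral_nonneg norm_ge_zero)
    define \<delta> where "\<delta> = \<epsilon> / 2 / (CU + 1)"
    have \<delta>: "0 < \<delta>" "\<delta> * CU < \<epsilon>"
    proof -
      show "0 < \<delta>" using \<epsilon> CU0 by (simp add: \<delta>_def)
      then have "\<delta> * CU \<le> \<delta> * (CU + 1)" by (intro mult_left_mono) auto
      also have "\<dots> = \<epsilon> / 2" by (rule iffD1[OF nonzero_eq_divide_eq \<delta>_def]) (use CU0 in simp)
      finally show "\<delta> * CU < \<epsilon>" using \<epsilon> by linarith
    qed
    from unif[OF \<delta>(1)]
    show "eventually (\<lambda>n. dist ((\<integral>x. U n x * \<Psi> n (x, \<sigma> n x) \<partial>lborel) - (\<integral>x. U n x * \<Psi>0 (x, \<sigma> n x) \<partial>lborel)) 0 < \<epsilon>) sequentially"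
    proof (rule eventually_mono)
      fix n assume n: "\<forall>P. norm (\<Psi> n P - \<Psi>0 P) \<le> \<delta>"
      have "(\<integral>x. U n x * \<Psi> n (x, \<sigma> n x) \<partial>lborel) - (\<integral>x. U n x * \<Psi>0 (x, \<sigma> n x) \<partial>lborel)
          = (\<integral>x. U n x * \<Psi> n (x, \<sigma> n x) - U n x * \<Psi>0 (x, \<sigma> n x) \<partial>lborel)"
        by (intro Bochner_Integration.integral_diff[symmetric] iU tfn tf0 supp supp0)
      also have "norm \<dots> \<le> (\<integral>x. \<delta> * norm (indicator (cball 0 (R + \<rho>)) x *\<^sub>R U n x) \<partial>lborel)"
      proof (rule norm_integral_le)
        show "integrable lborel (\<lambda>x. U n x * \<Psi> n (x, \<sigma> n x) - U n x * \<Psi>0 (x, \<sigma> n x))"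
          by (intro Bochner_Integration.integrable_diff iU tfn tf0 supp supp0)
        show "integrable lborel (\<lambda>x. \<delta> * norm (indicator (cball 0 (R + \<rho>)) x *\<^sub>R U n x))"
          by (intro integrable_mult_right integrable_norm Uint)
        show "AE x in lborel. norm (U n x * \<Psi> n (x, \<sigma> n x) - U n x * \<Psi>0 (x, \<sigma> n x))
            \<le> \<delta> * norm (indicator (cball 0 (R + \<rho>)) x *\<^sub>R U n x)"
        proof (rule AE_I2)
          fix x
          have "norm (indicator (cball 0 (R + \<rho>)) x *\<^sub>R U n x) * norm (\<Psi> n (x, \<sigma> n x) - \<Psi>0 (x, \<sigma> n x))
              \<le> norm (indicator (cball 0 (R + \<rho>)) x *\<^sub>R U n x) * \<delta>"
            using n by (intro mult_left_mono norm_ge_zero) blast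
          moreover have "U n x * \<Psi> n (x, \<sigma> n x) - U n x * \<Psi>0 (x, \<sigma> n x)
              = (indicator (cball 0 (R + \<rho>)) x *\<^sub>R U n x) * (\<Psi> n (x, \<sigma> n x) - \<Psi>0 (x, \<sigma> n x))"
            using loc[of "\<Psi> n", OF supp, of n x] loc[of \<Psi>0, OF supp0, of n x] by (simp only: right_diff_distrib)
          ultimately show "norm (U n x * \<Psi> n (x, \<sigma> n x) - U n x * \<Psi>0 (x, \<sigma> n x))
              \<le> \<delta> * norm (indicator (cball 0 (R + \<rho>)) x *\<^sub>R U n x)"
            by (simp only: norm_mult mult.commute)
        qed
      qed
      also have "\<dots> = \<delta> * (\<integral>x. norm (indicator (cball 0 (R + \<rho>)) x *\<^sub>R U n x) \<partial>lborel)" by simp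
      also have "\<dots> \<le> \<delta> * CU" using \<delta> CU[of n] by (intro mult_left_mono) auto
      finally show "dist ((\<integral>x. U n x * \<Psi> n (x, \<sigma> n x) \<partial>lborel) - (\<integral>x. U n x * \<Psi>0 (x, \<sigma> n x) \<partial>lborel)) 0 < \<epsilon>"
        using \<delta> unfolding dist_norm by simp
    qed
  qed
  have "(\<lambda>n. \<integral>x. U n x * \<Psi> n (x, \<sigma> n x) \<partial>lborel) \<longlonglongrightarrow> (\<integral>P. cell_ind P *\<^sub>R (U0 P * \<Psi>0 P) \<partial>lborel)"
    using tendsto_add[OF diff weakU[OF tf0]] by simp
  then show "(\<lambda>n. \<integral>\<xi>. U n \<xi> * (\<integral>\<eta>. V n \<eta> * G ((\<xi>, \<sigma> n \<xi>) + (\<eta>, \<sigma> n \<eta>)) \<partial>lborel) \<partial>lborel)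
      \<longlonglongrightarrow> (\<integral>P. cell_ind P *\<^sub>R (U0 P * (\<integral>Q. cell_ind Q *\<^sub>R (V0 Q * G (P + Q)) \<partial>lborel)) \<partial>lborel)"
    by (simp only: \<Psi>_def \<Psi>0_def)
qed

section \<open>Convolutions tested against continuous functions\<close>

text \<open>
  Fubini's theorem for the pairing of \<open>x \<mapsto> \<integral> u(y) K(x, y) dy\<close> with a bounded function \<open>g\<close> that vanishes off a set
  \<open>E\<close> of finite measure, and an estimate of this pairing. As \<open>t\<close> is free, the pairing is small if \<open>B\<close> is
  small: choose \<open>t\<close> first, and then \<open>B\<close>.
\<close>

lemma pair_kernel:
  fixes u g :: "'x \<Rightarrow> 'a::{real_normed_field, euclidean_space}" and K :: "'x \<Rightarrow> 'x \<Rightarrow> 'a"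
  assumes M: "sigma_finite_measure M"
    and u[measurable]: "u \<in> borel_measurable M" and K[measurable]: "case_prod K \<in> borel_measurable (M \<Otimes>\<^sub>M M)"
    and g[measurable]: "g \<in> borel_measurable M" and E[measurable]: "E \<in> sets M"
    and gC: "\<And>x. norm (g x) \<le> C * indicator E x" and C0: "0 \<le> C" and E\<beta>: "emeasure M E \<le> ennreal \<beta>" and \<beta>: "0 \<le> \<beta>"
    and pqm: "p \<ge> 1" "q \<ge> 1" "m \<ge> 1" "1 / p + 1 / q = 1 + 1 / m"
    and AB: "0 \<le> A" "0 \<le> B"
    and A: "(\<integral>\<^sup>+y. norm (u y) powr p \<partial>M) \<le> ennreal A"
    and B1: "\<And>x. x \<in> space M \<Longrightarrow> (\<integral>\<^sup>+y. norm (K x y) powr q \<partial>M) \<le> ennreal B"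
    and B2: "\<And>y. y \<in> space M \<Longrightarrow> (\<integral>\<^sup>+x. norm (K x y) powr q \<partial>M) \<le> ennreal B"
  shows "integrable (M \<Otimes>\<^sub>M M) (\<lambda>(x, y). u y * K x y * g x)"
    and "(\<integral>z. (case z of (x, y) \<Rightarrow> u y * K x y * g x) \<partial>(M \<Otimes>\<^sub>M M)) = (\<integral>x. (\<integral>y. u y * K x y \<partial>M) * g x \<partial>M)"
    and "(\<integral>z. (case z of (x, y) \<Rightarrow> u y * K x y * g x) \<partial>(M \<Otimes>\<^sub>M M)) = (\<integral>y. u y * (\<integral>x. K x y * g x \<partial>M) \<partial>M)"
    and "0 < t \<Longrightarrow> norm (\<integral>z. (case z of (x, y) \<Rightarrow> u y * K x y * g x) \<partial>(M \<Otimes>\<^sub>M M))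
      \<le> C * (t * \<beta> + t powr (1 - m) * (A * B * (1 + A + B) powr m))"
proof -
  interpret M: sigma_finite_measure M by fact
  interpret MM: pair_sigma_finite M M ..
  have Kn: "case_prod (\<lambda>x y. norm (K x y)) \<in> borel_measurable (M \<Otimes>\<^sub>M M)" by measurable
  have K1[measurable]: "K x \<in> borel_measurable M" if "x \<in> space M" for x
    using measurable_Pair2[OF K that] by simp
  have un: "(\<lambda>y. norm (u y)) \<in> borel_measurable M" by measurable
  note Y = kernel_young[where f = "\<lambda>y. norm (u y)" and k = "\<lambda>x y. norm (K x y)", OF M un Kn norm_ge_zero norm_ge_zero pqm AB A]
  have Y1: "AE x in M. integrable M (\<lambda>y. norm (u y) * norm (K x y))"
    by (rule Y(1)) (fact B1 B2)+
  define J where "J x = (\<integral>y. norm (u y) * norm (K x y) \<partial>M)" for x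
  have J0: "0 \<le> J x" for x unfolding J_def by (intro Bochner_Integration.integral_nonneg) simp
  have Jm[measurable]: "J \<in> borel_measurable M" unfolding J_def[abs_def] by measurable
  have Jint: "integrable M (\<lambda>x. J x powr m)" unfolding J_def by (rule Y(2)) (fact B1 B2)+
  have Jle: "(\<integral>x. J x powr m \<partial>M) \<le> A * B * (1 + A + B) powr m" unfolding J_def by (rule Y(3)) (fact B1 B2)+
  have bound: "(\<integral>\<^sup>+z. norm (case z of (x, y) \<Rightarrow> u y * K x y * g x) \<partial>(M \<Otimes>\<^sub>M M))
      \<le> ennreal (C * (t * \<beta> + t powr (1 - m) * (A * B * (1 + A + B) powr m)))" if t: "0 < t" for t
  proof -
    have "(\<integral>\<^sup>+z. norm (case z of (x, y) \<Rightarrow> u y * K x y * g x) \<partial>(M \<Otimes>\<^sub>M M))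
        = (\<integral>\<^sup>+x. \<integral>\<^sup>+y. norm (u y * K x y * g x) \<partial>M \<partial>M)"
      by (subst M.nn_integral_fst[symmetric]) auto
    also have "\<dots> \<le> (\<integral>\<^sup>+x. ennreal C * (ennreal t * indicator E x + ennreal (t powr (1 - m)) * ennreal (J x powr m)) \<partial>M)"
    proof (rule nn_integral_mono_AE)
      show "AE x in M. (\<integral>\<^sup>+y. norm (u y * K x y * g x) \<partial>M)
          \<le> ennreal C * (ennreal t * indicator E x + ennreal (t powr (1 - m)) * ennreal (J x powr m))"
        using Y1 AE_space
      proof eventually_elim
        fix x assume int: "integrable M (\<lambda>y. norm (u y) * norm (K x y))" and x: "x \<in> space M"
        note [measurable] = K1[OF x]
        have "(\<integral>\<^sup>+y. norm (u y * K x y * g x) \<partial>M) = (\<integral>\<^sup>+y. ennreal (norm (u y) * norm (K x y)) * ennreal (norm (g x)) \<partial>M)"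
          by (simp add: norm_mult ennreal_mult)
        also have "\<dots> = (\<integral>\<^sup>+y. ennreal (norm (u y) * norm (K x y)) \<partial>M) * ennreal (norm (g x))"
          by (rule nn_integral_multc) measurable
        also have "(\<integral>\<^sup>+y. ennreal (norm (u y) * norm (K x y)) \<partial>M) = ennreal (J x)"
          unfolding J_def by (rule nn_integral_eq_integral[OF int]) simp
        finally have eq: "(\<integral>\<^sup>+y. norm (u y * K x y * g x) \<partial>M) = ennreal (J x * norm (g x))"
          using J0 by (simp add: ennreal_mult)
        show "(\<integral>\<^sup>+y. norm (u y * K x y * g x) \<partial>M)
          \<le> ennreal C * (ennreal t * indicator E x + ennreal (t powr (1 - m)) * ennreal (J x powr m))"
        proof (cases "x \<in> E")
          case True
          have "J x * norm (g x) \<le> (t + t powr (1 - m) * J x powr m) * C"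
            using le_add_powr[OF J0[of x] t pqm(3)] gC[of x] True C0 by (intro mult_mono) (auto intro: add_nonneg_nonneg t[THEN less_imp_le])
          then have "ennreal (J x * norm (g x)) \<le> ennreal (C * (t + t powr (1 - m) * J x powr m))"
            by (intro ennreal_leI) (simp add: mult.commute)
          also have "\<dots> = ennreal C * (ennreal t * indicator E x + ennreal (t powr (1 - m)) * ennreal (J x powr m))"
            using t True C0 by (simp add: ennreal_mult)
          finally show ?thesis unfolding eq .
        next
          case False
          then have "g x = 0" using gC[of x] by simp
          then show ?thesis unfolding eq by simp
        qed
      qed
    qed
    also have "\<dots> = ennreal C * (ennreal t * emeasure M E + ennreal (t powr (1 - m)) * (\<integral>\<^sup>+x. ennreal (J x powr m) \<partial>M))"
      by (simp add: nn_integral_cmult nn_integral_add)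
    also have "(\<integral>\<^sup>+x. ennreal (J x powr m) \<partial>M) = ennreal (\<integral>x. J x powr m \<partial>M)"
      by (rule nn_integral_eq_integral[OF Jint]) simp
    also have "ennreal C * (ennreal t * emeasure M E + ennreal (t powr (1 - m)) * ennreal (\<integral>x. J x powr m \<partial>M))
        \<le> ennreal C * (ennreal t * ennreal \<beta> + ennreal (t powr (1 - m)) * ennreal (A * B * (1 + A + B) powr m))"
      by (intro mult_left_mono add_mono E\<beta> ennreal_leI Jle) auto
    also have "\<dots> = ennreal (C * (t * \<beta> + t powr (1 - m) * (A * B * (1 + A + B) powr m)))"
      using t \<beta> AB C0 by (simp add: ennreal_mult)
    finally show ?thesis .
  qed
  show int: "integrable (M \<Otimes>\<^sub>M M) (\<lambda>(x, y). u y * K x y * g x)"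
  proof (rule integrableI_bounded)
    show "(\<lambda>(x, y). u y * K x y * g x) \<in> borel_measurable (M \<Otimes>\<^sub>M M)" by measurable
    show "(\<integral>\<^sup>+z. norm (case z of (x, y) \<Rightarrow> u y * K x y * g x) \<partial>(M \<Otimes>\<^sub>M M)) < \<infinity>"
      using bound[of 1] by (simp add: order_le_less_trans[OF _ ennreal_less_top])
  qed
  show "(\<integral>z. (case z of (x, y) \<Rightarrow> u y * K x y * g x) \<partial>(M \<Otimes>\<^sub>M M)) = (\<integral>x. (\<integral>y. u y * K x y \<partial>M) * g x \<partial>M)"
    by (subst MM.integral_fst'[OF int, symmetric]) simp
  have "(\<integral>z. (case z of (x, y) \<Rightarrow> u y * K x y * g x) \<partial>(M \<Otimes>\<^sub>M M)) = (\<integral>y. \<integral>x. u y * K x y * g x \<partial>M \<partial>M)"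
    by (rule MM.integral_snd[OF int, symmetric])
  then show "(\<integral>z. (case z of (x, y) \<Rightarrow> u y * K x y * g x) \<partial>(M \<Otimes>\<^sub>M M)) = (\<integral>y. u y * (\<integral>x. K x y * g x \<partial>M) \<partial>M)"
    by (simp add: mult.assoc)
  show "norm (\<integral>z. (case z of (x, y) \<Rightarrow> u y * K x y * g x) \<partial>(M \<Otimes>\<^sub>M M))
      \<le> C * (t * \<beta> + t powr (1 - m) * (A * B * (1 + A + B) powr m))" if t: "0 < t"
  proof -
    have "ennreal (norm (\<integral>z. (case z of (x, y) \<Rightarrow> u y * K x y * g x) \<partial>(M \<Otimes>\<^sub>M M)))
        \<le> ennreal (C * (t * \<beta> + t powr (1 - m) * (A * B * (1 + A + B) powr m)))"
      by (rule order_trans[OF integral_norm_bound_ennreal[OF int] bound[OF t]])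
    moreover have "0 \<le> C * (t * \<beta> + t powr (1 - m) * (A * B * (1 + A + B) powr m))"
      using t \<beta> AB C0 by simp
    ultimately show ?thesis by (simp only: ennreal_le_iff)
  qed
qed

text \<open>
  The convolutions of the theorem in terms of \<open>lborel\<close>: \<open>sconv\<close> is the ordinary one, and \<open>pconv\<close> is the
  double convolution over \<open>\<real>\<^sup>N \<times> ucell\<close>, with \<open>(y, z)\<close> written as a single periodic variable.
\<close>

definition sconv :: "('b::euclidean_space \<Rightarrow> 'a::{real_normed_field, euclidean_space}) \<Rightarrow> ('b \<Rightarrow> 'a) \<Rightarrow> 'b \<Rightarrow> 'a" where
  "sconv U V x = (\<integral>y. U y * V (x - y) \<partial>lborel)"

definition pconv :: "('b::euclidean_space \<times> 'c::euclidean_space \<Rightarrow> 'a::{real_normed_field, euclidean_space})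
    \<Rightarrow> ('b \<times> 'c \<Rightarrow> 'a) \<Rightarrow> 'b \<times> 'c \<Rightarrow> 'a" where
  "pconv U V P = (\<integral>Q. cell_ind Q *\<^sub>R (U Q * V (P - Q)) \<partial>lborel)"

lemma integral_lborel_shift:
  fixes f :: "'b::euclidean_space \<Rightarrow> 'a::{banach, second_countable_topology}"
  assumes [measurable]: "f \<in> borel_measurable borel"
  shows "(\<integral>x. f (x + a) \<partial>lborel) = (\<integral>x. f x \<partial>lborel)"
proof -
  have "(\<integral>x. f x \<partial>lborel) = (\<integral>x. f x \<partial>distr lborel borel ((+) a))"
    by (simp add: lborel_distr_plus)
  also have "\<dots> = (\<integral>x. f (a + x) \<partial>lborel)" by (rule integral_distr) simp_all
  finally show ?thesis by (simp add: add.commute)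
qed

text \<open>
  The hypotheses of \<open>pair_kernel\<close> for the two convolutions. For the periodic one the \<open>L\<^sup>q\<close> bound in
  either variable holds because translations and reflections preserve integrals over the cell.
\<close>

lemma sconv_kernel:
  fixes V :: "'b::euclidean_space \<Rightarrow> 'a::{real_normed_field, euclidean_space}"
  assumes [measurable]: "V \<in> borel_measurable borel" and B: "(\<integral>\<^sup>+x. norm (V x) powr q \<partial>lborel) \<le> ennreal B"
  shows "case_prod (\<lambda>x y. V (x - y)) \<in> borel_measurable (lborel \<Otimes>\<^sub>M lborel)"
    and "(\<integral>\<^sup>+y. norm (V (x - y)) powr q \<partial>lborel) \<le> ennreal B"
    and "(\<integral>\<^sup>+x. norm (V (x - y)) powr q \<partial>lborel) \<le> ennreal B"
proof -
  show "case_prod (\<lambda>x y. V (x - y)) \<in> borel_measurable (lborel \<Otimes>\<^sub>M lborel)" by measurable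
  show "(\<integral>\<^sup>+y. norm (V (x - y)) powr q \<partial>lborel) \<le> ennreal B"
    using nn_integral_lborel_reflect[of "\<lambda>x. ennreal (norm (V x) powr q)" x] B by simp
  show "(\<integral>\<^sup>+x. norm (V (x - y)) powr q \<partial>lborel) \<le> ennreal B"
    using nn_integral_lborel_shift[of "\<lambda>x. ennreal (norm (V x) powr q)" "- y"] B by simp
qed

lemma norm_cell_ind_powr:
  assumes "0 < q"
  shows "ennreal (norm (cell_ind P *\<^sub>R v) powr q) = ennreal (cell_ind P) * ennreal (norm v powr q)"
  using cell_ind_cases[of P] assms by auto

lemma pconv_kernel:
  fixes V :: "'b::euclidean_space \<times> 'c::euclidean_space \<Rightarrow> 'a::{real_normed_field, euclidean_space}"
  assumes V[measurable]: "V \<in> borel_measurable borel" and per: "\<And>x. periodic (\<lambda>w. V (x, w))" and q: "0 < q"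
    and B: "(\<integral>\<^sup>+P. ennreal (cell_ind P) * ennreal (norm (V P) powr q) \<partial>lborel) \<le> ennreal B"
  defines "K \<equiv> \<lambda>P Q. cell_ind P *\<^sub>R (cell_ind Q *\<^sub>R V (P - Q))"
  shows "case_prod K \<in> borel_measurable (lborel \<Otimes>\<^sub>M lborel)"
    and "(\<integral>\<^sup>+Q. norm (K P Q) powr q \<partial>lborel) \<le> ennreal B"
    and "(\<integral>\<^sup>+P. norm (K P Q) powr q \<partial>lborel) \<le> ennreal B"
proof -
  define h where "h P = ennreal (norm (V P) powr q)" for P
  have hm[measurable]: "h \<in> borel_measurable borel" unfolding h_def[abs_def] by measurable
  have hp: "periodic (\<lambda>w. h (x, w))" for x using per[of x] by (simp add: periodic_def h_def)
  have d: "(\<lambda>z::('b \<times> 'c) \<times> ('b \<times> 'c). V (fst z - snd z)) \<in> borel_measurable (borel \<Otimes>\<^sub>M borel)"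
    by (rule measurable_compose[OF _ V]) (measurable)
  show "case_prod K \<in> borel_measurable (lborel \<Otimes>\<^sub>M lborel)"
    unfolding K_def split_beta' using d by (intro borel_measurable_scaleR) measurable
  have "(\<integral>\<^sup>+Q. norm (K P Q) powr q \<partial>lborel) \<le> (\<integral>\<^sup>+Q. ennreal (cell_ind Q) * h (P - Q) \<partial>lborel)"
    unfolding K_def norm_cell_ind_powr[OF q] h_def
    by (intro nn_integral_mono) (use cell_ind_cases[of P] in auto)
  also have "\<dots> \<le> ennreal B"
    unfolding nn_integral_cell_reflect[OF hp hm] using B by (simp only: h_def)
  finally show "(\<integral>\<^sup>+Q. norm (K P Q) powr q \<partial>lborel) \<le> ennreal B" .
  have "(\<integral>\<^sup>+P. norm (K P Q) powr q \<partial>lborel) \<le> (\<integral>\<^sup>+P. ennreal (cell_ind P) * h (P + - Q) \<partial>lborel)"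
    unfolding K_def norm_cell_ind_powr[OF q] h_def
    by (intro nn_integral_mono) (use cell_ind_cases[of Q] in auto)
  also have "\<dots> \<le> ennreal B"
    unfolding nn_integral_cell_shift[OF hp hm] using B by (simp only: h_def)
  finally show "(\<integral>\<^sup>+P. norm (K P Q) powr q \<partial>lborel) \<le> ennreal B" .
qed

lemma test_fun_scale_measurable:
  fixes G :: "'b::euclidean_space \<times> 'c::euclidean_space \<Rightarrow> 'a::{real_normed_field, euclidean_space}"
  assumes "G \<in> borel_measurable borel" and [measurable]: "s \<in> borel_measurable borel"
  shows "(\<lambda>x. G (x, s x)) \<in> borel_measurable borel"
proof -
  have "(\<lambda>x. (x, s x)) \<in> borel \<rightarrow>\<^sub>M borel" unfolding borel_prod[symmetric] by measurable
  from measurable_compose[OF this assms(1)] show ?thesis .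
qed

lemma emeasure_cball_eq: "emeasure lborel (cball a R) = ennreal (measure lborel (cball a R))"
  by (rule emeasure_eq_ennreal_measure) (use emeasure_lborel_cball_finite[of a R] in auto)

lemma emeasure_cball_cell:
  "emeasure lborel (cball (0::'b::euclidean_space) R \<times> (ucell :: 'c::euclidean_space set))
    = ennreal (measure lborel (cball (0::'b) R))"
proof -
  have "emeasure (lborel \<Otimes>\<^sub>M lborel) (cball (0::'b) R \<times> (ucell :: 'c set))
      = emeasure lborel (cball (0::'b) R) * emeasure lborel (ucell :: 'c set)"
    by (rule lborel.emeasure_pair_measure_Times) auto
  then show ?thesis
    by (simp only: lborel_prod emeasure_ucell emeasure_cball_eq mult_1_right)
qed

text \<open>
  The first fact moves the test function onto the second factor, the second one estimates the effect
  of replacing \<open>V\<close> by \<open>V'\<close> in terms of the \<open>L\<^sup>q\<close> distance \<open>B'\<close> of the two.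
\<close>

lemma sconv_pairing:
  fixes U V :: "'b::euclidean_space \<Rightarrow> 'a::{real_normed_field, euclidean_space}" and s :: "'b \<Rightarrow> 'c::euclidean_space"
  assumes G: "test_fun G" and s_add: "\<And>x y. s (x + y) = s x + s y" and s[measurable]: "s \<in> borel_measurable borel"
    and U[measurable]: "U \<in> borel_measurable borel" and V[measurable]: "V \<in> borel_measurable borel"
    and pqm: "p \<ge> 1" "q \<ge> 1" "m \<ge> 1" "1 / p + 1 / q = 1 + 1 / m" and AB: "0 \<le> A" "0 \<le> B"
    and A: "(\<integral>\<^sup>+y. norm (U y) powr p \<partial>lborel) \<le> ennreal A" and B: "(\<integral>\<^sup>+y. norm (V y) powr q \<partial>lborel) \<le> ennreal B"
  shows "(\<integral>x. sconv U V x * G (x, s x) \<partial>lborel) = (\<integral>y. U y * (\<integral>z. V z * G ((y, s y) + (z, s z)) \<partial>lborel) \<partial>lborel)"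
    (is ?fubini)
    and "\<And>V' B' t C R. V' \<in> borel_measurable borel \<Longrightarrow> 0 \<le> B' \<Longrightarrow> (\<integral>\<^sup>+y. norm (V' y) powr q \<partial>lborel) \<le> ennreal B
      \<Longrightarrow> (\<integral>\<^sup>+y. norm (V y - V' y) powr q \<partial>lborel) \<le> ennreal B' \<Longrightarrow> 0 < t
      \<Longrightarrow> (\<And>P. norm (G P) \<le> C) \<Longrightarrow> (\<And>x w. R < norm x \<Longrightarrow> G (x, w) = 0)
      \<Longrightarrow> norm ((\<integral>x. sconv U V x * G (x, s x) \<partial>lborel) - (\<integral>x. sconv U V' x * G (x, s x) \<partial>lborel))
        \<le> C * (t * measure lborel (cball (0::'b) R) + t powr (1 - m) * (A * B' * (1 + A + B') powr m))"
proof -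
  have gm[measurable]: "(\<lambda>x. G (x, s x)) \<in> borel_measurable borel"
    by (rule test_fun_scale_measurable[OF test_fun_measurable[OF G] s])
  have gC: "norm (G (x, s x)) \<le> C * indicator (cball 0 R) x" if "\<And>P. norm (G P) \<le> C" "\<And>x w. R < norm x \<Longrightarrow> G (x, w) = 0" for C R x
    using that by (cases "R < norm x") (auto simp: indicator_def)
  have E: "emeasure lborel (cball (0::'b) R) \<le> ennreal (measure lborel (cball (0::'b) R))" for R
    by (simp only: emeasure_cball_eq)
  obtain C0 where C0: "0 \<le> C0" "\<And>P. norm (G P) \<le> C0" using test_fun_bounded[OF G] by blast
  obtain R0 where R0: "\<And>x w. R0 < norm x \<Longrightarrow> G (x, w) = 0" using G by (auto simp: test_fun_def)
  have U': "U \<in> borel_measurable lborel" and g': "(\<lambda>x. G (x, s x)) \<in> borel_measurable lborel" by simp_all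
  note pk = pair_kernel[where M = lborel and u = U and g = "\<lambda>x. G (x, s x)", OF sigma_finite_lborel U' _ g' _ _ _ _ _ pqm AB(1) _ A]
  have T: "integrable (lborel \<Otimes>\<^sub>M lborel) (\<lambda>(x, y). U y * W (x - y) * G (x, s x))"
    "(\<integral>z. (case z of (x, y) \<Rightarrow> U y * W (x - y) * G (x, s x)) \<partial>(lborel \<Otimes>\<^sub>M lborel)) = (\<integral>x. sconv U W x * G (x, s x) \<partial>lborel)"
    "(\<integral>z. (case z of (x, y) \<Rightarrow> U y * W (x - y) * G (x, s x)) \<partial>(lborel \<Otimes>\<^sub>M lborel)) = (\<integral>y. U y * (\<integral>x. W (x - y) * G (x, s x) \<partial>lborel) \<partial>lborel)"
    if W: "W \<in> borel_measurable borel" "(\<integral>\<^sup>+y. norm (W y) powr q \<partial>lborel) \<le> ennreal B'" "0 \<le> B'" for W B'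
  proof -
    have cb: "cball (0::'b) R0 \<in> sets lborel" by simp
    have g0: "norm (G (x, s x)) \<le> C0 * indicator (cball 0 R0) x" for x
      by (rule gC) (fact C0(2), fact R0)
    note pkW = pk[where K = "\<lambda>x y. W (x - y)", OF sconv_kernel(1)[OF W(1,2)] cb g0 C0(1) E measure_nonneg W(3)
        sconv_kernel(2)[OF W(1,2)] sconv_kernel(3)[OF W(1,2)]]
    show "integrable (lborel \<Otimes>\<^sub>M lborel) (\<lambda>(x, y). U y * W (x - y) * G (x, s x))" by (rule pkW(1))
    show "(\<integral>z. (case z of (x, y) \<Rightarrow> U y * W (x - y) * G (x, s x)) \<partial>(lborel \<Otimes>\<^sub>M lborel)) = (\<integral>x. sconv U W x * G (x, s x) \<partial>lborel)"
      unfolding sconv_def by (rule pkW(2))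
    show "(\<integral>z. (case z of (x, y) \<Rightarrow> U y * W (x - y) * G (x, s x)) \<partial>(lborel \<Otimes>\<^sub>M lborel)) = (\<integral>y. U y * (\<integral>x. W (x - y) * G (x, s x) \<partial>lborel) \<partial>lborel)"
      by (rule pkW(3))
  qed
  show ?fubini
  proof -
    have "(\<integral>x. V (x - y) * G (x, s x) \<partial>lborel) = (\<integral>z. V z * G ((y, s y) + (z, s z)) \<partial>lborel)" for y
    proof -
      have "(\<integral>x. V (x - y) * G (x, s x) \<partial>lborel) = (\<integral>z. V (z + y - y) * G (z + y, s (z + y)) \<partial>lborel)"
        by (rule integral_lborel_shift[symmetric]) measurable
      then show ?thesis by (simp add: s_add add.commute)
    qed
    then show ?thesis using T(2,3)[OF V B AB(2)] by simp
  qed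
  fix V' :: "'b \<Rightarrow> 'a" and B' t C R :: real
  assume V'[measurable]: "V' \<in> borel_measurable borel" and B': "0 \<le> B'" and V'B: "(\<integral>\<^sup>+y. norm (V' y) powr q \<partial>lborel) \<le> ennreal B"
    and D: "(\<integral>\<^sup>+y. norm (V y - V' y) powr q \<partial>lborel) \<le> ennreal B'" and t: "0 < t"
    and C: "\<And>P. norm (G P) \<le> C" and R: "\<And>x w. R < norm x \<Longrightarrow> G (x, w) = 0"
  have C1: "0 \<le> C" using C[of 0] norm_ge_zero order_trans by blast
  have Dm: "(\<lambda>y. V y - V' y) \<in> borel_measurable borel" by measurable
  have "(\<integral>x. sconv U V x * G (x, s x) \<partial>lborel) - (\<integral>x. sconv U V' x * G (x, s x) \<partial>lborel)
    = (\<integral>z. (case z of (x, y) \<Rightarrow> U y * V (x - y) * G (x, s x)) - (case z of (x, y) \<Rightarrow> U y * V' (x - y) * G (x, s x)) \<partial>(lborel \<Otimes>\<^sub>M lborel))"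
    unfolding T(2)[OF V B AB(2), symmetric] T(2)[OF V' V'B AB(2), symmetric]
    by (rule Bochner_Integration.integral_diff[symmetric, OF T(1)[OF V B AB(2)] T(1)[OF V' V'B AB(2)]])
  also have "\<dots> = (\<integral>z. (case z of (x, y) \<Rightarrow> U y * (V (x - y) - V' (x - y)) * G (x, s x)) \<partial>(lborel \<Otimes>\<^sub>M lborel))"
    by (rule Bochner_Integration.integral_cong) (auto simp: algebra_simps)
  also have "norm \<dots> \<le> C * (t * measure lborel (cball (0::'b) R) + t powr (1 - m) * (A * B' * (1 + A + B') powr m))"
  proof -
    have cb: "cball (0::'b) R \<in> sets lborel" by simp
    have g0: "norm (G (x, s x)) \<le> C * indicator (cball 0 R) x" for x
      by (rule gC) (fact C, fact R)
    show ?thesis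
      by (rule pk(4)[where K = "\<lambda>x y. V (x - y) - V' (x - y)", OF sconv_kernel(1)[OF Dm D] cb g0 C1 E measure_nonneg B'
            sconv_kernel(2)[OF Dm D] sconv_kernel(3)[OF Dm D] t])
  qed
  finally show "norm ((\<integral>x. sconv U V x * G (x, s x) \<partial>lborel) - (\<integral>x. sconv U V' x * G (x, s x) \<partial>lborel))
        \<le> C * (t * measure lborel (cball (0::'b) R) + t powr (1 - m) * (A * B' * (1 + A + B') powr m))" .
qed

lemma pconv_pairing:
  fixes U V :: "'b::euclidean_space \<times> 'c::euclidean_space \<Rightarrow> 'a::{real_normed_field, euclidean_space}"
  assumes G: "test_fun G"
    and U[measurable]: "U \<in> borel_measurable borel" and V[measurable]: "V \<in> borel_measurable borel"
    and per: "\<And>x. periodic (\<lambda>w. V (x, w))"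
    and pqm: "p \<ge> 1" "q \<ge> 1" "m \<ge> 1" "1 / p + 1 / q = 1 + 1 / m" and AB: "0 \<le> A" "0 \<le> B"
    and A: "(\<integral>\<^sup>+P. ennreal (cell_ind P) * ennreal (norm (U P) powr p) \<partial>lborel) \<le> ennreal A"
    and B: "(\<integral>\<^sup>+P. ennreal (cell_ind P) * ennreal (norm (V P) powr q) \<partial>lborel) \<le> ennreal B"
  shows "(\<integral>P. cell_ind P *\<^sub>R (pconv U V P * G P) \<partial>lborel)
      = (\<integral>P. cell_ind P *\<^sub>R (U P * (\<integral>Q. cell_ind Q *\<^sub>R (V Q * G (P + Q)) \<partial>lborel)) \<partial>lborel)"
    (is ?fubini)
    and "\<And>V' B' t C R. V' \<in> borel_measurable borel \<Longrightarrow> (\<And>x. periodic (\<lambda>w. V' (x, w))) \<Longrightarrow> 0 \<le> B'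
      \<Longrightarrow> (\<integral>\<^sup>+P. ennreal (cell_ind P) * ennreal (norm (V' P) powr q) \<partial>lborel) \<le> ennreal B
      \<Longrightarrow> (\<integral>\<^sup>+P. ennreal (cell_ind P) * ennreal (norm (V P - V' P) powr q) \<partial>lborel) \<le> ennreal B' \<Longrightarrow> 0 < t
      \<Longrightarrow> (\<And>P. norm (G P) \<le> C) \<Longrightarrow> (\<And>x w. R < norm x \<Longrightarrow> G (x, w) = 0)
      \<Longrightarrow> norm ((\<integral>P. cell_ind P *\<^sub>R (pconv U V P * G P) \<partial>lborel) - (\<integral>P. cell_ind P *\<^sub>R (pconv U V' P * G P) \<partial>lborel))
        \<le> C * (t * measure lborel (cball (0::'b) R) + t powr (1 - m) * (A * B' * (1 + A + B') powr m))"
proof -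
  have q0: "0 < q" and p0: "0 < p" using pqm by auto
  note [measurable] = test_fun_measurable[OF G]
  define u where "u Q = cell_ind Q *\<^sub>R U Q" for Q
  define g where "g P = cell_ind P *\<^sub>R G P" for P
  define K where "K W P Q = cell_ind P *\<^sub>R (cell_ind Q *\<^sub>R (W (P - Q) :: 'a))" for W :: "'b \<times> 'c \<Rightarrow> 'a" and P Q
  have u: "u \<in> borel_measurable lborel" and g: "g \<in> borel_measurable lborel"
    unfolding u_def[abs_def] g_def[abs_def] by measurable
  have A': "(\<integral>\<^sup>+Q. norm (u Q) powr p \<partial>lborel) \<le> ennreal A"
    unfolding u_def norm_cell_ind_powr[OF p0] by (rule A)
  have gC: "norm (g P) \<le> C * indicator (cball 0 R \<times> ucell) P"
    if "\<And>P. norm (G P) \<le> C" "\<And>x w. R < norm x \<Longrightarrow> G (x, w) = 0" for C R P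
  proof -
    obtain x w where P: "P = (x, w)" by (cases P)
    show ?thesis
    proof (cases "R < norm x \<or> w \<notin> ucell")
      case True
      then have "g P = 0" using that(2)[of x w] by (auto simp: g_def P cell_ind_pair)
      moreover have "0 \<le> C" using that(1)[of 0] norm_ge_zero order_trans by blast
      ultimately show ?thesis by simp
    next
      case False
      then show ?thesis using that(1)[of P] by (simp add: g_def P cell_ind_pair)
    qed
  qed
  have E: "emeasure lborel (cball (0::'b) R \<times> (ucell :: 'c set)) \<le> ennreal (measure lborel (cball (0::'b) R))" for R
    by (simp only: emeasure_cball_cell)
  have cb: "cball (0::'b) R \<times> (ucell :: 'c set) \<in> sets lborel" for R
  proof -
    have "cball (0::'b) R \<times> (ucell :: 'c set) \<in> sets (borel \<Otimes>\<^sub>M borel)" by (rule pair_measureI) auto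
    then show ?thesis unfolding borel_prod by simp
  qed
  obtain C0 where C0: "0 \<le> C0" "\<And>P. norm (G P) \<le> C0" using test_fun_bounded[OF G] by blast
  obtain R0 where R0: "\<And>x w. R0 < norm x \<Longrightarrow> G (x, w) = 0" using G by (auto simp: test_fun_def)
  note pk = pair_kernel[where M = lborel and u = u and g = g, OF sigma_finite_lborel u _ g _ _ _ _ _ pqm AB(1) _ A']
  have Kconv: "(\<integral>Q. u Q * K W P Q \<partial>lborel) * g P = cell_ind P *\<^sub>R (pconv U W P * G P)" for W P
  proof -
    have "u Q * K W P Q = cell_ind P *\<^sub>R (cell_ind Q *\<^sub>R (U Q * W (P - Q)))" for Q
      using cell_ind_cases[of Q] by (auto simp: u_def K_def)
    then have "(\<integral>Q. u Q * K W P Q \<partial>lborel) = cell_ind P *\<^sub>R pconv U W P"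
      unfolding pconv_def by (simp only: integral_scaleR_right)
    then show ?thesis using cell_ind_cases[of P] by (auto simp: g_def)
  qed
  have Kshift: "u Q * (\<integral>P. K W P Q * g P \<partial>lborel) = cell_ind Q *\<^sub>R (U Q * (\<integral>P. cell_ind P *\<^sub>R (W P * G (Q + P)) \<partial>lborel))"
    if W[measurable]: "W \<in> borel_measurable borel" and Wp: "\<And>x. periodic (\<lambda>w. W (x, w))" for W Q
  proof -
    define h where "h P = W (P - Q) * G P" for P
    have [measurable]: "(\<lambda>P. W (P - Q)) \<in> borel_measurable borel" by (rule measurable_compose[OF _ W]) measurable
    have hm: "h \<in> borel_measurable borel" unfolding h_def[abs_def] by measurable
    have hp: "periodic (\<lambda>w. h (x, w))" for x
    proof -
      obtain y v where Q: "Q = (y, v)" by (cases Q)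
      have "W (x - y, w + k - v) = W (x - y, w - v)" if "lattice_point k" for w k
        using periodicD[OF Wp[of "x - y"] that, of "w - v"] by (simp add: algebra_simps)
      then show ?thesis by (simp add: periodic_def h_def Q test_fun_periodic[OF G])
    qed
    have "K W P Q * g P = cell_ind Q *\<^sub>R (cell_ind P *\<^sub>R h P)" for P
      using cell_ind_cases[of P] cell_ind_cases[of Q] by (auto simp: K_def g_def h_def)
    then have "(\<integral>P. K W P Q * g P \<partial>lborel) = (\<integral>P. cell_ind Q *\<^sub>R (cell_ind P *\<^sub>R h P) \<partial>lborel)"
      by (simp only:)
    also have "\<dots> = cell_ind Q *\<^sub>R (\<integral>P. cell_ind P *\<^sub>R h P \<partial>lborel)" by (simp only: integral_scaleR_right)
    also have "(\<integral>P. cell_ind P *\<^sub>R h P \<partial>lborel) = (\<integral>P. cell_ind P *\<^sub>R h (P + Q) \<partial>lborel)"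
      by (rule integral_cell_shift[OF hp hm, symmetric])
    also have "\<dots> = (\<integral>P. cell_ind P *\<^sub>R (W P * G (Q + P)) \<partial>lborel)"
      by (simp add: h_def add.commute)
    finally show ?thesis using cell_ind_cases[of Q] by (auto simp: u_def)
  qed
  have T: "integrable (lborel \<Otimes>\<^sub>M lborel) (\<lambda>(P, Q). u Q * K W P Q * g P)"
    "(\<integral>z. (case z of (P, Q) \<Rightarrow> u Q * K W P Q * g P) \<partial>(lborel \<Otimes>\<^sub>M lborel)) = (\<integral>P. cell_ind P *\<^sub>R (pconv U W P * G P) \<partial>lborel)"
    "(\<integral>z. (case z of (P, Q) \<Rightarrow> u Q * K W P Q * g P) \<partial>(lborel \<Otimes>\<^sub>M lborel))
      = (\<integral>Q. cell_ind Q *\<^sub>R (U Q * (\<integral>P. cell_ind P *\<^sub>R (W P * G (Q + P)) \<partial>lborel)) \<partial>lborel)"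
    if W: "W \<in> borel_measurable borel" "(\<integral>\<^sup>+P. ennreal (cell_ind P) * ennreal (norm (W P) powr q) \<partial>lborel) \<le> ennreal B'" "0 \<le> B'"
      and Wp: "\<And>x. periodic (\<lambda>w. W (x, w))" for W B'
  proof -
    have g0: "norm (g P) \<le> C0 * indicator (cball 0 R0 \<times> ucell) P" for P
      by (rule gC) (fact C0(2), fact R0)
    note k = pconv_kernel[OF W(1) Wp q0 W(2), folded K_def]
    note pkW = pk[where K = "K W", OF k(1) cb g0 C0(1) E measure_nonneg W(3) k(2) k(3)]
    show "integrable (lborel \<Otimes>\<^sub>M lborel) (\<lambda>(P, Q). u Q * K W P Q * g P)" by (rule pkW(1))
    show "(\<integral>z. (case z of (P, Q) \<Rightarrow> u Q * K W P Q * g P) \<partial>(lborel \<Otimes>\<^sub>M lborel)) = (\<integral>P. cell_ind P *\<^sub>R (pconv U W P * G P) \<partial>lborel)"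
      unfolding Kconv[symmetric] by (rule pkW(2))
    show "(\<integral>z. (case z of (P, Q) \<Rightarrow> u Q * K W P Q * g P) \<partial>(lborel \<Otimes>\<^sub>M lborel))
      = (\<integral>Q. cell_ind Q *\<^sub>R (U Q * (\<integral>P. cell_ind P *\<^sub>R (W P * G (Q + P)) \<partial>lborel)) \<partial>lborel)"
      unfolding Kshift[OF W(1) Wp, symmetric] by (rule pkW(3))
  qed
  show ?fubini using T(2,3)[OF V B AB(2) per] by simp
  fix V' :: "'b \<times> 'c \<Rightarrow> 'a" and B' t C R :: real
  assume V'[measurable]: "V' \<in> borel_measurable borel" and per': "\<And>x. periodic (\<lambda>w. V' (x, w))" and B': "0 \<le> B'"
    and V'B: "(\<integral>\<^sup>+P. ennreal (cell_ind P) * ennreal (norm (V' P) powr q) \<partial>lborel) \<le> ennreal B"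
    and D: "(\<integral>\<^sup>+P. ennreal (cell_ind P) * ennreal (norm (V P - V' P) powr q) \<partial>lborel) \<le> ennreal B'" and t: "0 < t"
    and C: "\<And>P. norm (G P) \<le> C" and R: "\<And>x w. R < norm x \<Longrightarrow> G (x, w) = 0"
  have C1: "0 \<le> C" using C[of 0] norm_ge_zero order_trans by blast
  define Df where "Df P = V P - V' P" for P
  have Dm: "Df \<in> borel_measurable borel" unfolding Df_def[abs_def] by measurable
  have Dp: "periodic (\<lambda>w. Df (x, w))" for x
    using per[of x] per'[of x] by (simp add: periodic_def Df_def)
  have "(\<integral>P. cell_ind P *\<^sub>R (pconv U V P * G P) \<partial>lborel) - (\<integral>P. cell_ind P *\<^sub>R (pconv U V' P * G P) \<partial>lborel)
    = (\<integral>z. (case z of (P, Q) \<Rightarrow> u Q * K V P Q * g P) - (case z of (P, Q) \<Rightarrow> u Q * K V' P Q * g P) \<partial>(lborel \<Otimes>\<^sub>M lborel))"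
    unfolding T(2)[OF V B AB(2) per, symmetric] T(2)[OF V' V'B AB(2) per', symmetric]
    by (rule Bochner_Integration.integral_diff[symmetric, OF T(1)[OF V B AB(2) per] T(1)[OF V' V'B AB(2) per']])
  also have "\<dots> = (\<integral>z. (case z of (P, Q) \<Rightarrow> u Q * K Df P Q * g P) \<partial>(lborel \<Otimes>\<^sub>M lborel))"
    by (rule Bochner_Integration.integral_cong) (auto simp: K_def Df_def algebra_simps scaleR_diff_right)
  also have "norm \<dots> \<le> C * (t * measure lborel (cball (0::'b) R) + t powr (1 - m) * (A * B' * (1 + A + B') powr m))"
  proof -
    have g0: "norm (g P) \<le> C * indicator (cball 0 R \<times> ucell) P" for P
      by (rule gC) (fact C, fact R)
    note k = pconv_kernel[OF Dm Dp q0 D[folded Df_def], folded K_def]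
    show ?thesis
      by (rule pk(4)[where K = "K Df", OF k(1) cb g0 C1 E measure_nonneg B' k(2) k(3) t])
  qed
  finally show "norm ((\<integral>P. cell_ind P *\<^sub>R (pconv U V P * G P) \<partial>lborel) - (\<integral>P. cell_ind P *\<^sub>R (pconv U V' P * G P) \<partial>lborel))
        \<le> C * (t * measure lborel (cball (0::'b) R) + t powr (1 - m) * (A * B' * (1 + A + B') powr m))" .
qed

lemma measurable_cball[measurable]: "cball (a::'b::euclidean_space) r \<in> sets borel"
  by (rule borel_closed[OF closed_cball])

lemma local_L1_bound:
  fixes F :: "'b::euclidean_space \<Rightarrow> 'a::{real_normed_field, euclidean_space}"
  assumes [measurable]: "F \<in> borel_measurable borel" and p: "1 \<le> p" and A: "0 \<le> A" "(\<integral>\<^sup>+x. norm (F x) powr p \<partial>lborel) \<le> ennreal A"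
    and le: "\<And>x. norm (F' x) \<le> indicator (cball 0 r) x * norm (F x)" and [measurable]: "F' \<in> borel_measurable borel"
  shows "integrable lborel (F' :: 'b \<Rightarrow> 'a)" and "(\<integral>x. norm (F' x) \<partial>lborel) \<le> measure lborel (cball (0::'b) r) + A"
proof -
  have "(\<integral>\<^sup>+x. norm (F' x) \<partial>lborel) \<le> (\<integral>\<^sup>+x. indicator (cball 0 r) x + ennreal (norm (F x) powr p) \<partial>lborel)"
  proof (rule nn_integral_mono)
    fix x
    have "norm (F x) \<le> 1 + norm (F x) powr p" using le_add_powr[OF norm_ge_zero[of "F x"], of 1 p] p by simp
    then have "norm (F' x) \<le> indicator (cball 0 r) x + norm (F x) powr p"
      using le[of x] by (cases "x \<in> cball 0 r") (auto intro: order_trans)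
    then have "ennreal (norm (F' x)) \<le> ennreal (indicator (cball 0 r) x + norm (F x) powr p)" by (rule ennreal_leI)
    also have "\<dots> = indicator (cball 0 r) x + ennreal (norm (F x) powr p)" by (simp add: indicator_def)
    finally show "ennreal (norm (F' x)) \<le> indicator (cball 0 r) x + ennreal (norm (F x) powr p)" .
  qed
  also have "\<dots> = emeasure lborel (cball (0::'b) r) + (\<integral>\<^sup>+x. norm (F x) powr p \<partial>lborel)"
    by (subst nn_integral_add) auto
  also have "\<dots> \<le> ennreal (measure lborel (cball (0::'b) r)) + ennreal A"
    by (intro add_mono A) (simp only: emeasure_cball_eq)
  also have "\<dots> = ennreal (measure lborel (cball (0::'b) r) + A)" using A by simp
  finally have le': "(\<integral>\<^sup>+x. norm (F' x) \<partial>lborel) \<le> ennreal (measure lborel (cball (0::'b) r) + A)" .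
  show int: "integrable lborel F'"
    by (rule integrableI_bounded) (use le' in \<open>auto intro: order_le_less_trans[OF _ ennreal_less_top]\<close>)
  have "ennreal (\<integral>x. norm (F' x) \<partial>lborel) \<le> ennreal (measure lborel (cball (0::'b) r) + A)"
    using le' by (subst (asm) nn_integral_eq_integral[OF integrable_norm[OF int]]) auto
  moreover have "0 \<le> measure lborel (cball (0::'b) r) + A" using A by simp
  ultimately show "(\<integral>x. norm (F' x) \<partial>lborel) \<le> measure lborel (cball (0::'b) r) + A"
    by (simp only: ennreal_le_iff)
qed

definition cutoff :: "real \<Rightarrow> 'b::real_normed_vector \<Rightarrow> real" where
  "cutoff \<rho> x = max 0 (min 1 (\<rho> + 1 - norm x))"

lemma cutoff_bounds: "0 \<le> cutoff \<rho> x" "cutoff \<rho> x \<le> 1"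
  by (auto simp: cutoff_def)

lemma cutoff_one: "norm x \<le> \<rho> \<Longrightarrow> cutoff \<rho> x = 1"
  by (auto simp: cutoff_def)

lemma cutoff_zero: "\<rho> + 1 \<le> norm x \<Longrightarrow> cutoff \<rho> x = 0"
  by (auto simp: cutoff_def)

lemma continuous_on_cutoff: "continuous_on S (cutoff \<rho>)"
  unfolding cutoff_def[abs_def] by (intro continuous_intros)

lemma cutoff_measurable[measurable]: "cutoff \<rho> \<in> borel_measurable (borel :: 'b::euclidean_space measure)"
  by (intro borel_measurable_continuous_onI continuous_on_cutoff)

lemma test_fun_cutoff:
  fixes G :: "'b::euclidean_space \<times> 'c::euclidean_space \<Rightarrow> 'a::real_normed_vector"
  assumes G: "test_fun G" shows "test_fun (\<lambda>P. cutoff \<rho> (fst P) *\<^sub>R G P)"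
proof -
  have "continuous_on UNIV (\<lambda>P::'b \<times> 'c. cutoff \<rho> (fst P))"
    by (rule continuous_on_compose2[OF continuous_on_cutoff[of UNIV \<rho>]]) (auto intro!: continuous_intros)
  then have "continuous_on UNIV (\<lambda>P. cutoff \<rho> (fst P) *\<^sub>R G P)"
    using G by (intro continuous_on_scaleR) (auto simp: test_fun_def)
  moreover have "periodic (\<lambda>w. cutoff \<rho> (fst (x, w)) *\<^sub>R G (x, w))" for x
    using G by (auto simp: periodic_def test_fun_periodic)
  moreover have "\<exists>R. \<forall>x w. R < norm x \<longrightarrow> cutoff \<rho> (fst (x, w)) *\<^sub>R G (x, w) = 0"
    using G unfolding test_fun_def by auto
  ultimately show ?thesis unfolding test_fun_def by blast
qed

lemma norm_cutoff_diff_powr: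
  fixes v :: "'a::real_normed_vector"
  assumes "0 < q"
  shows "norm (v - cutoff \<rho> x *\<^sub>R v) powr q \<le> indicator {x. \<rho> < norm x} x * norm v powr q"
proof (cases "\<rho> < norm x")
  case True
  have "v - cutoff \<rho> x *\<^sub>R v = (1 - cutoff \<rho> x) *\<^sub>R v" by (simp add: scaleR_diff_left)
  then have "norm (v - cutoff \<rho> x *\<^sub>R v) \<le> norm v"
    using cutoff_bounds[of \<rho> x] by (simp add: mult_left_le_one_le)
  then show ?thesis using True assms by (simp add: powr_mono2)
qed (simp add: cutoff_one)

lemma norm_cutoff_powr:
  fixes v :: "'a::real_normed_vector"
  assumes "0 < q"
  shows "norm (cutoff \<rho> x *\<^sub>R v) powr q \<le> norm v powr q"
  using cutoff_bounds[of \<rho> x] assms by (intro powr_mono2) (auto simp: mult_left_le_one_le)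

lemma nn_integral_tail_small:
  fixes \<phi> :: "'x \<Rightarrow> real" and f :: "'x \<Rightarrow> ennreal"
  assumes [measurable]: "f \<in> borel_measurable M" "\<phi> \<in> borel_measurable M" and fin: "(\<integral>\<^sup>+x. f x \<partial>M) < \<infinity>" and "0 < \<delta>"
  shows "\<exists>k::nat. (\<integral>\<^sup>+x. indicator {x. real k < \<phi> x} x * f x \<partial>M) \<le> ennreal \<delta>"
proof -
  have "(\<lambda>k::nat. \<integral>\<^sup>+x. indicator {x. real k < \<phi> x} x * f x \<partial>M) \<longlonglongrightarrow> (\<integral>\<^sup>+x. 0 \<partial>M)"
  proof (rule nn_integral_dominated_convergence[where w = f])
    show "AE x in M. (\<lambda>k::nat. indicator {x. real k < \<phi> x} x * f x) \<longlonglongrightarrow> 0"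
    proof (rule AE_I2)
      fix x
      obtain K :: nat where K: "\<phi> x \<le> real K" using real_arch_simple by blast
      show "(\<lambda>k::nat. indicator {x. real k < \<phi> x} x * f x) \<longlonglongrightarrow> 0"
      proof (rule tendsto_eventually, rule eventually_sequentiallyI[of K])
        fix k assume "K \<le> k"
        then have "\<not> real k < \<phi> x" using K by linarith
        then show "indicator {x. real k < \<phi> x} x * f x = 0" by simp
      qed
    qed
  qed (use fin in \<open>auto simp: indicator_def\<close>)
  then have "eventually (\<lambda>k::nat. (\<integral>\<^sup>+x. indicator {x. real k < \<phi> x} x * f x \<partial>M) < ennreal \<delta>) sequentially"
    using \<open>0 < \<delta>\<close> by (intro order_tendstoD(2)) auto
  then show ?thesis by (auto simp: eventually_sequentially intro: less_imp_le)
qed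

text \<open>
  The error term of \<open>pair_kernel\<close> can be made small by choosing first \<open>t\<close> and then the bound \<open>\<delta>\<close> for
  the \<open>q\<close>th power of the discarded part.
\<close>

lemma pairing_error_small:
  fixes C \<beta> A m \<epsilon> :: real
  assumes "0 \<le> C" "0 \<le> \<beta>" "0 \<le> A" "1 \<le> m" "0 < \<epsilon>"
  shows "\<exists>t>0. \<exists>\<delta>>0. C * (t * \<beta> + t powr (1 - m) * (A * \<delta> * (1 + A + \<delta>) powr m)) \<le> \<epsilon>"
proof -
  define t where "t = \<epsilon> / 2 / (C * \<beta> + 1)"
  have cb: "0 \<le> C * \<beta>" using assms by simp
  have cb1: "0 < C * \<beta> + 1" using cb by linarith
  have t: "0 < t" unfolding t_def using assms cb1 by (intro divide_pos_pos) simp_all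
  have tt: "t * (C * \<beta> + 1) = \<epsilon> / 2" by (rule iffD1[OF nonzero_eq_divide_eq t_def]) (use cb in simp)
  define D where "D = C * t powr (1 - m) * A * (2 + A) powr m"
  have D: "0 \<le> D" using assms by (simp add: D_def)
  define \<delta> where "\<delta> = min 1 (\<epsilon> / 2 / (D + 1))"
  have \<delta>: "0 < \<delta>" "\<delta> \<le> 1" using assms D by (auto simp: \<delta>_def)
  have "\<epsilon> / 2 / (D + 1) * (D + 1) = \<epsilon> / 2"
    by (rule iffD1[OF nonzero_eq_divide_eq refl]) (use D in simp)
  moreover have "\<delta> * (D + 1) \<le> \<epsilon> / 2 / (D + 1) * (D + 1)" using D by (intro mult_right_mono) (auto simp: \<delta>_def)
  ultimately have dd: "\<delta> * (D + 1) \<le> \<epsilon> / 2" by linarith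
  have "(1 + A + \<delta>) powr m \<le> (2 + A) powr m" using assms \<delta> by (intro powr_mono2) auto
  then have "C * (t powr (1 - m) * (A * \<delta> * (1 + A + \<delta>) powr m)) \<le> C * (t powr (1 - m) * (A * \<delta> * (2 + A) powr m))"
    using assms \<delta> by (intro mult_left_mono) auto
  also have "\<dots> = \<delta> * D" by (simp add: D_def)
  also have "\<dots> \<le> \<epsilon> / 2" using dd \<delta> by (simp add: algebra_simps)
  finally have 2: "C * (t powr (1 - m) * (A * \<delta> * (1 + A + \<delta>) powr m)) \<le> \<epsilon> / 2" .
  have 1: "C * (t * \<beta>) \<le> \<epsilon> / 2" using tt t by (simp add: algebra_simps)
  from 1 2 have "C * (t * \<beta> + t powr (1 - m) * (A * \<delta> * (1 + A + \<delta>) powr m)) \<le> \<epsilon>"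
    unfolding distrib_left by linarith
  then show ?thesis using t \<delta> by blast
qed

text \<open>
  Tightness of \<open>V n\<close> is what permits to cut off \<open>V n\<close> at a large radius: by Young's inequality
  the error is small, uniformly in \<open>n\<close>. For the truncated functions only a compact set of
  arguments matters and \<open>pairing_compact\<close> applies.
\<close>

lemma conv_test:
  fixes U V :: "nat \<Rightarrow> 'b::euclidean_space \<Rightarrow> 'a::{real_normed_field, euclidean_space}"
    and U0 V0 :: "'b \<times> 'c::euclidean_space \<Rightarrow> 'a" and \<sigma> :: "nat \<Rightarrow> 'b \<Rightarrow> 'c"
  assumes G: "test_fun G"
    and \<sigma>_add: "\<And>n x y. \<sigma> n (x + y) = \<sigma> n x + \<sigma> n y" and \<sigma>[measurable]: "\<And>n. \<sigma> n \<in> borel_measurable borel"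
    and U[measurable]: "\<And>n. U n \<in> borel_measurable borel" and V[measurable]: "\<And>n. V n \<in> borel_measurable borel"
    and U0[measurable]: "U0 \<in> borel_measurable borel" and V0[measurable]: "V0 \<in> borel_measurable borel"
    and per: "\<And>x. periodic (\<lambda>w. V0 (x, w))"
    and pqm: "p \<ge> 1" "q \<ge> 1" "m \<ge> 1" "1 / p + 1 / q = 1 + 1 / m" and AB: "0 \<le> A" "0 \<le> B"
    and A: "\<And>n. (\<integral>\<^sup>+y. norm (U n y) powr p \<partial>lborel) \<le> ennreal A"
    and B: "\<And>n. (\<integral>\<^sup>+y. norm (V n y) powr q \<partial>lborel) \<le> ennreal B"
    and A0: "(\<integral>\<^sup>+P. ennreal (cell_ind P) * ennreal (norm (U0 P) powr p) \<partial>lborel) \<le> ennreal A"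
    and B0: "(\<integral>\<^sup>+P. ennreal (cell_ind P) * ennreal (norm (V0 P) powr q) \<partial>lborel) \<le> ennreal B"
    and tight: "\<And>\<delta>. 0 < \<delta> \<Longrightarrow> \<exists>\<rho>. eventually (\<lambda>n. (\<integral>\<^sup>+x. indicator {x. \<rho> < norm x} x * ennreal (norm (V n x) powr q) \<partial>lborel) \<le> ennreal \<delta>) sequentially"
    and weakU: "\<And>H. test_fun H \<Longrightarrow> (\<lambda>n. \<integral>x. U n x * H (x, \<sigma> n x) \<partial>lborel) \<longlonglongrightarrow> (\<integral>P. cell_ind P *\<^sub>R (U0 P * H P) \<partial>lborel)"
    and weakV: "\<And>H. test_fun H \<Longrightarrow> (\<lambda>n. \<integral>x. V n x * H (x, \<sigma> n x) \<partial>lborel) \<longlonglongrightarrow> (\<integral>P. cell_ind P *\<^sub>R (V0 P * H P) \<partial>lborel)"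
  shows "(\<lambda>n. \<integral>x. sconv (U n) (V n) x * G (x, \<sigma> n x) \<partial>lborel) \<longlonglongrightarrow> (\<integral>P. cell_ind P *\<^sub>R (pconv U0 V0 P * G P) \<partial>lborel)"
proof (rule tendstoI)
  fix \<epsilon> :: real assume \<epsilon>: "0 < \<epsilon>"
  have p0: "0 < p" and q0: "0 < q" using pqm by auto
  obtain C where C0: "0 \<le> C" and C: "\<And>P. norm (G P) \<le> C" using test_fun_bounded[OF G] by blast
  obtain R where R: "\<And>x w. R < norm x \<Longrightarrow> G (x, w) = 0" using G by (auto simp: test_fun_def)
  define \<beta> where "\<beta> = measure lborel (cball (0::'b) R)"
  obtain t \<delta> where t: "0 < t" and \<delta>: "0 < \<delta>"
    and small: "C * (t * \<beta> + t powr (1 - m) * (A * \<delta> * (1 + A + \<delta>) powr m)) \<le> \<epsilon> / 4"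
    using pairing_error_small[OF C0 _ AB(1) pqm(3), of \<beta> "\<epsilon> / 4"] \<epsilon> by (auto simp: \<beta>_def)
  obtain \<rho>1 where \<rho>1: "eventually (\<lambda>n. (\<integral>\<^sup>+x. indicator {x. \<rho>1 < norm x} x * ennreal (norm (V n x) powr q) \<partial>lborel) \<le> ennreal \<delta>) sequentially"
    using tight[OF \<delta>] by blast
  have fin0: "(\<integral>\<^sup>+P. ennreal (cell_ind P) * ennreal (norm (V0 P) powr q) \<partial>lborel) < \<infinity>"
    by (rule order_le_less_trans[OF B0]) simp
  have mfst: "(\<lambda>P::'b \<times> 'c. norm (fst P)) \<in> borel_measurable lborel"
    by (simp add: borel_measurable_continuous_onI continuous_on_fst continuous_on_id continuous_on_norm)
  obtain k :: nat where k: "(\<integral>\<^sup>+P. indicator {P. real k < norm (fst P)} P * (ennreal (cell_ind P) * ennreal (norm (V0 P) powr q)) \<partial>lborel) \<le> ennreal \<delta>"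
    using nn_integral_tail_small[OF _ mfst fin0 \<delta>] by auto
  define \<rho> where "\<rho> = max \<rho>1 (real k)"
  define Vc where "Vc n x = cutoff \<rho> x *\<^sub>R V n x" for n x
  define V0c where "V0c P = cutoff \<rho> (fst P) *\<^sub>R V0 P" for P
  have Vc[measurable]: "Vc n \<in> borel_measurable borel" for n unfolding Vc_def[abs_def] by measurable
  have mcut: "(\<lambda>P::'b \<times> 'c. cutoff \<rho> (fst P)) \<in> borel_measurable borel"
    unfolding borel_prod[symmetric] by measurable
  have V0c[measurable]: "V0c \<in> borel_measurable borel"
    unfolding V0c_def[abs_def] using mcut V0 by (rule borel_measurable_scaleR)
  have perc: "periodic (\<lambda>w. V0c (x, w))" for x using per[of x] by (simp add: periodic_def V0c_def)
  have Bc: "(\<integral>\<^sup>+y. norm (Vc n y) powr q \<partial>lborel) \<le> ennreal B" for n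
    by (rule order_trans[OF nn_integral_mono B[of n]]) (simp only: Vc_def ennreal_leI norm_cutoff_powr[OF q0])
  have B0c: "(\<integral>\<^sup>+P. ennreal (cell_ind P) * ennreal (norm (V0c P) powr q) \<partial>lborel) \<le> ennreal B"
    by (rule order_trans[OF nn_integral_mono B0], unfold V0c_def, intro mult_left_mono ennreal_leI norm_cutoff_powr[OF q0]) simp
  have D0: "(\<integral>\<^sup>+P. ennreal (cell_ind P) * ennreal (norm (V0 P - V0c P) powr q) \<partial>lborel) \<le> ennreal \<delta>"
  proof (rule order_trans[OF nn_integral_mono k])
    fix P
    have "norm (V0 P - V0c P) powr q \<le> indicator {x. \<rho> < norm x} (fst P) * norm (V0 P) powr q"
      unfolding V0c_def by (rule norm_cutoff_diff_powr[OF q0])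
    also have "\<dots> \<le> indicator {P. real k < norm (fst P)} P * norm (V0 P) powr q"
      by (intro mult_right_mono) (auto simp: \<rho>_def indicator_def)
    finally have "ennreal (norm (V0 P - V0c P) powr q) \<le> indicator {P. real k < norm (fst P)} P * ennreal (norm (V0 P) powr q)"
      by (cases "real k < norm (fst P)") (auto simp: ennreal_leI)
    then have "ennreal (cell_ind P) * ennreal (norm (V0 P - V0c P) powr q) \<le> ennreal (cell_ind P) * (indicator {P. real k < norm (fst P)} P * ennreal (norm (V0 P) powr q))"
      by (rule mult_left_mono) simp
    then show "ennreal (cell_ind P) * ennreal (norm (V0 P - V0c P) powr q)
        \<le> indicator {P. real k < norm (fst P)} P * (ennreal (cell_ind P) * ennreal (norm (V0 P) powr q))"
      by (simp only: mult.left_commute)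
  qed
  have Dn: "(\<integral>\<^sup>+y. norm (V n y - Vc n y) powr q \<partial>lborel) \<le> ennreal \<delta>"
    if n: "(\<integral>\<^sup>+x. indicator {x. \<rho>1 < norm x} x * ennreal (norm (V n x) powr q) \<partial>lborel) \<le> ennreal \<delta>" for n
  proof (rule order_trans[OF nn_integral_mono n])
    fix x
    have "norm (V n x - Vc n x) powr q \<le> indicator {x. \<rho> < norm x} x * norm (V n x) powr q"
      unfolding Vc_def by (rule norm_cutoff_diff_powr[OF q0])
    also have "\<dots> \<le> indicator {x. \<rho>1 < norm x} x * norm (V n x) powr q"
      by (intro mult_right_mono) (auto simp: \<rho>_def indicator_def)
    finally show "ennreal (norm (V n x - Vc n x) powr q) \<le> indicator {x. \<rho>1 < norm x} x * ennreal (norm (V n x) powr q)"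
      by (cases "\<rho>1 < norm x") (auto simp: ennreal_leI)
  qed
  define T where "T n = (\<integral>x. sconv (U n) (V n) x * G (x, \<sigma> n x) \<partial>lborel)" for n
  define Tc where "Tc n = (\<integral>x. sconv (U n) (Vc n) x * G (x, \<sigma> n x) \<partial>lborel)" for n
  define T0 where "T0 = (\<integral>P. cell_ind P *\<^sub>R (pconv U0 V0 P * G P) \<partial>lborel)"
  define T0c where "T0c = (\<integral>P. cell_ind P *\<^sub>R (pconv U0 V0c P * G P) \<partial>lborel)"
  have e0: "norm (T0 - T0c) \<le> \<epsilon> / 4"
    unfolding T0_def T0c_def
    by (rule order_trans[OF pconv_pairing(2)[OF G U0 V0 per pqm AB A0 B0 V0c perc less_imp_le[OF \<delta>] B0c D0 t C R] small[unfolded \<beta>_def]])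
  have en: "eventually (\<lambda>n. norm (T n - Tc n) \<le> \<epsilon> / 4) sequentially"
    using \<rho>1
  proof (rule eventually_mono)
    fix n assume "(\<integral>\<^sup>+x. indicator {x. \<rho>1 < norm x} x * ennreal (norm (V n x) powr q) \<partial>lborel) \<le> ennreal \<delta>"
    from Dn[OF this] show "norm (T n - Tc n) \<le> \<epsilon> / 4"
      unfolding T_def Tc_def
      by (intro order_trans[OF sconv_pairing(2)[OF G \<sigma>_add \<sigma> U V pqm AB A B Vc less_imp_le[OF \<delta>] Bc _ t C R] small[unfolded \<beta>_def]])
  qed
  have Vc_le: "norm (Vc n x) \<le> indicator (cball 0 (\<rho> + 1)) x * norm (V n x)" for n x
    using cutoff_bounds[of \<rho> x] cutoff_zero[of \<rho> x]
    by (cases "norm x \<le> \<rho> + 1") (auto simp: Vc_def mult_left_le_one_le)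
  have Uc_m: "(\<lambda>x. indicator (cball 0 r) x *\<^sub>R U n x) \<in> borel_measurable borel" for r n by measurable
  have Uc_le: "norm (indicator (cball 0 r) x *\<^sub>R U n x) \<le> indicator (cball 0 r) x * norm (U n x)" for r n x by simp
  have mid: "Tc \<longlonglongrightarrow> T0c"
  proof -
    have "(\<lambda>n. \<integral>\<xi>. U n \<xi> * (\<integral>\<eta>. Vc n \<eta> * G ((\<xi>, \<sigma> n \<xi>) + (\<eta>, \<sigma> n \<eta>)) \<partial>lborel) \<partial>lborel)
      \<longlonglongrightarrow> (\<integral>P. cell_ind P *\<^sub>R (U0 P * (\<integral>Q. cell_ind Q *\<^sub>R (V0c Q * G (P + Q)) \<partial>lborel)) \<partial>lborel)"
    proof (rule pairing_compact(2)[OF G \<sigma>_add \<sigma> U])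
      show "integrable lborel (\<lambda>x. indicator (cball 0 r) x *\<^sub>R U n x)" for n r
        by (rule local_L1_bound(1)[OF U pqm(1) AB(1) A Uc_le Uc_m])
      show "\<exists>C. \<forall>n. (\<integral>x. norm (indicator (cball 0 r) x *\<^sub>R U n x) \<partial>lborel) \<le> C" for r
        using local_L1_bound(2)[OF U pqm(1) AB(1) A Uc_le Uc_m] by blast
      show "integrable lborel (Vc n)" for n
        by (rule local_L1_bound(1)[OF V pqm(2) AB(2) B Vc_le Vc])
      show "(\<integral>x. norm (Vc n x) \<partial>lborel) \<le> measure lborel (cball (0::'b) (\<rho> + 1)) + B" for n
        by (rule local_L1_bound(2)[OF V pqm(2) AB(2) B Vc_le Vc])
      show "Vc n x = 0" if "\<rho> + 1 < norm x" for n x using that by (simp add: Vc_def cutoff_zero)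
      show "(\<lambda>n. \<integral>x. U n x * H (x, \<sigma> n x) \<partial>lborel) \<longlonglongrightarrow> (\<integral>P. cell_ind P *\<^sub>R (U0 P * H P) \<partial>lborel)" if "test_fun H" for H
        by (rule weakU[OF that])
      show "(\<lambda>n. \<integral>x. Vc n x * H (x, \<sigma> n x) \<partial>lborel) \<longlonglongrightarrow> (\<integral>P. cell_ind P *\<^sub>R (V0c P * H P) \<partial>lborel)" if "test_fun H" for H
        using weakV[OF test_fun_cutoff[OF that, of \<rho>]] by (simp add: Vc_def V0c_def)
    qed
    then show ?thesis
      unfolding Tc_def T0c_def
      by (simp only: sconv_pairing(1)[OF G \<sigma>_add \<sigma> U Vc pqm AB A Bc] pconv_pairing(1)[OF G U0 V0c perc pqm AB A0 B0c])
  qed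
  have "eventually (\<lambda>n. norm (Tc n - T0c) < \<epsilon> / 4) sequentially"
    using tendstoD[OF mid, of "\<epsilon> / 4"] \<epsilon> by (simp add: dist_norm)
  with en have "eventually (\<lambda>n. dist (T n) T0 < \<epsilon>) sequentially"
  proof (rule eventually_elim2)
    fix n assume n: "norm (T n - Tc n) \<le> \<epsilon> / 4" "norm (Tc n - T0c) < \<epsilon> / 4"
    have "norm (T n - T0) \<le> norm (T n - Tc n) + norm (Tc n - T0)"
      using norm_triangle_ineq[of "T n - Tc n" "Tc n - T0"] by simp
    moreover have "norm (Tc n - T0) \<le> norm (Tc n - T0c) + norm (T0 - T0c)"
      using norm_triangle_ineq4[of "Tc n - T0c" "T0 - T0c"] by simp
    ultimately show "dist (T n) T0 < \<epsilon>" using n e0 \<epsilon> unfolding dist_norm by linarith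
  qed
  then show "eventually (\<lambda>n. dist (\<integral>x. sconv (U n) (V n) x * G (x, \<sigma> n x) \<partial>lborel) (\<integral>P. cell_ind P *\<^sub>R (pconv U0 V0 P * G P) \<partial>lborel) < \<epsilon>) sequentially"
    by (simp only: T_def T0_def)
qed

section \<open>General test functions\<close>

text \<open>
  Phrased with weights that tend to zero, the condition excludes both concentration on small sets
  and escape of mass to infinity, and it is directly applicable to errors of approximation.
\<close>

definition uniformly_integrable :: "(nat \<Rightarrow> 'b::euclidean_space \<Rightarrow> 'a::{real_normed_field, euclidean_space}) \<Rightarrow> bool" where
  "uniformly_integrable F \<longleftrightarrow> (\<forall>\<phi> C. (\<forall>j::nat. \<phi> j \<in> borel_measurable borel) \<longrightarrow> (\<forall>j x. 0 \<le> \<phi> j x \<and> \<phi> j x \<le> C) \<longrightarrow>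
     (AE x in lborel. (\<lambda>j. \<phi> j x) \<longlonglongrightarrow> 0) \<longrightarrow>
     (\<forall>\<delta>>0. \<exists>J. \<forall>j\<ge>J. \<forall>n. (\<integral>x. norm (F n x) * \<phi> j x \<partial>lborel) < (\<delta>::real)))"

text \<open>
  The nonnegative elements of \<open>L\<^bsup>m'\<^esup>\<close>, where \<open>m'\<close> is the conjugate exponent of \<open>m\<close>; for \<open>m = 1\<close> they are
  the bounded functions.
\<close>

definition admissible :: "real \<Rightarrow> ('b::euclidean_space \<Rightarrow> real) \<Rightarrow> bool" where
  "admissible m g \<longleftrightarrow> g \<in> borel_measurable borel \<and> (\<forall>x. 0 \<le> g x) \<and>
     (if m = 1 then \<exists>C. \<forall>x. g x \<le> C else integrable lborel (\<lambda>x. g x powr (1 / (1 - 1 / m))))"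

text \<open>
  Young's inequality with a parameter, which makes the contribution of \<open>a\<^sup>m\<close> small.
\<close>

lemma young_scaled:
  fixes a b t m :: real
  assumes "0 \<le> a" "0 \<le> b" "0 < t" "1 < m"
  shows "a * b \<le> t * a powr m + t powr (- (1 / (m - 1))) * b powr (1 / (1 - 1 / m))"
proof (cases "b \<le> t * a powr (m - 1)")
  case True
  show ?thesis
  proof (cases "a = 0")
    case False
    then have "a * b \<le> a * (t * a powr (m - 1))" using True assms by (intro mult_left_mono) auto
    also have "\<dots> = t * (a powr 1 * a powr (m - 1))" using assms False by simp
    also have "a powr 1 * a powr (m - 1) = a powr m" by (simp only: powr_add[symmetric]) simp
    finally show ?thesis by (smt (verit) mult_nonneg_nonneg powr_ge_zero)
  qed (use assms in simp)
next
  case False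
  then have b: "0 < b" using assms by (smt (verit) mult_nonneg_nonneg powr_ge_zero)
  have ex: "1 / (1 - 1 / m) = 1 + 1 / (m - 1)" using assms by (simp add: field_simps)
  have "a powr (m - 1) \<le> b / t" using False assms by (simp add: field_simps)
  then have "(a powr (m - 1)) powr (1 / (m - 1)) \<le> (b / t) powr (1 / (m - 1))"
    using assms by (intro powr_mono2) auto
  moreover have "(a powr (m - 1)) powr (1 / (m - 1)) = a" using assms by (simp add: powr_powr)
  ultimately have "a \<le> (b / t) powr (1 / (m - 1))" by simp
  then have "a * b \<le> (b / t) powr (1 / (m - 1)) * b" using assms by (intro mult_right_mono) auto
  also have "(b / t) powr (1 / (m - 1)) = b powr (1 / (m - 1)) * t powr (- (1 / (m - 1)))"
    using b assms by (simp add: powr_divide powr_minus_divide)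
  also have "b powr (1 / (m - 1)) * t powr (- (1 / (m - 1))) * b = t powr (- (1 / (m - 1))) * (b powr 1 * b powr (1 / (m - 1)))"
    using b by simp
  also have "b powr 1 * b powr (1 / (m - 1)) = b powr (1 / (1 - 1 / m))"
    unfolding ex by (simp only: powr_add)
  finally show ?thesis using assms by (smt (verit) mult_nonneg_nonneg powr_ge_zero)
qed

text \<open>
  Both cases are instances of \<open>kernel_young\<close>. Where the integral defining a convolution does not exist
  its value is 0, which does not spoil the estimate.
\<close>

lemma sconv_Lm:
  fixes U V :: "'b::euclidean_space \<Rightarrow> 'a::{real_normed_field, euclidean_space}"
  assumes U[measurable]: "U \<in> borel_measurable borel" and V[measurable]: "V \<in> borel_measurable borel"
    and pqm: "p \<ge> 1" "q \<ge> 1" "m \<ge> 1" "1 / p + 1 / q = 1 + 1 / m" and AB: "0 \<le> A" "0 \<le> B"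
    and A: "(\<integral>\<^sup>+y. norm (U y) powr p \<partial>lborel) \<le> ennreal A" and B: "(\<integral>\<^sup>+y. norm (V y) powr q \<partial>lborel) \<le> ennreal B"
  shows "sconv U V \<in> borel_measurable borel" and "integrable lborel (\<lambda>x. norm (sconv U V x) powr m)"
    and "(\<integral>x. norm (sconv U V x) powr m \<partial>lborel) \<le> A * B * (1 + A + B) powr m"
proof -
  note k = sconv_kernel[OF V B]
  have un: "(\<lambda>y. norm (U y)) \<in> borel_measurable lborel" and kn: "case_prod (\<lambda>x y. norm (V (x - y))) \<in> borel_measurable (lborel \<Otimes>\<^sub>M lborel)"
    by measurable
  note Y = kernel_young[where f = "\<lambda>y. norm (U y)" and k = "\<lambda>x y. norm (V (x - y))",
      OF sigma_finite_lborel un kn norm_ge_zero norm_ge_zero pqm AB A k(2) k(3)]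
  define J where "J x = (\<integral>y. norm (U y) * norm (V (x - y)) \<partial>lborel)" for x
  have m: "sconv U V \<in> borel_measurable lborel" unfolding sconv_def[abs_def] by measurable
  then show m': "sconv U V \<in> borel_measurable borel" by simp
  have le: "norm (sconv U V x) powr m \<le> J x powr m" for x
  proof (rule powr_mono2)
    show "norm (sconv U V x) \<le> J x"
      unfolding sconv_def J_def norm_mult[symmetric] by (rule integral_norm_bound)
  qed (use pqm in auto)
  have Jint: "integrable lborel (\<lambda>x. J x powr m)" unfolding J_def by (rule Y(2))
  show int: "integrable lborel (\<lambda>x. norm (sconv U V x) powr m)"
    by (rule Bochner_Integration.integrable_bound[OF Jint]) (use m' le in auto)
  have "(\<integral>x. norm (sconv U V x) powr m \<partial>lborel) \<le> (\<integral>x. J x powr m \<partial>lborel)"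
    by (rule Bochner_Integration.integral_mono[OF int Jint le])
  also have "\<dots> \<le> A * B * (1 + A + B) powr m" unfolding J_def by (rule Y(3))
  finally show "(\<integral>x. norm (sconv U V x) powr m \<partial>lborel) \<le> A * B * (1 + A + B) powr m" .
qed

lemma pconv_Lm:
  fixes U V :: "'b::euclidean_space \<times> 'c::euclidean_space \<Rightarrow> 'a::{real_normed_field, euclidean_space}"
  assumes U[measurable]: "U \<in> borel_measurable borel" and V[measurable]: "V \<in> borel_measurable borel"
    and per: "\<And>x. periodic (\<lambda>w. V (x, w))"
    and pqm: "p \<ge> 1" "q \<ge> 1" "m \<ge> 1" "1 / p + 1 / q = 1 + 1 / m" and AB: "0 \<le> A" "0 \<le> B"
    and A: "(\<integral>\<^sup>+P. ennreal (cell_ind P) * ennreal (norm (U P) powr p) \<partial>lborel) \<le> ennreal A"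
    and B: "(\<integral>\<^sup>+P. ennreal (cell_ind P) * ennreal (norm (V P) powr q) \<partial>lborel) \<le> ennreal B"
  shows "pconv U V \<in> borel_measurable borel" and "integrable lborel (\<lambda>P. cell_ind P * norm (pconv U V P) powr m)"
proof -
  have q0: "0 < q" and p0: "0 < p" using pqm by auto
  define K where "K P Q = cell_ind P *\<^sub>R (cell_ind Q *\<^sub>R V (P - Q))" for P Q
  define u where "u Q = cell_ind Q *\<^sub>R U Q" for Q
  note k = pconv_kernel[OF V per q0 B, folded K_def]
  have un: "(\<lambda>y. norm (u y)) \<in> borel_measurable lborel" unfolding u_def by measurable
  have kn: "case_prod (\<lambda>x y. norm (K x y)) \<in> borel_measurable (lborel \<Otimes>\<^sub>M lborel)"
    using measurable_compose[OF k(1) borel_measurable_norm] by (simp add: split_beta')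
  have A': "(\<integral>\<^sup>+Q. norm (u Q) powr p \<partial>lborel) \<le> ennreal A"
    unfolding u_def norm_cell_ind_powr[OF p0] by (rule A)
  note Y = kernel_young[where f = "\<lambda>y. norm (u y)" and k = "\<lambda>x y. norm (K x y)",
      OF sigma_finite_lborel un kn norm_ge_zero norm_ge_zero pqm AB A' k(2) k(3)]
  define J where "J x = (\<integral>y. norm (u y) * norm (K x y) \<partial>lborel)" for x
  have Jint: "integrable lborel (\<lambda>x. J x powr m)" unfolding J_def by (rule Y(2))
  have d: "(\<lambda>z::('b \<times> 'c) \<times> ('b \<times> 'c). V (fst z - snd z)) \<in> borel_measurable (borel \<Otimes>\<^sub>M borel)"
    by (rule measurable_compose[OF _ V]) measurable
  have "(\<lambda>(P, Q). cell_ind Q *\<^sub>R (U Q * V (P - Q))) \<in> borel_measurable (borel \<Otimes>\<^sub>M lborel)"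
    unfolding split_beta' using d by measurable
  then show m: "pconv U V \<in> borel_measurable borel"
    unfolding pconv_def[abs_def] by (rule lborel.borel_measurable_lebesgue_integral)
  have le: "norm (cell_ind P * norm (pconv U V P) powr m) \<le> norm (J P powr m)" for P
  proof (cases "cell_ind P = 0")
    case False
    then have c: "cell_ind P = 1" using cell_ind_cases[of P] by blast
    have "cell_ind Q *\<^sub>R (U Q * V (P - Q)) = u Q * K P Q" for Q
      using cell_ind_cases[of Q] c by (auto simp: u_def K_def)
    then have "norm (pconv U V P) \<le> J P"
      unfolding pconv_def J_def norm_mult[symmetric] by (simp only: integral_norm_bound)
    then show ?thesis using c pqm by (simp add: powr_mono2)
  qed simp
  show "integrable lborel (\<lambda>P. cell_ind P * norm (pconv U V P) powr m)"
    by (rule Bochner_Integration.integrable_bound[OF Jint]) (use m in measurable, use le in auto)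
qed

text \<open>
  All that the passage to the limit uses: a common bound \<open>A\<close>, \<open>B\<close> for the powers of the norms,
  tightness of \<open>V n\<close>, convergence against continuous test functions, and uniform integrability if
  \<open>m = 1\<close>. The scale map \<open>\<sigma> n\<close> is additive and measurable.
\<close>

locale conv_setting =
  fixes U V :: "nat \<Rightarrow> 'b::euclidean_space \<Rightarrow> 'a::{real_normed_field, euclidean_space}"
    and U0 V0 :: "'b \<times> 'c::euclidean_space \<Rightarrow> 'a" and \<sigma> :: "nat \<Rightarrow> 'b \<Rightarrow> 'c" and p q m A B :: real
  assumes \<sigma>_add: "\<And>n x y. \<sigma> n (x + y) = \<sigma> n x + \<sigma> n y" and \<sigma>[measurable]: "\<And>n. \<sigma> n \<in> borel_measurable borel"
    and U[measurable]: "\<And>n. U n \<in> borel_measurable borel" and V[measurable]: "\<And>n. V n \<in> borel_measurable borel"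
    and U0[measurable]: "U0 \<in> borel_measurable borel" and V0[measurable]: "V0 \<in> borel_measurable borel"
    and per: "\<And>x. periodic (\<lambda>w. V0 (x, w))"
    and pqm: "p \<ge> 1" "q \<ge> 1" "m \<ge> 1" "1 / p + 1 / q = 1 + 1 / m" and AB: "0 \<le> A" "0 \<le> B"
    and A: "\<And>n. (\<integral>\<^sup>+y. norm (U n y) powr p \<partial>lborel) \<le> ennreal A"
    and B: "\<And>n. (\<integral>\<^sup>+y. norm (V n y) powr q \<partial>lborel) \<le> ennreal B"
    and A0: "(\<integral>\<^sup>+P. ennreal (cell_ind P) * ennreal (norm (U0 P) powr p) \<partial>lborel) \<le> ennreal A"
    and B0: "(\<integral>\<^sup>+P. ennreal (cell_ind P) * ennreal (norm (V0 P) powr q) \<partial>lborel) \<le> ennreal B"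
    and tight: "\<And>\<delta>. 0 < \<delta> \<Longrightarrow> \<exists>\<rho>. eventually (\<lambda>n. (\<integral>\<^sup>+x. indicator {x. \<rho> < norm x} x * ennreal (norm (V n x) powr q) \<partial>lborel) \<le> ennreal \<delta>) sequentially"
    and weakU: "\<And>H. test_fun H \<Longrightarrow> (\<lambda>n. \<integral>x. U n x * H (x, \<sigma> n x) \<partial>lborel) \<longlonglongrightarrow> (\<integral>P. cell_ind P *\<^sub>R (U0 P * H P) \<partial>lborel)"
    and weakV: "\<And>H. test_fun H \<Longrightarrow> (\<lambda>n. \<integral>x. V n x * H (x, \<sigma> n x) \<partial>lborel) \<longlonglongrightarrow> (\<integral>P. cell_ind P *\<^sub>R (V0 P * H P) \<partial>lborel)"
    and uiU: "m = 1 \<Longrightarrow> uniformly_integrable U" and uiV: "m = 1 \<Longrightarrow> uniformly_integrable V"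
begin

abbreviation W :: "nat \<Rightarrow> 'b \<Rightarrow> 'a" where "W n \<equiv> sconv (U n) (V n)"

abbreviation W0 :: "'b \<times> 'c \<Rightarrow> 'a" where "W0 \<equiv> pconv U0 V0"

definition passes_to_limit :: "('b \<times> 'c \<Rightarrow> 'a) \<Rightarrow> bool" where
  "passes_to_limit H \<longleftrightarrow> (\<lambda>n. \<integral>x. W n x * H (x, \<sigma> n x) \<partial>lborel) \<longlonglongrightarrow> (\<integral>P. cell_ind P *\<^sub>R (W0 P * H P) \<partial>lborel)"

lemma test_fun_passes: "test_fun G \<Longrightarrow> passes_to_limit G"
  unfolding passes_to_limit_def
  by (rule conv_test[OF _ \<sigma>_add \<sigma> U V U0 V0 per pqm AB A B A0 B0 tight weakU weakV])

lemmas W_meas[measurable] = sconv_Lm(1)[OF U V pqm AB A B]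
lemmas W_int = sconv_Lm(2)[OF U V pqm AB A B]
lemmas W_le = sconv_Lm(3)[OF U V pqm AB A B]
lemmas W0_meas[measurable] = pconv_Lm(1)[OF U0 V0 per pqm AB A0 B0]
lemmas W0_int = pconv_Lm(2)[OF U0 V0 per pqm AB A0 B0]

lemma W_admissible_integrable:
  assumes g: "admissible m g" shows "integrable lborel (\<lambda>x. norm (W n x) * g x)"
proof (cases "m = 1")
  case True
  then obtain C where C: "\<And>x. g x \<le> C" using g by (auto simp: admissible_def)
  have i: "integrable lborel (\<lambda>x. C * norm (W n x))"
    using W_int[of n] True by (intro integrable_mult_right) simp
  have [measurable]: "g \<in> borel_measurable borel" and g0: "\<And>x. 0 \<le> g x" using g by (auto simp: admissible_def)
  show ?thesis
  proof (rule Bochner_Integration.integrable_bound[OF i], measurable, rule AE_I2)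
    fix x
    have "norm (W n x) * g x \<le> norm (W n x) * C" by (intro mult_left_mono C norm_ge_zero)
    also have "\<dots> \<le> \<bar>C * norm (W n x)\<bar>" by (simp add: mult.commute)
    finally show "norm (norm (W n x) * g x) \<le> norm (C * norm (W n x))" using g0[of x] by (simp add: abs_mult)
  qed
next
  case False
  then have m: "1 < m" using pqm by simp
  have gi: "integrable lborel (\<lambda>x. g x powr (1 / (1 - 1 / m)))" and g0: "\<And>x. 0 \<le> g x"
    and [measurable]: "g \<in> borel_measurable borel" using g False by (auto simp: admissible_def)
  have i: "integrable lborel (\<lambda>x. norm (W n x) powr m + g x powr (1 / (1 - 1 / m)))"
    by (intro Bochner_Integration.integrable_add W_int gi)
  show ?thesis
  proof (rule Bochner_Integration.integrable_bound[OF i])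
    show "AE x in lborel. norm (norm (W n x) * g x) \<le> norm (norm (W n x) powr m + g x powr (1 / (1 - 1 / m)))"
      using young_scaled[OF norm_ge_zero g0 _ m, of 1] g0 by (intro AE_I2) (simp add: abs_mult)
  qed measurable
qed

lemma nn_integral_fst_cell:
  fixes f :: "'b \<Rightarrow> ennreal"
  assumes [measurable]: "f \<in> borel_measurable borel"
  shows "(\<integral>\<^sup>+P. ennreal (cell_ind (P :: 'b \<times> 'c)) * f (fst P) \<partial>lborel) = (\<integral>\<^sup>+x. f x \<partial>lborel)"
proof -
  have m: "(\<lambda>P::'b \<times> 'c. ennreal (cell_ind P) * f (fst P)) \<in> borel_measurable borel"
    unfolding borel_prod[symmetric] cell_ind_def by measurable
  have "(\<integral>\<^sup>+w. ennreal (indicator (ucell :: 'c set) w) * f x \<partial>lborel) = f x" for x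
  proof -
    have "(\<integral>\<^sup>+w. ennreal (indicator (ucell :: 'c set) w) * f x \<partial>lborel) = (\<integral>\<^sup>+w. f x * indicator (ucell :: 'c set) w \<partial>lborel)"
      by (rule nn_integral_cong) (simp add: indicator_def)
    also have "\<dots> = f x" by (simp add: nn_integral_cmult_indicator emeasure_ucell)
    finally show ?thesis .
  qed
  then show ?thesis by (simp add: nn_integral_lborel_prod[OF m] cell_ind_pair)
qed

lemma W0_admissible_integrable:
  assumes g: "admissible m g" shows "integrable lborel (\<lambda>P. cell_ind P * (norm (W0 P) * g (fst P)))"
proof -
  have [measurable]: "g \<in> borel_measurable borel" and g0: "\<And>x. 0 \<le> g x" using g by (auto simp: admissible_def)
  have gm: "(\<lambda>P::'b \<times> 'c. g (fst P)) \<in> borel_measurable borel" unfolding borel_prod[symmetric] by measurable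
  have meas: "(\<lambda>P. cell_ind P * (norm (W0 P) * g (fst P))) \<in> borel_measurable lborel"
    using gm by measurable
  show ?thesis
  proof (cases "m = 1")
    case True
    then obtain C where C: "\<And>x. g x \<le> C" using g by (auto simp: admissible_def)
    have i: "integrable lborel (\<lambda>P. C * (cell_ind P * norm (W0 P)))"
      using W0_int True by (intro integrable_mult_right) simp
    show ?thesis
    proof (rule Bochner_Integration.integrable_bound[OF i meas], rule AE_I2)
      fix P
      have "norm (W0 P) * g (fst P) \<le> norm (W0 P) * C" by (intro mult_left_mono C norm_ge_zero)
      then have "cell_ind P * (norm (W0 P) * g (fst P)) \<le> cell_ind P * (norm (W0 P) * C)"
        by (rule mult_left_mono[OF _ cell_ind_nonneg])
      moreover have "0 \<le> cell_ind P * (norm (W0 P) * g (fst P))"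
        by (intro mult_nonneg_nonneg cell_ind_nonneg norm_ge_zero g0)
      ultimately show "norm (cell_ind P * (norm (W0 P) * g (fst P))) \<le> norm (C * (cell_ind P * norm (W0 P)))"
        by (simp add: mult_ac)
    qed
  next
    case False
    then have m: "1 < m" using pqm by simp
    have gi: "integrable lborel (\<lambda>x. g x powr (1 / (1 - 1 / m)))" using g False by (auto simp: admissible_def)
    have "integrable lborel (\<lambda>P :: 'b \<times> 'c. cell_ind P * g (fst P) powr (1 / (1 - 1 / m)))"
    proof (rule integrableI_bounded)
      show "(\<lambda>P :: 'b \<times> 'c. cell_ind P * g (fst P) powr (1 / (1 - 1 / m))) \<in> borel_measurable lborel"
        by (intro borel_measurable_times powr_real_measurable borel_measurable_const) (simp_all add: gm measurable_cell_ind)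
      have "(\<integral>\<^sup>+P. norm (cell_ind (P :: 'b \<times> 'c) * g (fst P) powr (1 / (1 - 1 / m))) \<partial>lborel)
          = (\<integral>\<^sup>+P. ennreal (cell_ind (P :: 'b \<times> 'c)) * ennreal (g (fst P) powr (1 / (1 - 1 / m))) \<partial>lborel)"
        by (rule nn_integral_cong) (simp add: abs_mult cell_ind_nonneg ennreal_mult)
      also have "\<dots> = (\<integral>\<^sup>+x. ennreal (g x powr (1 / (1 - 1 / m))) \<partial>lborel)"
        by (rule nn_integral_fst_cell) measurable
      also have "\<dots> < \<infinity>" using gi by (simp add: nn_integral_eq_integral)
      finally show "(\<integral>\<^sup>+P. norm (cell_ind (P :: 'b \<times> 'c) * g (fst P) powr (1 / (1 - 1 / m))) \<partial>lborel) < \<infinity>" .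
    qed
    then have i: "integrable lborel (\<lambda>P. cell_ind P * norm (W0 P) powr m + cell_ind P * g (fst P) powr (1 / (1 - 1 / m)))"
      by (intro Bochner_Integration.integrable_add W0_int)
    show ?thesis
    proof (rule Bochner_Integration.integrable_bound[OF i meas], rule AE_I2)
      fix P
      have "norm (W0 P) * g (fst P) \<le> norm (W0 P) powr m + g (fst P) powr (1 / (1 - 1 / m))"
        using young_scaled[OF norm_ge_zero g0 _ m, of 1] by simp
      then have "cell_ind P * (norm (W0 P) * g (fst P)) \<le> cell_ind P * (norm (W0 P) powr m + g (fst P) powr (1 / (1 - 1 / m)))"
        by (rule mult_left_mono[OF _ cell_ind_nonneg])
      moreover have "0 \<le> cell_ind P * (norm (W0 P) * g (fst P))"
        by (intro mult_nonneg_nonneg cell_ind_nonneg norm_ge_zero g0)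
      ultimately show "norm (cell_ind P * (norm (W0 P) * g (fst P)))
          \<le> norm (cell_ind P * norm (W0 P) powr m + cell_ind P * g (fst P) powr (1 / (1 - 1 / m)))"
        by (simp add: distrib_left)
    qed
  qed
qed

text \<open>
  The contributions of the \<open>W n\<close> against weights that tend to zero are uniformly small: for
  \<open>m > 1\<close> because the \<open>W n\<close> are bounded in \<open>L\<^sup>m\<close>, for \<open>m = 1\<close> because uniform integrability
  of \<open>U n\<close> and \<open>V n\<close> is passed on to their convolutions. In the latter case \<open>\<Phi> j\<close> collects the
  worst contribution of the \<open>V n\<close> and is itself a sequence of weights for the \<open>U n\<close>.
\<close>

lemma W_uniformly_small:
  assumes g: "admissible m g" and h[measurable]: "\<And>j::nat. h j \<in> borel_measurable borel"
    and h0: "\<And>j x. 0 \<le> h j x" and hg: "\<And>j x. h j x \<le> g x"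
    and lim: "AE x in lborel. (\<lambda>j. h j x) \<longlonglongrightarrow> 0" and \<delta>: "0 < \<delta>"
  shows "\<exists>J. \<forall>j\<ge>J. \<forall>n. (\<integral>x. norm (W n x) * h j x \<partial>lborel) < \<delta>"
proof (cases "m = 1")
  case False
  then have m: "1 < m" using pqm by simp
  define m' where "m' = 1 / (1 - 1 / m)"
  have m'0: "0 < m'" using m by (simp add: m'_def)
  have gi: "integrable lborel (\<lambda>x. g x powr m')" and g0: "\<And>x. 0 \<le> g x"
    and [measurable]: "g \<in> borel_measurable borel" using g False by (auto simp: admissible_def m'_def)
  define M where "M = A * B * (1 + A + B) powr m"
  have M0: "0 \<le> M" using AB by (simp add: M_def)
  define t where "t = \<delta> / 2 / (M + 1)"
  have t: "0 < t" using \<delta> M0 by (simp add: t_def)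
  have tt: "t * (M + 1) = \<delta> / 2" by (rule iffD1[OF nonzero_eq_divide_eq t_def]) (use M0 in simp)
  have tM: "t * M < \<delta> / 2" using tt t by (simp add: algebra_simps)
  have hi: "integrable lborel (\<lambda>x. h j x powr m')" for j
    by (rule Bochner_Integration.integrable_bound[OF gi]) (use h0 hg m'0 in \<open>auto intro!: powr_mono2\<close>)
  have "(\<lambda>j. \<integral>x. h j x powr m' \<partial>lborel) \<longlonglongrightarrow> (\<integral>x. 0 \<partial>(lborel :: 'b measure))"
  proof (rule integral_dominated_convergence[where w = "\<lambda>x. g x powr m'"])
    show "AE x in lborel. (\<lambda>j. h j x powr m') \<longlonglongrightarrow> 0"
      using lim
    proof eventually_elim
      fix x assume "(\<lambda>j. h j x) \<longlonglongrightarrow> 0"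
      then have "(\<lambda>j. h j x powr m') \<longlonglongrightarrow> 0 powr m'" by (rule tendsto_powr') (use m'0 h0 in auto)
      then show "(\<lambda>j. h j x powr m') \<longlonglongrightarrow> 0" by simp
    qed
    show "AE x in lborel. norm (h j x powr m') \<le> g x powr m'" for j
      using h0 hg m'0 by (intro AE_I2) (auto intro!: powr_mono2)
  qed (use gi in auto)
  then have "(\<lambda>j. t powr (- (1 / (m - 1))) * (\<integral>x. h j x powr m' \<partial>lborel)) \<longlonglongrightarrow> t powr (- (1 / (m - 1))) * 0"
    by (intro tendsto_mult tendsto_const) simp
  then have "eventually (\<lambda>j. t powr (- (1 / (m - 1))) * (\<integral>x. h j x powr m' \<partial>lborel) < \<delta> / 2) sequentially"
    using \<delta> by (intro order_tendstoD(2)) auto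
  then obtain J where J: "\<And>j. J \<le> j \<Longrightarrow> t powr (- (1 / (m - 1))) * (\<integral>x. h j x powr m' \<partial>lborel) < \<delta> / 2"
    by (auto simp: eventually_sequentially)
  have "(\<integral>x. norm (W n x) * h j x \<partial>lborel) < \<delta>" if j: "J \<le> j" for j n
  proof -
    have adm: "admissible m (h j)" using h h0 hi[of j] False by (simp add: admissible_def m'_def)
    have "(\<integral>x. norm (W n x) * h j x \<partial>lborel) \<le> (\<integral>x. t * norm (W n x) powr m + t powr (- (1 / (m - 1))) * h j x powr m' \<partial>lborel)"
      unfolding m'_def
      by (intro Bochner_Integration.integral_mono W_admissible_integrable[OF adm] Bochner_Integration.integrable_add
          integrable_mult_right W_int hi[unfolded m'_def] young_scaled norm_ge_zero h0 t m)
    also have "\<dots> = t * (\<integral>x. norm (W n x) powr m \<partial>lborel) + t powr (- (1 / (m - 1))) * (\<integral>x. h j x powr m' \<partial>lborel)"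
      using W_int hi by simp
    also have "\<dots> \<le> t * M + t powr (- (1 / (m - 1))) * (\<integral>x. h j x powr m' \<partial>lborel)"
      using W_le[of n] t by (intro add_right_mono mult_left_mono) (auto simp: M_def)
    also have "\<dots> < \<delta>" using tM J[OF j] by linarith
    finally show ?thesis .
  qed
  then show ?thesis by blast
next
  case True
  then obtain C where C: "\<And>x. g x \<le> C" using g by (auto simp: admissible_def)
  have hC: "h j x \<le> C" for j x using hg C order_trans by blast
  have C0: "0 \<le> C" using h0[of 0 0] hC[of 0 0] by linarith
  have pq1: "p = 1" "q = 1"
  proof -
    have "1 / p \<le> 1" "1 / q \<le> 1" "1 / p + 1 / q = 2" using pqm True by auto
    then have "1 / p = 1" "1 / q = 1" by linarith+
    then show "p = 1" "q = 1" by auto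
  qed
  have UI: "\<exists>J. \<forall>j\<ge>J. \<forall>n. (\<integral>x. norm (F n x) * \<phi> j x \<partial>lborel) < \<delta>'"
    if "uniformly_integrable F" "\<And>j::nat. \<phi> j \<in> borel_measurable borel" "\<And>j x. 0 \<le> \<phi> j x" "\<And>j x. \<phi> j x \<le> C'"
      "AE x in lborel. (\<lambda>j. \<phi> j x) \<longlonglongrightarrow> 0" "0 < \<delta>'" for F :: "nat \<Rightarrow> 'b \<Rightarrow> 'a" and \<phi> and C' \<delta>' :: real
    using that unfolding uniformly_integrable_def by blast
  have B': "(\<integral>\<^sup>+y. norm (V n y) \<partial>lborel) \<le> ennreal B" for n using B[of n] pq1 by simp
  have A': "(\<integral>\<^sup>+y. norm (U n y) \<partial>lborel) \<le> ennreal A" for n using A[of n] pq1 by simp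
  have Vi: "integrable lborel (V n)" for n
    by (rule integrableI_bounded) (use B'[of n] in \<open>auto intro: order_le_less_trans[OF _ ennreal_less_top]\<close>)
  have Ui: "integrable lborel (U n)" for n
    by (rule integrableI_bounded) (use A'[of n] in \<open>auto intro: order_le_less_trans[OF _ ennreal_less_top]\<close>)
  define I where "I j n \<xi> = (\<integral>\<^sup>+x. ennreal (norm (V n (x - \<xi>)) * h j x) \<partial>lborel)" for j n \<xi>
  have I_m[measurable]: "I j n \<in> borel_measurable borel" for j n unfolding I_def[abs_def] by measurable
  have I_shift: "I j n \<xi> = (\<integral>\<^sup>+y. ennreal (norm (V n y) * h j (\<xi> + y)) \<partial>lborel)" for j n \<xi>
    using nn_integral_lborel_shift[of "\<lambda>x. ennreal (norm (V n (x - \<xi>)) * h j x)" \<xi>] by (simp add: I_def add.commute)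
  have I_le: "I j n \<xi> \<le> ennreal (C * B)" for j n \<xi>
  proof -
    have "I j n \<xi> \<le> (\<integral>\<^sup>+y. ennreal C * ennreal (norm (V n y)) \<partial>lborel)"
      unfolding I_shift
    proof (rule nn_integral_mono)
      fix y
      have "norm (V n y) * h j (\<xi> + y) \<le> C * norm (V n y)" using hC by (subst mult.commute) (intro mult_right_mono, auto)
      then show "ennreal (norm (V n y) * h j (\<xi> + y)) \<le> ennreal C * ennreal (norm (V n y))"
        using C0 by (simp add: ennreal_leI flip: ennreal_mult)
    qed
    also have "\<dots> = ennreal C * (\<integral>\<^sup>+y. norm (V n y) \<partial>lborel)" by (rule nn_integral_cmult) measurable
    also have "\<dots> \<le> ennreal C * ennreal B" by (intro mult_left_mono B') simp
    finally show ?thesis using C0 AB by (simp add: ennreal_mult)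
  qed
  have I_int: "I j n \<xi> = ennreal (\<integral>y. norm (V n y) * h j (\<xi> + y) \<partial>lborel)" for j n \<xi>
    unfolding I_shift
  proof (rule nn_integral_eq_integral)
    show "integrable lborel (\<lambda>y. norm (V n y) * h j (\<xi> + y))"
    proof (rule Bochner_Integration.integrable_bound[OF integrable_mult_right[OF integrable_norm[OF Vi[of n]], of C]])
      show "AE y in lborel. norm (norm (V n y) * h j (\<xi> + y)) \<le> norm (C * norm (V n y))"
      proof (rule AE_I2)
        fix y
        have "norm (V n y) * h j (\<xi> + y) \<le> norm (V n y) * C" by (intro mult_left_mono hC norm_ge_zero)
        then show "norm (norm (V n y) * h j (\<xi> + y)) \<le> norm (C * norm (V n y))"
          using h0[of j "\<xi> + y"] C0 by (simp add: abs_mult mult.commute)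
      qed
    qed measurable
  qed (use h0 in auto)
  define \<Phi> where "\<Phi> j \<xi> = enn2real (SUP n. I j n \<xi>)" for j \<xi>
  have \<Phi>m: "\<Phi> j \<in> borel_measurable borel" for j unfolding \<Phi>_def[abs_def] by measurable
  have S_le: "(SUP n. I j n \<xi>) \<le> ennreal (C * B)" for j \<xi> by (intro SUP_least I_le)
  have CB: "0 \<le> C * B" using C0 AB by simp
  have \<Phi>0: "0 \<le> \<Phi> j \<xi>" and \<Phi>C: "\<Phi> j \<xi> \<le> C * B" for j \<xi>
    unfolding \<Phi>_def using S_le[of j \<xi>] CB by (auto intro: enn2real_leI)
  have I_\<Phi>: "I j n \<xi> \<le> ennreal (\<Phi> j \<xi>)" for j n \<xi>
  proof -
    have "(SUP n. I j n \<xi>) < top" using S_le[of j \<xi>] by (rule order_le_less_trans) simp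
    then have "ennreal (\<Phi> j \<xi>) = (SUP n. I j n \<xi>)" unfolding \<Phi>_def by (rule ennreal_enn2real)
    then show ?thesis by (simp only:) (rule SUP_upper, simp)
  qed
  have \<Phi>lim: "(\<lambda>j. \<Phi> j \<xi>) \<longlonglongrightarrow> 0" for \<xi>
  proof (rule tendstoI)
    fix \<epsilon> :: real assume \<epsilon>: "0 < \<epsilon>"
    have ae: "AE y in lborel. (\<lambda>j. h j (\<xi> + y)) \<longlonglongrightarrow> 0"
    proof -
      obtain N where N: "N \<in> null_sets lborel" "\<And>x. x \<in> space lborel - N \<Longrightarrow> (\<lambda>j. h j x) \<longlonglongrightarrow> 0"
        using lim by (auto elim!: AE_E3)
      have "(\<integral>\<^sup>+y. indicator N (y + \<xi>) \<partial>lborel) = (\<integral>\<^sup>+y. indicator N y \<partial>lborel)"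
        using N(1) by (intro nn_integral_lborel_shift) auto
      also have "\<dots> = 0" using N(1) by (subst nn_integral_indicator) auto
      finally have "AE y in lborel. indicator N (y + \<xi>) = (0::ennreal)"
        using N(1) by (subst (asm) nn_integral_0_iff_AE) auto
      then show ?thesis
      proof eventually_elim
        fix y assume "indicator N (y + \<xi>) = (0::ennreal)"
        then have "\<xi> + y \<notin> N" by (auto simp: indicator_def add.commute split: if_splits)
        then show "(\<lambda>j. h j (\<xi> + y)) \<longlonglongrightarrow> 0" by (intro N(2)) simp
      qed
    qed
    have "\<exists>J. \<forall>j\<ge>J. \<forall>n. (\<integral>y. norm (V n y) * h j (\<xi> + y) \<partial>lborel) < \<epsilon> / 2"
    proof (rule UI[OF uiV[OF True], where C' = C])
      show "(\<lambda>y. h j (\<xi> + y)) \<in> borel_measurable borel" for j by measurable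
    qed (use h0 hC ae \<epsilon> in simp_all)
    then obtain J where J: "\<And>j n. J \<le> j \<Longrightarrow> (\<integral>y. norm (V n y) * h j (\<xi> + y) \<partial>lborel) < \<epsilon> / 2"
      by blast
    show "eventually (\<lambda>j. dist (\<Phi> j \<xi>) 0 < \<epsilon>) sequentially"
    proof (rule eventually_sequentiallyI[of J])
      fix j assume "J \<le> j"
      then have "(SUP n. I j n \<xi>) \<le> ennreal (\<epsilon> / 2)"
        unfolding I_int using J by (intro SUP_least ennreal_leI less_imp_le) auto
      then have "\<Phi> j \<xi> \<le> \<epsilon> / 2" unfolding \<Phi>_def using \<epsilon> by (intro enn2real_leI) auto
      then show "dist (\<Phi> j \<xi>) 0 < \<epsilon>" using \<Phi>0[of j \<xi>] \<epsilon> by simp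
    qed
  qed
  have "\<exists>J. \<forall>j\<ge>J. \<forall>n. (\<integral>x. norm (U n x) * \<Phi> j x \<partial>lborel) < \<delta>"
    by (rule UI[OF uiU[OF True] \<Phi>m \<Phi>0 \<Phi>C _ \<delta>]) (simp add: \<Phi>lim)
  then obtain J where J: "\<And>j n. J \<le> j \<Longrightarrow> (\<integral>x. norm (U n x) * \<Phi> j x \<partial>lborel) < \<delta>" by blast
  have "(\<integral>x. norm (W n x) * h j x \<partial>lborel) < \<delta>" if j: "J \<le> j" for j n
  proof -
    have i\<Phi>: "integrable lborel (\<lambda>x. norm (U n x) * \<Phi> j x)"
    proof (rule Bochner_Integration.integrable_bound[OF integrable_mult_right[OF integrable_norm[OF Ui[of n]], of "C * B"]])
      show "AE y in lborel. norm (norm (U n y) * \<Phi> j y) \<le> norm (C * B * norm (U n y))"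
      proof (rule AE_I2)
        fix y
        have "norm (U n y) * \<Phi> j y \<le> norm (U n y) * (C * B)" by (intro mult_left_mono \<Phi>C norm_ge_zero)
        moreover have "0 \<le> norm (U n y) * \<Phi> j y" "0 \<le> C * B * norm (U n y)"
          by (rule mult_nonneg_nonneg[OF norm_ge_zero \<Phi>0], rule mult_nonneg_nonneg[OF CB norm_ge_zero])
        ultimately show "norm (norm (U n y) * \<Phi> j y) \<le> norm (C * B * norm (U n y))"
          by (simp only: real_norm_def abs_of_nonneg mult.commute[of "C * B"])
      qed
    qed (use \<Phi>m in measurable)
    have adm: "admissible m (h j)" using h h0 hC True unfolding admissible_def by (simp, intro exI[of _ C] allI)
    have wi: "integrable lborel (\<lambda>x. norm (W n x) * h j x)" by (rule W_admissible_integrable[OF adm])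
    have "ennreal (\<integral>x. norm (W n x) * h j x \<partial>lborel) = (\<integral>\<^sup>+x. ennreal (norm (W n x) * h j x) \<partial>lborel)"
      by (rule nn_integral_eq_integral[symmetric, OF wi]) (use h0 in auto)
    also have "\<dots> \<le> (\<integral>\<^sup>+x. (\<integral>\<^sup>+y. ennreal (norm (U n y)) * ennreal (norm (V n (x - y)) * h j x) \<partial>lborel) \<partial>lborel)"
    proof (rule nn_integral_mono)
      fix x
      have "ennreal (norm (W n x)) \<le> (\<integral>\<^sup>+y. norm (U n y * V n (x - y)) \<partial>lborel)"
        unfolding sconv_def
        by (cases "integrable lborel (\<lambda>y. U n y * V n (x - y))")
          (auto simp: integral_norm_bound_ennreal not_integrable_integral_eq)
      then have "ennreal (norm (W n x)) * ennreal (h j x) \<le> (\<integral>\<^sup>+y. norm (U n y * V n (x - y)) \<partial>lborel) * ennreal (h j x)"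
        by (rule mult_right_mono) simp
      also have "\<dots> = (\<integral>\<^sup>+y. ennreal (norm (U n y * V n (x - y))) * ennreal (h j x) \<partial>lborel)"
        by (rule nn_integral_multc[symmetric]) measurable
      finally show "ennreal (norm (W n x) * h j x) \<le> (\<integral>\<^sup>+y. ennreal (norm (U n y)) * ennreal (norm (V n (x - y)) * h j x) \<partial>lborel)"
        using h0 by (simp add: norm_mult ennreal_mult mult.assoc)
    qed
    also have "\<dots> = (\<integral>\<^sup>+y. (\<integral>\<^sup>+x. ennreal (norm (U n y)) * ennreal (norm (V n (x - y)) * h j x) \<partial>lborel) \<partial>lborel)"
      by (rule lborel_pair.Fubini') measurable
    also have "\<dots> = (\<integral>\<^sup>+y. ennreal (norm (U n y)) * I j n y \<partial>lborel)"
      unfolding I_def by (intro nn_integral_cong nn_integral_cmult) measurable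
    also have "\<dots> \<le> (\<integral>\<^sup>+y. ennreal (norm (U n y) * \<Phi> j y) \<partial>lborel)"
      using \<Phi>0 by (intro nn_integral_mono) (simp add: ennreal_mult mult_left_mono I_\<Phi>)
    also have "\<dots> = ennreal (\<integral>y. norm (U n y) * \<Phi> j y \<partial>lborel)"
      by (rule nn_integral_eq_integral[OF i\<Phi>]) (use \<Phi>0 in auto)
    finally have "(\<integral>x. norm (W n x) * h j x \<partial>lborel) \<le> (\<integral>y. norm (U n y) * \<Phi> j y \<partial>lborel)"
      using \<Phi>0 by (subst (asm) ennreal_le_iff) (auto intro!: Bochner_Integration.integral_nonneg)
    also have "\<dots> < \<delta>" by (rule J[OF j])
    finally show ?thesis .
  qed
  then show ?thesis by blast
qed

end

lemma AE_fst_lborel: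
  assumes "AE x in lborel. Q x"
  shows "AE P in (lborel :: ('b::euclidean_space \<times> 'c::euclidean_space) measure). Q (fst P)"
proof -
  obtain N where N: "N \<in> null_sets lborel" "\<And>x. x \<in> space lborel - N \<Longrightarrow> Q x"
    using assms by (auto elim!: AE_E3)
  have "emeasure (lborel \<Otimes>\<^sub>M lborel) (N \<times> (UNIV :: 'c set)) = emeasure lborel N * emeasure lborel (UNIV :: 'c set)"
    using N(1) by (intro lborel.emeasure_pair_measure_Times) auto
  also have "\<dots> = 0" by (simp add: null_setsD1[OF N(1)])
  finally have "emeasure lborel (N \<times> (UNIV :: 'c set)) = 0" by (simp only: lborel_prod)
  moreover have "N \<times> (UNIV :: 'c set) \<in> sets lborel"
  proof -
    have "N \<times> (UNIV :: 'c set) \<in> sets (borel \<Otimes>\<^sub>M borel)" using N(1) by (intro pair_measureI) auto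
    then show ?thesis unfolding borel_prod by simp
  qed
  ultimately have "N \<times> (UNIV :: 'c set) \<in> null_sets lborel" by (rule null_setsI)
  then show ?thesis
  proof (rule AE_I')
    show "{P \<in> space lborel. \<not> Q (fst P)} \<subseteq> N \<times> (UNIV :: 'c set)"
    proof
      fix P :: "'b \<times> 'c" assume "P \<in> {P \<in> space lborel. \<not> Q (fst P)}"
      then have "fst P \<in> N" using N(2)[of "fst P"] by auto
      then show "P \<in> N \<times> (UNIV :: 'c set)" by (simp add: mem_Times_iff)
    qed
  qed
qed

context conv_setting
begin

lemma W_integrable:
  assumes g: "admissible m g" and H: "H \<in> borel_measurable borel" and Hg: "\<And>x w. norm (H (x, w)) \<le> g x"
  shows "integrable lborel (\<lambda>x. W n x * H (x, \<sigma> n x))"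
    and "integrable lborel (\<lambda>P. cell_ind P *\<^sub>R (W0 P * H P))"
proof -
  have g0: "\<And>x. 0 \<le> g x" using g by (auto simp: admissible_def)
  have [measurable]: "(\<lambda>x. H (x, \<sigma> n x)) \<in> borel_measurable borel"
    by (rule test_fun_scale_measurable[OF H \<sigma>])
  show "integrable lborel (\<lambda>x. W n x * H (x, \<sigma> n x))"
  proof (rule Bochner_Integration.integrable_bound[OF W_admissible_integrable[OF g, of n]])
    show "AE x in lborel. norm (W n x * H (x, \<sigma> n x)) \<le> norm (norm (W n x) * g x)"
    proof (rule AE_I2)
      fix x
      have "norm (W n x) * norm (H (x, \<sigma> n x)) \<le> norm (W n x) * g x" by (intro mult_left_mono Hg norm_ge_zero)
      then show "norm (W n x * H (x, \<sigma> n x)) \<le> norm (norm (W n x) * g x)"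
        using g0[of x] by (simp add: norm_mult)
    qed
  qed measurable
  show "integrable lborel (\<lambda>P. cell_ind P *\<^sub>R (W0 P * H P))"
  proof (rule Bochner_Integration.integrable_bound[OF W0_admissible_integrable[OF g]])
    show "(\<lambda>P. cell_ind P *\<^sub>R (W0 P * H P)) \<in> borel_measurable lborel"
      using H by (intro borel_measurable_scaleR borel_measurable_times) simp_all
    show "AE P in lborel. norm (cell_ind P *\<^sub>R (W0 P * H P)) \<le> norm (cell_ind P * (norm (W0 P) * g (fst P)))"
    proof (rule AE_I2)
      fix P :: "'b \<times> 'c"
      have "norm (H P) \<le> g (fst P)" using Hg[of "fst P" "snd P"] by simp
      then have "norm (W0 P) * norm (H P) \<le> norm (W0 P) * g (fst P)" by (intro mult_left_mono norm_ge_zero)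
      then have "cell_ind P * (norm (W0 P) * norm (H P)) \<le> cell_ind P * (norm (W0 P) * g (fst P))"
        by (rule mult_left_mono[OF _ cell_ind_nonneg])
      moreover have "0 \<le> cell_ind P * (norm (W0 P) * g (fst P))"
        by (intro mult_nonneg_nonneg cell_ind_nonneg norm_ge_zero g0)
      ultimately show "norm (cell_ind P *\<^sub>R (W0 P * H P)) \<le> norm (cell_ind P * (norm (W0 P) * g (fst P)))"
        by (simp add: norm_mult cell_ind_nonneg)
    qed
  qed
qed

text \<open>
  Replacing \<open>H\<close> by \<open>Hj j\<close> changes the pairings by at most \<open>\<integral> \<bar>W n\<bar> h\<^sub>j\<close>, which by \<open>W_uniformly_small\<close> is small
  uniformly in \<open>n\<close>; so the limits in \<open>n\<close> and in \<open>j\<close> may be interchanged.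
\<close>

lemma passes_to_limit_closed:
  fixes H :: "'b \<times> 'c \<Rightarrow> 'a" and Hj :: "nat \<Rightarrow> 'b \<times> 'c \<Rightarrow> 'a"
  assumes g: "admissible m g"
    and H: "H \<in> borel_measurable borel" and Hg: "\<And>x w. norm (H (x, w)) \<le> g x"
    and Hj: "\<And>j. Hj j \<in> borel_measurable borel" and Hjg: "\<And>j x w. norm (Hj j (x, w)) \<le> g x"
    and h[measurable]: "\<And>j. h j \<in> borel_measurable borel" and hg: "\<And>j x. h j x \<le> g x"
    and diff: "\<And>j x w. norm (Hj j (x, w) - H (x, w)) \<le> h j x"
    and lim: "AE x in lborel. (\<lambda>j. h j x) \<longlonglongrightarrow> 0"
    and pass: "\<And>j. passes_to_limit (Hj j)"
  shows "passes_to_limit H"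
  unfolding passes_to_limit_def
proof (rule tendstoI)
  fix \<epsilon> :: real assume \<epsilon>: "0 < \<epsilon>"
  have h0: "0 \<le> h j x" for j x using diff[of j x 0] norm_ge_zero order_trans by blast
  define T where "T H n = (\<integral>x. W n x * H (x, \<sigma> n x) \<partial>lborel)" for H n
  define T0 where "T0 H = (\<integral>P. cell_ind P *\<^sub>R (W0 P * H P) \<partial>lborel)" for H
  have hadm: "admissible m (h j)" for j
  proof -
    have "integrable lborel (\<lambda>x. h j x powr (1 / (1 - 1 / m)))" if "m \<noteq> 1"
    proof -
      have "integrable lborel (\<lambda>x. g x powr (1 / (1 - 1 / m)))" using g that by (simp add: admissible_def)
      moreover have "0 \<le> 1 / (1 - 1 / m)" using pqm by simp
      ultimately show ?thesis
        by (rule_tac Bochner_Integration.integrable_bound[rotated -1]) (use h0 hg in \<open>auto intro!: powr_mono2 AE_I2\<close>)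
    qed
    moreover have "\<exists>C. \<forall>x. h j x \<le> C" if "m = 1"
      using g that hg unfolding admissible_def by (metis order_trans)
    ultimately show ?thesis using h0 h unfolding admissible_def by simp
  qed
  have Wd: "norm (T (Hj j) n - T H n) \<le> (\<integral>x. norm (W n x) * h j x \<partial>lborel)" for j n
  proof -
    have i: "integrable lborel (\<lambda>x. W n x * Hj j (x, \<sigma> n x))" "integrable lborel (\<lambda>x. W n x * H (x, \<sigma> n x))"
      by (rule W_integrable(1)[OF g Hj Hjg], rule W_integrable(1)[OF g H Hg])
    have "T (Hj j) n - T H n = (\<integral>x. W n x * Hj j (x, \<sigma> n x) - W n x * H (x, \<sigma> n x) \<partial>lborel)"
      unfolding T_def by (rule Bochner_Integration.integral_diff[symmetric]) (fact i)+
    also have "norm \<dots> \<le> (\<integral>x. norm (W n x) * h j x \<partial>lborel)"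
    proof (rule norm_integral_le[OF Bochner_Integration.integrable_diff[OF i] W_admissible_integrable[OF hadm]], rule AE_I2)
      fix x
      have "norm (W n x) * norm (Hj j (x, \<sigma> n x) - H (x, \<sigma> n x)) \<le> norm (W n x) * h j x"
        by (intro mult_left_mono diff norm_ge_zero)
      then show "norm (W n x * Hj j (x, \<sigma> n x) - W n x * H (x, \<sigma> n x)) \<le> norm (W n x) * h j x"
        by (simp only: right_diff_distrib[symmetric] norm_mult)
    qed
    finally show ?thesis .
  qed
  obtain J where J: "\<And>j n. J \<le> j \<Longrightarrow> (\<integral>x. norm (W n x) * h j x \<partial>lborel) < \<epsilon> / 3"
    using W_uniformly_small[OF g h h0 hg lim, of "\<epsilon> / 3"] \<epsilon> by auto
  have "(\<lambda>j. T0 (Hj j)) \<longlonglongrightarrow> T0 H"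
    unfolding T0_def
  proof (rule integral_dominated_convergence[where w = "\<lambda>P. cell_ind P * (norm (W0 P) * g (fst P))"])
    show "(\<lambda>P. cell_ind P *\<^sub>R (W0 P * H P)) \<in> borel_measurable lborel"
      using W_integrable(2)[OF g H Hg] by (rule borel_measurable_integrable)
    show "(\<lambda>P. cell_ind P *\<^sub>R (W0 P * Hj j P)) \<in> borel_measurable lborel" for j
      using W_integrable(2)[OF g Hj Hjg] by (rule borel_measurable_integrable)
    show "integrable lborel (\<lambda>P. cell_ind P * (norm (W0 P) * g (fst P)))" by (rule W0_admissible_integrable[OF g])
    show "AE P in lborel. (\<lambda>j. cell_ind P *\<^sub>R (W0 P * Hj j P)) \<longlonglongrightarrow> cell_ind P *\<^sub>R (W0 P * H P)"
      using AE_fst_lborel[OF lim]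
    proof eventually_elim
      fix P :: "'b \<times> 'c" assume P: "(\<lambda>j. h j (fst P)) \<longlonglongrightarrow> 0"
      have "(\<lambda>j. Hj j P - H P) \<longlonglongrightarrow> 0"
        by (rule Lim_null_comparison[OF always_eventually[OF allI] P]) (use diff[of _ "fst P" "snd P"] in simp)
      then have "(\<lambda>j. Hj j P) \<longlonglongrightarrow> H P" by (rule LIM_zero_cancel)
      then show "(\<lambda>j. cell_ind P *\<^sub>R (W0 P * Hj j P)) \<longlonglongrightarrow> cell_ind P *\<^sub>R (W0 P * H P)"
        by (intro tendsto_intros)
    qed
    show "AE P in lborel. norm (cell_ind P *\<^sub>R (W0 P * Hj j P)) \<le> cell_ind P * (norm (W0 P) * g (fst P))" for j
    proof (rule AE_I2)
      fix P :: "'b \<times> 'c"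
      have "norm (Hj j P) \<le> g (fst P)" using Hjg[of j "fst P" "snd P"] by simp
      then have "norm (W0 P) * norm (Hj j P) \<le> norm (W0 P) * g (fst P)" by (intro mult_left_mono norm_ge_zero)
      then have "cell_ind P * (norm (W0 P) * norm (Hj j P)) \<le> cell_ind P * (norm (W0 P) * g (fst P))"
        by (rule mult_left_mono[OF _ cell_ind_nonneg])
      then show "norm (cell_ind P *\<^sub>R (W0 P * Hj j P)) \<le> cell_ind P * (norm (W0 P) * g (fst P))"
        by (simp add: norm_mult cell_ind_nonneg)
    qed
  qed
  then have "eventually (\<lambda>j. dist (T0 (Hj j)) (T0 H) < \<epsilon> / 3 \<and> J \<le> j) sequentially"
    using \<epsilon> by (intro eventually_conj tendstoD eventually_ge_at_top) auto
  then obtain j where j: "dist (T0 (Hj j)) (T0 H) < \<epsilon> / 3" "J \<le> j" by (auto simp: eventually_sequentially)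
  have "eventually (\<lambda>n. dist (T (Hj j) n) (T0 (Hj j)) < \<epsilon> / 3) sequentially"
    using pass[of j] \<epsilon> unfolding passes_to_limit_def T_def T0_def by (intro tendstoD) auto
  then have "eventually (\<lambda>n. dist (T H n) (T0 H) < \<epsilon>) sequentially"
  proof (rule eventually_mono)
    fix n assume n: "dist (T (Hj j) n) (T0 (Hj j)) < \<epsilon> / 3"
    have "dist (T H n) (T (Hj j) n) < \<epsilon> / 3"
      using Wd[of j n] J[OF j(2), of n] by (simp add: dist_norm norm_minus_commute)
    moreover have "dist (T H n) (T0 H) \<le> dist (T H n) (T (Hj j) n) + (dist (T (Hj j) n) (T0 (Hj j)) + dist (T0 (Hj j)) (T0 H))"
      using dist_triangle[of "T H n" "T0 H" "T (Hj j) n"] dist_triangle[of "T (Hj j) n" "T0 H" "T0 (Hj j)"] by linarith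
    ultimately show "dist (T H n) (T0 H) < \<epsilon>" using n j by linarith
  qed
  then show "eventually (\<lambda>n. dist (\<integral>x. W n x * H (x, \<sigma> n x) \<partial>lborel) (\<integral>P. cell_ind P *\<^sub>R (W0 P * H P) \<partial>lborel) < \<epsilon>) sequentially"
    by (simp only: T_def T0_def)
qed

lemma admissible_compact:
  assumes "0 \<le> C" shows "admissible m (\<lambda>x::'b. C * indicator (cball 0 r) x)"
proof -
  have m': "0 \<le> 1 / (1 - 1 / m)" using pqm by simp
  have "integrable lborel (\<lambda>x::'b. (C * indicator (cball 0 r) x) powr (1 / (1 - 1 / m)))"
  proof (rule Bochner_Integration.integrable_bound)
    show "integrable lborel (\<lambda>x::'b. C powr (1 / (1 - 1 / m)) * indicator (cball 0 r) x)"
      by (intro integrable_mult_right integrable_real_indicator) (auto simp: emeasure_cball_eq)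
  qed (auto simp: indicator_def)
  moreover have "C * indicator (cball 0 r) x \<le> C" for x :: 'b using assms by (simp add: indicator_def)
  moreover have "(\<lambda>x::'b. C * indicator (cball 0 r) x) \<in> borel_measurable borel" by measurable
  ultimately show ?thesis using assms unfolding admissible_def by (auto intro!: exI[of _ C])
qed

lemma test_fun_prod:
  fixes f :: "'c \<Rightarrow> 'a" and a :: "'b \<Rightarrow> real"
  assumes a: "continuous_on UNIV a" and f: "continuous_on UNIV f" "periodic f"
  shows "test_fun (\<lambda>P. (cutoff \<rho> (fst P) * a (fst P)) *\<^sub>R f (snd P))"
proof -
  have "continuous_on UNIV (\<lambda>P::'b \<times> 'c. cutoff \<rho> (fst P))" "continuous_on UNIV (\<lambda>P::'b \<times> 'c. a (fst P))"
    "continuous_on UNIV (\<lambda>P::'b \<times> 'c. f (snd P))"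
    by (rule continuous_on_compose2[OF continuous_on_cutoff[of UNIV \<rho>]] continuous_on_compose2[OF a] continuous_on_compose2[OF f(1)];
        simp add: continuous_on_fst continuous_on_snd continuous_on_id)+
  then have "continuous_on UNIV (\<lambda>P::'b \<times> 'c. (cutoff \<rho> (fst P) * a (fst P)) *\<^sub>R f (snd P))"
    by (intro continuous_on_scaleR continuous_on_mult)
  moreover have "\<forall>x w. \<rho> + 1 < norm x \<longrightarrow> (cutoff \<rho> (fst (x, w)) * a (fst (x, w))) *\<^sub>R f (snd (x, w)) = 0" for x :: 'b and w :: 'c
    by (simp add: cutoff_zero)
  ultimately show ?thesis using f(2) unfolding test_fun_def periodic_def by auto
qed

text \<open>
  The indicator of \<open>E\<close> is almost everywhere a limit of continuous functions, which are clipped to the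
  unit interval and cut off, so that one multiple of the indicator of a ball dominates them.
\<close>

lemma passes_indicator:
  fixes f :: "'c \<Rightarrow> 'a"
  assumes E[measurable]: "E \<in> sets borel" and E\<rho>: "\<And>x. x \<in> E \<Longrightarrow> norm x \<le> \<rho>"
    and f: "continuous_on UNIV f" "periodic f" and fC: "\<And>w. norm (f w) \<le> C"
  shows "passes_to_limit (\<lambda>P. indicator E (fst P) *\<^sub>R f (snd P))"
proof -
  have C0: "0 \<le> C" using fC[of 0] norm_ge_zero order_trans by blast
  have "(indicator E :: 'b \<Rightarrow> real) measurable_on UNIV"
    by (intro lebesgue_measurable_imp_measurable_on_real borel_measurable_indicator sets_completionI_sets) simp_all
  then obtain N b where N: "negligible N" and b: "\<And>j::nat. continuous_on UNIV (b j)"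
    and bl: "\<And>x. x \<notin> N \<Longrightarrow> (\<lambda>j. b j x) \<longlonglongrightarrow> (indicator E x :: real)"
    unfolding measurable_on_def by auto
  define a where "a j x = max 0 (min 1 (b j x))" for j x
  have a: "continuous_on UNIV (a j)" for j unfolding a_def[abs_def] by (intro continuous_intros b)
  have [measurable]: "a j \<in> borel_measurable borel" for j by (rule borel_measurable_continuous_onI[OF a])
  have a01: "0 \<le> a j x" "a j x \<le> 1" for j x by (auto simp: a_def)
  have al: "(\<lambda>j. a j x) \<longlonglongrightarrow> indicator E x" if "x \<notin> N" for x
  proof -
    have "(\<lambda>j. a j x) \<longlonglongrightarrow> max 0 (min 1 (indicator E x))"
      unfolding a_def by (intro tendsto_intros bl that)
    then show ?thesis by (simp add: indicator_def split: if_splits)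
  qed
  define g where "g x = C * indicator (cball 0 (\<rho> + 1)) x" for x :: 'b
  have g: "admissible m g" unfolding g_def[abs_def] by (rule admissible_compact[OF C0])
  define h where "h j x = C * \<bar>cutoff \<rho> x * a j x - indicator E x\<bar>" for j x
  have c01: "0 \<le> cutoff \<rho> x * a j x" "cutoff \<rho> x * a j x \<le> 1" for j x
    using a01[of j x] cutoff_bounds[of \<rho> x] by (auto intro: mult_le_one)
  have fm: "f \<in> borel_measurable borel" by (rule borel_measurable_continuous_onI[OF f(1)])
  have Hm: "(\<lambda>P::'b \<times> 'c. e (fst P) *\<^sub>R f (snd P)) \<in> borel_measurable borel" if [measurable]: "e \<in> borel_measurable borel" for e :: "'b \<Rightarrow> real"
    unfolding borel_prod[symmetric] using fm by measurable
  have out: "cutoff \<rho> x * a j x = 0 \<and> indicator E x = (0::real)" if "x \<notin> cball 0 (\<rho> + 1)" for j x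
    using that E\<rho>[of x] by (auto simp: cutoff_zero indicator_def)
  have bnd: "norm (e *\<^sub>R f w) \<le> C" if "0 \<le> e" "e \<le> 1" for e w
  proof -
    have "e * norm (f w) \<le> 1 * C" using that fC[of w] by (intro mult_mono) auto
    then show ?thesis using that by simp
  qed
  show ?thesis
  proof (rule passes_to_limit_closed[where g = g and h = h and Hj = "\<lambda>j P. (cutoff \<rho> (fst P) * a j (fst P)) *\<^sub>R f (snd P)"])
    show "admissible m g" by (rule g)
    show "(\<lambda>P. indicator E (fst P) *\<^sub>R f (snd P)) \<in> borel_measurable borel" by (rule Hm) measurable
    show "(\<lambda>P. (cutoff \<rho> (fst P) * a j (fst P)) *\<^sub>R f (snd P)) \<in> borel_measurable borel" for j by (rule Hm) measurable
    show "norm (indicator E (fst (x, w)) *\<^sub>R f (snd (x, w))) \<le> g x" for x w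
    proof (cases "x \<in> cball 0 (\<rho> + 1)")
      case True
      then show ?thesis using bnd[of "indicator E x" w] by (simp add: g_def)
    next
      case False
      then show ?thesis using out[of x 0] C0 by (simp add: g_def)
    qed
    show "norm ((cutoff \<rho> (fst (x, w)) * a j (fst (x, w))) *\<^sub>R f (snd (x, w))) \<le> g x" for j x w
    proof (cases "x \<in> cball 0 (\<rho> + 1)")
      case True
      then show ?thesis using bnd[OF c01[of x j], of w] by (simp add: g_def)
    next
      case False
      then have "cutoff \<rho> x * a j x = 0" using out by blast
      then show ?thesis using False by (simp only: fst_conv snd_conv) (simp add: g_def)
    qed
    show "h j \<in> borel_measurable borel" for j unfolding h_def[abs_def] by measurable
    show "h j x \<le> g x" for j x
    proof (cases "x \<in> cball 0 (\<rho> + 1)")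
      case True
      have "\<bar>cutoff \<rho> x * a j x - indicator E x\<bar> \<le> 1" using c01[of x j] by (auto simp: indicator_def)
      then have "h j x \<le> C * 1" unfolding h_def using C0 by (intro mult_left_mono)
      then show ?thesis using True by (simp add: g_def)
    next
      case False
      then have "cutoff \<rho> x * a j x = 0" "indicator E x = (0::real)" using out by blast+
      then show ?thesis using False by (simp only: h_def) (simp add: g_def)
    qed
    show "norm ((cutoff \<rho> (fst (x, w)) * a j (fst (x, w))) *\<^sub>R f (snd (x, w)) - indicator E (fst (x, w)) *\<^sub>R f (snd (x, w))) \<le> h j x" for j x w
      unfolding scaleR_diff_left[symmetric] norm_scaleR h_def fst_conv snd_conv
      by (subst mult.commute) (intro mult_right_mono fC abs_ge_zero)
    show "AE x in lborel. (\<lambda>j. h j x) \<longlonglongrightarrow> 0"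
    proof -
      have "AE x in lebesgue. x \<notin> N" using N by (intro AE_not_in) (simp add: negligible_iff_null_sets)
      then have "AE x in lborel. x \<notin> N" by (simp only: AE_completion_iff)
      then show ?thesis
      proof eventually_elim
        fix x assume x: "x \<notin> N"
        have ci: "cutoff \<rho> x * indicator E x = indicator E x"
          using E\<rho>[of x] cutoff_one[of x \<rho>] by (auto simp: indicator_def)
        have "(\<lambda>j. h j x) \<longlonglongrightarrow> C * \<bar>cutoff \<rho> x * indicator E x - indicator E x\<bar>"
          unfolding h_def by (intro tendsto_intros al[OF x])
        then show "(\<lambda>j. h j x) \<longlonglongrightarrow> 0" by (simp add: ci)
      qed
    qed
    show "passes_to_limit (\<lambda>P. (cutoff \<rho> (fst P) * a j (fst P)) *\<^sub>R f (snd P))" for j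
      by (rule test_fun_passes[OF test_fun_prod[OF a f]])
  qed
qed

end

lemma admissible_scale:
  assumes g: "admissible m g" and c: "0 \<le> c" shows "admissible m (\<lambda>x. c * g x)"
proof -
  have [measurable]: "g \<in> borel_measurable borel" and g0: "\<And>x. 0 \<le> g x" using g by (auto simp: admissible_def)
  have "(\<lambda>x. c * g x) \<in> borel_measurable borel" by measurable
  moreover have "\<exists>C. \<forall>x. c * g x \<le> C" if m1: "m = 1"
  proof -
    obtain C where "\<And>x. g x \<le> C" using g m1 by (auto simp: admissible_def)
    then show ?thesis using c by (intro exI[of _ "c * C"] allI mult_left_mono)
  qed
  moreover have "integrable lborel (\<lambda>x. (c * g x) powr (1 / (1 - 1 / m)))" if "m \<noteq> 1"
  proof -
    have "integrable lborel (\<lambda>x. c powr (1 / (1 - 1 / m)) * g x powr (1 / (1 - 1 / m)))"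
      using g that by (intro integrable_mult_right) (simp add: admissible_def)
    then show ?thesis using c g0 by (simp add: powr_mult)
  qed
  ultimately show ?thesis using c g0 unfolding admissible_def by simp
qed

text \<open>
  The space of continuous functions is not second countable, so that the measurability of the
  evaluation map is derived from the finiteness of the range.
\<close>

lemma simple_eval:
  fixes s :: "'b::euclidean_space \<Rightarrow> ('c::euclidean_space \<Rightarrow>\<^sub>C 'a::{real_normed_field, euclidean_space})"
  assumes s: "simple_function borel s"
  shows "finite (range s)" and "s -` {f} \<in> sets borel"
    and "apply_bcontfun (s x) w = (\<Sum>f\<in>range s. indicator (s -` {f}) x *\<^sub>R apply_bcontfun f w)"
    and "(\<lambda>P. apply_bcontfun (s (fst P)) (snd P)) \<in> borel_measurable borel"
proof -
  show fin: "finite (range s)" using s by (simp add: simple_function_def)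
  have pre: "s -` {f} \<in> sets borel" for f
  proof (cases "f \<in> range s")
    case True
    then show ?thesis using s by (auto simp: simple_function_def)
  next
    case False
    then have "s -` {f} = {}" by auto
    then show ?thesis by simp
  qed
  then show "s -` {f} \<in> sets borel" .
  have eval: "apply_bcontfun (s x) w = (\<Sum>f\<in>range s. indicator (s -` {f}) x *\<^sub>R apply_bcontfun f w)" for x w
  proof -
    have "(\<Sum>f\<in>range s. indicator (s -` {f}) x *\<^sub>R apply_bcontfun f w) = (\<Sum>f\<in>range s. if f = s x then apply_bcontfun f w else 0)"
      by (rule sum.cong) (auto simp: indicator_def)
    also have "\<dots> = apply_bcontfun (s x) w" using fin by simp
    finally show ?thesis by simp
  qed
  then show "apply_bcontfun (s x) w = (\<Sum>f\<in>range s. indicator (s -` {f}) x *\<^sub>R apply_bcontfun f w)" .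
  have "(\<lambda>P::'b \<times> 'c. \<Sum>f\<in>range s. indicator (s -` {f}) (fst P) *\<^sub>R apply_bcontfun f (snd P)) \<in> borel_measurable borel"
  proof (rule borel_measurable_sum)
    fix f
    have [measurable]: "s -` {f} \<in> sets borel" by (rule pre)
    have [measurable]: "apply_bcontfun f \<in> borel_measurable borel" by (rule borel_measurable_continuous_onI) simp
    show "(\<lambda>P::'b \<times> 'c. indicator (s -` {f}) (fst P) *\<^sub>R apply_bcontfun f (snd P)) \<in> borel_measurable borel"
      unfolding borel_prod[symmetric] by measurable
  qed
  then show "(\<lambda>P. apply_bcontfun (s (fst P)) (snd P)) \<in> borel_measurable borel" by (simp only: eval)
qed

lemma norm_eval_diff:
  fixes f g :: "'c::topological_space \<Rightarrow>\<^sub>C 'a::real_normed_vector"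
  shows "norm (apply_bcontfun f w - apply_bcontfun g w) \<le> norm (f - g)"
  using norm_bounded[of "f - g" w] by (simp add: minus_bcontfun.rep_eq)

context conv_setting
begin

lemma passes_simple:
  fixes s :: "'b \<Rightarrow> ('c \<Rightarrow>\<^sub>C 'a)"
  assumes s: "simple_function borel s" and s_per: "\<And>x. periodic (apply_bcontfun (s x))"
    and s0: "\<And>x. \<rho> < norm x \<Longrightarrow> s x = 0"
  shows "passes_to_limit (\<lambda>P. apply_bcontfun (s (fst P)) (snd P))"
proof -
  note se = simple_eval[OF s]
  define H where "H f P = indicator (s -` {f}) (fst P) *\<^sub>R apply_bcontfun f (snd P)" for f :: "'c \<Rightarrow>\<^sub>C 'a" and P :: "'b \<times> 'c"
  have Hm: "H f \<in> borel_measurable borel" for f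
  proof -
    have [measurable]: "s -` {f} \<in> sets borel" by (rule se(2))
    have [measurable]: "apply_bcontfun f \<in> borel_measurable borel" by (rule borel_measurable_continuous_onI) simp
    show ?thesis unfolding H_def[abs_def] borel_prod[symmetric] by measurable
  qed
  have Hg: "norm (H f (x, w)) \<le> norm f * indicator (cball 0 \<rho>) x" for f x w
  proof (cases "s x = f \<and> f \<noteq> 0")
    case True
    then have "norm x \<le> \<rho>" using s0[of x] by (auto simp: not_less[symmetric])
    then show ?thesis using True norm_bounded[of f w] by (simp add: H_def)
  next
    case False
    then have "H f (x, w) = 0" by (auto simp: H_def indicator_def)
    then show ?thesis by simp
  qed
  have pass: "passes_to_limit (H f)" if f: "f \<in> range s" for f
  proof (cases "f = 0")
    case True
    then have "H f = (\<lambda>_. 0)" by (simp add: H_def fun_eq_iff)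
    then show ?thesis by (simp add: passes_to_limit_def)
  next
    case False
    show ?thesis
      unfolding H_def[abs_def]
    proof (rule passes_indicator[where \<rho> = \<rho> and C = "norm f"])
      show "norm x \<le> \<rho>" if "x \<in> s -` {f}" for x using that False s0[of x] by (auto simp: not_less[symmetric])
      show "periodic (apply_bcontfun f)" using f s_per by auto
    qed (use se(2) norm_bounded in auto)
  qed
  have int: "integrable lborel (\<lambda>x. W n x * H f (x, \<sigma> n x))" "integrable lborel (\<lambda>P. cell_ind P *\<^sub>R (W0 P * H f P))" for f n
    by (rule W_integrable[OF admissible_compact[OF norm_ge_zero] Hm Hg])+
  have eq: "(\<lambda>P. apply_bcontfun (s (fst P)) (snd P)) = (\<lambda>P. \<Sum>f\<in>range s. H f P)"
    by (rule ext) (simp only: H_def se(3))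
  have "(\<integral>x. W n x * (\<Sum>f\<in>range s. H f (x, \<sigma> n x)) \<partial>lborel) = (\<Sum>f\<in>range s. \<integral>x. W n x * H f (x, \<sigma> n x) \<partial>lborel)" for n
    unfolding sum_distrib_left by (rule Bochner_Integration.integral_sum) (rule int)
  moreover have "(\<integral>P. cell_ind P *\<^sub>R (W0 P * (\<Sum>f\<in>range s. H f P)) \<partial>lborel) = (\<Sum>f\<in>range s. \<integral>P. cell_ind P *\<^sub>R (W0 P * H f P) \<partial>lborel)"
    unfolding sum_distrib_left scaleR_sum_right by (rule Bochner_Integration.integral_sum) (rule int)
  ultimately show ?thesis
    unfolding eq passes_to_limit_def using pass by (simp add: passes_to_limit_def tendsto_sum)
qed

text \<open>
  A strongly measurable \<open>\<psi>\<close> is a limit of simple functions, which may be truncated so that they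
  have bounded support and are dominated by a multiple of \<open>norm \<circ> \<psi>\<close>.
\<close>

lemma passes_strongly_measurable:
  fixes \<psi> :: "'b \<Rightarrow> ('c \<Rightarrow>\<^sub>C 'a)"
  assumes s: "\<And>j::nat. simple_function borel (s j)" and s_per: "\<And>j x. periodic (apply_bcontfun (s j x))"
    and lim: "\<And>x. (\<lambda>j. s j x) \<longlonglongrightarrow> \<psi> x" and adm: "admissible m (\<lambda>x. norm (\<psi> x))"
  shows "(\<lambda>P. apply_bcontfun (\<psi> (fst P)) (snd P)) \<in> borel_measurable borel"
    and "passes_to_limit (\<lambda>P. apply_bcontfun (\<psi> (fst P)) (snd P))"
proof -
  have eval_lim: "(\<lambda>j. apply_bcontfun (f j) w) \<longlonglongrightarrow> apply_bcontfun f0 w" if "f \<longlonglongrightarrow> f0" for f :: "nat \<Rightarrow> ('c \<Rightarrow>\<^sub>C 'a)" and f0 w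
  proof -
    have "(\<lambda>j. norm (f j - f0)) \<longlonglongrightarrow> 0" by (rule tendsto_norm_zero[OF LIM_zero[OF that]])
    then have "(\<lambda>j. apply_bcontfun (f j) w - apply_bcontfun f0 w) \<longlonglongrightarrow> 0"
      by (rule Lim_null_comparison[rotated]) (intro always_eventually allI norm_eval_diff)
    then show ?thesis by (rule LIM_zero_cancel)
  qed
  show Hm: "(\<lambda>P. apply_bcontfun (\<psi> (fst P)) (snd P)) \<in> borel_measurable borel"
    by (rule borel_measurable_LIMSEQ_metric[OF simple_eval(4)[OF s]]) (rule eval_lim[OF lim])
  have Nm: "(\<lambda>x. norm (\<psi> x)) \<in> borel_measurable borel" using adm by (simp add: admissible_def)
  have sn: "(\<lambda>x. norm (s j x)) \<in> borel_measurable borel" for j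
    by (rule borel_measurable_simple_function[OF simple_function_compose1[OF s]])
  define s' where "s' j x = (if norm x \<le> real j \<and> norm (s j x) \<le> 2 * norm (\<psi> x) then s j x else 0)" for j x
  have s's: "simple_function borel (s' j)" for j
    unfolding s'_def
  proof (rule simple_function_If[OF s simple_function_const])
    have "Measurable.pred borel (\<lambda>x. norm x \<le> real j \<and> norm (s j x) \<le> 2 * norm (\<psi> x))"
      using Nm sn by measurable
    then show "{x \<in> space borel. norm x \<le> real j \<and> norm (s j x) \<le> 2 * norm (\<psi> x)} \<in> sets borel"
      by (simp add: pred_def)
  qed
  have s'per: "periodic (apply_bcontfun (s' j x))" for j x
    using s_per[of j x] by (simp add: s'_def periodic_def)
  have s'2: "norm (s' j x) \<le> 2 * norm (\<psi> x)" for j x by (simp add: s'_def)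
  have s'lim: "(\<lambda>j. s' j x) \<longlonglongrightarrow> \<psi> x" for x
  proof (cases "\<psi> x = 0")
    case True
    then have "s' j x = 0" for j using s'2[of j x] by simp
    then show ?thesis using True by simp
  next
    case False
    have "eventually (\<lambda>j. norm (s j x) < 2 * norm (\<psi> x)) sequentially"
      using False by (intro order_tendstoD(2)[OF tendsto_norm[OF lim]]) simp
    moreover have "eventually (\<lambda>j. norm x \<le> real j) sequentially"
      using filterlim_real_sequentially by (auto simp: filterlim_at_top)
    ultimately have "eventually (\<lambda>j. s j x = s' j x) sequentially"
      by eventually_elim (simp add: s'_def)
    then show ?thesis using lim by (rule Lim_transform_eventually[rotated])
  qed
  define h where "h j x = norm (s' j x - \<psi> x)" for j x
  have hm: "h j \<in> borel_measurable borel" for j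
  proof (rule borel_measurable_LIMSEQ_metric)
    show "(\<lambda>x. norm (s' j x - s k x)) \<in> borel_measurable borel" for k
      by (rule borel_measurable_simple_function[OF simple_function_compose2[OF s's s]])
    show "(\<lambda>k. norm (s' j x - s k x)) \<longlonglongrightarrow> h j x" for x
      unfolding h_def by (intro tendsto_norm tendsto_diff tendsto_const lim)
  qed
  have adm3: "admissible m (\<lambda>x. 3 * norm (\<psi> x))" by (rule admissible_scale[OF adm]) simp
  show "passes_to_limit (\<lambda>P. apply_bcontfun (\<psi> (fst P)) (snd P))"
  proof (rule passes_to_limit_closed[OF adm3 Hm _ _ _ hm, where Hj = "\<lambda>j P. apply_bcontfun (s' j (fst P)) (snd P)"])
    show "norm (apply_bcontfun (\<psi> (fst (x, w))) (snd (x, w))) \<le> 3 * norm (\<psi> x)" for x w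
      unfolding fst_conv snd_conv using norm_bounded[of "\<psi> x" w] norm_ge_zero[of "\<psi> x"] by linarith
    show "(\<lambda>P. apply_bcontfun (s' j (fst P)) (snd P)) \<in> borel_measurable borel" for j
      by (rule simple_eval(4)[OF s's])
    show "norm (apply_bcontfun (s' j (fst (x, w))) (snd (x, w))) \<le> 3 * norm (\<psi> x)" for j x w
      unfolding fst_conv snd_conv using norm_bounded[of "s' j x" w] s'2[of j x] norm_ge_zero[of "\<psi> x"] by linarith
    show "h j x \<le> 3 * norm (\<psi> x)" for j x
      using norm_triangle_ineq4[of "s' j x" "\<psi> x"] s'2[of j x] by (simp add: h_def)
    show "norm (apply_bcontfun (s' j (fst (x, w))) (snd (x, w)) - apply_bcontfun (\<psi> (fst (x, w))) (snd (x, w))) \<le> h j x" for j x w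
      using norm_eval_diff[of "s' j x" w "\<psi> x"] by (simp add: h_def)
    show "AE x in lborel. (\<lambda>j. h j x) \<longlonglongrightarrow> 0"
      unfolding h_def by (intro AE_I2 tendsto_norm_zero LIM_zero s'lim)
    show "passes_to_limit (\<lambda>P. apply_bcontfun (s' j (fst P)) (snd P))" for j
    proof (rule passes_simple[OF s's s'per, where \<rho> = "real j"])
      fix x :: 'b assume "real j < norm x"
      then have "\<not> norm x \<le> real j" by simp
      then show "s' j x = 0" unfolding s'_def by simp
    qed
  qed
qed

end

section \<open>Mean values of oscillating functions\<close>

lemma Basis_prod_ball:
  "(\<forall>b\<in>(Basis :: ('b::euclidean_space \<times> 'd::euclidean_space) set). Q b) \<longleftrightarrow> (\<forall>b\<in>Basis. Q (b, 0)) \<and> (\<forall>b\<in>Basis. Q (0, b))"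
  by (auto simp: Basis_prod_def)

lemma ucell_Pair: "(r, s) \<in> ucell \<longleftrightarrow> r \<in> ucell \<and> s \<in> ucell"
  by (simp add: ucell_def Basis_prod_ball)

lemma lattice_point_Pair: "lattice_point (k, l) \<longleftrightarrow> lattice_point k \<and> lattice_point l"
  by (simp add: lattice_point_def Basis_prod_ball)

lemma lattice_point_0: "lattice_point 0"
  by (simp add: lattice_point_def)

definition two_scales :: "real \<Rightarrow> 'b::euclidean_space \<Rightarrow> 'b \<times> 'b" where
  "two_scales \<epsilon> x = (x /\<^sub>R \<epsilon>, x /\<^sub>R \<epsilon>\<^sup>2)"

lemma two_scales_add: "two_scales \<epsilon> (x + y) = two_scales \<epsilon> x + two_scales \<epsilon> y"
  by (simp add: two_scales_def scaleR_add_right)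

lemma continuous_on_two_scales: "continuous_on S (two_scales \<epsilon>)"
  unfolding two_scales_def[abs_def] by (intro continuous_intros)

lemma measurable_two_scales[measurable]: "two_scales \<epsilon> \<in> borel_measurable borel"
  by (rule borel_measurable_continuous_onI[OF continuous_on_two_scales])

text \<open>
  Moving the cell of integration in both periodic variables, first in \<open>s\<close> and then in \<open>r\<close>,
  does not change the integral, even if the second displacement depends on \<open>r\<close>.
\<close>

lemma nn_integral_shear:
  fixes H :: "'b::euclidean_space \<times> ('b \<times> 'b) \<Rightarrow> ennreal"
  assumes H[measurable]: "H \<in> borel_measurable borel" and per: "\<And>x. periodic (\<lambda>w. H (x, w))"
    and \<epsilon>: "0 < \<epsilon>"
  shows "(\<integral>\<^sup>+P. cell_ind P * H (fst P, fst (two_scales \<epsilon> (fst P)) + fst (snd P),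
            snd (two_scales \<epsilon> (fst P)) + fst (snd P) /\<^sub>R \<epsilon> + snd (snd P)) \<partial>lborel)
    = (\<integral>\<^sup>+P. cell_ind P * H P \<partial>lborel)"
proof -
  have Hm[measurable]: "H \<in> borel_measurable (borel \<Otimes>\<^sub>M (borel \<Otimes>\<^sub>M borel))" using H by (simp only: borel_prod)
  have per1: "periodic (\<lambda>s. H (x, r, s))" for x r
    unfolding periodic_def
  proof (intro allI impI)
    fix s k :: 'b assume "lattice_point k"
    then have "lattice_point (0 :: 'b, k)" by (simp add: lattice_point_Pair lattice_point_0)
    from periodicD[OF per this, of x "(r, s)"] show "H (x, r, s + k) = H (x, r, s)" by simp
  qed
  have per2: "periodic (\<lambda>r. H (x, r, s))" for x s
    unfolding periodic_def
  proof (intro allI impI)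
    fix r k :: 'b assume "lattice_point k"
    then have "lattice_point (k, 0 :: 'b)" by (simp add: lattice_point_Pair lattice_point_0)
    from periodicD[OF per this, of x "(r, s)"] show "H (x, r + k, s) = H (x, r, s)" by simp
  qed
  have ind: "ennreal (indicator ucell (r, s)) = indicator ucell r * (indicator ucell s :: ennreal)" for r s :: 'b
    by (simp add: indicator_def ucell_Pair)
  have split: "(\<integral>\<^sup>+P. cell_ind P * F P \<partial>lborel)
      = (\<integral>\<^sup>+x. (\<integral>\<^sup>+r. indicator ucell r * (\<integral>\<^sup>+s. indicator ucell s * F (x, r, s) \<partial>lborel) \<partial>lborel) \<partial>lborel)"
    if F[measurable]: "F \<in> borel_measurable (borel \<Otimes>\<^sub>M (borel \<Otimes>\<^sub>M borel))" for F :: "'b \<times> ('b \<times> 'b) \<Rightarrow> ennreal"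
  proof -
    have m1: "(\<lambda>P. ennreal (cell_ind P) * F P) \<in> borel_measurable borel"
      using F by (intro borel_measurable_times_ennreal measurable_compose[OF measurable_cell_ind measurable_ennreal]) (simp only: borel_prod)
    have m2: "(\<lambda>w. ennreal (indicator ucell w) * F (x, w)) \<in> borel_measurable borel" for x
    proof -
      have F2: "(\<lambda>w. F (x, w)) \<in> borel_measurable borel"
        using measurable_Pair2[OF F, of x] by (simp add: borel_prod)
      show ?thesis
        by (intro borel_measurable_times_ennreal F2
            measurable_compose[OF borel_measurable_indicator[OF measurable_ucell] measurable_ennreal])
    qed
    show ?thesis
      by (subst nn_integral_lborel_prod[OF m1], simp only: cell_ind_pair, subst nn_integral_lborel_prod[OF m2])
        (simp add: ind mult.assoc nn_integral_cmult)
  qed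
  define F where "F P = H (fst P, fst (two_scales \<epsilon> (fst P)) + fst (snd P),
            snd (two_scales \<epsilon> (fst P)) + fst (snd P) /\<^sub>R \<epsilon> + snd (snd P))" for P
  have Fm: "F \<in> borel_measurable (borel \<Otimes>\<^sub>M (borel \<Otimes>\<^sub>M borel))"
    unfolding F_def two_scales_def fst_conv snd_conv by measurable
  have "(\<integral>\<^sup>+P. cell_ind P * F P \<partial>lborel)
      = (\<integral>\<^sup>+x. (\<integral>\<^sup>+r. indicator ucell r * (\<integral>\<^sup>+s. indicator ucell s * F (x, r, s) \<partial>lborel) \<partial>lborel) \<partial>lborel)"
    by (rule split[OF Fm])
  also have "\<dots> = (\<integral>\<^sup>+x. (\<integral>\<^sup>+r. indicator ucell r * (\<integral>\<^sup>+s. indicator ucell s * H (x, r, s) \<partial>lborel) \<partial>lborel) \<partial>lborel)"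
  proof (rule nn_integral_cong)
    fix x :: 'b
    obtain a b where ab: "two_scales \<epsilon> x = (a, b)" by (cases "two_scales \<epsilon> x")
    define h where "h r = (\<integral>\<^sup>+s. indicator ucell s * H (x, r, s) \<partial>lborel)" for r
    have hm: "h \<in> borel_measurable borel" unfolding h_def[abs_def] by measurable
    have hp: "periodic h" using per2[of x] by (simp add: periodic_def h_def)
    have "(\<integral>\<^sup>+s. indicator ucell s * F (x, r, s) \<partial>lborel) = h (r + a)" for r
    proof -
      have "(\<integral>\<^sup>+s. indicator ucell s * F (x, r, s) \<partial>lborel) = (\<integral>\<^sup>+s. indicator ucell s * H (x, r + a, s + (b + r /\<^sub>R \<epsilon>)) \<partial>lborel)"
        by (simp add: F_def ab algebra_simps)
      also have "\<dots> = h (r + a)"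
        unfolding h_def by (rule nn_integral_ucell_shift[OF per1]) measurable
      finally show ?thesis .
    qed
    then have "(\<integral>\<^sup>+r. indicator ucell r * (\<integral>\<^sup>+s. indicator ucell s * F (x, r, s) \<partial>lborel) \<partial>lborel) = (\<integral>\<^sup>+r. indicator ucell r * h (r + a) \<partial>lborel)"
      by (simp only:)
    also have "\<dots> = (\<integral>\<^sup>+r. indicator ucell r * h r \<partial>lborel)" by (rule nn_integral_ucell_shift[OF hp hm])
    finally show "(\<integral>\<^sup>+r. indicator ucell r * (\<integral>\<^sup>+s. indicator ucell s * F (x, r, s) \<partial>lborel) \<partial>lborel)
        = (\<integral>\<^sup>+r. indicator ucell r * (\<integral>\<^sup>+s. indicator ucell s * H (x, r, s) \<partial>lborel) \<partial>lborel)"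
      by (simp only: h_def)
  qed
  also have "\<dots> = (\<integral>\<^sup>+P. cell_ind P * H P \<partial>lborel)" by (rule split[OF Hm, symmetric])
  finally show ?thesis by (simp only: F_def)
qed

text \<open>
  Translating \<open>x\<close> by \<open>\<epsilon> r + \<epsilon>\<^sup>2 s\<close> does not change the left-hand integral, so it may be averaged
  over all \<open>r\<close>, \<open>s\<close> in the unit cell. The fast variables are thereby translated by \<open>r\<close> and
  \<open>r / \<epsilon> + s\<close>, up to a vanishing error, and so they sweep over the whole cell.
\<close>

lemma mean_value:
  fixes H :: "'b::euclidean_space \<times> ('b \<times> 'b) \<Rightarrow> real" and e :: "nat \<Rightarrow> real"
  assumes H: "test_fun H" and H0: "\<And>P. 0 \<le> H P"
    and e0: "\<And>n. 0 < e n" and e1: "\<And>n. e n \<le> 1" and lim: "e \<longlonglongrightarrow> 0"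
  shows "(\<lambda>n. \<integral>x. H (x, two_scales (e n) x) \<partial>lborel) \<longlonglongrightarrow> (\<integral>P. cell_ind P * H P \<partial>lborel)"
proof (rule tendstoI)
  fix \<eta> :: real assume \<eta>: "0 < \<eta>"
  obtain R where R: "\<And>x w. R < norm x \<Longrightarrow> H (x, w) = 0" using H unfolding test_fun_def by blast
  obtain C where C0: "0 \<le> C" and C: "\<And>P. norm (H P) \<le> C" using test_fun_bounded[OF H] by blast
  have Hm[measurable]: "H \<in> borel_measurable borel" by (rule test_fun_measurable[OF H])
  have Hm'[measurable]: "H \<in> borel_measurable (borel \<Otimes>\<^sub>M (borel \<Otimes>\<^sub>M borel))" using Hm by (simp only: borel_prod)
  obtain c where c: "0 \<le> c" "\<And>w::'b. w \<in> ucell \<Longrightarrow> norm w \<le> c" using bounded_ucell by blast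
  define \<beta> where "\<beta> = measure lborel (cball (0::'b) (R + 2 * c))"
  have \<beta>0: "0 \<le> \<beta>" by (simp add: \<beta>_def)
  define \<omega> where "\<omega> = \<eta> / 2 / (\<beta> + 1)"
  have \<omega>: "0 < \<omega>" using \<eta> \<beta>0 by (simp add: \<omega>_def)
  have "\<omega> * (\<beta> + 1) = \<eta> / 2" by (rule iffD1[OF nonzero_eq_divide_eq \<omega>_def]) (use \<beta>0 in simp)
  then have \<omega>\<beta>: "\<omega> * \<beta> < \<eta>" using \<omega> \<eta> by (simp add: algebra_simps)
  obtain d where d: "0 < d" "\<And>P Q. dist P Q < d \<Longrightarrow> dist (H P) (H Q) < \<omega>"
    using test_fun_uniform[OF H \<omega>] by blast
  have "(\<lambda>n. e n * (3 * c)) \<longlonglongrightarrow> 0 * (3 * c)" by (intro tendsto_mult lim tendsto_const)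
  then have "eventually (\<lambda>n. e n * (3 * c) < d) sequentially" using d(1) by (intro order_tendstoD(2)) auto
  then show "eventually (\<lambda>n. dist (\<integral>x. H (x, two_scales (e n) x) \<partial>lborel) (\<integral>P. cell_ind P * H P \<partial>lborel) < \<eta>) sequentially"
  proof (rule eventually_mono)
    fix n assume n: "e n * (3 * c) < d"
    define \<epsilon> where "\<epsilon> = e n"
    have \<epsilon>: "0 < \<epsilon>" "\<epsilon> \<le> 1" "\<epsilon> * (3 * c) < d" using e0 e1 n by (auto simp: \<epsilon>_def)
    (* K is the translated integrand and L the same without the error: the slow variable is not
       translated, and the first fast variable is translated by r only. *)
    define S where "S w = \<epsilon> *\<^sub>R fst w + \<epsilon>\<^sup>2 *\<^sub>R snd w" for w :: "'b \<times> 'b"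
    define K where "K P = H (fst P + S (snd P), two_scales \<epsilon> (fst P + S (snd P)))" for P :: "'b \<times> ('b \<times> 'b)"
    define L where "L P = H (fst P, fst (two_scales \<epsilon> (fst P)) + fst (snd P),
            snd (two_scales \<epsilon> (fst P)) + fst (snd P) /\<^sub>R \<epsilon> + snd (snd P))" for P :: "'b \<times> ('b \<times> 'b)"
    have Km: "K \<in> borel_measurable borel"
      unfolding K_def S_def two_scales_def borel_prod[symmetric] by measurable
    have Lm: "L \<in> borel_measurable borel"
      unfolding L_def two_scales_def borel_prod[symmetric] fst_conv snd_conv by measurable
    have f_m: "(\<lambda>x. H (x, two_scales \<epsilon> x)) \<in> borel_measurable borel"
      by (rule test_fun_scale_measurable[OF Hm measurable_two_scales])
    have K0: "0 \<le> K P" and L0: "0 \<le> L P" for P using H0 by (auto simp: K_def L_def)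
    have 1: "(\<integral>\<^sup>+P. ennreal (cell_ind P) * ennreal (K P) \<partial>lborel) = (\<integral>\<^sup>+x. ennreal (H (x, two_scales \<epsilon> x)) \<partial>lborel)"
    proof -
      have m: "(\<lambda>P. ennreal (cell_ind P) * ennreal (K P)) \<in> borel_measurable borel"
        using Km by (intro borel_measurable_times_ennreal measurable_compose[OF _ measurable_ennreal] measurable_cell_ind)
      then have m': "(\<lambda>(x, w). ennreal (indicator ucell w) * ennreal (K (x, w))) \<in> borel_measurable (lborel \<Otimes>\<^sub>M lborel)"
        by (simp add: lborel_prod split_beta' cell_ind_def)
      have "(\<integral>\<^sup>+P. ennreal (cell_ind P) * ennreal (K P) \<partial>lborel)
          = (\<integral>\<^sup>+x. (\<integral>\<^sup>+w. ennreal (indicator ucell w) * ennreal (K (x, w)) \<partial>lborel) \<partial>lborel)"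
        by (subst nn_integral_lborel_prod[OF m]) (simp add: cell_ind_pair)
      also have "\<dots> = (\<integral>\<^sup>+w. (\<integral>\<^sup>+x. ennreal (indicator ucell w) * ennreal (K (x, w)) \<partial>lborel) \<partial>lborel)"
        by (rule lborel_pair.Fubini'[OF m', symmetric])
      also have "\<dots> = (\<integral>\<^sup>+w. (\<integral>\<^sup>+x. ennreal (H (x, two_scales \<epsilon> x)) \<partial>lborel) * indicator (ucell :: ('b \<times> 'b) set) w \<partial>lborel)"
      proof (rule nn_integral_cong)
        fix w :: "'b \<times> 'b"
        have "(\<integral>\<^sup>+x. ennreal (H (x + S w, two_scales \<epsilon> (x + S w))) \<partial>lborel) = (\<integral>\<^sup>+x. ennreal (H (x, two_scales \<epsilon> x)) \<partial>lborel)"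
          using f_m by (intro nn_integral_lborel_shift measurable_compose[OF _ measurable_ennreal])
        then show "(\<integral>\<^sup>+x. ennreal (indicator ucell w) * ennreal (K (x, w)) \<partial>lborel)
            = (\<integral>\<^sup>+x. ennreal (H (x, two_scales \<epsilon> x)) \<partial>lborel) * indicator (ucell :: ('b \<times> 'b) set) w"
          by (cases "w \<in> ucell") (simp_all add: K_def)
      qed
      also have "\<dots> = (\<integral>\<^sup>+x. ennreal (H (x, two_scales \<epsilon> x)) \<partial>lborel)"
        by (subst nn_integral_cmult_indicator) (simp_all add: emeasure_ucell)
      finally show ?thesis .
    qed
    have 2: "(\<integral>\<^sup>+P. ennreal (cell_ind P) * ennreal (L P) \<partial>lborel) = (\<integral>\<^sup>+P. ennreal (cell_ind P) * ennreal (H P) \<partial>lborel)"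
      unfolding L_def
    proof (rule nn_integral_shear[where H = "\<lambda>P. ennreal (H P)", OF _ _ \<epsilon>(1)])
      show "periodic (\<lambda>w. ennreal (H (x, w)))" for x using H by (simp add: test_fun_def periodic_def)
    qed measurable
    have fin: "(\<integral>\<^sup>+P. ennreal (cell_ind P) * ennreal (H P) \<partial>lborel) < \<infinity>" "(\<integral>\<^sup>+x. ennreal (H (x, two_scales \<epsilon> x)) \<partial>lborel) < \<infinity>"
    proof -
      have b: "ennreal (H (x, w)) \<le> ennreal C * indicator (cball 0 R) x" for x w
        using C[of "(x, w)"] R[of x w] by (cases "R < norm x") (auto intro: ennreal_leI)
      have f1: "(\<integral>\<^sup>+x. ennreal C * indicator (cball (0::'b) R) x \<partial>lborel) < \<infinity>"
        by (subst nn_integral_cmult_indicator) (simp_all add: emeasure_cball_eq ennreal_mult_less_top)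
      show "(\<integral>\<^sup>+x. ennreal (H (x, two_scales \<epsilon> x)) \<partial>lborel) < \<infinity>"
        by (rule order_le_less_trans[OF nn_integral_mono f1]) (rule b)
      have "(\<integral>\<^sup>+P. ennreal (cell_ind P) * ennreal (H P) \<partial>lborel) \<le> (\<integral>\<^sup>+P. ennreal C * indicator (cball (0::'b) R \<times> (ucell :: ('b \<times> 'b) set)) P \<partial>lborel)"
      proof (rule nn_integral_mono)
        fix P :: "'b \<times> ('b \<times> 'b)"
        show "ennreal (cell_ind P) * ennreal (H P) \<le> ennreal C * indicator (cball 0 R \<times> ucell) P"
          using b[of "fst P" "snd P"] by (cases P) (auto simp: cell_ind_def indicator_def split: if_splits)
      qed
      also have "\<dots> = ennreal C * emeasure lborel (cball (0::'b) R \<times> (ucell :: ('b \<times> 'b) set))"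
      proof (rule nn_integral_cmult_indicator)
        have "cball (0::'b) R \<times> (ucell :: ('b \<times> 'b) set) \<in> sets (borel \<Otimes>\<^sub>M borel)" by (intro pair_measureI) auto
        then show "cball (0::'b) R \<times> (ucell :: ('b \<times> 'b) set) \<in> sets lborel" unfolding borel_prod by simp
      qed
      also have "\<dots> < \<infinity>" by (simp add: emeasure_cball_cell ennreal_mult_less_top)
      finally show "(\<integral>\<^sup>+P. ennreal (cell_ind P) * ennreal (H P) \<partial>lborel) < \<infinity>" .
    qed
    have conv: "integrable lborel (\<lambda>P. cell_ind P * F P)" "ennreal (\<integral>P. cell_ind P * F P \<partial>lborel) = (\<integral>\<^sup>+P. ennreal (cell_ind P) * ennreal (F P) \<partial>lborel)"
      if F: "F \<in> borel_measurable borel" "\<And>P. 0 \<le> F P" "(\<integral>\<^sup>+P. ennreal (cell_ind P) * ennreal (F P) \<partial>lborel) < \<infinity>" for F :: "'b \<times> ('b \<times> 'b) \<Rightarrow> real"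
    proof -
      have e: "ennreal (cell_ind P * F P) = ennreal (cell_ind P) * ennreal (F P)" for P
        by (rule ennreal_mult[OF cell_ind_nonneg F(2)])
      have p: "0 \<le> cell_ind P * F P" for P by (intro mult_nonneg_nonneg cell_ind_nonneg F(2))
      show i: "integrable lborel (\<lambda>P. cell_ind P * F P)"
      proof (rule integrableI_nonneg)
        show "(\<lambda>P. cell_ind P * F P) \<in> borel_measurable lborel" using F(1) by (intro borel_measurable_times) simp_all
        show "(\<integral>\<^sup>+P. ennreal (cell_ind P * F P) \<partial>lborel) < \<infinity>" using F(3) by (simp only: e)
      qed (simp add: p)
      show "ennreal (\<integral>P. cell_ind P * F P \<partial>lborel) = (\<integral>\<^sup>+P. ennreal (cell_ind P) * ennreal (F P) \<partial>lborel)"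
        by (subst nn_integral_eq_integral[OF i, symmetric]) (simp_all add: p e)
    qed
    have pos: "0 \<le> (\<integral>P. cell_ind P * F P \<partial>lborel)" if "\<And>P. 0 \<le> F P" for F :: "'b \<times> ('b \<times> 'b) \<Rightarrow> real"
      by (intro Bochner_Integration.integral_nonneg mult_nonneg_nonneg cell_ind_nonneg that)
    note cK = conv[OF Km K0] note cL = conv[OF Lm L0] note cH = conv[OF Hm H0 fin(1)]
    have iK: "integrable lborel (\<lambda>P. cell_ind P * K P)" by (rule cK(1)) (simp only: 1 fin(2))
    have iL: "integrable lborel (\<lambda>P. cell_ind P * L P)" by (rule cL(1)) (simp only: 2 fin(1))
    have eqL: "(\<integral>P. cell_ind P * L P \<partial>lborel) = (\<integral>P. cell_ind P * H P \<partial>lborel)"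
    proof -
      have "ennreal (\<integral>P. cell_ind P * L P \<partial>lborel) = ennreal (\<integral>P. cell_ind P * H P \<partial>lborel)"
        by (subst cL(2), simp only: 2 fin(1)) (simp only: 2 cH(2))
      then show ?thesis using pos[OF L0] pos[OF H0] by simp
    qed
    have eqK: "(\<integral>P. cell_ind P * K P \<partial>lborel) = (\<integral>x. H (x, two_scales \<epsilon> x) \<partial>lborel)"
    proof -
      have "integrable lborel (\<lambda>x. H (x, two_scales \<epsilon> x))"
        using f_m H0 fin(2) by (intro integrableI_nonneg) auto
      then have "ennreal (\<integral>x. H (x, two_scales \<epsilon> x) \<partial>lborel) = (\<integral>\<^sup>+x. ennreal (H (x, two_scales \<epsilon> x)) \<partial>lborel)"
        using H0 by (intro nn_integral_eq_integral[symmetric]) auto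
      moreover have "ennreal (\<integral>P. cell_ind P * K P \<partial>lborel) = (\<integral>\<^sup>+x. ennreal (H (x, two_scales \<epsilon> x)) \<partial>lborel)"
        by (subst cK(2), simp only: 1 fin(2)) (simp only: 1)
      ultimately have "ennreal (\<integral>P. cell_ind P * K P \<partial>lborel) = ennreal (\<integral>x. H (x, two_scales \<epsilon> x) \<partial>lborel)" by simp
      then show ?thesis using pos[OF K0] H0 by (simp add: Bochner_Integration.integral_nonneg)
    qed
    have close: "norm (cell_ind P * K P - cell_ind P * L P) \<le> \<omega> * indicator (cball 0 (R + 2 * c) \<times> ucell) P" for P :: "'b \<times> ('b \<times> 'b)"
    proof -
      obtain x r s where P: "P = (x, r, s)" by (cases P) auto
      show ?thesis
      proof (cases "r \<in> ucell \<and> s \<in> ucell")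
        case False
        then show ?thesis using \<omega> by (simp add: P cell_ind_pair ucell_Pair)
      next
        case True
        then have nr: "norm r \<le> c" and ns: "norm s \<le> c" and ci: "cell_ind P = 1"
          using c(2) by (auto simp: P cell_ind_pair ucell_Pair)
        have e2: "\<epsilon>\<^sup>2 \<le> \<epsilon>" using \<epsilon> by (simp add: power2_eq_square mult_left_le)
        have t1: "norm (\<epsilon> *\<^sub>R r) \<le> \<epsilon> * c" "norm (\<epsilon> *\<^sub>R s) \<le> \<epsilon> * c" using \<epsilon> nr ns by (simp_all add: mult_left_mono)
        have "\<epsilon>\<^sup>2 * norm s \<le> \<epsilon> * c" using e2 ns \<epsilon> by (intro mult_mono) auto
        then have t2: "norm (\<epsilon>\<^sup>2 *\<^sub>R s) \<le> \<epsilon> * c" by simp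
        have nS: "norm (S (r, s)) \<le> \<epsilon> * c + \<epsilon> * c"
          unfolding S_def fst_conv snd_conv by (rule order_trans[OF norm_triangle_ineq add_mono[OF t1(1) t2]])
        have "\<epsilon> * c \<le> 1 * c" using \<epsilon> c by (intro mult_right_mono) auto
        then have nS2: "norm (S (r, s)) \<le> 2 * c" using nS by linarith
        have sc: "two_scales \<epsilon> (x + S (r, s)) = (fst (two_scales \<epsilon> x) + r + \<epsilon> *\<^sub>R s, snd (two_scales \<epsilon> x) + r /\<^sub>R \<epsilon> + s)"
          using \<epsilon>(1) by (simp add: two_scales_def S_def scaleR_add_right power2_eq_square algebra_simps)
        show ?thesis
        proof (cases "R + 2 * c < norm x")
          case True
          have "norm x \<le> norm (x + S (r, s)) + norm (S (r, s))" using norm_triangle_ineq4[of "x + S (r, s)" "S (r, s)"] by simp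
          then have "R < norm (x + S (r, s))" "R < norm x" using True nS2 c(1) by linarith+
          then have "K P = 0" "L P = 0" by (simp_all add: K_def L_def P R)
          then show ?thesis using \<omega> by simp
        next
          case False
          have "dist (x + S (r, s), two_scales \<epsilon> (x + S (r, s))) (x, fst (two_scales \<epsilon> x) + r, snd (two_scales \<epsilon> x) + r /\<^sub>R \<epsilon> + s)
              = norm (S (r, s), (\<epsilon> *\<^sub>R s, 0 :: 'b))"
            unfolding sc dist_norm by simp
          also have "\<dots> \<le> norm (S (r, s)) + norm (\<epsilon> *\<^sub>R s, 0 :: 'b)" by (rule norm_Pair_le)
          also have "norm (\<epsilon> *\<^sub>R s, 0 :: 'b) = norm (\<epsilon> *\<^sub>R s)" by (simp add: norm_Pair)
          finally have "dist (x + S (r, s), two_scales \<epsilon> (x + S (r, s))) (x, fst (two_scales \<epsilon> x) + r, snd (two_scales \<epsilon> x) + r /\<^sub>R \<epsilon> + s) < d"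
            using nS t1 \<epsilon>(3) by linarith
          from d(2)[OF this] have "norm (K P - L P) \<le> \<omega>" by (simp add: K_def L_def P dist_norm)
          then show ?thesis using False True ci by (simp add: P ucell_Pair)
        qed
      qed
    qed
    have ig: "integrable lborel (\<lambda>P. \<omega> * indicator (cball (0::'b) (R + 2 * c) \<times> (ucell :: ('b \<times> 'b) set)) P)"
      and Ig: "(\<integral>P. \<omega> * indicator (cball (0::'b) (R + 2 * c) \<times> (ucell :: ('b \<times> 'b) set)) P \<partial>lborel) = \<omega> * \<beta>"
    proof -
      have m: "cball (0::'b) (R + 2 * c) \<times> (ucell :: ('b \<times> 'b) set) \<in> sets lborel"
      proof -
        have "cball (0::'b) (R + 2 * c) \<times> (ucell :: ('b \<times> 'b) set) \<in> sets (borel \<Otimes>\<^sub>M borel)" by (intro pair_measureI) auto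
        then show ?thesis unfolding borel_prod by simp
      qed
      then show "integrable lborel (\<lambda>P. \<omega> * indicator (cball (0::'b) (R + 2 * c) \<times> (ucell :: ('b \<times> 'b) set)) P)"
        by (intro integrable_mult_right integrable_real_indicator) (simp_all add: emeasure_cball_cell)
      show "(\<integral>P. \<omega> * indicator (cball (0::'b) (R + 2 * c) \<times> (ucell :: ('b \<times> 'b) set)) P \<partial>lborel) = \<omega> * \<beta>"
        using m by (simp add: measure_def emeasure_cball_cell \<beta>_def)
    qed
    have "norm ((\<integral>P. cell_ind P * K P \<partial>lborel) - (\<integral>P. cell_ind P * L P \<partial>lborel)) = norm (\<integral>P. cell_ind P * K P - cell_ind P * L P \<partial>lborel)"
      by (simp only: Bochner_Integration.integral_diff[OF iK iL])
    also have "\<dots> \<le> \<omega> * \<beta>"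
      unfolding Ig[symmetric]
      by (rule norm_integral_le[OF Bochner_Integration.integrable_diff[OF iK iL] ig]) (rule AE_I2, rule close)
    finally show "dist (\<integral>x. H (x, two_scales (e n) x) \<partial>lborel) (\<integral>P. cell_ind P * H P \<partial>lborel) < \<eta>"
      using \<omega>\<beta> unfolding eqK eqL \<epsilon>_def dist_norm by linarith
  qed
qed

section \<open>Tightness of strongly convergent sequences\<close>

text \<open>
  A continuous periodic approximation of the constant 1 that vanishes on the boundary of the cell
  and its translates.
\<close>

definition bump :: "real \<Rightarrow> 'c::euclidean_space \<Rightarrow> real" where
  "bump j w = min 1 (j * (\<Prod>b\<in>Basis. (sin (pi * (w \<bullet> b)))\<^sup>2))"

lemma bump_bounds: "0 \<le> j \<Longrightarrow> 0 \<le> bump j w" "bump j w \<le> 1"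
  by (auto simp: bump_def intro!: mult_nonneg_nonneg prod_nonneg)

lemma continuous_on_bump: "continuous_on S (bump j)"
  unfolding bump_def[abs_def] by (intro continuous_intros)

lemma bump_periodic: "lattice_point k \<Longrightarrow> bump j (w + k) = bump j w"
proof -
  assume k: "lattice_point k"
  have "(sin (pi * ((w + k) \<bullet> b)))\<^sup>2 = (sin (pi * (w \<bullet> b)))\<^sup>2" if "b \<in> Basis" for b
  proof -
    obtain i where i: "k \<bullet> b = of_int i" using k \<open>b \<in> Basis\<close> by (auto simp: lattice_point_def elim: Ints_cases)
    have "sin (pi * ((w + k) \<bullet> b)) = sin (pi * (w \<bullet> b)) * cos (pi * of_int i)"
      by (simp add: inner_add_left distrib_left sin_add i)
    then show ?thesis by (simp add: power_mult_distrib)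
  qed
  then show ?thesis unfolding bump_def by (simp cong: prod.cong)
qed

lemma bump_zero:
  assumes b: "b \<in> Basis" and w: "w \<bullet> b \<in> \<int>" shows "bump j w = 0"
proof -
  obtain i where "w \<bullet> b = of_int i" using w by (auto elim: Ints_cases)
  then have "(sin (pi * (w \<bullet> b)))\<^sup>2 = 0" by simp
  then have z: "(\<Prod>b\<in>Basis. (sin (pi * (w \<bullet> b)))\<^sup>2) = 0"
    using b by (intro prod_zero) auto
  show ?thesis unfolding bump_def z by simp
qed

lemma bump_eventually_one:
  assumes w: "\<And>b. b \<in> Basis \<Longrightarrow> 0 < w \<bullet> b \<and> w \<bullet> b < 1"
  shows "eventually (\<lambda>j::nat. bump (real j) w = 1) sequentially"
proof -
  define c where "c = (\<Prod>b\<in>Basis. (sin (pi * (w \<bullet> b)))\<^sup>2)"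
  have s: "0 < sin (pi * (w \<bullet> b))" if "b \<in> Basis" for b
    using w[OF that] by (intro sin_gt_zero) auto
  have c: "0 < c" unfolding c_def by (intro prod_pos zero_less_power s)
  obtain J :: nat where J: "1 / c \<le> real J" using real_arch_simple by blast
  show ?thesis
  proof (rule eventually_sequentiallyI[of J])
    fix j assume "J \<le> j"
    then have "1 / c \<le> real j" using J by linarith
    then have "1 \<le> real j * c" using c by (simp add: field_simps)
    then show "bump (real j) w = 1" by (simp add: bump_def c_def)
  qed
qed

definition clip :: "real \<Rightarrow> 'a::real_normed_vector \<Rightarrow> 'a" where
  "clip M v = (M / max M (norm v)) *\<^sub>R v"

lemma norm_clip_le: "0 < M \<Longrightarrow> norm (clip M v) \<le> M"
  by (auto simp: clip_def max_def divide_simps)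

lemma clip_eq: "0 < M \<Longrightarrow> norm v \<le> M \<Longrightarrow> clip M v = v"
  by (simp add: clip_def max_def)

lemma continuous_on_clip: "0 < M \<Longrightarrow> continuous_on S (clip M)"
  unfolding clip_def[abs_def] by (intro continuous_intros) (auto simp: max_def)

lemma AE_interior_ucell: "AE w in lborel. w \<in> (ucell :: 'c::euclidean_space set) \<longrightarrow> (\<forall>b\<in>Basis. 0 < w \<bullet> b \<and> w \<bullet> b < 1)"
proof -
  have "negligible (cbox 0 One - box 0 (One :: 'c))" by (rule negligible_frontier_interval)
  then have "AE w in lebesgue. w \<notin> cbox 0 One - box 0 (One :: 'c)"
    by (intro AE_not_in) (simp add: negligible_iff_null_sets)
  then have "AE w in lborel. w \<notin> cbox 0 One - box 0 (One :: 'c)" by (simp only: AE_completion_iff)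
  then show ?thesis
  proof eventually_elim
    fix w :: 'c assume w: "w \<notin> cbox 0 One - box 0 One"
    show "w \<in> ucell \<longrightarrow> (\<forall>b\<in>Basis. 0 < w \<bullet> b \<and> w \<bullet> b < 1)"
    proof
      assume "w \<in> ucell"
      then have "w \<in> box 0 One" using w ucell_bounds(2) by blast
      then show "\<forall>b\<in>Basis. 0 < w \<bullet> b \<and> w \<bullet> b < 1" by (simp add: mem_box)
    qed
  qed
qed

lemma AE_snd_lborel:
  assumes "AE x in lborel. Q x"
  shows "AE P in (lborel :: ('b::euclidean_space \<times> 'c::euclidean_space) measure). Q (snd P)"
proof -
  obtain N where N: "N \<in> null_sets lborel" "\<And>x. x \<in> space lborel - N \<Longrightarrow> Q x"
    using assms by (auto elim!: AE_E3)
  have "emeasure (lborel \<Otimes>\<^sub>M lborel) ((UNIV :: 'b set) \<times> N) = emeasure lborel (UNIV :: 'b set) * emeasure lborel N"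
    using N(1) by (intro lborel.emeasure_pair_measure_Times) auto
  also have "\<dots> = 0" by (simp add: null_setsD1[OF N(1)])
  finally have "emeasure lborel ((UNIV :: 'b set) \<times> N) = 0" by (simp only: lborel_prod)
  moreover have "(UNIV :: 'b set) \<times> N \<in> sets lborel"
  proof -
    have "(UNIV :: 'b set) \<times> N \<in> sets (borel \<Otimes>\<^sub>M borel)" using N(1) by (intro pair_measureI) auto
    then show ?thesis unfolding borel_prod by simp
  qed
  ultimately have "(UNIV :: 'b set) \<times> N \<in> null_sets lborel" by (rule null_setsI)
  then show ?thesis
  proof (rule AE_I')
    show "{P \<in> space lborel. \<not> Q (snd P)} \<subseteq> (UNIV :: 'b set) \<times> N"
    proof
      fix P :: "'b \<times> 'c" assume "P \<in> {P \<in> space lborel. \<not> Q (snd P)}"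
      then have "snd P \<in> N" using N(2)[of "snd P"] by auto
      then show "P \<in> (UNIV :: 'b set) \<times> N" by (simp add: mem_Times_iff)
    qed
  qed
qed

text \<open>
  Continuous approximations are made periodic by reading them on the unit cell only. The factor
  \<open>bump\<close> vanishes where the fractional part jumps and so restores continuity.
\<close>

lemma test_fun_dense:
  fixes g :: "'b::euclidean_space \<times> 'c::euclidean_space \<Rightarrow> 'a::euclidean_space"
  assumes g: "g \<in> borel_measurable borel" and M: "0 < M" and gM: "\<And>P. norm (g P) \<le> M"
    and g0: "\<And>x w. k < norm x \<Longrightarrow> g (x, w) = 0"
  shows "\<exists>\<psi>. (\<forall>j::nat. test_fun (\<psi> j)) \<and> (\<forall>j P. norm (\<psi> j P) \<le> M)
      \<and> (\<forall>j x w. k + 1 < norm x \<longrightarrow> \<psi> j (x, w) = 0)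
      \<and> (AE P in lborel. snd P \<in> ucell \<longrightarrow> (\<lambda>j. \<psi> j P) \<longlonglongrightarrow> g P)"
proof -
  have "g measurable_on UNIV"
    by (intro lebesgue_measurable_imp_measurable_on measurable_completion) (use g in simp_all)
  then obtain N G where N: "negligible N" and G: "\<And>j::nat. continuous_on UNIV (G j)"
    and Gl: "\<And>P. P \<notin> N \<Longrightarrow> (\<lambda>j. G j P) \<longlonglongrightarrow> g P"
    unfolding measurable_on_def by auto
  define F where "F j P = clip M (G j (fst P, vfrac (snd P)))" for j and P :: "'b \<times> 'c"
  define \<psi> where "\<psi> j P = (cutoff k (fst P) * bump (real j) (snd P)) *\<^sub>R F j P" for j P
  have FM: "norm (F j P) \<le> M" for j P unfolding F_def by (rule norm_clip_le[OF M])
  have \<psi>b: "norm (\<psi> j P) \<le> bump (real j) (snd P) * M" for j P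
  proof -
    have "cutoff k (fst P) * bump (real j) (snd P) \<le> 1 * bump (real j) (snd P)"
      by (intro mult_right_mono cutoff_bounds bump_bounds) simp
    then have "cutoff k (fst P) * bump (real j) (snd P) * norm (F j P) \<le> bump (real j) (snd P) * M"
      using FM[of j P] bump_bounds[of "real j" "snd P"] by (intro mult_mono) auto
    then show ?thesis using cutoff_bounds[of k "fst P"] bump_bounds[of "real j" "snd P"] by (simp add: \<psi>_def)
  qed
  have \<psi>M: "norm (\<psi> j P) \<le> M" for j P
  proof -
    have "bump (real j) (snd P) * M \<le> 1 * M" using M by (intro mult_right_mono bump_bounds) simp
    then show ?thesis using \<psi>b[of j P] by linarith
  qed
  have cut0: "\<psi> j (x, w) = 0" if "k + 1 < norm x" for j x w
    using that by (simp add: \<psi>_def cutoff_zero)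
  have cont_bump: "continuous_on UNIV (\<lambda>P::'b \<times> 'c. bump (real j) (snd P))" for j
    by (rule continuous_on_compose2[OF continuous_on_bump[of UNIV "real j"]]) (auto intro!: continuous_intros)
  have cont_cut: "continuous_on UNIV (\<lambda>P::'b \<times> 'c. cutoff k (fst P))"
    by (rule continuous_on_compose2[OF continuous_on_cutoff[of UNIV k]]) (auto intro!: continuous_intros)
  have contH: "isCont (\<psi> j) P" for j P
  proof (cases "\<exists>b\<in>Basis. snd P \<bullet> b \<in> \<int>")
    case True
    then have z: "bump (real j) (snd P) = 0" using bump_zero by blast
    then have "\<psi> j P = 0" by (simp add: \<psi>_def)
    moreover have "(\<lambda>Q. bump (real j) (snd Q) * M) \<midarrow>P\<rightarrow> bump (real j) (snd P) * M"
    proof (intro tendsto_mult tendsto_const)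
      have "isCont (\<lambda>Q::'b \<times> 'c. bump (real j) (snd Q)) P"
        by (rule continuous_on_interior[OF cont_bump]) simp
      then show "(\<lambda>Q. bump (real j) (snd Q)) \<midarrow>P\<rightarrow> bump (real j) (snd P)" by (rule isContD)
    qed
    then have "(\<lambda>Q. bump (real j) (snd Q) * M) \<midarrow>P\<rightarrow> 0" by (simp only: z mult_zero_left)
    then have "(\<lambda>Q. \<psi> j Q) \<midarrow>P\<rightarrow> 0"
      by (rule Lim_null_comparison[rotated]) (intro always_eventually allI \<psi>b)
    ultimately show ?thesis by (simp add: isCont_def)
  next
    case False
    have "isCont (\<lambda>Q::'b \<times> 'c. vfrac (snd Q)) P"
    proof -
      have vf: "vfrac w = (\<Sum>b\<in>Basis. frac (w \<bullet> b) *\<^sub>R b)" for w :: 'c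
        by (rule euclidean_eqI) (simp add: vfrac_inner inner_sum_left inner_Basis if_distrib cong: if_cong)
      have fr: "isCont (\<lambda>Q::'b \<times> 'c. frac (snd Q \<bullet> b)) P" if b: "b \<in> Basis" for b
      proof (rule isCont_o2[where g = frac])
        show "isCont (\<lambda>Q::'b \<times> 'c. snd Q \<bullet> b) P" by (intro continuous_intros)
        show "isCont frac (snd P \<bullet> b)" using False b by (intro continuous_frac) auto
      qed
      show ?thesis unfolding vf by (intro continuous_sum continuous_scaleR continuous_const fr)
    qed
    then have "isCont (\<lambda>Q::'b \<times> 'c. (fst Q, vfrac (snd Q))) P"
      by (intro continuous_Pair) (auto intro!: continuous_intros)
    moreover have "isCont (G j) (fst P, vfrac (snd P))" by (rule continuous_on_interior[OF G]) simp
    ultimately have "isCont (\<lambda>Q. G j (fst Q, vfrac (snd Q))) P" by (rule isCont_o2)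
    moreover have "isCont (clip M) (G j (fst P, vfrac (snd P)))"
      by (rule continuous_on_interior[OF continuous_on_clip[OF M, of UNIV]]) simp
    ultimately have "isCont (F j) P" unfolding F_def[abs_def] by (rule isCont_o2)
    moreover have "isCont (\<lambda>P::'b \<times> 'c. bump (real j) (snd P)) P" "isCont (\<lambda>P::'b \<times> 'c. cutoff k (fst P)) P"
      by (rule continuous_on_interior[OF cont_bump], simp, rule continuous_on_interior[OF cont_cut], simp)
    ultimately show ?thesis unfolding \<psi>_def[abs_def] by (intro continuous_scaleR continuous_mult)
  qed
  have tf: "test_fun (\<psi> j)" for j
    unfolding test_fun_def
  proof (intro conjI allI)
    show "continuous_on UNIV (\<psi> j)" by (intro continuous_at_imp_continuous_on ballI contH)
    show "periodic (\<lambda>w. \<psi> j (x, w))" for x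
      by (simp add: periodic_def \<psi>_def F_def bump_periodic vfrac_add_lattice_point)
    show "\<exists>R. \<forall>x w. R < norm x \<longrightarrow> \<psi> j (x, w) = 0" using cut0 by blast
  qed
  have "AE P in lebesgue. P \<notin> N" using N by (intro AE_not_in) (simp add: negligible_iff_null_sets)
  then have "AE P in lborel. P \<notin> N" by (simp only: AE_completion_iff)
  then have "AE P in lborel. snd P \<in> ucell \<longrightarrow> (\<lambda>j. \<psi> j P) \<longlonglongrightarrow> g P"
    using AE_snd_lborel[OF AE_interior_ucell]
  proof eventually_elim
    fix P :: "'b \<times> 'c" assume P: "P \<notin> N" and int: "snd P \<in> ucell \<longrightarrow> (\<forall>b\<in>Basis. 0 < snd P \<bullet> b \<and> snd P \<bullet> b < 1)"
    show "snd P \<in> ucell \<longrightarrow> (\<lambda>j. \<psi> j P) \<longlonglongrightarrow> g P"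
    proof
      assume c: "snd P \<in> ucell"
      have Pv: "(fst P, vfrac (snd P)) = P" by (simp add: vfrac_ucell[OF c])
      have clipc: "isCont (clip M) (g P)"
        by (rule continuous_on_interior[OF continuous_on_clip[OF M, of UNIV]]) simp
      have "(\<lambda>j. F j P) \<longlonglongrightarrow> clip M (g P)"
        unfolding F_def Pv by (rule isCont_tendsto_compose[OF clipc Gl[OF P]])
      then have Fl: "(\<lambda>j. F j P) \<longlonglongrightarrow> g P" by (simp only: clip_eq[OF M gM])
      have "eventually (\<lambda>j::nat. bump (real j) (snd P) = 1) sequentially"
        using int c by (intro bump_eventually_one) blast
      then have bl: "(\<lambda>j::nat. bump (real j) (snd P)) \<longlonglongrightarrow> 1" by (rule tendsto_eventually)
      have "(\<lambda>j. \<psi> j P) \<longlonglongrightarrow> (cutoff k (fst P) * 1) *\<^sub>R g P"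
        unfolding \<psi>_def by (intro tendsto_scaleR tendsto_mult tendsto_const bl Fl)
      moreover have "(cutoff k (fst P) * 1) *\<^sub>R g P = g P"
        using g0[of "fst P" "snd P"] cutoff_one[of "fst P" k] by (cases "k < norm (fst P)") auto
      ultimately show "(\<lambda>j. \<psi> j P) \<longlonglongrightarrow> g P" by simp
    qed
  qed
  then show ?thesis using tf \<psi>M cut0 by (intro exI[of _ \<psi>]) blast
qed

lemma test_fun_norm_powr:
  assumes \<psi>: "test_fun \<psi>" and r: "0 < r"
  shows "test_fun (\<lambda>P. norm (\<psi> P) powr r)"
proof -
  obtain R where R: "\<And>x w. R < norm x \<Longrightarrow> \<psi> (x, w) = 0" using \<psi> unfolding test_fun_def by blast
  have "continuous_on UNIV (\<lambda>P. norm (\<psi> P) powr r)"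
    using \<psi> r by (intro continuous_on_powr' continuous_on_norm continuous_on_const) (auto simp: test_fun_def)
  moreover have "periodic (\<lambda>w. norm (\<psi> (x, w)) powr r)" for x using \<psi> by (simp add: test_fun_def periodic_def)
  moreover have "\<exists>R. \<forall>x w. R < norm x \<longrightarrow> norm (\<psi> (x, w)) powr r = 0"
    using R by (intro exI[of _ R] allI impI) (simp add: R)
  ultimately show ?thesis unfolding test_fun_def by blast
qed

lemma integrable_cell_cball:
  "integrable lborel (\<lambda>P :: 'b::euclidean_space \<times> 'c::euclidean_space. indicator (cball (0::'b) r \<times> (ucell :: 'c set)) P :: real)"
proof (rule integrable_real_indicator)
  have "cball (0::'b) r \<times> (ucell :: 'c set) \<in> sets (borel \<Otimes>\<^sub>M borel)" by (intro pair_measureI) auto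
  then show "cball (0::'b) r \<times> (ucell :: 'c set) \<in> sets lborel" unfolding borel_prod by simp
  show "emeasure lborel (cball (0::'b) r \<times> (ucell :: 'c set)) < \<infinity>" by (simp add: emeasure_cball_cell)
qed

text \<open>
  Tested against (an approximation of) \<open>\<bar>V0\<bar>\<^sup>q / V0\<close>, supported in a large ball, the weak
  convergence bounds the mass of \<open>\<bar>V n\<bar>\<^sup>q\<close> in this ball from below by almost all of the mass of
  \<open>\<bar>V0\<bar>\<^sup>q\<close>. As the total masses converge, little remains outside.
\<close>

lemma tight_of_norm_convergence:
  fixes V :: "nat \<Rightarrow> 'b::euclidean_space \<Rightarrow> 'a::{real_normed_field, euclidean_space}"
    and V0 :: "'b \<times> ('b \<times> 'b) \<Rightarrow> 'a"
  assumes V[measurable]: "\<And>n. V n \<in> borel_measurable borel" and V0[measurable]: "V0 \<in> borel_measurable borel"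
    and q: "1 < q"
    and Vi: "\<And>n. integrable lborel (\<lambda>x. norm (V n x) powr q)"
    and V0i: "integrable lborel (\<lambda>P. cell_ind P * norm (V0 P) powr q)"
    and normlim: "(\<lambda>n. \<integral>x. norm (V n x) powr q \<partial>lborel) \<longlonglongrightarrow> (\<integral>P. cell_ind P * norm (V0 P) powr q \<partial>lborel)"
    and weak: "\<And>H. test_fun H \<Longrightarrow> (\<lambda>n. \<integral>x. V n x * H (x, two_scales (e n) x) \<partial>lborel) \<longlonglongrightarrow> (\<integral>P. cell_ind P *\<^sub>R (V0 P * H P) \<partial>lborel)"
    and e: "\<And>n. 0 < e n" "\<And>n. e n \<le> 1" "e \<longlonglongrightarrow> 0" and \<delta>: "0 < \<delta>"
  shows "\<exists>\<rho>. eventually (\<lambda>n. (\<integral>\<^sup>+x. indicator {x. \<rho> < norm x} x * ennreal (norm (V n x) powr q) \<partial>lborel) \<le> ennreal \<delta>) sequentially"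
proof -
  define q' where "q' = 1 / (1 - 1 / q)"
  have q': "1 < q'" "1 / q + 1 / q' = 1" using q by (simp_all add: q'_def field_simps)
  have qq': "(q - 1) * q' = q" "q / q' = q - 1" using q by (simp_all add: q'_def field_simps)
  define I0 where "I0 = (\<integral>P. cell_ind P * norm (V0 P) powr q \<partial>lborel)"
  (* The budget for three errors: the truncation to E k below and the two approximations of the
     dual function, which enter the final estimate with total weight 2 * q. *)
  define \<delta>' where "\<delta>' = \<delta> / (4 * q)"
  have \<delta>': "0 < \<delta>'" "2 * q * \<delta>' < \<delta>" using \<delta> q by (simp_all add: \<delta>'_def)
  have mfst: "(\<lambda>P::'b \<times> ('b \<times> 'b). norm (fst P)) \<in> borel_measurable borel"
    by (simp add: borel_measurable_continuous_onI continuous_on_fst continuous_on_id continuous_on_norm)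
  define E where "E k = {P :: 'b \<times> ('b \<times> 'b). norm (fst P) \<le> real k \<and> norm (V0 P) \<le> real k}" for k :: nat
  have Em[measurable]: "E k \<in> sets borel" for k
  proof -
    have "E k = {P \<in> space borel. norm (fst P) \<le> real k} \<inter> {P \<in> space borel. norm (V0 P) \<le> real k}"
      by (auto simp: E_def)
    also have "\<dots> \<in> sets borel"
      using mfst by (intro sets.Int borel_measurable_le) simp_all
    finally show ?thesis .
  qed
  have IE_lim: "(\<lambda>k. \<integral>P. indicator (E k) P * (cell_ind P * norm (V0 P) powr q) \<partial>lborel) \<longlonglongrightarrow> I0"
    unfolding I0_def
  proof (rule integral_dominated_convergence[where w = "\<lambda>P. cell_ind P * norm (V0 P) powr q"])
    show "AE P in lborel. (\<lambda>k. indicator (E k) P * (cell_ind P * norm (V0 P) powr q)) \<longlonglongrightarrow> cell_ind P * norm (V0 P) powr q"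
    proof (rule AE_I2)
      fix P :: "'b \<times> ('b \<times> 'b)"
      obtain K :: nat where K: "max (norm (fst P)) (norm (V0 P)) \<le> real K" using real_arch_simple by blast
      show "(\<lambda>k. indicator (E k) P * (cell_ind P * norm (V0 P) powr q)) \<longlonglongrightarrow> cell_ind P * norm (V0 P) powr q"
      proof (rule tendsto_eventually, rule eventually_sequentiallyI[of K])
        fix k assume "K \<le> k"
        then have "P \<in> E k" using K by (auto simp: E_def)
        then show "indicator (E k) P * (cell_ind P * norm (V0 P) powr q) = cell_ind P * norm (V0 P) powr q" by simp
      qed
    qed
    show "AE P in lborel. norm (indicator (E k) P * (cell_ind P * norm (V0 P) powr q)) \<le> cell_ind P * norm (V0 P) powr q" for k
      by (intro AE_I2) (simp add: indicator_def cell_ind_nonneg)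
  qed (use V0i in measurable)
  have "eventually (\<lambda>k. I0 - \<delta>' < (\<integral>P. indicator (E k) P * (cell_ind P * norm (V0 P) powr q) \<partial>lborel)) sequentially"
    using \<delta>' by (intro order_tendstoD(1)[OF IE_lim]) simp
  then obtain k where k: "I0 - \<delta>' < (\<integral>P. indicator (E k) P * (cell_ind P * norm (V0 P) powr q) \<partial>lborel)"
    by (auto simp: eventually_sequentially)
  define IE where "IE = (\<integral>P. indicator (E k) P * (cell_ind P * norm (V0 P) powr q) \<partial>lborel)"
  (* The dual function, truncated to where both the slow variable and V0 are bounded. *)
  define g where "g P = (indicator (E k) P * norm (V0 P) powr (q - 1)) *\<^sub>R conj_sign (V0 P)" for P
  define M where "M = real k powr (q - 1) + 1"
  have M: "0 < M" by (simp add: M_def add_nonneg_pos)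
  have gm: "g \<in> borel_measurable borel" unfolding g_def[abs_def] by measurable
  have gM: "norm (g P) \<le> M" for P
  proof (cases "P \<in> E k")
    case True
    then have "norm (V0 P) powr (q - 1) \<le> real k powr (q - 1)" using q by (intro powr_mono2) (auto simp: E_def)
    then have "norm (V0 P) powr (q - 1) * norm (conj_sign (V0 P)) \<le> real k powr (q - 1) * 1"
      by (intro mult_mono norm_conj_sign_le) auto
    then show ?thesis using True by (simp add: g_def M_def)
  qed (use M in \<open>simp add: g_def\<close>)
  have g_out: "g (x, w) = 0" if "real k < norm x" for x w
    using that by (simp add: g_def E_def indicator_def)
  have V0g: "V0 P * g P = of_real (indicator (E k) P * norm (V0 P) powr q)" for P
  proof -
    have "V0 P * g P = (indicator (E k) P * norm (V0 P) powr (q - 1)) *\<^sub>R of_real (norm (V0 P))"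
      by (simp add: g_def mult_conj_sign)
    also have "\<dots> = of_real (indicator (E k) P * (norm (V0 P) powr (q - 1) * norm (V0 P) powr 1))"
      by (simp add: scaleR_conv_of_real mult.assoc)
    also have "norm (V0 P) powr (q - 1) * norm (V0 P) powr 1 = norm (V0 P) powr q"
      by (simp only: powr_add[symmetric]) simp
    finally show ?thesis .
  qed
  have gq: "norm (g P) powr q' = indicator (E k) P * norm (V0 P) powr q" for P
  proof (cases "P \<in> E k \<and> V0 P \<noteq> 0")
    case True
    then have "norm (g P) = norm (V0 P) powr (q - 1)" by (simp add: g_def conj_sign_def norm_divide)
    then show ?thesis using True qq' by (simp add: powr_powr)
  qed (auto simp: g_def conj_sign_def)
  obtain \<psi> where tf: "\<And>j::nat. test_fun (\<psi> j)" and \<psi>M: "\<And>j P. norm (\<psi> j P) \<le> M"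
    and \<psi>0: "\<And>j x w. real k + 1 < norm x \<Longrightarrow> \<psi> j (x, w) = 0"
    and \<psi>l: "AE P in lborel. snd P \<in> ucell \<longrightarrow> (\<lambda>j. \<psi> j P) \<longlonglongrightarrow> g P"
    using test_fun_dense[OF gm M gM g_out] by blast
  define \<rho> where "\<rho> = real k + 1"
  define Z where "Z = cball (0::'b) \<rho> \<times> (ucell :: ('b \<times> 'b) set)"
  note Zi = integrable_cell_cball[where 'b = 'b and 'c = "'b \<times> 'b", of \<rho>, folded Z_def]
  have \<psi>Z: "cell_ind P * norm (\<psi> j P) \<le> M * indicator Z P" for j P
  proof -
    obtain x w where P: "P = (x, w)" by (cases P)
    show ?thesis
    proof (cases "P \<in> Z")
      case True
      then show ?thesis using \<psi>M[of j P] by (simp add: P Z_def cell_ind_pair)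
    next
      case False
      then have "cell_ind P = 0 \<or> \<psi> j P = 0" using \<psi>0[of x j w] by (auto simp: P Z_def \<rho>_def cell_ind_pair)
      then show ?thesis using M by auto
    qed
  qed
  have \<psi>m[measurable]: "\<psi> j \<in> borel_measurable borel" for j by (rule test_fun_measurable[OF tf])
  have a_lim: "(\<lambda>j. \<integral>P. cell_ind P *\<^sub>R (V0 P * \<psi> j P) \<partial>lborel) \<longlonglongrightarrow> (\<integral>P. cell_ind P *\<^sub>R (V0 P * g P) \<partial>lborel)"
  proof (rule integral_dominated_convergence[where w = "\<lambda>P. M * (indicator Z P + cell_ind P * norm (V0 P) powr q)"])
    show "integrable lborel (\<lambda>P. M * (indicator Z P + cell_ind P * norm (V0 P) powr q))"
      by (intro integrable_mult_right Bochner_Integration.integrable_add Zi V0i)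
    show "AE P in lborel. (\<lambda>j. cell_ind P *\<^sub>R (V0 P * \<psi> j P)) \<longlonglongrightarrow> cell_ind P *\<^sub>R (V0 P * g P)"
      using \<psi>l
    proof eventually_elim
      fix P :: "'b \<times> ('b \<times> 'b)" assume P: "snd P \<in> ucell \<longrightarrow> (\<lambda>j. \<psi> j P) \<longlonglongrightarrow> g P"
      show "(\<lambda>j. cell_ind P *\<^sub>R (V0 P * \<psi> j P)) \<longlonglongrightarrow> cell_ind P *\<^sub>R (V0 P * g P)"
      proof (cases "snd P \<in> ucell")
        case True
        then show ?thesis using P by (intro tendsto_scaleR tendsto_mult tendsto_const) simp
      qed (simp add: cell_ind_def)
    qed
    show "AE P in lborel. norm (cell_ind P *\<^sub>R (V0 P * \<psi> j P)) \<le> M * (indicator Z P + cell_ind P * norm (V0 P) powr q)" for j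
    proof (rule AE_I2)
      fix P
      have "norm (V0 P) \<le> 1 + norm (V0 P) powr q" using le_add_powr[OF norm_ge_zero[of "V0 P"], of 1 q] q by simp
      then have "cell_ind P * norm (\<psi> j P) * norm (V0 P) \<le> cell_ind P * norm (\<psi> j P) * (1 + norm (V0 P) powr q)"
        by (intro mult_left_mono mult_nonneg_nonneg cell_ind_nonneg norm_ge_zero)
      also have "\<dots> = cell_ind P * norm (\<psi> j P) + norm (\<psi> j P) * (cell_ind P * norm (V0 P) powr q)"
        by (simp add: algebra_simps)
      also have "\<dots> \<le> M * indicator Z P + M * (cell_ind P * norm (V0 P) powr q)"
        by (intro add_mono \<psi>Z mult_right_mono \<psi>M mult_nonneg_nonneg cell_ind_nonneg powr_ge_zero)
      finally show "norm (cell_ind P *\<^sub>R (V0 P * \<psi> j P)) \<le> M * (indicator Z P + cell_ind P * norm (V0 P) powr q)"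
        by (simp add: norm_mult cell_ind_nonneg distrib_left mult_ac)
    qed
  qed (use gm in measurable)
  have b_lim: "(\<lambda>j. \<integral>P. cell_ind P * norm (\<psi> j P) powr q' \<partial>lborel) \<longlonglongrightarrow> (\<integral>P. cell_ind P * norm (g P) powr q' \<partial>lborel)"
  proof (rule integral_dominated_convergence[where w = "\<lambda>P. M powr q' * indicator Z P"])
    show "integrable lborel (\<lambda>P. M powr q' * indicator Z P)" by (intro integrable_mult_right Zi)
    show "AE P in lborel. (\<lambda>j. cell_ind P * norm (\<psi> j P) powr q') \<longlonglongrightarrow> cell_ind P * norm (g P) powr q'"
      using \<psi>l
    proof eventually_elim
      fix P :: "'b \<times> ('b \<times> 'b)" assume P: "snd P \<in> ucell \<longrightarrow> (\<lambda>j. \<psi> j P) \<longlonglongrightarrow> g P"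
      show "(\<lambda>j. cell_ind P * norm (\<psi> j P) powr q') \<longlonglongrightarrow> cell_ind P * norm (g P) powr q'"
      proof (cases "snd P \<in> ucell")
        case True
        then have "(\<lambda>j. norm (\<psi> j P)) \<longlonglongrightarrow> norm (g P)" using P by (intro tendsto_norm) simp
        then have "(\<lambda>j. norm (\<psi> j P) powr q') \<longlonglongrightarrow> norm (g P) powr q'"
          using q' by (intro tendsto_powr') auto
        then show ?thesis by (intro tendsto_mult tendsto_const)
      qed (simp add: cell_ind_def)
    qed
    show "AE P in lborel. norm (cell_ind P * norm (\<psi> j P) powr q') \<le> M powr q' * indicator Z P" for j
    proof (rule AE_I2)
      fix P
      show "norm (cell_ind P * norm (\<psi> j P) powr q') \<le> M powr q' * indicator Z P"
      proof (cases "P \<in> Z")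
        case True
        have "norm (\<psi> j P) powr q' \<le> M powr q'" using \<psi>M q' by (intro powr_mono2) auto
        then show ?thesis using True cell_ind_cases[of P] by auto
      next
        case False
        then have "cell_ind P * norm (\<psi> j P) \<le> 0" using \<psi>Z[of P j] by simp
        then have "cell_ind P = 0 \<or> \<psi> j P = 0" using cell_ind_cases[of P] by auto
        then show ?thesis using False by auto
      qed
    qed
  qed (use gm in measurable)
  have ci: "cell_ind P *\<^sub>R (of_real r :: 'a) = of_real (cell_ind P * r)" for P :: "'b \<times> ('b \<times> 'b)" and r
    by (simp add: scaleR_conv_of_real)
  have iE: "integrable lborel (\<lambda>P. indicator (E k) P * (cell_ind P * norm (V0 P) powr q))"
    by (rule Bochner_Integration.integrable_bound[OF V0i]) (measurable, simp add: indicator_def)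
  have a0: "(\<integral>P. cell_ind P *\<^sub>R (V0 P * g P) \<partial>lborel) = of_real IE"
    unfolding V0g ci IE_def by (subst mult.left_commute) (rule integral_of_real[OF iE])
  have b0: "(\<integral>P. cell_ind P * norm (g P) powr q' \<partial>lborel) = IE"
    unfolding gq IE_def by (simp only: mult.left_commute)
  have IE0: "0 \<le> IE"
    unfolding IE_def by (intro Bochner_Integration.integral_nonneg mult_nonneg_nonneg cell_ind_nonneg powr_ge_zero) (simp add: indicator_def)
  have "(\<lambda>j. norm (\<integral>P. cell_ind P *\<^sub>R (V0 P * \<psi> j P) \<partial>lborel)) \<longlonglongrightarrow> IE"
    using tendsto_norm[OF a_lim] IE0 unfolding a0 by simp
  then have "eventually (\<lambda>j. IE - \<delta>' < norm (\<integral>P. cell_ind P *\<^sub>R (V0 P * \<psi> j P) \<partial>lborel)) sequentially"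
    using \<delta>' by (intro order_tendstoD(1)) auto
  moreover have "eventually (\<lambda>j. (\<integral>P. cell_ind P * norm (\<psi> j P) powr q' \<partial>lborel) < IE + \<delta>') sequentially"
    using b_lim[unfolded b0] \<delta>' by (intro order_tendstoD(2)) auto
  ultimately have "eventually (\<lambda>j. IE - \<delta>' < norm (\<integral>P. cell_ind P *\<^sub>R (V0 P * \<psi> j P) \<partial>lborel)
      \<and> (\<integral>P. cell_ind P * norm (\<psi> j P) powr q' \<partial>lborel) < IE + \<delta>') sequentially"
    by (rule eventually_conj)
  then obtain j where j1: "IE - \<delta>' < norm (\<integral>P. cell_ind P *\<^sub>R (V0 P * \<psi> j P) \<partial>lborel)"
    and j2: "(\<integral>P. cell_ind P * norm (\<psi> j P) powr q' \<partial>lborel) < IE + \<delta>'"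
    by (auto simp: eventually_sequentially)
  define An where "An n = (\<integral>x. V n x * \<psi> j (x, two_scales (e n) x) \<partial>lborel)" for n
  define Bn where "Bn n = (\<integral>x. norm (\<psi> j (x, two_scales (e n) x)) powr q' \<partial>lborel)" for n
  define Nn where "Nn n = (\<integral>x. norm (V n x) powr q \<partial>lborel)" for n
  have q'0: "0 < q'" using q' by simp
  have "(\<lambda>n. Nn n - q * norm (An n) + q / q' * Bn n) \<longlonglongrightarrow> I0 - q * norm (\<integral>P. cell_ind P *\<^sub>R (V0 P * \<psi> j P) \<partial>lborel)
      + q / q' * (\<integral>P. cell_ind P * norm (\<psi> j P) powr q' \<partial>lborel)"
    unfolding An_def Bn_def Nn_def I0_def
    by (intro tendsto_intros normlim weak[OF tf] mean_value[OF test_fun_norm_powr[OF tf q'0] powr_ge_zero e])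
  moreover have "I0 - q * norm (\<integral>P. cell_ind P *\<^sub>R (V0 P * \<psi> j P) \<partial>lborel)
      + q / q' * (\<integral>P. cell_ind P * norm (\<psi> j P) powr q' \<partial>lborel) < \<delta>"
  proof -
    have "q * (IE - \<delta>') \<le> q * norm (\<integral>P. cell_ind P *\<^sub>R (V0 P * \<psi> j P) \<partial>lborel)"
      using j1 q by (intro mult_left_mono) auto
    moreover have "q / q' * (\<integral>P. cell_ind P * norm (\<psi> j P) powr q' \<partial>lborel) \<le> (q - 1) * (IE + \<delta>')"
      unfolding qq' using j2 q by (intro mult_left_mono) auto
    moreover have "I0 - q * (IE - \<delta>') + (q - 1) * (IE + \<delta>') = (I0 - IE) + 2 * q * \<delta>' - \<delta>'" by (simp add: algebra_simps)
    moreover have "I0 - IE < \<delta>'" using k by (simp add: IE_def)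
    ultimately show ?thesis using \<delta>' by linarith
  qed
  ultimately have ev: "eventually (\<lambda>n. Nn n - q * norm (An n) + q / q' * Bn n < \<delta>) sequentially"
    by (rule order_tendstoD(2))
  have tail: "(\<integral>\<^sup>+x. indicator {x. \<rho> < norm x} x * ennreal (norm (V n x) powr q) \<partial>lborel) \<le> ennreal (Nn n - q * norm (An n) + q / q' * Bn n)" for n
  proof -
    define f where "f x = \<psi> j (x, two_scales (e n) x)" for x
    have fm[measurable]: "f \<in> borel_measurable borel" unfolding f_def[abs_def] by (rule test_fun_scale_measurable[OF \<psi>m measurable_two_scales])
    have f0: "f x = 0" if "\<rho> < norm x" for x using that \<psi>0 by (simp add: f_def \<rho>_def)
    have fi: "integrable lborel (\<lambda>x. norm (f x) powr q')"
    proof (rule Bochner_Integration.integrable_bound)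
      show "integrable lborel (\<lambda>x::'b. M powr q' * indicator (cball 0 \<rho>) x)"
        by (intro integrable_mult_right integrable_real_indicator) (simp_all add: emeasure_cball_eq)
      show "AE x in lborel. norm (norm (f x) powr q') \<le> norm (M powr q' * indicator (cball 0 \<rho>) x)"
      proof (rule AE_I2)
        fix x
        have "norm (f x) powr q' \<le> M powr q'" using \<psi>M q' unfolding f_def by (intro powr_mono2) auto
        then show "norm (norm (f x) powr q') \<le> norm (M powr q' * indicator (cball 0 \<rho>) x)"
          using f0[of x] by (cases "\<rho> < norm x") auto
      qed
    qed measurable
    have Ti: "integrable lborel (\<lambda>x. indicator {x. \<rho> < norm x} x * norm (V n x) powr q)"
      by (rule Bochner_Integration.integrable_bound[OF Vi[of n]]) (measurable, simp add: indicator_def)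
    (* Outside the ball f vanishes, so in Young's inequality the tail of V n may be subtracted. *)
    have yi: "q * norm (V n x * f x) \<le> norm (V n x) powr q - indicator {x. \<rho> < norm x} x * norm (V n x) powr q + q / q' * norm (f x) powr q'" for x
    proof (cases "\<rho> < norm x")
      case True
      then show ?thesis using q q' by (simp add: f0)
    next
      case False
      have "norm (V n x) * norm (f x) \<le> norm (V n x) powr q / q + norm (f x) powr q' / q'"
        by (rule Youngs_inequality[OF q q' norm_ge_zero norm_ge_zero])
      then have "q * (norm (V n x) * norm (f x)) \<le> q * (norm (V n x) powr q / q + norm (f x) powr q' / q')"
        using q by (intro mult_left_mono) auto
      also have "\<dots> = norm (V n x) powr q + q / q' * norm (f x) powr q'" using q by (simp add: distrib_left)
      finally show ?thesis using False by (simp add: norm_mult)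
    qed
    have gi: "integrable lborel (\<lambda>x. norm (V n x) powr q - indicator {x. \<rho> < norm x} x * norm (V n x) powr q + q / q' * norm (f x) powr q')"
      by (intro Bochner_Integration.integrable_add Bochner_Integration.integrable_diff integrable_mult_right Vi Ti fi)
    have Vfi: "integrable lborel (\<lambda>x. q * norm (V n x * f x))"
    proof (rule Bochner_Integration.integrable_bound[OF gi])
      show "AE x in lborel. norm (q * norm (V n x * f x)) \<le> norm (norm (V n x) powr q - indicator {x. \<rho> < norm x} x * norm (V n x) powr q + q / q' * norm (f x) powr q')"
      proof (rule AE_I2)
        fix x
        have "0 \<le> q * norm (V n x * f x)" using q by simp
        then show "norm (q * norm (V n x * f x)) \<le> norm (norm (V n x) powr q - indicator {x. \<rho> < norm x} x * norm (V n x) powr q + q / q' * norm (f x) powr q')"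
          using yi[of x] unfolding real_norm_def by linarith
      qed
    qed measurable
    have "q * norm (An n) \<le> q * (\<integral>x. norm (V n x * f x) \<partial>lborel)"
      using q unfolding An_def f_def by (intro mult_left_mono integral_norm_bound) auto
    also have "\<dots> = (\<integral>x. q * norm (V n x * f x) \<partial>lborel)" by simp
    also have "\<dots> \<le> (\<integral>x. norm (V n x) powr q - indicator {x. \<rho> < norm x} x * norm (V n x) powr q + q / q' * norm (f x) powr q' \<partial>lborel)"
      by (rule Bochner_Integration.integral_mono[OF Vfi gi yi])
    also have "\<dots> = Nn n - (\<integral>x. indicator {x. \<rho> < norm x} x * norm (V n x) powr q \<partial>lborel) + q / q' * Bn n"
      unfolding Nn_def Bn_def f_def[symmetric] using Vi Ti fi by simp
    finally have le: "(\<integral>x. indicator {x. \<rho> < norm x} x * norm (V n x) powr q \<partial>lborel) \<le> Nn n - q * norm (An n) + q / q' * Bn n"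
      by linarith
    have "(\<integral>\<^sup>+x. indicator {x. \<rho> < norm x} x * ennreal (norm (V n x) powr q) \<partial>lborel)
        = (\<integral>\<^sup>+x. ennreal (indicator {x. \<rho> < norm x} x * norm (V n x) powr q) \<partial>lborel)"
      by (rule nn_integral_cong) (simp add: indicator_def)
    also have "\<dots> = ennreal (\<integral>x. indicator {x. \<rho> < norm x} x * norm (V n x) powr q \<partial>lborel)"
      by (rule nn_integral_eq_integral[OF Ti]) (simp add: indicator_def)
    also have "\<dots> \<le> ennreal (Nn n - q * norm (An n) + q / q' * Bn n)" by (rule ennreal_leI[OF le])
    finally show ?thesis .
  qed
  have "eventually (\<lambda>n. (\<integral>\<^sup>+x. indicator {x. \<rho> < norm x} x * ennreal (norm (V n x) powr q) \<partial>lborel) \<le> ennreal \<delta>) sequentially"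
    using ev
  proof (rule eventually_mono)
    fix n assume "Nn n - q * norm (An n) + q / q' * Bn n < \<delta>"
    then show "(\<integral>\<^sup>+x. indicator {x. \<rho> < norm x} x * ennreal (norm (V n x) powr q) \<partial>lborel) \<le> ennreal \<delta>"
      by (intro order_trans[OF tail ennreal_leI]) simp
  qed
  then show ?thesis by blast
qed

section \<open>Boundedness and uniform integrability of weakly convergent sequences\<close>

text \<open>
  Integrating \<open>F0\<close> over the cell gives a weak limit in \<open>L\<^sup>1\<close>, so that \<open>weak_L1_uniformly_integrable\<close> applies.
\<close>

lemma uniformly_integrable_of_weak:
  fixes F :: "nat \<Rightarrow> 'b::euclidean_space \<Rightarrow> 'a::{real_normed_field, euclidean_space}"
    and F0 :: "'b \<times> 'c::euclidean_space \<Rightarrow> 'a"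
  assumes F: "\<And>n. integrable lborel (F n)" and F0: "integrable lborel (\<lambda>P. cell_ind P *\<^sub>R F0 P)"
    and weak: "\<And>b C. b \<in> borel_measurable borel \<Longrightarrow> (\<And>x. norm (b x) \<le> C)
        \<Longrightarrow> (\<lambda>n. \<integral>x. F n x * b x \<partial>lborel) \<longlonglongrightarrow> (\<integral>P. cell_ind P *\<^sub>R (F0 P * b (fst P)) \<partial>lborel)"
  shows "uniformly_integrable F"
proof -
  define G where "G x = (\<integral>w. cell_ind (x, w) *\<^sub>R F0 (x, w) \<partial>lborel)" for x
  have F0': "integrable (lborel \<Otimes>\<^sub>M lborel) (\<lambda>P. cell_ind P *\<^sub>R F0 P)" using F0 by (simp only: lborel_prod)
  have G: "integrable lborel G"
    unfolding G_def[abs_def] by (rule lborel_pair.integrable_fst'[OF F0'])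
  have weakG: "(\<lambda>n. \<integral>x. F n x * b x \<partial>lborel) \<longlonglongrightarrow> (\<integral>x. G x * b x \<partial>lborel)"
    if b: "b \<in> borel_measurable lborel" "\<And>x. norm (b x) \<le> C" for b C
  proof -
    have bm[measurable]: "b \<in> borel_measurable borel" using b by simp
    have bf: "(\<lambda>P::'b \<times> 'c. b (fst P)) \<in> borel_measurable lborel"
    proof -
      have "(\<lambda>P::'b \<times> 'c. b (fst P)) \<in> borel_measurable (borel \<Otimes>\<^sub>M borel)" by measurable
      then show ?thesis unfolding borel_prod by simp
    qed
    have i: "integrable lborel (\<lambda>P. cell_ind P *\<^sub>R F0 P * b (fst P))"
      by (rule integrable_mult_bounded[OF F0 bf]) (rule b(2))
    then have i': "integrable (lborel \<Otimes>\<^sub>M lborel) (\<lambda>P. cell_ind P *\<^sub>R F0 P * b (fst P))" by (simp only: lborel_prod)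
    have "(\<integral>P. cell_ind P *\<^sub>R (F0 P * b (fst P)) \<partial>lborel) = (\<integral>P. cell_ind P *\<^sub>R F0 P * b (fst P) \<partial>(lborel \<Otimes>\<^sub>M lborel))"
      by (simp add: lborel_prod)
    also have "\<dots> = (\<integral>x. (\<integral>w. cell_ind (x, w) *\<^sub>R F0 (x, w) * b (fst (x, w)) \<partial>lborel) \<partial>lborel)"
      by (rule lborel_pair.integral_fst'[OF i', symmetric])
    also have "\<dots> = (\<integral>x. G x * b x \<partial>lborel)" by (simp only: G_def fst_conv integral_mult_left_zero)
    finally show ?thesis using weak[OF bm b(2)] by simp
  qed
  show ?thesis
    unfolding uniformly_integrable_def
  proof (intro allI impI)
    fix \<phi> :: "nat \<Rightarrow> 'b \<Rightarrow> real" and C \<delta> :: real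
    assume "\<forall>j. \<phi> j \<in> borel_measurable borel" "\<forall>j x. 0 \<le> \<phi> j x \<and> \<phi> j x \<le> C" "AE x in lborel. (\<lambda>j. \<phi> j x) \<longlonglongrightarrow> 0" "0 < \<delta>"
    then show "\<exists>J. \<forall>j\<ge>J. \<forall>n. (\<integral>x. norm (F n x) * \<phi> j x \<partial>lborel) < \<delta>"
      by (intro weak_L1_uniformly_integrable[OF F G weakG, where C = C]) auto
  qed
qed

text \<open>
  Were the norms unbounded, choose a rapidly growing subsequence \<open>f\<^sub>j\<close>. The weight \<open>G\<close> with
  \<open>G\<^bsup>p'\<^esup> = \<Sum>\<^sub>j 2\<^bsup>-j-1\<^esup> \<bar>f\<^sub>j\<bar>\<^sup>p / \<integral>\<bar>f\<^sub>j\<bar>\<^sup>p\<close> belongs to the dual space, but the integrals of \<open>\<bar>f\<^sub>j\<bar> G\<close> are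
  unbounded. This contradicts \<open>L1_uniform_boundedness\<close>, applied to the products \<open>f\<^sub>j G\<close>.
\<close>

lemma Lp_uniform_boundedness:
  fixes f :: "nat \<Rightarrow> 'x \<Rightarrow> 'a::{real_normed_field, euclidean_space}"
  assumes f[measurable]: "\<And>n. f n \<in> borel_measurable M" and p: "1 < p"
    and fi: "\<And>n. integrable M (\<lambda>x. norm (f n x) powr p)"
    and weak: "\<And>b. b \<in> borel_measurable M \<Longrightarrow> integrable M (\<lambda>x. norm (b x) powr (1 / (1 - 1 / p)))
        \<Longrightarrow> Bseq (\<lambda>n. \<integral>x. f n x * b x \<partial>M)"
  shows "\<exists>C. \<forall>n. (\<integral>x. norm (f n x) powr p \<partial>M) \<le> C"
proof (rule ccontr)
  assume neg: "\<not> ?thesis"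
  define p' where "p' = 1 / (1 - 1 / p)"
  have p': "1 < p'" "1 / p + 1 / p' = 1" "1 + p / p' = p" using p by (simp_all add: p'_def field_simps)
  define I where "I n = (\<integral>x. norm (f n x) powr p \<partial>M)" for n
  have "\<forall>j::nat. \<exists>n. (4 ^ Suc j) powr p < I n" using neg by (simp add: not_le I_def)
  from choice[OF this] obtain \<nu> where \<nu>: "\<And>j::nat. (4 ^ Suc j) powr p < I (\<nu> j)" by blast
  have I0: "0 < I (\<nu> j)" for j using \<nu>[of j] by (smt (verit) powr_ge_zero)
  (* The functions T j have integral 2 ^ -(j + 1), so their sum F is integrable and dominates each
     of them; G is the power of F that belongs to the dual space. *)
  define T where "T j x = (1 / 2) ^ Suc j * (norm (f (\<nu> j) x) powr p / I (\<nu> j))" for j x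
  have T0: "0 \<le> T j x" for j x using I0[of j] by (simp add: T_def less_imp_le)
  have Tm[measurable]: "T j \<in> borel_measurable M" for j unfolding T_def by measurable
  have Tint: "(\<integral>\<^sup>+x. ennreal (T j x) \<partial>M) = ennreal ((1 / 2) ^ Suc j)" for j
  proof -
    have i: "integrable M (T j)" unfolding T_def by (intro integrable_mult_right integrable_divide fi)
    have "(\<integral>x. T j x \<partial>M) = (1 / 2) ^ Suc j"
      using I0[of j] by (simp add: T_def I_def)
    then show ?thesis using nn_integral_eq_integral[OF i] T0 by simp
  qed
  define S where "S x = (\<Sum>j. ennreal (T j x))" for x
  have Sm[measurable]: "S \<in> borel_measurable M" unfolding S_def[abs_def] by measurable
  have "(\<integral>\<^sup>+x. S x \<partial>M) = (\<Sum>j. \<integral>\<^sup>+x. ennreal (T j x) \<partial>M)" unfolding S_def by (rule nn_integral_suminf) measurable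
  also have "\<dots> = ennreal 1" unfolding Tint by (rule suminf_ennreal_eq[OF _ power_half_series]) simp
  finally have Sint: "(\<integral>\<^sup>+x. S x \<partial>M) = 1" by simp
  have Sfin: "AE x in M. S x \<noteq> \<infinity>" by (rule nn_integral_noteq_infinite) (use Sint in auto)
  define F where "F x = enn2real (S x)" for x
  have Fm[measurable]: "F \<in> borel_measurable M" unfolding F_def[abs_def] by measurable
  have F0: "0 \<le> F x" for x by (simp add: F_def)
  have Fi: "integrable M F"
  proof (rule integrableI_nonneg)
    have "(\<integral>\<^sup>+x. ennreal (F x) \<partial>M) \<le> (\<integral>\<^sup>+x. S x \<partial>M)"
      unfolding F_def by (rule nn_integral_mono) (metis ennreal_enn2real_if infinity_ennreal_def le_less top_greatest zero_le)
    then show "(\<integral>\<^sup>+x. ennreal (F x) \<partial>M) < \<infinity>" using Sint by (auto intro: order_le_less_trans)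
  qed (simp_all add: F0)
  have TF: "AE x in M. \<forall>j. T j x \<le> F x"
    using Sfin
  proof eventually_elim
    fix x assume x: "S x \<noteq> \<infinity>"
    show "\<forall>j. T j x \<le> F x"
    proof
      fix j
      have "ennreal (T j x) \<le> S x" unfolding S_def using sum_le_suminf[of "\<lambda>j. ennreal (T j x)" "{j}"] by simp
      also have "S x = ennreal (F x)" unfolding F_def using x by (simp add: less_top)
      finally show "T j x \<le> F x" using F0 by simp
    qed
  qed
  define G where "G x = F x powr (1 / p')" for x
  have Gm[measurable]: "G \<in> borel_measurable M" unfolding G_def[abs_def] by measurable
  have G0: "0 \<le> G x" for x by (simp add: G_def)
  have GF: "G x powr p' = F x" for x using p' F0 by (simp add: G_def powr_powr)
  have fG: "integrable M (\<lambda>x. f n x * of_real (G x))" for n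
  proof (rule Bochner_Integration.integrable_bound)
    show "integrable M (\<lambda>x. norm (f n x) powr p / p + F x / p')"
      by (intro Bochner_Integration.integrable_add integrable_divide fi Fi)
    show "AE x in M. norm (f n x * of_real (G x)) \<le> norm (norm (f n x) powr p / p + F x / p')"
    proof (rule AE_I2)
      fix x
      have "norm (f n x) * G x \<le> norm (f n x) powr p / p + G x powr p' / p'"
        by (rule Youngs_inequality[OF p p'(1,2) norm_ge_zero G0])
      then show "norm (f n x * of_real (G x)) \<le> norm (norm (f n x) powr p / p + F x / p')"
        using G0[of x] by (simp add: norm_mult GF)
    qed
  qed measurable
  have "\<exists>C. \<forall>n. (\<integral>x. norm (f n x * of_real (G x)) \<partial>M) \<le> C"
  proof (rule L1_uniform_boundedness[OF fG])
    fix b :: "'x \<Rightarrow> 'a" and C assume b[measurable]: "b \<in> borel_measurable M" and C: "\<And>x. norm (b x) \<le> C"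
    have "integrable M (\<lambda>x. norm (of_real (G x) * b x) powr p')"
    proof (rule Bochner_Integration.integrable_bound)
      show "integrable M (\<lambda>x. C powr p' * F x)" by (intro integrable_mult_right Fi)
      show "AE x in M. norm (norm (of_real (G x) * b x) powr p') \<le> norm (C powr p' * F x)"
      proof (rule AE_I2)
        fix x
        have "norm (of_real (G x) * b x) powr p' = F x * norm (b x) powr p'"
          using G0[of x] by (simp add: norm_mult powr_mult GF)
        also have "\<dots> \<le> F x * C powr p'" using C p' F0 by (intro mult_left_mono powr_mono2) auto
        finally show "norm (norm (of_real (G x) * b x) powr p') \<le> norm (C powr p' * F x)"
          using F0[of x] by (simp add: mult.commute)
      qed
    qed measurable
    then have "Bseq (\<lambda>n. \<integral>x. f n x * (of_real (G x) * b x) \<partial>M)"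
      unfolding p'_def by (intro weak) measurable
    then show "Bseq (\<lambda>n. \<integral>x. f n x * of_real (G x) * b x \<partial>M)" by (simp only: mult.assoc)
  qed
  then obtain C where C: "\<And>n. (\<integral>x. norm (f n x * of_real (G x)) \<partial>M) \<le> C" by blast
  have "real j \<le> C" for j
  proof -
    define a where "a = (1 / 2) ^ Suc j / I (\<nu> j)"
    have a0: "0 < a" using I0[of j] by (simp add: a_def)
    have i1: "integrable M (\<lambda>x. a powr (1 / p') * norm (f (\<nu> j) x) powr p)" by (intro integrable_mult_right fi)
    have "(\<integral>x. a powr (1 / p') * norm (f (\<nu> j) x) powr p \<partial>M) \<le> (\<integral>x. norm (f (\<nu> j) x * of_real (G x)) \<partial>M)"
    proof (rule integral_mono_AE[OF i1 integrable_norm[OF fG]])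
      show "AE x in M. a powr (1 / p') * norm (f (\<nu> j) x) powr p \<le> norm (f (\<nu> j) x * of_real (G x))"
        using TF
      proof eventually_elim
        fix x assume x: "\<forall>j. T j x \<le> F x"
        have "T j x = a * norm (f (\<nu> j) x) powr p" by (simp add: T_def a_def)
        then have "(a * norm (f (\<nu> j) x) powr p) powr (1 / p') \<le> G x"
          unfolding G_def using x[rule_format, of j] p' T0[of j x] by (intro powr_mono2) auto
        then have "norm (f (\<nu> j) x) * (a * norm (f (\<nu> j) x) powr p) powr (1 / p') \<le> norm (f (\<nu> j) x) * G x"
          by (intro mult_left_mono norm_ge_zero)
        moreover have "norm (f (\<nu> j) x) * (a * norm (f (\<nu> j) x) powr p) powr (1 / p')
            = a powr (1 / p') * (norm (f (\<nu> j) x) powr 1 * norm (f (\<nu> j) x) powr (p / p'))"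
          using a0 by (simp add: powr_mult powr_powr)
        moreover have "norm (f (\<nu> j) x) powr 1 * norm (f (\<nu> j) x) powr (p / p') = norm (f (\<nu> j) x) powr p"
          by (simp only: powr_add[symmetric] p'(3))
        ultimately show "a powr (1 / p') * norm (f (\<nu> j) x) powr p \<le> norm (f (\<nu> j) x * of_real (G x))"
          using G0[of x] by (simp add: norm_mult)
      qed
    qed
    also have "\<dots> \<le> C" by (rule C)
    finally have le: "a powr (1 / p') * I (\<nu> j) \<le> C" by (simp add: I_def)
    have "a powr (1 / p') = ((1 / 2) ^ Suc j) powr (1 / p') / I (\<nu> j) powr (1 / p')"
      unfolding a_def by (rule powr_divide)
    then have "a powr (1 / p') * I (\<nu> j) = ((1 / 2) ^ Suc j) powr (1 / p') * (I (\<nu> j) powr (- (1 / p')) * I (\<nu> j) powr 1)"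
      using I0[of j] by (simp only: powr_minus_divide powr_one[OF less_imp_le[OF I0[of j]]]) simp
    also have "I (\<nu> j) powr (- (1 / p')) * I (\<nu> j) powr 1 = I (\<nu> j) powr (1 / p)"
    proof -
      have "- (1 / p') + 1 = 1 / p" using p'(2) by simp
      then show ?thesis by (simp only: powr_add[symmetric])
    qed
    finally have eq: "a powr (1 / p') * I (\<nu> j) = ((1 / 2) ^ Suc j) powr (1 / p') * I (\<nu> j) powr (1 / p)" .
    have h: "(1 / 2) ^ Suc j \<le> ((1 / 2) ^ Suc j :: real) powr (1 / p')"
    proof -
      have "((1 / 2) ^ Suc j :: real) powr 1 \<le> ((1 / 2) ^ Suc j) powr (1 / p')"
      proof (rule powr_mono')
        show "((1 / 2) ^ Suc j :: real) \<le> 1" by (rule power_le_one) auto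
      qed (use p' in auto)
      then show ?thesis by simp
    qed
    have "((4 ^ Suc j) powr p) powr (1 / p) \<le> I (\<nu> j) powr (1 / p)"
      using \<nu>[of j] p by (intro powr_mono2) auto
    then have i: "4 ^ Suc j \<le> I (\<nu> j) powr (1 / p)" using p by (simp add: powr_powr)
    have "(1 / 2) ^ Suc j * 4 ^ Suc j \<le> ((1 / 2) ^ Suc j) powr (1 / p') * I (\<nu> j) powr (1 / p)"
      by (intro mult_mono h i) auto
    then have "(1 / 2 * 4) ^ Suc j \<le> C" using le eq by (simp only: power_mult_distrib)
    moreover have "real j < 2 ^ j" by (rule of_nat_less_two_power)
    moreover have "(1 / 2 * 4) ^ Suc j = 2 * (2 ^ j :: real)" by simp
    ultimately show "real j \<le> C" using zero_le_power[of "2::real" j] by linarith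
  qed
  moreover obtain j :: nat where "C < real j" using reals_Archimedean2 by blast
  ultimately show False by (meson not_le)
qed

section \<open>Borel representatives\<close>

lemma borel_version:
  fixes f :: "'b::euclidean_space \<Rightarrow> 'd::euclidean_space"
  assumes f: "f \<in> borel_measurable lebesgue"
  shows "\<exists>F\<in>borel_measurable borel. AE x in lborel. f x = F x"
proof -
  have "\<forall>b\<in>Basis. \<exists>g. g \<in> borel_measurable lborel \<and> (AE x in lborel. f x \<bullet> b = g x)"
  proof
    fix b :: 'd assume "b \<in> Basis"
    have "(\<lambda>x. f x \<bullet> b) \<in> borel_measurable lebesgue" using f by measurable
    then show "\<exists>g. g \<in> borel_measurable lborel \<and> (AE x in lborel. f x \<bullet> b = g x)"
      using completion_ex_borel_measurable_real by blast
  qed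
  from bchoice[OF this] obtain g where g: "\<And>b. b \<in> Basis \<Longrightarrow> g b \<in> borel_measurable lborel"
    "\<And>b. b \<in> Basis \<Longrightarrow> AE x in lborel. f x \<bullet> b = g b x" by blast
  have "AE x in lborel. \<forall>b\<in>Basis. f x \<bullet> b = g b x"
    by (rule AE_finite_allI) (auto intro: g)
  then have "AE x in lborel. f x = (\<Sum>b\<in>Basis. g b x *\<^sub>R b)"
  proof eventually_elim
    fix x assume "\<forall>b\<in>Basis. f x \<bullet> b = g b x"
    then have "(\<Sum>b\<in>Basis. g b x *\<^sub>R b) = (\<Sum>b\<in>Basis. (f x \<bullet> b) *\<^sub>R b)" by (intro sum.cong) auto
    then show "f x = (\<Sum>b\<in>Basis. g b x *\<^sub>R b)" by (simp add: euclidean_representation)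
  qed
  moreover have "(\<lambda>x. \<Sum>b\<in>Basis. g b x *\<^sub>R b) \<in> borel_measurable borel"
    using g(1) by (intro borel_measurable_sum borel_measurable_scaleR) auto
  ultimately show ?thesis by (intro bexI[of _ "\<lambda>x. \<Sum>b\<in>Basis. g b x *\<^sub>R b"])
qed

lemma borel_version_on:
  fixes f :: "'b::euclidean_space \<Rightarrow> 'd::euclidean_space"
  assumes f: "f \<in> borel_measurable (lebesgue_on S)" and S[measurable]: "S \<in> sets borel"
  shows "\<exists>F. F \<in> borel_measurable borel \<and> (\<forall>x. x \<notin> S \<longrightarrow> F x = 0) \<and> (AE x in lborel. x \<in> S \<longrightarrow> f x = F x)"
proof -
  have "(\<lambda>x. if x \<in> S then f x else 0) \<in> borel_measurable lebesgue"
    using f S by (simp add: borel_measurable_if)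
  from borel_version[OF this] obtain F where F[measurable]: "F \<in> borel_measurable borel" and ae: "AE x in lborel. (if x \<in> S then f x else 0) = F x" by blast
  have "(\<lambda>x. if x \<in> S then F x else 0) \<in> borel_measurable borel" by measurable
  moreover have "AE x in lborel. x \<in> S \<longrightarrow> f x = (if x \<in> S then F x else 0)"
    using ae by eventually_elim (auto split: if_splits)
  ultimately show ?thesis by (intro exI[of _ "\<lambda>x. if x \<in> S then F x else 0"]) simp
qed

text \<open>
  The completion only adds null sets, so a function that agrees almost everywhere on \<open>S\<close> with a Borel
  function may be integrated as if it were that function.
\<close>

lemma lebesgue_on_borel:
  fixes f :: "'b::euclidean_space \<Rightarrow> 'd::euclidean_space"
  assumes S[measurable]: "S \<in> sets borel" and F[measurable]: "F \<in> borel_measurable borel"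
    and ae: "AE x in lborel. x \<in> S \<longrightarrow> f x = F x"
  shows "integrable (lebesgue_on S) f \<longleftrightarrow> integrable lborel (\<lambda>x. indicator S x *\<^sub>R F x)"
    and "(\<integral>x. f x \<partial>lebesgue_on S) = (\<integral>x. indicator S x *\<^sub>R F x \<partial>lborel)"
    and "f \<in> borel_measurable (lebesgue_on S)"
proof -
  have Sl: "S \<inter> space lebesgue \<in> sets lebesgue" using sets_completionI_sets[of S lborel] by simp
  have Fm: "(\<lambda>x. indicator S x *\<^sub>R F x) \<in> borel_measurable lborel" by measurable
  have Fl: "(\<lambda>x. indicator S x *\<^sub>R F x) \<in> borel_measurable lebesgue" by (rule measurable_completion[OF Fm])
  have ae': "AE x in lebesgue. indicator S x *\<^sub>R f x = indicator S x *\<^sub>R F x"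
  proof -
    have "AE x in lborel. indicator S x *\<^sub>R f x = indicator S x *\<^sub>R F x"
      using ae by eventually_elim (auto simp: indicator_def)
    then show ?thesis by (rule AE_completion)
  qed
  have fl: "(\<lambda>x. indicator S x *\<^sub>R f x) \<in> borel_measurable lebesgue"
  proof (rule borel_measurable_AE[OF Fl])
    show "AE x in lebesgue. indicator S x *\<^sub>R F x = indicator S x *\<^sub>R f x"
      using ae' by eventually_elim (rule sym)
  qed
  show "integrable (lebesgue_on S) f \<longleftrightarrow> integrable lborel (\<lambda>x. indicator S x *\<^sub>R F x)"
    unfolding integrable_restrict_space[OF Sl] integrable_cong_AE[OF fl Fl ae'] by (rule integrable_completion[OF Fm])
  show "(\<integral>x. f x \<partial>lebesgue_on S) = (\<integral>x. indicator S x *\<^sub>R F x \<partial>lborel)"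
    unfolding integral_restrict_space[OF Sl] integral_cong_AE[OF fl Fl ae'] by (rule integral_completion[OF Fm])
  show "f \<in> borel_measurable (lebesgue_on S)"
    unfolding borel_measurable_restrict_space_iff[OF Sl] by (rule fl)
qed

lemma AE_lborel_reflect:
  assumes "AE x in lborel. Q x" shows "AE x in lborel. Q (a - x :: 'b::euclidean_space)"
proof -
  obtain N where N: "N \<in> null_sets lborel" "\<And>x. x \<in> space lborel - N \<Longrightarrow> Q x"
    using assms by (auto elim!: AE_E3)
  have "(\<integral>\<^sup>+y. indicator N (a - y) \<partial>lborel) = (\<integral>\<^sup>+y. indicator N y \<partial>lborel)"
    using N(1) by (intro nn_integral_lborel_reflect) auto
  also have "\<dots> = 0" using N(1) by (subst nn_integral_indicator) auto
  finally have "AE y in lborel. indicator N (a - y) = (0::ennreal)"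
    using N(1) by (subst (asm) nn_integral_0_iff_AE) auto
  then show ?thesis
    by eventually_elim (use N(2) in \<open>auto simp: indicator_def split: if_splits\<close>)
qed

lemma AE_lborel_shift:
  assumes "AE x in lborel. Q x" shows "AE x in lborel. Q (x + a :: 'b::euclidean_space)"
proof -
  obtain N where N: "N \<in> null_sets lborel" "\<And>x. x \<in> space lborel - N \<Longrightarrow> Q x"
    using assms by (auto elim!: AE_E3)
  have "(\<integral>\<^sup>+y. indicator N (y + a) \<partial>lborel) = (\<integral>\<^sup>+y. indicator N y \<partial>lborel)"
    using N(1) by (intro nn_integral_lborel_shift) auto
  also have "\<dots> = 0" using N(1) by (subst nn_integral_indicator) auto
  finally have "AE y in lborel. indicator N (y + a) = (0::ennreal)"
    using N(1) by (subst (asm) nn_integral_0_iff_AE) auto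
  then show ?thesis
    by eventually_elim (use N(2) in \<open>auto simp: indicator_def split: if_splits\<close>)
qed

text \<open>
  The lattice is countable, so the translates of a null set in the cell form a null set.
\<close>

lemma AE_reduced_to_ucell:
  fixes Q :: "'b::euclidean_space \<times> 'c::euclidean_space \<Rightarrow> bool"
  assumes "AE P in lborel. snd P \<in> ucell \<longrightarrow> Q P"
  shows "AE P in lborel. Q (fst P, vfrac (snd P))"
proof -
  have "AE P in lborel. \<forall>k\<in>{k. lattice_point k}. snd (P + (0, - k)) \<in> ucell \<longrightarrow> Q (P + (0, - k))"
    unfolding AE_ball_countable[OF countable_lattice] by (intro ballI AE_lborel_shift[OF assms])
  then show ?thesis
  proof eventually_elim
    fix P :: "'b \<times> 'c" assume P: "\<forall>k\<in>{k. lattice_point k}. snd (P + (0, - k)) \<in> ucell \<longrightarrow> Q (P + (0, - k))"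
    have "P + (0, - vfloor (snd P)) = (fst P, vfrac (snd P))" by (simp add: prod_eq_iff vfrac_def)
    then show "Q (fst P, vfrac (snd P))"
      using P[rule_format, of "vfloor (snd P)"] lattice_point_vfloor[of "snd P"] vfrac_in_ucell[of "snd P"] by simp
  qed
qed

section \<open>Multiscale convergence in terms of Borel representatives\<close>

lemma lattice_point_vec: "lattice_point k \<longleftrightarrow> int_vec (k :: real ^ 'n)"
proof -
  have "(\<forall>b\<in>Basis. k \<bullet> b \<in> \<int>) \<longleftrightarrow> (\<forall>i. k \<bullet> axis i 1 \<in> \<int>)" by (auto simp: Basis_vec_def)
  then show ?thesis by (simp add: lattice_point_def int_vec_def inner_axis)
qed

lemma ucell_vec: "ucell = (unit_cell :: (real ^ 'n) set)"
proof -
  have "(\<forall>b\<in>Basis. 0 \<le> w \<bullet> b \<and> w \<bullet> b < 1) \<longleftrightarrow> (\<forall>i. 0 \<le> w \<bullet> axis i 1 \<and> w \<bullet> axis i 1 < 1)" for w :: "real ^ 'n"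
    by (auto simp: Basis_vec_def)
  then show ?thesis by (simp add: ucell_def unit_cell_def inner_axis)
qed

lemma ucell_cells: "unit_cell \<times> unit_cell = (ucell :: ((real ^ 'n) \<times> (real ^ 'n)) set)"
  by (auto simp: ucell_Pair ucell_vec[symmetric])

lemma C_per_iff:
  fixes f :: "((real ^ 'n) \<times> (real ^ 'n)) \<Rightarrow>\<^sub>C 'a::{real_normed_field, euclidean_space}"
  shows "f \<in> C_per \<longleftrightarrow> periodic (apply_bcontfun f)"
proof
  assume f: "f \<in> C_per"
  show "periodic (apply_bcontfun f)"
    unfolding periodic_def
  proof (intro allI impI)
    fix w k :: "(real ^ 'n) \<times> (real ^ 'n)" assume k: "lattice_point k"
    obtain k1 k2 where kk: "k = (k1, k2)" by (cases k)
    obtain y z where w: "w = (y, z)" by (cases w)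
    have "int_vec k1" "int_vec k2" using k by (simp_all add: kk lattice_point_Pair lattice_point_vec)
    then show "apply_bcontfun f (w + k) = apply_bcontfun f w" using f by (simp add: C_per_def kk w)
  qed
next
  assume f: "periodic (apply_bcontfun f)"
  show "f \<in> C_per"
    unfolding C_per_def
  proof (intro CollectI allI impI)
    fix y z k l :: "real ^ 'n" assume "int_vec k" "int_vec l"
    then have "lattice_point (k, l)" by (simp add: lattice_point_Pair lattice_point_vec)
    from periodicD[OF f this, of "(y, z)"] show "apply_bcontfun f (y + k, z + l) = apply_bcontfun f (y, z)" by simp
  qed
qed

lemma conj_exponent_cases:
  assumes "1 \<le> p"
  shows "p = 1 \<Longrightarrow> conj_exponent p = \<infinity>" and "p \<noteq> 1 \<Longrightarrow> conj_exponent p \<noteq> \<infinity>"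
    and "p \<noteq> 1 \<Longrightarrow> real_of_ereal (conj_exponent p) = 1 / (1 - 1 / p)"
  by (simp_all add: conj_exponent_def)

lemma Lp_C_per_conj_iff:
  assumes "1 \<le> p"
  shows "\<psi> \<in> Lp_C_per (conj_exponent p) S \<longleftrightarrow> (\<forall>x\<in>S. \<psi> x \<in> C_per) \<and> strongly_measurable_C_per S \<psi> \<and>
     (if p = 1 then \<exists>C. AE x in lebesgue_on S. norm (\<psi> x) \<le> C
      else integrable (lebesgue_on S) (\<lambda>x. norm (\<psi> x) powr (1 / (1 - 1 / p))))"
  using conj_exponent_cases[OF assms] by (cases "p = 1") (simp_all add: Lp_C_per_def)

text \<open>
  Two classes of elements of \<open>L\<^bsup>p'\<^esup>(S; C_per)\<close>: continuous functions of bounded support and functions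
  of \<open>x\<close> alone. The first serves to identify limits, the second to obtain bounds and uniform integrability.
\<close>

lemma test_bcf_mem:
  fixes G :: "(real ^ 'n) \<times> ((real ^ 'n) \<times> (real ^ 'n)) \<Rightarrow> 'a::{real_normed_field, euclidean_space}"
  assumes G: "test_fun G" and S: "S \<in> sets borel" and p: "1 \<le> p"
  shows "test_bcf G \<in> Lp_C_per (conj_exponent p) S"
proof -
  obtain R where R: "\<And>x w. R < norm x \<Longrightarrow> G (x, w) = 0" using G unfolding test_fun_def by blast
  obtain C where C0: "0 \<le> C" and C: "\<And>P. norm (G P) \<le> C" using test_fun_bounded[OF G] by blast
  have out: "test_bcf G x = 0" if "R < norm x" for x
    by (rule bcontfun_eqI) (simp add: apply_test_bcf[OF G] R[OF that])
  have nC: "norm (test_bcf G x) \<le> C" for x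
    by (rule norm_bound) (simp add: apply_test_bcf[OF G] C)
  have Cper: "test_bcf G x \<in> C_per" for x
  proof -
    have "apply_bcontfun (test_bcf G x) = (\<lambda>w. G (x, w))" by (rule ext) (rule apply_test_bcf[OF G])
    then show ?thesis unfolding C_per_iff using G by (simp add: test_fun_def)
  qed
  have id: "(\<lambda>x. x) \<in> lebesgue_on S \<rightarrow>\<^sub>M borel"
    by (intro measurable_restrict_space1 measurable_completion) simp
  obtain s where s: "\<And>j::nat. simple_function (lebesgue_on S) (s j)" "\<And>j x. s j x \<in> range (test_bcf G)"
    "\<And>x. (\<lambda>j. s j x) \<longlonglongrightarrow> test_bcf G x"
    using continuous_simple_approx[OF continuous_on_test_bcf[OF G] out id] by blast
  have sm: "strongly_measurable_C_per S (test_bcf G)"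
    unfolding strongly_measurable_C_per_def
  proof (intro exI[of _ s] conjI allI ballI AE_I2)
    show "simple_function (lebesgue_on S) (s j)" for j by (rule s(1))
    show "(\<lambda>j. s j x) \<longlonglongrightarrow> test_bcf G x" for x by (rule s(3))
    fix j x
    obtain y where "s j x = test_bcf G y" using s(2)[of j x] by blast
    then show "s j x \<in> C_per" by (simp only: Cper)
  qed
  have "integrable (lebesgue_on S) (\<lambda>x. norm (test_bcf G x) powr r)" if r: "0 < r" for r
  proof -
    have Fm: "(\<lambda>x. norm (test_bcf G x) powr r) \<in> borel_measurable borel"
      using continuous_on_test_bcf[OF G] r
      by (intro borel_measurable_continuous_onI continuous_on_powr' continuous_on_norm continuous_on_const) auto
    have ind: "(\<lambda>x. indicator S x *\<^sub>R (norm (test_bcf G x) powr r)) \<in> borel_measurable lborel"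
      using Fm S by (intro borel_measurable_scaleR borel_measurable_indicator) simp_all
    have "integrable lborel (\<lambda>x. indicator S x *\<^sub>R (norm (test_bcf G x) powr r))"
    proof (rule Bochner_Integration.integrable_bound[OF _ ind])
      show "integrable lborel (\<lambda>x::real ^ 'n. C powr r * indicator (cball 0 R) x)"
        by (intro integrable_mult_right integrable_real_indicator) (simp_all add: emeasure_cball_eq)
      show "AE x in lborel. norm (indicator S x *\<^sub>R (norm (test_bcf G x) powr r)) \<le> norm (C powr r * indicator (cball 0 R) x)"
      proof (rule AE_I2)
        fix x
        have "norm (test_bcf G x) powr r \<le> C powr r" using nC r by (intro powr_mono2) auto
        then show "norm (indicator S x *\<^sub>R (norm (test_bcf G x) powr r)) \<le> norm (C powr r * indicator (cball 0 R) x)"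
          using out[of x] by (cases "R < norm x") (auto simp: indicator_def)
      qed
    qed
    then show ?thesis by (subst lebesgue_on_borel(1)[OF S Fm]) simp_all
  qed
  moreover have "0 < 1 / (1 - 1 / p)" if "p \<noteq> 1" using p that by simp
  ultimately show ?thesis
    unfolding Lp_C_per_conj_iff[OF p] using Cper sm nC by (auto intro!: exI[of _ C])
qed

lemma const_mem:
  fixes b :: "real ^ 'n \<Rightarrow> 'a::{real_normed_field, euclidean_space}"
  assumes b[measurable]: "b \<in> borel_measurable borel" and S: "S \<in> sets borel" and p: "1 \<le> p"
    and adm: "if p = 1 then \<exists>C. \<forall>x. norm (b x) \<le> C else integrable lborel (\<lambda>x. norm (b x) powr (1 / (1 - 1 / p)))"
  shows "(\<lambda>x. const_bcontfun (b x)) \<in> Lp_C_per (conj_exponent p) S"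
proof -
  have nrm: "norm (const_bcontfun c :: ((real ^ 'n) \<times> (real ^ 'n)) \<Rightarrow>\<^sub>C 'a) = norm c" for c :: 'a
  proof (rule antisym)
    show "norm (const_bcontfun c :: ((real ^ 'n) \<times> (real ^ 'n)) \<Rightarrow>\<^sub>C 'a) \<le> norm c"
      by (rule norm_bound) (simp add: const_bcontfun.rep_eq)
    show "norm c \<le> norm (const_bcontfun c :: ((real ^ 'n) \<times> (real ^ 'n)) \<Rightarrow>\<^sub>C 'a)"
      using norm_bounded[of "const_bcontfun c :: ((real ^ 'n) \<times> (real ^ 'n)) \<Rightarrow>\<^sub>C 'a" 0] by (simp add: const_bcontfun.rep_eq)
  qed
  have Cper: "(const_bcontfun c :: ((real ^ 'n) \<times> (real ^ 'n)) \<Rightarrow>\<^sub>C 'a) \<in> C_per" for c :: 'a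
    by (simp add: C_per_iff periodic_def const_bcontfun.rep_eq)
  have bl: "b \<in> borel_measurable (lebesgue_on S)"
    by (intro measurable_restrict_space1 measurable_completion) simp
  obtain s where s: "\<And>j::nat. simple_function (lebesgue_on S) (s j)"
    "\<And>x. x \<in> space (lebesgue_on S) \<Longrightarrow> (\<lambda>j. s j x) \<longlonglongrightarrow> b x"
    using borel_measurable_implies_sequence_metric[OF bl, of 0] by blast
  have sm: "strongly_measurable_C_per S (\<lambda>x. const_bcontfun (b x))"
    unfolding strongly_measurable_C_per_def
  proof (intro exI[of _ "\<lambda>j x. const_bcontfun (s j x)"] conjI allI ballI AE_I2)
    show "simple_function (lebesgue_on S) (\<lambda>x. const_bcontfun (s j x))" for j by (rule simple_function_compose1[OF s(1)])
    show "(const_bcontfun (s j x) :: ((real ^ 'n) \<times> (real ^ 'n)) \<Rightarrow>\<^sub>C 'a) \<in> C_per" for j x by (rule Cper)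
    fix x assume "x \<in> space (lebesgue_on S)"
    then have "(\<lambda>j. norm (s j x - b x)) \<longlonglongrightarrow> 0" by (intro tendsto_norm_zero LIM_zero s(2))
    moreover have "const_bcontfun (s j x) - const_bcontfun (b x) = (const_bcontfun (s j x - b x) :: ((real ^ 'n) \<times> (real ^ 'n)) \<Rightarrow>\<^sub>C 'a)" for j
      by (rule bcontfun_eqI) (simp add: minus_bcontfun.rep_eq const_bcontfun.rep_eq)
    ultimately have "(\<lambda>j. const_bcontfun (s j x) - (const_bcontfun (b x) :: ((real ^ 'n) \<times> (real ^ 'n)) \<Rightarrow>\<^sub>C 'a)) \<longlonglongrightarrow> 0"
      by (intro tendsto_norm_zero_cancel[of "\<lambda>j. const_bcontfun (s j x) - const_bcontfun (b x)"]) (simp add: nrm)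
    then show "(\<lambda>j. const_bcontfun (s j x)) \<longlonglongrightarrow> (const_bcontfun (b x) :: ((real ^ 'n) \<times> (real ^ 'n)) \<Rightarrow>\<^sub>C 'a)"
      by (rule LIM_zero_cancel)
  qed
  have "integrable (lebesgue_on S) (\<lambda>x. norm (b x) powr (1 / (1 - 1 / p)))" if p1: "p \<noteq> 1"
  proof -
    have m: "(\<lambda>x. norm (b x) powr (1 / (1 - 1 / p))) \<in> borel_measurable borel" by measurable
    have "integrable lborel (\<lambda>x. indicator S x *\<^sub>R (norm (b x) powr (1 / (1 - 1 / p))))"
      using adm p1 S by (intro integrable_mult_indicator) simp_all
    then show ?thesis by (subst lebesgue_on_borel(1)[OF S m]) simp_all
  qed
  moreover have "\<exists>C. AE x in lebesgue_on S. norm (b x) \<le> C" if p1: "p = 1"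
  proof -
    have "\<exists>C. \<forall>x. norm (b x) \<le> C" using adm unfolding if_P[OF p1] .
    then obtain C where "\<forall>x. norm (b x) \<le> C" ..
    then show ?thesis by (intro exI[of _ C] AE_I2) simp
  qed
  ultimately show ?thesis
    unfolding Lp_C_per_conj_iff[OF p] nrm using Cper sm by simp
qed

lemma times_ucell_borel:
  assumes S: "S \<in> sets (borel :: 'b::euclidean_space measure)"
  shows "S \<times> (ucell :: 'c::euclidean_space set) \<in> sets borel"
proof -
  have "S \<times> (ucell :: 'c set) \<in> sets (borel \<Otimes>\<^sub>M borel)" by (intro pair_measureI S) simp_all
  then show ?thesis by (simp only: borel_prod)
qed

text \<open>
  The two integrals in the definition of multiscale convergence only see Borel representatives of
  the functions paired with each other.
\<close>

lemma scale_pairing_borel: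
  fixes w W :: "real ^ 'n \<Rightarrow> 'a::{real_normed_field, euclidean_space}"
  assumes S: "S \<in> sets borel" and W: "W \<in> borel_measurable borel" and K: "K \<in> borel_measurable borel"
    and wae: "AE x in lborel. x \<in> S \<longrightarrow> w x = W x"
    and \<psi>ae: "AE x in lborel. x \<in> S \<longrightarrow> (\<forall>v. apply_bcontfun (\<psi> x) v = K (x, v))"
    and out: "\<And>x v. x \<notin> S \<Longrightarrow> W x * K (x, v) = 0"
  shows "(\<integral>x. w x * apply_bcontfun (\<psi> x) (x /\<^sub>R \<epsilon>, x /\<^sub>R \<epsilon>\<^sup>2) \<partial>lebesgue_on S)
    = (\<integral>x. W x * K (x, two_scales \<epsilon> x) \<partial>lborel)"
proof -
  have m: "(\<lambda>x. W x * K (x, two_scales \<epsilon> x)) \<in> borel_measurable borel"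
    by (intro borel_measurable_times W test_fun_scale_measurable[OF K measurable_two_scales])
  have "(\<integral>x. w x * apply_bcontfun (\<psi> x) (x /\<^sub>R \<epsilon>, x /\<^sub>R \<epsilon>\<^sup>2) \<partial>lebesgue_on S)
      = (\<integral>x. indicator S x *\<^sub>R (W x * K (x, two_scales \<epsilon> x)) \<partial>lborel)"
  proof (rule lebesgue_on_borel(2)[OF S m])
    show "AE x in lborel. x \<in> S \<longrightarrow> w x * apply_bcontfun (\<psi> x) (x /\<^sub>R \<epsilon>, x /\<^sub>R \<epsilon>\<^sup>2) = W x * K (x, two_scales \<epsilon> x)"
      using wae \<psi>ae by eventually_elim (simp add: two_scales_def)
  qed
  also have "\<dots> = (\<integral>x. W x * K (x, two_scales \<epsilon> x) \<partial>lborel)"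
    by (rule Bochner_Integration.integral_cong) (auto simp: indicator_def out)
  finally show ?thesis .
qed

lemma cell_pairing_borel:
  fixes w0 W0 :: "(real ^ 'n) \<times> ((real ^ 'n) \<times> (real ^ 'n)) \<Rightarrow> 'a::{real_normed_field, euclidean_space}"
  assumes S: "S \<in> sets borel" and W0: "W0 \<in> borel_measurable borel" and K: "K \<in> borel_measurable borel"
    and wae: "AE P in lborel. P \<in> S \<times> ucell \<longrightarrow> w0 P = W0 P"
    and \<psi>ae: "AE x in lborel. x \<in> S \<longrightarrow> (\<forall>v. apply_bcontfun (\<psi> x) v = K (x, v))"
    and out: "\<And>x v. x \<notin> S \<Longrightarrow> W0 (x, v) * K (x, v) = 0"
  shows "(\<integral>(x, y, z). w0 (x, y, z) * apply_bcontfun (\<psi> x) (y, z) \<partial>lebesgue_on (S \<times> unit_cell \<times> unit_cell))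
    = (\<integral>P. cell_ind P *\<^sub>R (W0 P * K P) \<partial>lborel)"
proof -
  have m: "(\<lambda>P. W0 P * K P) \<in> borel_measurable borel" by (intro borel_measurable_times W0 K)
  have "(\<integral>(x, y, z). w0 (x, y, z) * apply_bcontfun (\<psi> x) (y, z) \<partial>lebesgue_on (S \<times> ucell))
      = (\<integral>P. indicator (S \<times> ucell) P *\<^sub>R (W0 P * K P) \<partial>lborel)"
  proof (rule lebesgue_on_borel(2)[OF times_ucell_borel[OF S] m])
    show "AE P in lborel. P \<in> S \<times> ucell \<longrightarrow> (case P of (x, y, z) \<Rightarrow> w0 (x, y, z) * apply_bcontfun (\<psi> x) (y, z)) = W0 P * K P"
      using wae AE_fst_lborel[OF \<psi>ae]
    proof eventually_elim
      case (elim P)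
      then show ?case by (cases P rule: prod_cases3) simp
    qed
  qed
  also have "\<dots> = (\<integral>P. cell_ind P *\<^sub>R (W0 P * K P) \<partial>lborel)"
  proof (rule Bochner_Integration.integral_cong)
    fix P :: "(real ^ 'n) \<times> ((real ^ 'n) \<times> (real ^ 'n))"
    show "indicator (S \<times> ucell) P *\<^sub>R (W0 P * K P) = cell_ind P *\<^sub>R (W0 P * K P)"
    proof (cases "fst P \<in> S")
      case True
      then have "indicator (S \<times> ucell) P = cell_ind P" by (simp add: cell_ind_def indicator_def mem_Times_iff)
      then show ?thesis by simp
    next
      case False
      then have "W0 P * K P = 0" using out[of "fst P" "snd P"] by simp
      then show ?thesis by simp
    qed
  qed simp
  finally show ?thesis by (simp only: ucell_cells)
qed

text \<open>
  The form in which multiscale convergence enters the proof: tested against the two classes of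
  functions above, for Borel representatives.
\<close>

lemma reit_weak_borel:
  fixes w :: "nat \<Rightarrow> real ^ 'n \<Rightarrow> 'a::{real_normed_field, euclidean_space}"
  assumes rw: "reit_weak e p S w w0" and S[measurable]: "S \<in> sets borel" and p: "1 \<le> p"
    and W[measurable]: "\<And>n. W n \<in> borel_measurable borel" and Wout: "\<And>n x. x \<notin> S \<Longrightarrow> W n x = 0"
    and Wae: "\<And>n. AE x in lborel. x \<in> S \<longrightarrow> w n x = W n x"
    and W0: "W0 \<in> borel_measurable borel" and W0out: "\<And>x v. x \<notin> S \<Longrightarrow> W0 (x, v) = 0"
    and W0ae: "AE P in lborel. P \<in> S \<times> ucell \<longrightarrow> w0 P = W0 P"
  shows "\<And>H. test_fun H \<Longrightarrow> (\<lambda>n. \<integral>x. W n x * H (x, two_scales (e n) x) \<partial>lborel) \<longlonglongrightarrow> (\<integral>P. cell_ind P *\<^sub>R (W0 P * H P) \<partial>lborel)"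
    and "\<And>b. b \<in> borel_measurable borel \<Longrightarrow>
        (if p = 1 then \<exists>C. \<forall>x. norm (b x) \<le> C else integrable lborel (\<lambda>x. norm (b x) powr (1 / (1 - 1 / p)))) \<Longrightarrow>
        (\<lambda>n. \<integral>x. W n x * b x \<partial>lborel) \<longlonglongrightarrow> (\<integral>P. cell_ind P *\<^sub>R (W0 P * b (fst P)) \<partial>lborel)"
proof -
  have main: "(\<lambda>n. \<integral>x. W n x * K (x, two_scales (e n) x) \<partial>lborel) \<longlonglongrightarrow> (\<integral>P. cell_ind P *\<^sub>R (W0 P * K P) \<partial>lborel)"
    if \<psi>: "\<psi> \<in> Lp_C_per (conj_exponent p) S" and K: "K \<in> borel_measurable borel"
      and eval: "\<And>x v. apply_bcontfun (\<psi> x) v = K (x, v)" for \<psi> K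
  proof -
    have "(\<lambda>n. \<integral>x. w n x * apply_bcontfun (\<psi> x) (x /\<^sub>R e n, x /\<^sub>R (e n)\<^sup>2) \<partial>lebesgue_on S)
        \<longlonglongrightarrow> (\<integral>(x, y, z). w0 (x, y, z) * apply_bcontfun (\<psi> x) (y, z) \<partial>lebesgue_on (S \<times> unit_cell \<times> unit_cell))"
      using rw \<psi> unfolding reit_weak_def by blast
    moreover have \<psi>ae: "AE x in lborel. x \<in> S \<longrightarrow> (\<forall>v. apply_bcontfun (\<psi> x) v = K (x, v))"
      by (simp add: eval)
    moreover have "W n x * K (x, v) = 0" "W0 (x, v) * K (x, v) = 0" if "x \<notin> S" for n x v
      using Wout[OF that] W0out[OF that] by simp_all
    ultimately show ?thesis
      using scale_pairing_borel[OF S W K Wae \<psi>ae] cell_pairing_borel[OF S W0 K W0ae \<psi>ae] by simp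
  qed
  show "(\<lambda>n. \<integral>x. W n x * H (x, two_scales (e n) x) \<partial>lborel) \<longlonglongrightarrow> (\<integral>P. cell_ind P *\<^sub>R (W0 P * H P) \<partial>lborel)" if H: "test_fun H" for H
    by (rule main[OF test_bcf_mem[OF H S p] test_fun_measurable[OF H] apply_test_bcf[OF H]])
  show "(\<lambda>n. \<integral>x. W n x * b x \<partial>lborel) \<longlonglongrightarrow> (\<integral>P. cell_ind P *\<^sub>R (W0 P * b (fst P)) \<partial>lborel)"
    if b[measurable]: "b \<in> borel_measurable borel"
      and adm: "if p = 1 then \<exists>C. \<forall>x. norm (b x) \<le> C else integrable lborel (\<lambda>x. norm (b x) powr (1 / (1 - 1 / p)))" for b
  proof -
    have bm: "(\<lambda>P::(real ^ 'n) \<times> ((real ^ 'n) \<times> (real ^ 'n)). b (fst P)) \<in> borel_measurable borel"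
      unfolding borel_prod[symmetric] by measurable
    show ?thesis
      using main[OF const_mem[OF b S p adm] bm] by (simp add: const_bcontfun.rep_eq)
  qed
qed

text \<open>
  A test function of \<open>L\<^bsup>m'\<^esup>(\<Omega>; C_per)\<close> agrees almost everywhere with a limit of Borel simple
  functions, extended by zero outside \<open>\<Omega>\<close>.
\<close>

lemma Lp_C_per_borel:
  fixes \<psi> :: "real ^ 'n \<Rightarrow> (((real ^ 'n) \<times> (real ^ 'n)) \<Rightarrow>\<^sub>C 'a::{real_normed_field, euclidean_space})"
  assumes \<psi>: "\<psi> \<in> Lp_C_per (conj_exponent m) S" and S[measurable]: "S \<in> sets borel" and m: "1 \<le> m"
  shows "\<exists>s \<psi>'. (\<forall>j::nat. simple_function borel (s j)) \<and> (\<forall>j x. periodic (apply_bcontfun (s j x)))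
      \<and> (\<forall>x. (\<lambda>j. s j x) \<longlonglongrightarrow> \<psi>' x) \<and> admissible m (\<lambda>x. norm (\<psi>' x))
      \<and> (AE x in lborel. x \<in> S \<longrightarrow> \<psi> x = \<psi>' x) \<and> (\<forall>x. x \<notin> S \<longrightarrow> \<psi>' x = 0)"
proof -
  have Cper: "\<And>x. x \<in> S \<Longrightarrow> \<psi> x \<in> C_per" and sm: "strongly_measurable_C_per S \<psi>"
    and nrm: "if m = 1 then \<exists>C. AE x in lebesgue_on S. norm (\<psi> x) \<le> C
      else integrable (lebesgue_on S) (\<lambda>x. norm (\<psi> x) powr (1 / (1 - 1 / m)))"
    using \<psi> unfolding Lp_C_per_conj_iff[OF m] by blast+
  have Sl: "S \<in> sets lebesgue" using sets_completionI_sets[of S lborel] by simp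
  obtain s0 where s0: "\<And>j::nat. simple_function (lebesgue_on S) (s0 j)" "\<And>j x. x \<in> S \<Longrightarrow> s0 j x \<in> C_per"
    and l0: "AE x in lebesgue_on S. (\<lambda>j. s0 j x) \<longlonglongrightarrow> \<psi> x"
    using sm unfolding strongly_measurable_C_per_def by blast
  have ex: "\<exists>s1. simple_function lborel s1 \<and> (AE x in lborel. x \<in> S \<longrightarrow> s0 j x = s1 x)" for j
  proof -
    have "simple_function lebesgue (\<lambda>x. if x \<in> S then s0 j x else 0)"
      unfolding simple_function_def
    proof (intro conjI ballI)
      have fin: "finite (s0 j ` S)" using s0(1)[of j] Sl by (simp add: simple_function_def space_restrict_space)
      have "(\<lambda>x. if x \<in> S then s0 j x else 0) ` space lebesgue \<subseteq> insert 0 (s0 j ` S)" by auto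
      then show "finite ((\<lambda>x. if x \<in> S then s0 j x else 0) ` space lebesgue)"
        by (rule finite_subset) (use fin in simp)
      fix f
      have "s0 j -` {f} \<inter> S \<in> sets lebesgue"
      proof (cases "f \<in> s0 j ` S")
        case True
        then have "s0 j -` {f} \<inter> S \<in> sets (lebesgue_on S)"
          using s0(1)[of j] by (auto simp: simple_function_def space_restrict_space)
        then show ?thesis using Sl by (simp add: sets_restrict_space_iff)
      next
        case False
        then have "s0 j -` {f} \<inter> S = {}" by auto
        then show ?thesis by simp
      qed
      moreover have "- S \<in> sets lebesgue"
        using sets_completionI_sets[of "- S" lborel] borel_comp[OF S] by simp
      ultimately have u: "(s0 j -` {f} \<inter> S) \<union> (if f = 0 then - S else {}) \<in> sets lebesgue" by (cases "f = 0") auto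
      have "(\<lambda>x. if x \<in> S then s0 j x else 0) -` {f} \<inter> space lebesgue = (s0 j -` {f} \<inter> S) \<union> (if f = 0 then - S else {})"
        by (auto split: if_splits)
      then show "(\<lambda>x. if x \<in> S then s0 j x else 0) -` {f} \<inter> space lebesgue \<in> sets lebesgue" by (simp only: u)
    qed
    from completion_ex_simple_function[OF this] obtain s1 where s1: "simple_function lborel s1"
      "AE x in lborel. (if x \<in> S then s0 j x else 0) = s1 x" by blast
    from s1(2) have "AE x in lborel. x \<in> S \<longrightarrow> s0 j x = s1 x" by eventually_elim auto
    then show ?thesis using s1(1) by blast
  qed
  have "\<exists>s1. \<forall>j. simple_function lborel (s1 j) \<and> (AE x in lborel. x \<in> S \<longrightarrow> s0 j x = s1 j x)"
    by (rule choice, rule allI, rule ex)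
  then obtain s1 where s1': "\<forall>j. simple_function lborel (s1 j) \<and> (AE x in lborel. x \<in> S \<longrightarrow> s0 j x = s1 j x)" ..
  have s1: "\<And>j. simple_function lborel (s1 j)" "\<And>j. AE x in lborel. x \<in> S \<longrightarrow> s0 j x = s1 j x"
    using s1' by simp_all
  have on: "AE x in lborel. x \<in> S \<longrightarrow> Q x" if "AE x in lebesgue_on S. Q x" for Q
  proof -
    have "AE x in lebesgue. x \<in> S \<longrightarrow> Q x" using that Sl by (simp add: AE_restrict_space_iff)
    then show ?thesis by (simp only: AE_completion_iff)
  qed
  have "m = 1 \<Longrightarrow> \<exists>C. AE x in lebesgue_on S. norm (\<psi> x) \<le> C" using nrm by (simp only: if_True)
  then have "\<exists>C. m = 1 \<longrightarrow> (AE x in lebesgue_on S. norm (\<psi> x) \<le> C)" by blast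
  then obtain C where C: "m = 1 \<longrightarrow> (AE x in lebesgue_on S. norm (\<psi> x) \<le> C)" ..
  define Q where "Q x \<longleftrightarrow> (x \<in> S \<longrightarrow> (\<lambda>j. s0 j x) \<longlonglongrightarrow> \<psi> x) \<and> (\<forall>j. x \<in> S \<longrightarrow> s0 j x = s1 j x) \<and> (m = 1 \<longrightarrow> x \<in> S \<longrightarrow> norm (\<psi> x) \<le> C)" for x
  have "AE x in lborel. Q x"
  proof -
    have "AE x in lborel. \<forall>j. x \<in> S \<longrightarrow> s0 j x = s1 j x" unfolding AE_all_countable using s1(2) by blast
    moreover have "AE x in lborel. m = 1 \<longrightarrow> x \<in> S \<longrightarrow> norm (\<psi> x) \<le> C"
    proof (cases "m = 1")
      case True
      from on[OF C[rule_format, OF True]] show ?thesis by eventually_elim simp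
    qed simp
    ultimately show ?thesis using on[OF l0] unfolding Q_def by eventually_elim blast
  qed
  then obtain N where NQ: "\<And>x. x \<in> space lborel - N \<Longrightarrow> Q x" and N: "N \<in> null_sets lborel" by (rule AE_E3) (rule that)
  have NP: "(x \<in> S \<longrightarrow> (\<lambda>j. s0 j x) \<longlonglongrightarrow> \<psi> x) \<and> (\<forall>j. x \<in> S \<longrightarrow> s0 j x = s1 j x) \<and> (m = 1 \<longrightarrow> x \<in> S \<longrightarrow> norm (\<psi> x) \<le> C)" if "x \<notin> N" for x
  proof -
    have "Q x" using that by (intro NQ) simp
    then show ?thesis unfolding Q_def .
  qed
  have Nm[measurable]: "N \<in> sets borel" using N by auto
  define s where "s j x = (if x \<in> S - N then s1 j x else 0)" for j x
  define \<psi>' where "\<psi>' x = (if x \<in> S - N then \<psi> x else 0)" for x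
  have s: "simple_function borel (s j)" for j
    unfolding s_def
  proof (rule simple_function_If)
    show "simple_function borel (s1 j)" using s1(1)[of j] by (simp add: simple_function_def)
    have "S - N \<in> sets borel" by measurable
    then show "{x \<in> space borel. x \<in> S - N} \<in> sets borel" by simp
  qed simp
  have sl: "(\<lambda>j. s j x) \<longlonglongrightarrow> \<psi>' x" for x
  proof (cases "x \<in> S - N")
    case True
    then have x: "x \<in> S" "x \<notin> N" by auto
    have "s j x = s0 j x" for j using NP[OF x(2)] x True by (simp add: s_def)
    moreover have "(\<lambda>j. s0 j x) \<longlonglongrightarrow> \<psi> x" using NP[OF x(2)] x by blast
    ultimately show ?thesis using True by (simp add: \<psi>'_def)
  next
    case False
    then show ?thesis unfolding s_def \<psi>'_def if_not_P[OF False] by simp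
  qed
  have sper: "periodic (apply_bcontfun (s j x))" for j x
  proof (cases "x \<in> S - N")
    case True
    then have x: "x \<in> S" "x \<notin> N" by auto
    have "s j x = s0 j x" using NP[OF x(2)] x True by (simp add: s_def)
    then show ?thesis using s0(2)[OF x(1), of j] by (simp add: C_per_iff)
  next
    case False
    show ?thesis unfolding s_def if_not_P[OF False] by (simp add: periodic_def)
  qed
  have nm: "(\<lambda>x. norm (\<psi>' x)) \<in> borel_measurable borel"
  proof (rule borel_measurable_LIMSEQ_metric)
    show "(\<lambda>x. norm (s j x)) \<in> borel_measurable borel" for j
      by (rule borel_measurable_simple_function[OF simple_function_compose1[OF s]])
    show "(\<lambda>j. norm (s j x)) \<longlonglongrightarrow> norm (\<psi>' x)" for x by (rule tendsto_norm[OF sl])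
  qed
  have ae: "AE x in lborel. x \<in> S \<longrightarrow> \<psi> x = \<psi>' x"
    using AE_not_in[OF N] by eventually_elim (simp add: \<psi>'_def)
  have adm: "admissible m (\<lambda>x. norm (\<psi>' x))"
  proof (cases "m = 1")
    case True
    have "norm (\<psi>' x) \<le> max C 0" for x
    proof (cases "x \<in> S - N")
      case True
      then show ?thesis using NP[of x] \<open>m = 1\<close> by (auto simp: \<psi>'_def)
    next
      case False
      show ?thesis unfolding \<psi>'_def if_not_P[OF False] by simp
    qed
    then show ?thesis using True nm unfolding admissible_def by (auto intro!: exI[of _ "max C 0"])
  next
    case False
    have pm: "(\<lambda>x. norm (\<psi>' x) powr (1 / (1 - 1 / m))) \<in> borel_measurable borel" using nm by measurable
    have "AE x in lborel. x \<in> S \<longrightarrow> norm (\<psi> x) powr (1 / (1 - 1 / m)) = norm (\<psi>' x) powr (1 / (1 - 1 / m))"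
      using ae by eventually_elim auto
    from lebesgue_on_borel(1)[OF S pm this]
    have "integrable lborel (\<lambda>x. indicator S x *\<^sub>R (norm (\<psi>' x) powr (1 / (1 - 1 / m))))" using nrm False by simp
    moreover have "indicator S x *\<^sub>R (norm (\<psi>' x) powr (1 / (1 - 1 / m))) = norm (\<psi>' x) powr (1 / (1 - 1 / m))" for x
      by (simp add: indicator_def \<psi>'_def)
    ultimately have "integrable lborel (\<lambda>x. norm (\<psi>' x) powr (1 / (1 - 1 / m)))" by (simp only:)
    then show ?thesis using False nm unfolding admissible_def by simp
  qed
  have "\<forall>x. x \<notin> S \<longrightarrow> \<psi>' x = 0" by (simp add: \<psi>'_def)
  then show ?thesis using s sper sl adm ae by blast
qed

text \<open>
  Borel representatives of the elements of the Lebesgue spaces. On the cell the representative is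
  extended periodically.
\<close>

lemma Lp_borel_version:
  fixes w :: "'b::euclidean_space \<Rightarrow> 'a::{real_normed_field, euclidean_space}"
  assumes w: "w \<in> Lp p S" and S: "S \<in> sets borel"
  shows "\<exists>W. W \<in> borel_measurable borel \<and> (\<forall>x. x \<notin> S \<longrightarrow> W x = 0) \<and> (AE x in lborel. x \<in> S \<longrightarrow> w x = W x)
    \<and> integrable lborel (\<lambda>x. norm (W x) powr p)
    \<and> (\<integral>x. norm (w x) powr p \<partial>lebesgue_on S) = (\<integral>x. norm (W x) powr p \<partial>lborel)"
proof -
  have wm: "w \<in> borel_measurable (lebesgue_on S)" and wi: "integrable (lebesgue_on S) (\<lambda>x. norm (w x) powr p)"
    using w by (simp_all add: Lp_def)
  obtain W where W: "W \<in> borel_measurable borel" and out: "\<forall>x. x \<notin> S \<longrightarrow> W x = 0"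
    and ae: "AE x in lborel. x \<in> S \<longrightarrow> w x = W x"
    using borel_version_on[OF wm S] by blast
  have Wp: "(\<lambda>x. norm (W x) powr p) \<in> borel_measurable borel" using W by measurable
  have aep: "AE x in lborel. x \<in> S \<longrightarrow> norm (w x) powr p = norm (W x) powr p"
    using ae by eventually_elim simp
  have ind: "(\<lambda>x. indicator S x *\<^sub>R (norm (W x) powr p)) = (\<lambda>x. norm (W x) powr p)"
  proof
    fix x show "indicator S x *\<^sub>R (norm (W x) powr p) = norm (W x) powr p" using out by (cases "x \<in> S") simp_all
  qed
  have "integrable lborel (\<lambda>x. norm (W x) powr p)"
    using wi lebesgue_on_borel(1)[OF S Wp aep] by (simp only: ind)
  moreover have "(\<integral>x. norm (w x) powr p \<partial>lebesgue_on S) = (\<integral>x. norm (W x) powr p \<partial>lborel)"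
    using lebesgue_on_borel(2)[OF S Wp aep] by (simp only: ind)
  ultimately show ?thesis using W out ae by blast
qed

lemma Lp_per_borel_version:
  fixes w :: "(real ^ 'n) \<times> (real ^ 'n) \<times> (real ^ 'n) \<Rightarrow> 'a::{real_normed_field, euclidean_space}"
  assumes w: "w \<in> Lp_per p UNIV"
  shows "\<exists>W. W \<in> borel_measurable borel \<and> (\<forall>x. periodic (\<lambda>v. W (x, v))) \<and> (AE P in lborel. w P = W P)
    \<and> integrable lborel (\<lambda>P. cell_ind P * norm (W P) powr p)
    \<and> (\<integral>P. norm (w P) powr p \<partial>lebesgue_on (UNIV \<times> unit_cell \<times> unit_cell)) = (\<integral>P. cell_ind P * norm (W P) powr p \<partial>lborel)"
proof -
  define S :: "((real ^ 'n) \<times> (real ^ 'n) \<times> (real ^ 'n)) set" where "S = UNIV \<times> ucell"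
  have S: "S \<in> sets borel" unfolding S_def by (rule times_ucell_borel) simp
  have wp: "w \<in> Lp p S" and wper: "\<And>x y z k l. int_vec k \<Longrightarrow> int_vec l \<Longrightarrow> w (x, y + k, z + l) = w (x, y, z)"
    using w by (simp_all add: Lp_per_def S_def ucell_cells)
  obtain V where V: "V \<in> borel_measurable borel" and Vout: "\<forall>P. P \<notin> S \<longrightarrow> V P = 0"
    and Vae: "AE P in lborel. P \<in> S \<longrightarrow> w P = V P"
    and Vi: "integrable lborel (\<lambda>P. norm (V P) powr p)"
    and Veq: "(\<integral>P. norm (w P) powr p \<partial>lebesgue_on S) = (\<integral>P. norm (V P) powr p \<partial>lborel)"
    using Lp_borel_version[OF wp S] by blast
  define W where "W P = V (fst P, vfrac (snd P))" for P
  have Vm[measurable]: "V \<in> borel_measurable (borel \<Otimes>\<^sub>M borel)" using V by (simp only: borel_prod)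
  have "W \<in> borel_measurable (borel \<Otimes>\<^sub>M borel)" unfolding W_def[abs_def] by measurable
  then have Wm: "W \<in> borel_measurable borel" by (simp only: borel_prod)
  have per: "periodic (\<lambda>v. W (x, v))" for x
    by (simp add: periodic_def W_def vfrac_add_lattice_point)
  have wfrac: "w P = w (fst P, vfrac (snd P))" for P
  proof -
    obtain x y z where P: "P = (x, y, z)" by (cases P rule: prod_cases3)
    obtain k l where kl: "vfloor (y, z) = (k, l)" by (cases "vfloor (y, z)")
    have "int_vec k" "int_vec l" using lattice_point_vfloor[of "(y, z)"] by (simp_all add: kl lattice_point_Pair lattice_point_vec)
    from wper[OF this, of x "y - k" "z - l"] show ?thesis by (simp add: P vfrac_def kl)
  qed
  have "AE P in lborel. snd P \<in> ucell \<longrightarrow> w P = V P" using Vae by eventually_elim (simp add: S_def mem_Times_iff)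
  from AE_reduced_to_ucell[OF this] have ae: "AE P in lborel. w P = W P"
  proof eventually_elim
    case (elim P)
    then show ?case by (simp only: W_def wfrac[of P])
  qed
  have cell: "cell_ind P * norm (W P) powr p = norm (V P) powr p" for P
  proof (cases "snd P \<in> ucell")
    case True
    then show ?thesis by (simp add: W_def cell_ind_def vfrac_ucell)
  next
    case False
    then have "P \<notin> S" by (simp add: S_def mem_Times_iff)
    then have "V P = 0" using Vout by blast
    then show ?thesis using False by (simp add: cell_ind_def)
  qed
  show ?thesis
    using Wm per ae Vi Veq by (intro exI[of _ W]) (simp add: cell S_def ucell_cells)
qed

text \<open>
  The two convolutions agree everywhere and not just almost everywhere, because for each fixed \<open>x\<close> the
  integrand is only modified on a null set.
\<close>

lemma conv_eq_sconv:
  fixes u v :: "real ^ 'n \<Rightarrow> 'a::{real_normed_field, euclidean_space}"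
  assumes U: "U \<in> borel_measurable borel" and V: "V \<in> borel_measurable borel"
    and out: "\<And>x. x \<notin> S \<Longrightarrow> U x = 0" and uae: "AE x in lborel. x \<in> S \<longrightarrow> u x = U x" and vae: "AE x in lborel. v x = V x"
  shows "conv (zero_ext S u) v = sconv U V"
proof
  fix x
  have m: "(\<lambda>y. U y * V (x - y)) \<in> borel_measurable borel" using U V by measurable
  have "AE y in lborel. y \<in> UNIV \<longrightarrow> zero_ext S u y * v (x - y) = U y * V (x - y)"
    using uae AE_lborel_reflect[OF vae, of x] by eventually_elim (auto simp: zero_ext_def out)
  from lebesgue_on_borel(2)[OF _ m this] show "conv (zero_ext S u) v x = sconv U V x"
    by (simp add: conv_def sconv_def lebesgue_on_UNIV_eq)
qed

lemma double_conv_eq_pconv: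
  fixes u0 v0 :: "(real ^ 'n) \<times> (real ^ 'n) \<times> (real ^ 'n) \<Rightarrow> 'a::{real_normed_field, euclidean_space}"
  assumes U: "U \<in> borel_measurable borel" and V: "V \<in> borel_measurable borel"
    and out: "\<And>P. P \<notin> S \<times> ucell \<Longrightarrow> U P = 0" and uae: "AE P in lborel. P \<in> S \<times> ucell \<longrightarrow> u0 P = U P" and vae: "AE P in lborel. v0 P = V P"
  shows "double_conv (zero_ext (S \<times> UNIV) u0) v0 = pconv U V"
proof
  fix P :: "(real ^ 'n) \<times> (real ^ 'n) \<times> (real ^ 'n)"
  obtain x y z where P: "P = (x, y, z)" by (cases P rule: prod_cases3)
  have m: "(\<lambda>Q. U Q * V (P - Q)) \<in> borel_measurable borel" using U V by measurable
  have B: "UNIV \<times> ucell \<in> sets (borel :: ((real ^ 'n) \<times> (real ^ 'n) \<times> (real ^ 'n)) measure)" by (rule times_ucell_borel) simp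
  have "AE Q in lborel. Q \<in> UNIV \<times> ucell \<longrightarrow> zero_ext (S \<times> UNIV) u0 Q * v0 (P - Q) = U Q * V (P - Q)"
    using uae AE_lborel_reflect[OF vae, of P]
    by eventually_elim (auto simp: zero_ext_def out mem_Times_iff)
  from lebesgue_on_borel(2)[OF B m this]
  have "(\<integral>Q. zero_ext (S \<times> UNIV) u0 Q * v0 (P - Q) \<partial>lebesgue_on (UNIV \<times> ucell)) = pconv U V P"
    by (simp add: pconv_def cell_ind_def indicator_def mem_Times_iff)
  moreover have "(\<lambda>(\<xi>, r, s). zero_ext (S \<times> UNIV) u0 (\<xi>, r, s) * v0 (x - \<xi>, y - r, z - s))
      = (\<lambda>Q. zero_ext (S \<times> UNIV) u0 Q * v0 (P - Q))"
    by (simp add: fun_eq_iff P)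
  ultimately show "double_conv (zero_ext (S \<times> UNIV) u0) v0 P = pconv U V P"
    by (simp add: double_conv_def P ucell_cells)
qed

text \<open>
  The pairings with a fixed function converge and are therefore bounded, so the uniform boundedness
  principle applies, in the version for \<open>p = 1\<close> or in that for \<open>p > 1\<close>.
\<close>

lemma weakly_convergent_Lp_bounded:
  fixes W :: "nat \<Rightarrow> 'b::euclidean_space \<Rightarrow> 'a::{real_normed_field, euclidean_space}"
  assumes W: "\<And>n. W n \<in> borel_measurable borel" and Wi: "\<And>n. integrable lborel (\<lambda>x. norm (W n x) powr p)" and p: "1 \<le> p"
    and weak: "\<And>b. b \<in> borel_measurable borel \<Longrightarrow>
        (if p = 1 then \<exists>C. \<forall>x. norm (b x) \<le> C else integrable lborel (\<lambda>x. norm (b x) powr (1 / (1 - 1 / p)))) \<Longrightarrow>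
        convergent (\<lambda>n. \<integral>x. W n x * b x \<partial>lborel)"
  shows "\<exists>A. \<forall>n. (\<integral>x. norm (W n x) powr p \<partial>lborel) \<le> A"
proof (cases "p = 1")
  case True
  have int: "integrable lborel (W n)" for n
    using Wi[of n] W[of n] unfolding True by (simp add: integrable_norm_iff)
  have bs: "Bseq (\<lambda>n. \<integral>x. W n x * b x \<partial>lborel)" if b: "b \<in> borel_measurable lborel" and C: "\<And>x. norm (b x) \<le> C" for b C
    by (rule convergent_imp_Bseq[OF weak]) (use b C True in auto)
  have "\<exists>A. \<forall>n. (\<integral>x. norm (W n x) \<partial>lborel) \<le> A"
    by (rule L1_uniform_boundedness[OF int], rule bs, assumption, assumption)
  then show ?thesis by (simp add: True)
next
  case False
  have "Bseq (\<lambda>n. \<integral>x. W n x * b x \<partial>lborel)" if b: "b \<in> borel_measurable lborel"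
    and i: "integrable lborel (\<lambda>x. norm (b x) powr (1 / (1 - 1 / p)))" for b
    by (rule convergent_imp_Bseq[OF weak]) (use b i False in auto)
  from Lp_uniform_boundedness[OF _ _ Wi this] show ?thesis using False p W by simp
qed

theorem theorem3p5:
  fixes \<Omega> :: "(real ^ 'n) set"
    and p q m :: real
    and e :: "nat \<Rightarrow> real"
    and u v :: "nat \<Rightarrow> real ^ 'n \<Rightarrow> 'a::{real_normed_field, euclidean_space}"
    and u0 v0 :: "(real ^ 'n) \<times> (real ^ 'n) \<times> (real ^ 'n) \<Rightarrow> 'a"
  assumes "open \<Omega>"
    and "p \<ge> 1" and "q \<ge> 1" and "m \<ge> 1"
    and "1 / p + 1 / q = 1 + 1 / m"
    and "\<And>n. 0 < e n" and "\<And>n. e n \<le> 1" and "e \<longlonglongrightarrow> 0"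
    and "\<And>n. u n \<in> Lp p \<Omega>"
    and "\<And>n. v n \<in> Lp q UNIV"
    and "u0 \<in> Lp_per p \<Omega>"
    and "v0 \<in> Lp_per q UNIV"
    and "reit_weak e p \<Omega> u u0"
    and "reit_strong e q UNIV v v0"
  shows "reit_weak e m \<Omega> (\<lambda>n. conv (zero_ext \<Omega> (u n)) (v n))
           (double_conv (zero_ext (\<Omega> \<times> UNIV) u0) v0)"
proof -
  have p: "1 \<le> p" and q: "1 \<le> q" and m: "1 \<le> m" and pqm: "1 / p + 1 / q = 1 + 1 / m" by fact+
  have e: "\<And>n. 0 < e n" "\<And>n. e n \<le> 1" "e \<longlonglongrightarrow> 0" by fact+
  have ru: "reit_weak e p \<Omega> u u0" and rv: "reit_weak e q UNIV v v0"
    and nv: "(\<lambda>n. Lp_norm q UNIV (v n)) \<longlonglongrightarrow> Lp_norm q (UNIV \<times> unit_cell \<times> unit_cell) v0"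
    using \<open>reit_weak e p \<Omega> u u0\<close> \<open>reit_strong e q UNIV v v0\<close> by (simp_all add: reit_strong_def)
  have \<Omega>: "\<Omega> \<in> sets borel" using \<open>open \<Omega>\<close> by simp
  have \<Omega>c: "\<Omega> \<times> ucell \<in> sets (borel :: ((real ^ 'n) \<times> (real ^ 'n) \<times> (real ^ 'n)) measure)" by (rule times_ucell_borel[OF \<Omega>])

  have "\<forall>n. \<exists>W. W \<in> borel_measurable borel \<and> (\<forall>x. x \<notin> \<Omega> \<longrightarrow> W x = 0) \<and> (AE x in lborel. x \<in> \<Omega> \<longrightarrow> u n x = W x)
    \<and> integrable lborel (\<lambda>x. norm (W x) powr p)
    \<and> (\<integral>x. norm (u n x) powr p \<partial>lebesgue_on \<Omega>) = (\<integral>x. norm (W x) powr p \<partial>lborel)"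
    by (rule allI, rule Lp_borel_version[OF _ \<Omega>]) fact
  from choice[OF this] obtain U where U: "\<And>n. U n \<in> borel_measurable borel" and Uout: "\<And>n x. x \<notin> \<Omega> \<Longrightarrow> U n x = 0"
    and Uae: "\<And>n. AE x in lborel. x \<in> \<Omega> \<longrightarrow> u n x = U n x" and Ui: "\<And>n. integrable lborel (\<lambda>x. norm (U n x) powr p)"
    by blast
  have "\<forall>n. \<exists>W. W \<in> borel_measurable borel \<and> (\<forall>x. x \<notin> UNIV \<longrightarrow> W x = 0) \<and> (AE x in lborel. x \<in> UNIV \<longrightarrow> v n x = W x)
    \<and> integrable lborel (\<lambda>x. norm (W x) powr q)
    \<and> (\<integral>x. norm (v n x) powr q \<partial>lebesgue_on UNIV) = (\<integral>x. norm (W x) powr q \<partial>lborel)"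
    by (rule allI, rule Lp_borel_version) (fact, simp)
  from choice[OF this] obtain V where V: "\<And>n. V n \<in> borel_measurable borel"
    and Vae: "\<And>n. AE x in lborel. x \<in> UNIV \<longrightarrow> v n x = V n x" and Vi: "\<And>n. integrable lborel (\<lambda>x. norm (V n x) powr q)"
    and Veq: "\<And>n. (\<integral>x. norm (v n x) powr q \<partial>lebesgue_on UNIV) = (\<integral>x. norm (V n x) powr q \<partial>lborel)"
    by blast
  have u0: "u0 \<in> Lp p (\<Omega> \<times> ucell)" using \<open>u0 \<in> Lp_per p \<Omega>\<close> by (simp add: Lp_per_def ucell_cells)
  obtain U0 where U0: "U0 \<in> borel_measurable borel" and U0out: "\<And>P. P \<notin> \<Omega> \<times> ucell \<Longrightarrow> U0 P = 0"
    and U0ae: "AE P in lborel. P \<in> \<Omega> \<times> ucell \<longrightarrow> u0 P = U0 P" and U0i: "integrable lborel (\<lambda>P. norm (U0 P) powr p)"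
    using Lp_borel_version[OF u0 \<Omega>c] by blast
  obtain V0 where V0: "V0 \<in> borel_measurable borel" and per: "\<And>x. periodic (\<lambda>w. V0 (x, w))"
    and V0ae: "AE P in lborel. v0 P = V0 P" and V0i: "integrable lborel (\<lambda>P. cell_ind P * norm (V0 P) powr q)"
    and V0eq: "(\<integral>P. norm (v0 P) powr q \<partial>lebesgue_on (UNIV \<times> unit_cell \<times> unit_cell)) = (\<integral>P. cell_ind P * norm (V0 P) powr q \<partial>lborel)"
    using Lp_per_borel_version[OF \<open>v0 \<in> Lp_per q UNIV\<close>] by blast
  have U0out1: "U0 (x, w) = 0" if "x \<notin> \<Omega>" for x w by (rule U0out) (use that in simp)
  have U0cell: "cell_ind P * norm (U0 P) powr p = norm (U0 P) powr p" for P
    by (cases "P \<in> \<Omega> \<times> ucell") (simp_all add: cell_ind_def mem_Times_iff U0out)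

  note weakU = reit_weak_borel[OF ru \<Omega> p U Uout Uae U0 U0out1 U0ae]
  have V0ae': "AE P in lborel. P \<in> UNIV \<times> ucell \<longrightarrow> v0 P = V0 P" using V0ae by eventually_elim simp
  note weakV = reit_weak_borel[OF rv _ q V _ Vae V0 _ V0ae', simplified]

  have normlim: "(\<lambda>n. \<integral>x. norm (V n x) powr q \<partial>lborel) \<longlonglongrightarrow> (\<integral>P. cell_ind P * norm (V0 P) powr q \<partial>lborel)"
  proof -
    have pw: "(I powr (1 / q)) powr q = I" if "0 \<le> I" for I :: real using that q by (simp add: powr_powr)
    have "(\<lambda>n. Lp_norm q UNIV (v n) powr q) \<longlonglongrightarrow> Lp_norm q (UNIV \<times> unit_cell \<times> unit_cell) v0 powr q"
      using q by (intro tendsto_powr' nv tendsto_const) (auto simp: Lp_norm_def)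
    then show ?thesis
      unfolding Lp_norm_def Veq V0eq by (simp add: pw integral_nonneg_AE cell_ind_nonneg)
  qed
  obtain A1 where A1: "\<And>n. (\<integral>x. norm (U n x) powr p \<partial>lborel) \<le> A1"
    using weakly_convergent_Lp_bounded[OF U Ui p convergentI[OF weakU(2)]] by blast
  obtain B1 where B1: "\<And>n. (\<integral>x. norm (V n x) powr q \<partial>lborel) \<le> B1"
  proof -
    from convergent_imp_Bseq[OF convergentI[OF normlim]]
    obtain K where "0 < K" and K: "\<forall>n. norm (\<integral>x. norm (V n x) powr q \<partial>lborel) \<le> K" by (rule BseqE)
    have "(\<integral>x. norm (V n x) powr q \<partial>lborel) \<le> K" for n
      using K[rule_format, of n] by simp
    then show ?thesis by (rule that)
  qed
  (* The inner maximum with 0 makes A and B nonnegative whatever A1 and B1 are. *)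
  define A where "A = max A1 (max 0 (\<integral>P. norm (U0 P) powr p \<partial>lborel))"
  define B where "B = max B1 (max 0 (\<integral>P. cell_ind P * norm (V0 P) powr q \<partial>lborel))"
  have le: "(\<integral>\<^sup>+x. ennreal (f x) \<partial>lborel) \<le> ennreal C" if "integrable lborel f" "\<And>x. 0 \<le> f x" "(\<integral>x. f x \<partial>lborel) \<le> C"
    for f :: "'b::euclidean_space \<Rightarrow> real" and C
    using that by (simp add: nn_integral_eq_integral ennreal_leI)

  have m1: "p = 1 \<and> q = 1" if "m = 1"
  proof -
    have "1 / p \<le> 1" "1 / q \<le> 1" using p q by simp_all
    moreover have "1 / p + 1 / q = 2" using pqm that by simp
    ultimately have "1 / p = 1" "1 / q = 1" by linarith+
    then show ?thesis using p q by simp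
  qed
  have uiV: "uniformly_integrable V" if "q = 1"
  proof (rule uniformly_integrable_of_weak)
    show "integrable lborel (V n)" for n using Vi[of n] V[of n] that by (simp add: integrable_norm_iff)
    have "integrable lborel (\<lambda>P. norm (cell_ind P *\<^sub>R V0 P))" using V0i that by (simp add: cell_ind_nonneg)
    then show "integrable lborel (\<lambda>P. cell_ind P *\<^sub>R V0 P)"
      by (rule integrable_norm_cancel) (use V0 in measurable)
    show "(\<lambda>n. \<integral>x. V n x * b x \<partial>lborel) \<longlonglongrightarrow> (\<integral>P. cell_ind P *\<^sub>R (V0 P * b (fst P)) \<partial>lborel)"
      if "b \<in> borel_measurable borel" "\<And>x. norm (b x) \<le> C" for b C
      by (rule weakV(2)) (use that \<open>q = 1\<close> in auto)
  qed
  have uiU: "uniformly_integrable U" if "p = 1"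
  proof (rule uniformly_integrable_of_weak)
    show "integrable lborel (U n)" for n using Ui[of n] U[of n] that by (simp add: integrable_norm_iff)
    have "norm (cell_ind P *\<^sub>R U0 P) = norm (U0 P) powr p" for P
      using U0cell[of P] that by (auto simp: cell_ind_nonneg)
    then have "integrable lborel (\<lambda>P. norm (cell_ind P *\<^sub>R U0 P))" using U0i by (simp only:)
    then show "integrable lborel (\<lambda>P. cell_ind P *\<^sub>R U0 P)"
      by (rule integrable_norm_cancel) (use U0 in measurable)
    show "(\<lambda>n. \<integral>x. U n x * b x \<partial>lborel) \<longlonglongrightarrow> (\<integral>P. cell_ind P *\<^sub>R (U0 P * b (fst P)) \<partial>lborel)"
      if "b \<in> borel_measurable borel" "\<And>x. norm (b x) \<le> C" for b C
      by (rule weakU(2)) (use that \<open>p = 1\<close> in auto)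
  qed

  interpret conv_setting U V U0 V0 "\<lambda>n. two_scales (e n)" p q m A B
  proof
    show "1 \<le> p" "1 \<le> q" "1 \<le> m" "1 / p + 1 / q = 1 + 1 / m" by fact+
    show "0 \<le> A" "0 \<le> B" unfolding A_def B_def by (rule max.coboundedI2, rule max.cobounded1)+
    show "(\<integral>\<^sup>+y. norm (U n y) powr p \<partial>lborel) \<le> ennreal A" for n
      by (rule le[OF Ui]) (use A1[of n] in \<open>simp_all add: A_def le_max_iff_disj\<close>)
    show "(\<integral>\<^sup>+y. norm (V n y) powr q \<partial>lborel) \<le> ennreal B" for n
      by (rule le[OF Vi]) (use B1[of n] in \<open>simp_all add: B_def le_max_iff_disj\<close>)
    have "(\<integral>\<^sup>+P. ennreal (cell_ind P * norm (U0 P) powr p) \<partial>lborel) \<le> ennreal A"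
      by (rule le) (simp_all add: U0cell U0i A_def)
    then show "(\<integral>\<^sup>+P. ennreal (cell_ind P) * ennreal (norm (U0 P) powr p) \<partial>lborel) \<le> ennreal A"
      by (simp add: ennreal_mult' cell_ind_nonneg)
    have "(\<integral>\<^sup>+P. ennreal (cell_ind P * norm (V0 P) powr q) \<partial>lborel) \<le> ennreal B"
      by (rule le[OF V0i]) (simp_all add: cell_ind_nonneg B_def)
    then show "(\<integral>\<^sup>+P. ennreal (cell_ind P) * ennreal (norm (V0 P) powr q) \<partial>lborel) \<le> ennreal B"
      by (simp add: ennreal_mult' cell_ind_nonneg)
    show "\<exists>\<rho>. \<forall>\<^sub>F n in sequentially. (\<integral>\<^sup>+x. indicator {x. \<rho> < norm x} x * ennreal (norm (V n x) powr q) \<partial>lborel) \<le> ennreal \<delta>"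
      if \<delta>: "0 < \<delta>" for \<delta>
    proof (cases "q = 1")
      case True
      (* The indicators of the complements of balls tend to zero, so uniform integrability contains
         tightness. *)
      define \<phi> where "\<phi> j x = (indicator {x. real j < norm x} x :: real)" for j :: nat and x :: "real ^ 'n"
      have \<phi>m: "\<phi> j \<in> borel_measurable borel" for j unfolding \<phi>_def[abs_def] by measurable
      have \<phi>01: "0 \<le> \<phi> j x \<and> \<phi> j x \<le> 1" for j x by (simp add: \<phi>_def indicator_def)
      have \<phi>lim: "(\<lambda>j. \<phi> j x) \<longlonglongrightarrow> 0" for x
      proof (rule tendsto_eventually)
        obtain J :: nat where J: "norm x \<le> real J" using real_arch_simple by blast
        show "\<forall>\<^sub>F j in sequentially. \<phi> j x = 0"
          using eventually_ge_at_top[of J] by eventually_elim (use J in \<open>simp add: \<phi>_def indicator_def\<close>)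
      qed
      have "\<exists>J. \<forall>j\<ge>J. \<forall>n. (\<integral>x. norm (V n x) * \<phi> j x \<partial>lborel) < \<delta>"
        using uiV[OF True, unfolded uniformly_integrable_def, rule_format, of \<phi> 1 \<delta>] \<phi>m \<phi>01 \<phi>lim \<delta> by simp
      then obtain J where J: "\<And>n. (\<integral>x. norm (V n x) * \<phi> J x \<partial>lborel) < \<delta>" by blast
      have "(\<integral>\<^sup>+x. indicator {x. real J < norm x} x * ennreal (norm (V n x) powr q) \<partial>lborel) \<le> ennreal \<delta>" for n
      proof -
        have "integrable lborel (\<lambda>x. norm (V n x) * \<phi> J x)"
        proof (rule Bochner_Integration.integrable_bound[OF Vi[of n]])
          show "(\<lambda>x. norm (V n x) * \<phi> J x) \<in> borel_measurable lborel" using V[of n] \<phi>m[of J] by measurable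
          show "AE x in lborel. norm (norm (V n x) * \<phi> J x) \<le> norm (norm (V n x) powr q)"
            by (rule AE_I2) (simp add: True \<phi>_def indicator_def)
        qed
        then have "(\<integral>\<^sup>+x. ennreal (norm (V n x) * \<phi> J x) \<partial>lborel) \<le> ennreal \<delta>"
          by (rule le) (use J[of n] in \<open>simp_all add: \<phi>_def\<close>)
        also have "(\<lambda>x. ennreal (norm (V n x) * \<phi> J x)) = (\<lambda>x. indicator {x. real J < norm x} x * ennreal (norm (V n x) powr q))"
          by (rule ext) (simp add: True \<phi>_def indicator_def)
        finally show ?thesis .
      qed
      then show ?thesis by (intro exI[of _ "real J"] always_eventually) simp
    next
      case False
      then have "1 < q" using q by simp
      from tight_of_norm_convergence[OF V V0 this Vi V0i normlim weakV(1) e \<delta>] show ?thesis by simp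
    qed
  qed (use U V U0 V0 per weakU(1) weakV(1) uiU uiV m1 in \<open>simp_all add: two_scales_add\<close>)

  have cv: "conv (zero_ext \<Omega> (u n)) (v n) = W n" for n
    by (rule conv_eq_sconv[OF U V Uout Uae]) (use Vae[of n] in simp_all)
  have dc: "double_conv (zero_ext (\<Omega> \<times> UNIV) u0) v0 = W0"
    by (rule double_conv_eq_pconv[OF U0 V0 U0out U0ae V0ae])

  have memW: "W n \<in> Lp m \<Omega>" for n
  proof -
    have pm: "(\<lambda>x. norm (W n x) powr m) \<in> borel_measurable borel" using W_meas[of n] by measurable
    have "integrable lborel (\<lambda>x. indicator \<Omega> x *\<^sub>R (norm (W n x) powr m))"
      by (rule integrable_mult_indicator[OF _ W_int]) (use \<Omega> in simp)
    then have "integrable (lebesgue_on \<Omega>) (\<lambda>x. norm (W n x) powr m)"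
      by (subst lebesgue_on_borel(1)[OF \<Omega> pm]) simp_all
    moreover have "W n \<in> borel_measurable (lebesgue_on \<Omega>)" by (rule lebesgue_on_borel(3)[OF \<Omega> W_meas[of n n]]) simp
    ultimately show ?thesis by (simp add: Lp_def)
  qed
  have memW0: "W0 \<in> Lp_per m \<Omega>"
  proof -
    have pm: "(\<lambda>P. norm (W0 P) powr m) \<in> borel_measurable borel" using W0_meas by measurable
    have "integrable lborel (\<lambda>P. indicator (\<Omega> \<times> ucell) P *\<^sub>R (cell_ind P * norm (W0 P) powr m))"
      by (rule integrable_mult_indicator[OF _ W0_int]) (use \<Omega>c in simp)
    moreover have "indicator (\<Omega> \<times> ucell) P *\<^sub>R (cell_ind P * norm (W0 P) powr m) = indicator (\<Omega> \<times> ucell) P *\<^sub>R (norm (W0 P) powr m)" for P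
      by (simp add: cell_ind_def indicator_def mem_Times_iff)
    ultimately have "integrable lborel (\<lambda>P. indicator (\<Omega> \<times> ucell) P *\<^sub>R (norm (W0 P) powr m))" by (simp only:)
    then have "integrable (lebesgue_on (\<Omega> \<times> ucell)) (\<lambda>P. norm (W0 P) powr m)"
      by (subst lebesgue_on_borel(1)[OF \<Omega>c pm]) simp_all
    moreover have "W0 \<in> borel_measurable (lebesgue_on (\<Omega> \<times> ucell))" by (rule lebesgue_on_borel(3)[OF \<Omega>c W0_meas]) simp
    moreover have "W0 (x, y + k, z + l) = W0 (x, y, z)" if "int_vec k" "int_vec l" for x y z k l
    proof -
      have kl: "lattice_point (k, l)" using that by (simp add: lattice_point_Pair lattice_point_vec)
      have "V0 ((x, y + k, z + l) - Q) = V0 ((x, y, z) - Q)" for Q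
      proof -
        obtain \<xi> r s where Q: "Q = (\<xi>, r, s)" by (cases Q rule: prod_cases3)
        show ?thesis using periodicD[OF per kl, of "x - \<xi>" "(y - r, z - s)"] by (simp add: Q algebra_simps)
      qed
      then show ?thesis by (simp add: pconv_def)
    qed
    ultimately show ?thesis by (simp add: Lp_per_def Lp_def ucell_cells)
  qed
  have lim: "(\<lambda>n. \<integral>x. W n x * apply_bcontfun (\<psi> x) (x /\<^sub>R e n, x /\<^sub>R (e n)\<^sup>2) \<partial>lebesgue_on \<Omega>)
      \<longlonglongrightarrow> (\<integral>(x, y, z). W0 (x, y, z) * apply_bcontfun (\<psi> x) (y, z) \<partial>lebesgue_on (\<Omega> \<times> unit_cell \<times> unit_cell))"
    if \<psi>: "\<psi> \<in> Lp_C_per (conj_exponent m) \<Omega>" for \<psi>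
  proof -
    obtain s \<psi>' where s: "\<And>j::nat. simple_function borel (s j)" "\<And>j x. periodic (apply_bcontfun (s j x))"
      "\<And>x. (\<lambda>j. s j x) \<longlonglongrightarrow> \<psi>' x" "admissible m (\<lambda>x. norm (\<psi>' x))"
      and ae: "AE x in lborel. x \<in> \<Omega> \<longrightarrow> \<psi> x = \<psi>' x" and out: "\<And>x. x \<notin> \<Omega> \<Longrightarrow> \<psi>' x = 0"
      using Lp_C_per_borel[OF \<psi> \<Omega> m] by blast
    define K where "K P = apply_bcontfun (\<psi>' (fst P)) (snd P)" for P
    have K: "K \<in> borel_measurable borel" and lim: "passes_to_limit K"
      unfolding K_def[abs_def] using passes_strongly_measurable[OF s] by blast+
    have \<psi>ae: "AE x in lborel. x \<in> \<Omega> \<longrightarrow> (\<forall>w. apply_bcontfun (\<psi> x) w = K (x, w))"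
      using ae by eventually_elim (simp add: K_def)
    (* K vanishes off \<Omega>, so the values of the convolutions there do not matter. *)
    have out0: "F * K (x, w) = 0" if "x \<notin> \<Omega>" for F x w by (simp add: K_def out[OF that])
    have "(\<integral>x. W n x * apply_bcontfun (\<psi> x) (x /\<^sub>R e n, x /\<^sub>R (e n)\<^sup>2) \<partial>lebesgue_on \<Omega>)
        = (\<integral>x. W n x * K (x, two_scales (e n) x) \<partial>lborel)" for n
      by (rule scale_pairing_borel[OF \<Omega> W_meas[of n n] K _ \<psi>ae out0]) simp_all
    moreover have "(\<integral>(x, y, z). W0 (x, y, z) * apply_bcontfun (\<psi> x) (y, z) \<partial>lebesgue_on (\<Omega> \<times> unit_cell \<times> unit_cell))
        = (\<integral>P. cell_ind P *\<^sub>R (W0 P * K P) \<partial>lborel)"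
      by (rule cell_pairing_borel[OF \<Omega> W0_meas K _ \<psi>ae out0]) simp_all
    ultimately show ?thesis using lim by (simp only: passes_to_limit_def)
  qed
  show ?thesis
    unfolding reit_weak_def cv dc using memW memW0 lim by blast
qed

end
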